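(* Let $\eta\in\mathbb{C}\setminus\{0\}$, $s<-1/4$ and $0\le\sigma<\min(-2s-1/2,\,1/2)$. Then, for any $T>0$, the data-to-solution map $u_0\mapsto u$ of the Cauchy problem $$i\partial_tu-\Delta u=\eta|u|^2\ \text{ in }\mathbb{R}\times\mathbb{R}^2,\qquad u(0,\cdot)=u_0,$$ as a map from the unit ball in $H^{s,\sigma}(\mathbb{R}^2)$ to $C([0,T];H^{s,\sigma}(\mathbb{R}^2))$, fails to be continuous at the origin.
   Context: On $\mathbb{R}^2$ let $\Delta_{\mathbb{S}^1}=(x^{(1)}\partial_{x^{(2)}}-x^{(2)}\partial_{x^{(1)}})^2$ and $\langle\Omega\rangle^\sigma=(1-\Delta_{\mathbb{S}^1})^{\sigma/2}$; i.e. $\langle\Omega\rangle^\sigma$ multiplies the $\ell$-th angular Fourier coefficient (coefficient of $e^{i\ell\theta}$, $\ell\in\mathbb{Z}$, in polar coordinates) by $(1+\ell^2)^{\sigma/2}$. $H^{s,\sigma}(\mathbb{R}^2)=\{f\in\mathcal{S}'(\mathbb{R}^2):\|f\|_{H^{s,\sigma}}:=\|\langle\Omega\rangle^\sigma f\|_{H^s}<\infty\}$. Solutions are solutions of the integral equation $u(t)=e^{-it\Delta}u_0-i\eta\int_0^te^{-i(t-t')\Delta}|u(t')|^2\,dt'$. For smooth data $u_0\in H^\infty(\mathbb{R}^2):=\bigcap_kH^k(\mathbb{R}^2)$ for which a solution $u\in C([0,T];H^\infty(\mathbb{R}^2))$ exists, this solution is unique and is the one assigned to $u_0$ by the data-to-solution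 map (in particular $0\mapsto0$). The assertion means that no map from the unit ball of $H^{s,\sigma}(\mathbb{R}^2)$ to $C([0,T];H^{s,\sigma}(\mathbb{R}^2))$ which agrees with this assignment on such smooth data is continuous at $u_0=0$. *)

theory Defs
  imports "HOL-Analysis.Analysis"
begin

type_synonym R2 = "real \<times> real"

text \<open>The iterated partial derivative of \<open>f\<close> in the directions listed in \<open>vs\<close>; it is only
  used for lists of coordinate directions (\<open>set vs \<subseteq> Basis\<close>).\<close>

fun iter_pderiv :: "R2 list \<Rightarrow> (R2 \<Rightarrow> complex) \<Rightarrow> R2 \<Rightarrow> complex" where
  "iter_pderiv [] f = f"
| "iter_pderiv (v # vs) f = (\<lambda>x. frechet_derivative (iter_pderiv vs f) (at x) v)"

definition schwartz :: "(R2 \<Rightarrow> complex) set" where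
  "schwartz = {f. \<forall>vs. set vs \<subseteq> Basis \<longrightarrow>
      (\<forall>x. iter_pderiv vs f differentiable at x) \<and>
      (\<forall>n::nat. bdd_above (range (\<lambda>x. (1 + norm x) ^ n * norm (iter_pderiv vs f x))))}"

definition schwartz_seminorm :: "nat \<Rightarrow> (R2 \<Rightarrow> complex) \<Rightarrow> real" where
  "schwartz_seminorm n f =
     (\<Sum>vs \<in> {vs. set vs \<subseteq> Basis \<and> length vs \<le> n}.
        SUP x. (1 + norm x) ^ n * norm (iter_pderiv vs f x))"

text \<open>A distribution is encoded as a functional on all functions that vanishes off the Schwartz
  space, so that equality of functionals is equality of distributions.\<close>

type_synonym distr = "(R2 \<Rightarrow> complex) \<Rightarrow> complex"

definition tempered :: "distr set" where
  "tempered = {u.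
     (\<forall>f. f \<notin> schwartz \<longrightarrow> u f = 0) \<and>
     (\<forall>f\<in>schwartz. \<forall>g\<in>schwartz. \<forall>a b. u (\<lambda>x. a * f x + b * g x) = a * u f + b * u g) \<and>
     (\<exists>n C. \<forall>f\<in>schwartz. norm (u f) \<le> C * schwartz_seminorm n f)}"

text \<open>The operator on distributions obtained by duality from an operator \<open>A\<close> on test functions,
  with respect to the bilinear pairing \<open>\<integral> f g\<close>.\<close>

definition by_duality :: "((R2 \<Rightarrow> complex) \<Rightarrow> (R2 \<Rightarrow> complex)) \<Rightarrow> distr \<Rightarrow> distr" where
  "by_duality A u = (\<lambda>f. if f \<in> schwartz then u (A f) else 0)"

definition distr_of_fun :: "(R2 \<Rightarrow> complex) \<Rightarrow> distr" where
  "distr_of_fun g = (\<lambda>f. if f \<in> schwartz then \<integral>x. g x * f x \<partial>lborel else 0)"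

definition represents :: "(R2 \<Rightarrow> complex) \<Rightarrow> distr \<Rightarrow> bool" where
  "represents g u \<longleftrightarrow> g \<in> borel_measurable lborel \<and>
     (\<forall>f\<in>schwartz. integrable lborel (\<lambda>x. g x * f x)) \<and> u = distr_of_fun g"

text \<open>The function given by a regular distribution; it is determined almost everywhere.\<close>

definition fun_of_distr :: "distr \<Rightarrow> R2 \<Rightarrow> complex" where
  "fun_of_distr u = (SOME g. represents g u)"

definition fourier_fun :: "(R2 \<Rightarrow> complex) \<Rightarrow> R2 \<Rightarrow> complex" where
  "fourier_fun f \<xi> = (\<integral>x. cis (- (x \<bullet> \<xi>)) * f x \<partial>lborel) / (2 * pi)"

definition inv_fourier_fun :: "(R2 \<Rightarrow> complex) \<Rightarrow> R2 \<Rightarrow> complex" where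
  "inv_fourier_fun f x = (\<integral>\<xi>. cis (x \<bullet> \<xi>) * f \<xi> \<partial>lborel) / (2 * pi)"

definition fourier :: "distr \<Rightarrow> distr" where
  "fourier = by_duality fourier_fun"

definition inv_fourier :: "distr \<Rightarrow> distr" where
  "inv_fourier = by_duality inv_fourier_fun"

definition sobolev :: "real \<Rightarrow> distr set" where
  "sobolev s = {u \<in> tempered. \<exists>g. represents g (fourier u) \<and>
     integrable lborel (\<lambda>\<xi>. (1 + (norm \<xi>)\<^sup>2) powr s * (norm (g \<xi>))\<^sup>2)}"

definition sobolev_norm :: "real \<Rightarrow> distr \<Rightarrow> real" where
  "sobolev_norm s u =
     sqrt (\<integral>\<xi>. (1 + (norm \<xi>)\<^sup>2) powr s * (norm (fun_of_distr (fourier u) \<xi>))\<^sup>2 \<partial>lborel)"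

definition sobolev_inf :: "distr set" where
  "sobolev_inf = (\<Inter>k::nat. sobolev (real k))"

definition angular_coeff :: "(R2 \<Rightarrow> complex) \<Rightarrow> int \<Rightarrow> real \<Rightarrow> complex" where
  "angular_coeff f l r =
     integral {0..2 * pi} (\<lambda>\<theta>. f (r * cos \<theta>, r * sin \<theta>) * cis (- of_int l * \<theta>)) / (2 * pi)"

definition angular_op_fun :: "real \<Rightarrow> (R2 \<Rightarrow> complex) \<Rightarrow> R2 \<Rightarrow> complex" where
  "angular_op_fun \<sigma> f x =
     (\<Sum>\<^sub>\<infinity>l\<in>UNIV. of_real ((1 + (of_int l)\<^sup>2) powr (\<sigma> / 2)) * angular_coeff f l (norm x)
        * cis (of_int l * Arg (Complex (fst x) (snd x))))"

text \<open>The weight is even in \<open>l\<close>, so this operator is symmetric for the bilinear pairing and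
  duality gives its extension to tempered distributions.\<close>

definition angular_op :: "real \<Rightarrow> distr \<Rightarrow> distr" where
  "angular_op \<sigma> = by_duality (angular_op_fun \<sigma>)"

definition ang_sobolev :: "real \<Rightarrow> real \<Rightarrow> distr set" where
  "ang_sobolev s \<sigma> = {u \<in> tempered. angular_op \<sigma> u \<in> sobolev s}"

definition ang_sobolev_norm :: "real \<Rightarrow> real \<Rightarrow> distr \<Rightarrow> real" where
  "ang_sobolev_norm s \<sigma> u = sobolev_norm s (angular_op \<sigma> u)"

definition ang_sobolev_unit_ball :: "real \<Rightarrow> real \<Rightarrow> distr set" where
  "ang_sobolev_unit_ball s \<sigma> = {u \<in> ang_sobolev s \<sigma>. ang_sobolev_norm s \<sigma> u < 1}"

text \<open>Values of the curve outside \<open>[0,T]\<close> are irrelevant.\<close>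

definition continuous_curve :: "distr set \<Rightarrow> (distr \<Rightarrow> real) \<Rightarrow> real \<Rightarrow> (real \<Rightarrow> distr) \<Rightarrow> bool" where
  "continuous_curve X N T u \<longleftrightarrow> (\<forall>t\<in>{0..T}. u t \<in> X \<and>
     ((\<lambda>t'. N (u t' - u t)) \<longlongrightarrow> 0) (at t within {0..T}))"

definition C_ang_sobolev :: "real \<Rightarrow> real \<Rightarrow> real \<Rightarrow> (real \<Rightarrow> distr) set" where
  "C_ang_sobolev T s \<sigma> =
     {u. continuous_curve (ang_sobolev s \<sigma>) (ang_sobolev_norm s \<sigma>) T u}"

definition C_sobolev_inf :: "real \<Rightarrow> (real \<Rightarrow> distr) set" where
  "C_sobolev_inf T =
     {u. \<forall>k::nat. continuous_curve (sobolev (real k)) (sobolev_norm (real k)) T u}"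

text \<open>The operator \<open>e\<^sup>-\<^sup>i\<^sup>t\<^sup>\<Delta>\<close>, i.e. the Fourier multiplier with symbol \<open>exp (i t |\<xi>|\<^sup>2)\<close>.\<close>

definition propagator :: "real \<Rightarrow> distr \<Rightarrow> distr" where
  "propagator t u =
     inv_fourier (by_duality (\<lambda>f \<xi>. cis (t * (norm \<xi>)\<^sup>2) * f \<xi>) (fourier u))"

definition abs_square :: "distr \<Rightarrow> distr" where
  "abs_square u = distr_of_fun (\<lambda>x. of_real ((norm (fun_of_distr u x))\<^sup>2))"

text \<open>The Duhamel integral is evaluated on test functions. For a curve in \<open>C([0,T]; H\<^sup>\<infinity>)\<close> the
  integrand is continuous with values in every \<open>H\<^sup>k\<close>, so this is the same as the vector-valued
  integral.\<close>

definition smooth_solution ::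
  "complex \<Rightarrow> real \<Rightarrow> distr \<Rightarrow> (real \<Rightarrow> distr) \<Rightarrow> bool" where
  "smooth_solution \<eta> T u0 u \<longleftrightarrow> u \<in> C_sobolev_inf T \<and>
     (\<forall>t\<in>{0..T}. \<forall>f\<in>schwartz. u t f = propagator t u0 f
        - \<i> * \<eta> * integral {0..t} (\<lambda>t'. propagator (t - t') (abs_square (u t')) f))"

definition data_to_solution_map ::
  "complex \<Rightarrow> real \<Rightarrow> real \<Rightarrow> real \<Rightarrow> (distr \<Rightarrow> real \<Rightarrow> distr) \<Rightarrow> bool" where
  "data_to_solution_map \<eta> T s \<sigma> \<Phi> \<longleftrightarrow>
     (\<forall>u0 \<in> ang_sobolev_unit_ball s \<sigma>. \<Phi> u0 \<in> C_ang_sobolev T s \<sigma>) \<and>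
     (\<forall>u0 \<in> ang_sobolev_unit_ball s \<sigma> \<inter> sobolev_inf. \<forall>u.
        smooth_solution \<eta> T u0 u \<longrightarrow> (\<forall>t\<in>{0..T}. \<Phi> u0 t = u t))"

definition continuous_at_origin ::
  "real \<Rightarrow> real \<Rightarrow> real \<Rightarrow> (distr \<Rightarrow> real \<Rightarrow> distr) \<Rightarrow> bool" where
  "continuous_at_origin T s \<sigma> \<Phi> \<longleftrightarrow>
     (\<forall>\<epsilon>>0. \<exists>\<delta>>0. \<forall>u0 \<in> ang_sobolev_unit_ball s \<sigma>. ang_sobolev_norm s \<sigma> u0 < \<delta> \<longrightarrow>
        (\<forall>t\<in>{0..T}. ang_sobolev_norm s \<sigma> (\<Phi> u0 t - \<Phi> (\<lambda>_. 0) t) < \<epsilon>))"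

end

(* The nonlinearity is quadratic of the form u * conj u, so high frequencies xi + zeta and zeta
   interact to the low frequency xi, with phase 2 xi . zeta. The data are spread over the annulus
   n^2 <= |x|^2 <= n^2 + 4 in Fourier space with amplitude n^(a-2) times a Fejer kernel in the
   angle. They are small in H^(s,sigma), since a < 1/2 - s - sigma, but for zeta near the positive
   horizontal axis and bounded xi near the vertical axis the phase is bounded, and these
   interactions push the output at such xi to size n^(2a) after pairing with a Fejer kernel in the
   angle, peaked on the vertical axis. If the solution stayed bounded in H^(s,sigma), that pairing
   would be O(n^(3/2 - sigma)), which is smaller because a > 3/4 - sigma/2; the second restriction
   sigma < 1/2 comes from summing (1 + l^2)^(-sigma) over |l| < n. The cubic and higher iterates
   contribute O(n^(3a-1)), which is negligible because a < 1, and averaging in time removes the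
   oscillation of the remaining interactions, whose contribution is then nonnegative. Solutions
   are built from their Fourier transforms, by iterating below an integrable majorant W with
   c * (W correlated with W) <= W. *)

theory Submission
  imports Defs "HOL-Probability.Probability" "HOL-Real_Asymp.Real_Asymp"
begin

section \<open>Schwartz functions\<close>

text \<open>A map \<Phi> is prescribed only at data with a smooth solution, so for each n a solution
  has to be built on the whole fixed interval [0,T]. This succeeds because the Fourier transform of
  the data has L^1 norm of order n^(a-1), which tends to zero. Nothing is known about the angular
  spectrum of that solution; the angular operator is therefore moved to the test function. Fejer
  kernels serve for data and test function alike: they have finitely many modes, on which the
  operator is explicit, and they are nonnegative, so that interactions cannot cancel. The size
  n^(2a) is the squared amplitude n^(2a-4) times three kernel values of order n^2, integrated over
  two boxes of area of order 1/n each. The annulus has area 4 pi for every n, so the data have norm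
  at most of order n^(a-1/2+\<sigma>+s). An exponent a between 3/4-\<sigma>/2 and 1/2-\<sigma>-s
  exists exactly when \<sigma> < -2s-1/2.\<close>

definition pd :: "R2 \<Rightarrow> (R2 \<Rightarrow> complex) \<Rightarrow> R2 \<Rightarrow> complex" where
  "pd v f = (\<lambda>x. frechet_derivative f (at x) v)"

definition rapid :: "(R2 \<Rightarrow> complex) \<Rightarrow> bool" where
  "rapid f \<longleftrightarrow> (\<forall>n::nat. \<exists>C. \<forall>x. (1 + norm x) ^ n * norm (f x) \<le> C)"

lemma iter_pderiv_Cons: "iter_pderiv (v # vs) f = pd v (iter_pderiv vs f)"
  by (simp add: pd_def)

lemma iter_pderiv_snoc: "iter_pderiv (vs @ [v]) f = iter_pderiv vs (pd v f)"
  by (induction vs) (simp_all add: pd_def)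

lemma Basis_R2: "(Basis :: R2 set) = {(1,0), (0,1)}"
  by (auto simp: Basis_prod_def)

lemma pd_eqI: "(\<And>x. (f has_derivative f' x) (at x)) \<Longrightarrow> pd v f = (\<lambda>x. f' x v)"
  unfolding pd_def by (metis frechet_derivative_at)

lemma pd_at: "(f has_derivative f') (at x) \<Longrightarrow> pd v f x = f' v"
  unfolding pd_def by (metis frechet_derivative_at)

lemma has_derivative_pd_fun: "f differentiable at x \<Longrightarrow> (f has_derivative (\<lambda>h. pd h f x)) (at x)"
  unfolding pd_def using frechet_derivative_works[of f "at x"] by (simp add: eta_contract_eq)

lemma schwartz_iff: "f \<in> schwartz \<longleftrightarrow>
  (\<forall>vs. set vs \<subseteq> Basis \<longrightarrow> (\<forall>x. iter_pderiv vs f differentiable at x) \<and> rapid (iter_pderiv vs f))"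
  unfolding schwartz_def rapid_def bdd_above_def by auto

text \<open>The Schwartz space is the largest class of differentiable, rapidly decreasing functions
  that is stable under coordinate derivatives. Exhibiting such a class \<open>X\<close> spares any
  computation of iterated derivatives.\<close>

lemma schwartz_coinduct:
  assumes "f \<in> X"
    and "\<And>f x. f \<in> X \<Longrightarrow> f differentiable at x"
    and "\<And>f. f \<in> X \<Longrightarrow> rapid f"
    and "\<And>f v. f \<in> X \<Longrightarrow> v \<in> Basis \<Longrightarrow> pd v f \<in> X"
  shows "f \<in> schwartz"
proof -
  have "iter_pderiv vs f \<in> X" if "set vs \<subseteq> Basis" for vs
    using that by (induction vs) (use assms in \<open>auto simp: iter_pderiv_Cons simp del: iter_pderiv.simps(2)\<close>)
  then show ?thesis using assms(2,3) by (auto simp: schwartz_iff)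
qed

lemma schwartz_pd: "f \<in> schwartz \<Longrightarrow> v \<in> Basis \<Longrightarrow> pd v f \<in> schwartz"
  unfolding schwartz_iff iter_pderiv_snoc[symmetric] by auto

lemma schwartz_differentiable: "f \<in> schwartz \<Longrightarrow> f differentiable at x"
  unfolding schwartz_iff by (metis empty_subsetI iter_pderiv.simps(1) list.set(1))

lemma schwartz_rapid: "f \<in> schwartz \<Longrightarrow> rapid f"
  unfolding schwartz_iff by (metis empty_subsetI iter_pderiv.simps(1) list.set(1))

lemma R2_decomp: "(h::R2) = fst h *\<^sub>R (1,0) + snd h *\<^sub>R (0,1)"
  by (cases h) simp

lemma differentiable_has_derivative_pd:
  assumes "f differentiable at x"
  shows "(f has_derivative (\<lambda>h. of_real (fst h) * pd (1,0) f x + of_real (snd h) * pd (0,1) f x)) (at x)"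
proof -
  let ?D = "frechet_derivative f (at x)"
  have D: "(f has_derivative ?D) (at x)"
    using assms frechet_derivative_works by blast
  then have lin: "linear ?D" by (rule has_derivative_linear)
  have "?D = (\<lambda>h. of_real (fst h) * pd (1,0) f x + of_real (snd h) * pd (0,1) f x)"
  proof
    fix h :: R2
    have "?D h = ?D (fst h *\<^sub>R (1,0) + snd h *\<^sub>R (0,1))" using R2_decomp[of h] by simp
    also have "\<dots> = of_real (fst h) * pd (1,0) f x + of_real (snd h) * pd (0,1) f x"
      by (simp only: linear_add[OF lin] linear_scale[OF lin]) (simp add: pd_def scaleR_conv_of_real)
    finally show "?D h = of_real (fst h) * pd (1,0) f x + of_real (snd h) * pd (0,1) f x" .
  qed
  with D show ?thesis by simp
qed

lemmas schwartz_has_derivative = differentiable_has_derivative_pd[OF schwartz_differentiable]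

lemma schwartz_continuous: "f \<in> schwartz \<Longrightarrow> continuous_on UNIV f"
  by (simp add: continuous_at_imp_continuous_on differentiable_imp_continuous_within schwartz_differentiable)

lemma schwartz_measurable: "f \<in> schwartz \<Longrightarrow> f \<in> borel_measurable borel"
  by (intro borel_measurable_continuous_onI schwartz_continuous)

text \<open>A product rule turns one product into a sum of products. Closing under sums allows an
  invariant class to be described by its single terms.\<close>

inductive_set sums_of :: "(R2 \<Rightarrow> complex) set \<Rightarrow> (R2 \<Rightarrow> complex) set" for X where
  base: "f \<in> X \<Longrightarrow> f \<in> sums_of X"
| plus: "f \<in> sums_of X \<Longrightarrow> g \<in> sums_of X \<Longrightarrow> (\<lambda>x. f x + g x) \<in> sums_of X"

lemma rapid_add: assumes "rapid f" "rapid g" shows "rapid (\<lambda>x. f x + g x)"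
  unfolding rapid_def
proof
  fix n
  from assms obtain C D where C: "\<And>x. (1 + norm x) ^ n * norm (f x) \<le> C" and
     D: "\<And>x. (1 + norm x) ^ n * norm (g x) \<le> D" unfolding rapid_def by meson
  have "(1 + norm x) ^ n * norm (f x + g x) \<le> C + D" for x
  proof -
    have "(1 + norm x) ^ n * norm (f x + g x) \<le> (1 + norm x) ^ n * (norm (f x) + norm (g x))"
      by (intro mult_left_mono norm_triangle_ineq) auto
    then show ?thesis using C[of x] D[of x] by (simp add: distrib_left)
  qed
  then show "\<exists>C. \<forall>x. (1 + norm x) ^ n * norm (f x + g x) \<le> C" by blast
qed

lemma rapid_le:
  assumes "rapid f" "\<And>x. norm (g x) \<le> C * (1 + norm x) ^ k * norm (f x)"
  shows "rapid g"
  unfolding rapid_def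
proof
  fix n
  from assms obtain D where D: "\<And>x. (1 + norm x) ^ (n+k) * norm (f x) \<le> D" unfolding rapid_def by meson
  have "(1 + norm x) ^ n * norm (g x) \<le> \<bar>C\<bar> * D" for x
  proof -
    have "(1 + norm x) ^ n * norm (g x) \<le> (1 + norm x) ^ n * (C * (1 + norm x) ^ k * norm (f x))"
      by (intro mult_left_mono assms) auto
    also have "\<dots> = C * ((1 + norm x) ^ (n+k) * norm (f x))" by (simp add: power_add)
    also have "\<dots> \<le> \<bar>C\<bar> * ((1 + norm x) ^ (n+k) * norm (f x))" by (intro mult_right_mono) auto
    also have "\<dots> \<le> \<bar>C\<bar> * D" by (intro mult_left_mono D) auto
    finally show ?thesis .
  qed
  then show "\<exists>C. \<forall>x. (1 + norm x) ^ n * norm (g x) \<le> C" by blast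
qed

lemma pd_add: "f differentiable at x \<Longrightarrow> g differentiable at x \<Longrightarrow>
    pd v (\<lambda>x. f x + g x) x = pd v f x + pd v g x"
  by (rule pd_at) (intro derivative_intros has_derivative_pd_fun)

lemma schwartz_coinduct_sums:
  assumes "f \<in> X"
    and D: "\<And>f x. f \<in> X \<Longrightarrow> f differentiable at x"
    and R: "\<And>f. f \<in> X \<Longrightarrow> rapid f"
    and P: "\<And>f v. f \<in> X \<Longrightarrow> v \<in> Basis \<Longrightarrow> pd v f \<in> sums_of X"
  shows "f \<in> schwartz"
proof (rule schwartz_coinduct[of _ "sums_of X"])
  show "f \<in> sums_of X" using assms(1) by (rule sums_of.base)
  show diff: "g differentiable at x" if "g \<in> sums_of X" for g x
    using that by (induction) (auto intro: D)
  show "rapid g" if "g \<in> sums_of X" for g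
    using that by (induction) (auto intro: R rapid_add)
  show "pd v g \<in> sums_of X" if "g \<in> sums_of X" "v \<in> Basis" for g v
    using that
  proof (induction)
    case (base f) then show ?case by (simp add: P)
  next
    case (plus f g)
    have "pd v (\<lambda>x. f x + g x) = (\<lambda>x. pd v f x + pd v g x)"
      using diff plus by (auto intro!: pd_add)
    then show ?case using plus by (auto intro: sums_of.plus)
  qed
qed

lemma pd_cmult: "f differentiable at x \<Longrightarrow> pd v (\<lambda>x. a * f x) x = a * pd v f x"
  by (rule pd_at) (intro derivative_intros has_derivative_pd_fun)

lemma pd_mult: "m differentiable at x \<Longrightarrow> f differentiable at x \<Longrightarrow>
    pd v (\<lambda>x. m x * f x) x = m x * pd v f x + pd v m x * f x"
  by (rule pd_at) (intro derivative_intros has_derivative_pd_fun)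

lemma schwartz_lincomb:
  assumes "f \<in> schwartz" "g \<in> schwartz"
  shows "(\<lambda>x. a * f x + b * g x) \<in> schwartz"
proof (rule schwartz_coinduct[of _ "{(\<lambda>x. a * f x + b * g x) |f g. f \<in> schwartz \<and> g \<in> schwartz}"], goal_cases)
  case 1 then show ?case using assms by blast
next
  case (2 h x)
  then obtain f g where "h = (\<lambda>x. a * f x + b * g x)" "f \<in> schwartz" "g \<in> schwartz" by auto
  then show ?case by (simp add: differentiable_add differentiable_mult schwartz_differentiable)
next
  case (3 f) 
  have "rapid (\<lambda>x. c * f x)" if "f \<in> schwartz" for c f
    by (rule rapid_le[OF schwartz_rapid[OF that], of _ "norm c" 0]) (simp add: norm_mult)
  then show ?case using 3 by (auto intro!: rapid_add)
next
  case (4 h v)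
  then obtain f g where fg: "h = (\<lambda>x. a * f x + b * g x)" "f \<in> schwartz" "g \<in> schwartz" by auto
  then have "pd v h = (\<lambda>x. a * pd v f x + b * pd v g x)"
    by (intro ext) (simp only: fg(1) pd_add pd_cmult schwartz_differentiable differentiable_mult differentiable_const)
  then show ?case using fg 4 schwartz_pd by blast
qed

lemma schwartz_zero [simp]: "(\<lambda>x. 0) \<in> schwartz"
  by (rule schwartz_coinduct[of _ "{\<lambda>x. 0}"]) (auto simp: rapid_def pd_def)

lemma schwartz_add: "f \<in> schwartz \<Longrightarrow> g \<in> schwartz \<Longrightarrow> (\<lambda>x. f x + g x) \<in> schwartz"
  using schwartz_lincomb[of f g 1 1] by simp

lemma schwartz_cmult: "f \<in> schwartz \<Longrightarrow> (\<lambda>x. c * f x) \<in> schwartz"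
  using schwartz_lincomb[of f f c 0] by simp

lemma schwartz_sum: "(\<And>i. i \<in> I \<Longrightarrow> f i \<in> schwartz) \<Longrightarrow> (\<lambda>x. \<Sum>i\<in>I. f i x) \<in> schwartz"
  by (induction I rule: infinite_finite_induct) (auto intro!: schwartz_add)

text \<open>By the product rule it is enough that the multipliers form a class of polynomial growth
  that is stable under derivatives. The degree may vary from one multiplier to the next, since rapid
  decay absorbs any power.\<close>

lemma schwartz_mult:
  assumes M: "m \<in> M" and f: "f \<in> schwartz"
    and D: "\<And>m x. m \<in> M \<Longrightarrow> m differentiable at x"
    and B: "\<And>m. m \<in> M \<Longrightarrow> \<exists>C k. \<forall>x. norm (m x) \<le> C * (1 + norm x) ^ k"
    and P: "\<And>m v. m \<in> M \<Longrightarrow> v \<in> Basis \<Longrightarrow> pd v m \<in> M"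
  shows "(\<lambda>x. m x * f x) \<in> schwartz"
proof (rule schwartz_coinduct_sums[of _ "{(\<lambda>x. m x * f x) |m f. m \<in> M \<and> f \<in> schwartz}"], goal_cases)
  case 1 then show ?case using M f by blast
next
  case (2 h x)
  then obtain m f where "h = (\<lambda>x. m x * f x)" "m \<in> M" "f \<in> schwartz" by auto
  then show ?case by (simp add: differentiable_mult schwartz_differentiable D)
next
  case (3 h)
  then obtain m f where h: "h = (\<lambda>x. m x * f x)" "m \<in> M" "f \<in> schwartz" by auto
  then obtain C k where "\<forall>x. norm (m x) \<le> C * (1 + norm x) ^ k" using B by blast
  then show ?case unfolding h
    by (intro rapid_le[OF schwartz_rapid[OF h(3)], of _ C k]) (auto simp: norm_mult intro!: mult_right_mono)
next
  case (4 h v)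
  then obtain m f where h: "h = (\<lambda>x. m x * f x)" "m \<in> M" "f \<in> schwartz" by auto
  have "pd v h = (\<lambda>x. m x * pd v f x + pd v m x * f x)"
    unfolding h(1) by (intro ext pd_mult D h schwartz_differentiable)
  moreover have "(\<lambda>x. m x * pd v f x) \<in> {(\<lambda>x. m x * f x) |m f. m \<in> M \<and> f \<in> schwartz}"
    using h(2,3) 4(2) by (blast intro: schwartz_pd)
  moreover have "(\<lambda>x. pd v m x * f x) \<in> {(\<lambda>x. m x * f x) |m f. m \<in> M \<and> f \<in> schwartz}"
    using h(2,3) 4(2) by (blast intro: P)
  ultimately show ?case by (simp only: sums_of.intros)
qed

text \<open>The class of multipliers consists of affine functions, because the derivative of a
  linear form is a constant.\<close>

lemma schwartz_mult_inner:
  assumes "f \<in> schwartz"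
  shows "(\<lambda>x. of_real (a \<bullet> x) * f x) \<in> schwartz"
proof (rule schwartz_mult[of _ "{\<lambda>x. of_real (a \<bullet> x + c) |a c. True}"], goal_cases)
  case 1 have "(\<lambda>x. of_real (a \<bullet> x)) = (\<lambda>x. of_real (a \<bullet> x + 0) :: complex)" by simp
  then show ?case by blast
next
  case 2 show ?case by fact
next
  case (3 m x) then show ?case
    by (elim CollectE exE conjE, hypsubst)
       (intro differentiableI[of _ "\<lambda>h. of_real (_ \<bullet> h)"], auto intro!: derivative_eq_intros)
next
  case (4 m)
  then obtain a c where m: "m = (\<lambda>x. of_real (a \<bullet> x + c))" by auto
  have "norm (m x) \<le> (norm a + \<bar>c\<bar>) * (1 + norm x) ^ 1" for x
  proof -
    have "norm (m x) \<le> \<bar>a \<bullet> x\<bar> + \<bar>c\<bar>" unfolding m norm_of_real by (rule abs_triangle_ineq)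
    also have "\<dots> \<le> norm a * norm x + \<bar>c\<bar>" using Cauchy_Schwarz_ineq2[of a x] by simp
    also have "\<dots> \<le> (norm a + \<bar>c\<bar>) * (1 + norm x)" by (simp add: algebra_simps)
    finally show ?thesis by simp
  qed
  then show ?case by blast
next
  case (5 m v)
  then obtain a c where m: "m = (\<lambda>x. of_real (a \<bullet> x + c))" by auto
  have "pd v m = (\<lambda>x. of_real (0 \<bullet> x + a \<bullet> v))" unfolding m
    by (subst pd_eqI[where f' = "\<lambda>x h. of_real (a \<bullet> h)"]) (auto intro!: derivative_eq_intros)
  then show ?case by blast
qed

text \<open>A derivative of the phase gives back the phase times a linear form, and the linear form
  is absorbed by the Schwartz factor. The products of the phase with Schwartz functions are thus a
  stable class. This is what lets the propagator act by duality.\<close>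

lemma schwartz_mult_unimodular:
  assumes "f \<in> schwartz"
  shows "(\<lambda>x. cis (t * (norm x)\<^sup>2) * f x) \<in> schwartz"
proof (rule schwartz_coinduct[of _ "{(\<lambda>x. cis (t * (norm x)\<^sup>2) * f x) |f. f \<in> schwartz}"], goal_cases)
  case 1 then show ?case using assms by blast
next
  have c: "((\<lambda>x. cis (t * (norm x)\<^sup>2)) has_derivative (\<lambda>h. \<i> * of_real (2 * t * (x \<bullet> h)) * cis (t * (norm x)\<^sup>2))) (at x)" for x :: R2
  proof -
    have "((\<lambda>x::R2. t * (x \<bullet> x)) has_derivative (\<lambda>h. 2 * t * (x \<bullet> h))) (at x)"
      by (auto intro!: derivative_eq_intros simp: inner_commute)
    from has_derivative_compose[OF has_derivative_mult_right[OF has_derivative_of_real[OF this], of \<i>]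
        has_field_derivative_imp_has_derivative[OF DERIV_exp]]
    show ?thesis unfolding power2_norm_eq_inner cis_conv_exp by (simp add: mult_ac)
  qed
  {
    case (2 h x)
    then obtain f where "h = (\<lambda>x. cis (t * (norm x)\<^sup>2) * f x)" "f \<in> schwartz" by auto
    moreover have "(\<lambda>x. cis (t * (norm x)\<^sup>2)) differentiable at x" using c differentiable_def by blast
    ultimately show ?case by (simp add: differentiable_mult schwartz_differentiable)
  next
    case (3 h)
    then show ?case using schwartz_rapid by (auto simp: rapid_def norm_mult)
  next
    case (4 h v)
    then obtain f where h: "h = (\<lambda>x. cis (t * (norm x)\<^sup>2) * f x)" "f \<in> schwartz" by auto
    define q where "q = (\<lambda>x. 1 * pd v f x + 2 * \<i> * t * (of_real (v \<bullet> x) * f x))"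
    have "pd v h = (\<lambda>x. cis (t * (norm x)\<^sup>2) * q x)"
      unfolding h q_def
      apply (subst pd_eqI[OF has_derivative_mult[OF c]])
       apply (rule frechet_derivative_works[THEN iffD1, OF schwartz_differentiable[OF h(2)]])
      by (simp add: pd_def algebra_simps inner_commute)
    moreover have "q \<in> schwartz" unfolding q_def
      using schwartz_pd[OF h(2) 4(2)] h(2) by (intro schwartz_lincomb schwartz_mult_inner)
    ultimately show ?case by blast
  }
qed

section \<open>Integrability, Fubini and differentiation under the integral sign\<close>

lemma cis_measurable [measurable]: "cis \<in> borel_measurable borel"
  by (intro borel_measurable_continuous_onI continuous_intros)

lemma one_plus_norm_pos [simp]: "0 < 1 + norm x" "1 + norm x \<noteq> 0" for x :: "'a::real_normed_vector"
  using norm_ge_zero[of x] by linarith+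

lemma integrable_mult_bounded:
  fixes f g :: "'a \<Rightarrow> complex"
  assumes "integrable M f" "g \<in> borel_measurable M" "\<And>x. norm (g x) \<le> C"
  shows "integrable M (\<lambda>x. g x * f x)" "integrable M (\<lambda>x. f x * g x)"
proof -
  have m: "f \<in> borel_measurable M" using assms(1) by auto
  have b: "norm (g x * f x) \<le> norm (C * norm (f x))" for x
  proof -
    have "norm (g x * f x) \<le> C * norm (f x)"
      unfolding norm_mult by (intro mult_right_mono assms norm_ge_zero)
    also have "\<dots> \<le> norm (C * norm (f x))" unfolding real_norm_def by (rule abs_ge_self)
    finally show ?thesis .
  qed
  have i: "integrable M (\<lambda>x. C * norm (f x))" using assms(1) by (intro integrable_mult_right integrable_norm)
  show "integrable M (\<lambda>x. g x * f x)"
    by (rule Bochner_Integration.integrable_bound[OF i]) (use assms(2) m b in \<open>measurable, simp\<close>)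
  then show "integrable M (\<lambda>x. f x * g x)" by (simp add: mult.commute)
qed

text \<open>A bounded kernel keeps the integrand below a product of integrable functions of one
  variable each. Most later exchanges of integrals are brought to this form.\<close>

lemma Fubini_kernel:
  fixes f :: "'a \<Rightarrow> complex" and g :: "'b \<Rightarrow> complex"
  assumes "sigma_finite_measure M1" "sigma_finite_measure M2"
    and f: "integrable M1 f" and g: "integrable M2 g"
    and k[measurable]: "(\<lambda>(x, y). k x y) \<in> borel_measurable (M1 \<Otimes>\<^sub>M M2)"
    and k1: "\<And>x y. norm (k x y) \<le> C"
  shows "(\<integral>x. f x * (\<integral>y. k x y * g y \<partial>M2) \<partial>M1) = (\<integral>y. g y * (\<integral>x. k x y * f x \<partial>M1) \<partial>M2)"
    and "integrable (M1 \<Otimes>\<^sub>M M2) (\<lambda>(x, y). f x * (k x y * g y))"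
proof -
  interpret p: pair_sigma_finite M1 M2 using assms(1,2) by (simp add: pair_sigma_finite_def)
  have [measurable]: "f \<in> borel_measurable M1" "g \<in> borel_measurable M2" using f g by auto
  have i: "integrable M2 (\<lambda>y. f x * (k x y * g y))" if "x \<in> space M1" for x
    using that by (intro integrable_mult_right integrable_mult_bounded(1)[OF g _ k1]) measurable
  have "integrable M1 (\<lambda>x. \<integral>y. norm (f x * (k x y * g y)) \<partial>M2)"
  proof (rule Bochner_Integration.integrable_bound)
    show "integrable M1 (\<lambda>x. norm (f x) * (C * (\<integral>y. norm (g y) \<partial>M2)))"
      using f by auto
    have "norm (\<integral>y. norm (f x * (k x y * g y)) \<partial>M2) \<le> norm (norm (f x) * (C * (\<integral>y. norm (g y) \<partial>M2)))"
      if "x \<in> space M1" for x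
    proof -
      have "(\<integral>y. norm (f x * (k x y * g y)) \<partial>M2) \<le> (\<integral>y. norm (f x) * (C * norm (g y)) \<partial>M2)"
        using integrable_norm[OF i[OF that]] g by (intro integral_mono) (auto simp: norm_mult intro!: mult_left_mono mult_right_mono k1)
      also have "\<dots> = norm (f x) * (C * (\<integral>y. norm (g y) \<partial>M2))" by simp
      finally show ?thesis by (subst real_norm_def, subst abs_of_nonneg) (auto intro!: integral_nonneg_AE)
    qed
    then show "AE x in M1. norm (\<integral>y. norm (f x * (k x y * g y)) \<partial>M2) \<le> norm (norm (f x) * (C * (\<integral>y. norm (g y) \<partial>M2)))"
      by (intro AE_I2) auto
  qed measurable
  then show I: "integrable (M1 \<Otimes>\<^sub>M M2) (\<lambda>(x, y). f x * (k x y * g y))"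
    using i by (intro p.Fubini_integrable) auto
  have "(\<integral>x. f x * (\<integral>y. k x y * g y \<partial>M2) \<partial>M1) = (\<integral>x. (\<integral>y. f x * (k x y * g y) \<partial>M2) \<partial>M1)"
    by simp
  also have "\<dots> = (\<integral>y. (\<integral>x. f x * (k x y * g y) \<partial>M1) \<partial>M2)"
    using p.Fubini_integral[OF I] by simp
  also have "\<dots> = (\<integral>y. (\<integral>x. g y * (k x y * f x) \<partial>M1) \<partial>M2)"
    by (simp only: mult_ac)
  also have "\<dots> = (\<integral>y. g y * (\<integral>x. k x y * f x \<partial>M1) \<partial>M2)"
    by simp
  finally show "(\<integral>x. f x * (\<integral>y. k x y * g y \<partial>M2) \<partial>M1) = (\<integral>y. g y * (\<integral>x. k x y * f x \<partial>M1) \<partial>M2)" .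
qed

lemma integrable_prod_lborel:
  fixes f g :: "real \<Rightarrow> complex"
  assumes f: "integrable lborel f" and g: "integrable lborel g"
  shows "integrable lborel (\<lambda>x. f (fst x) * g (snd x))"
    and "(\<integral>x. f (fst x) * g (snd x) \<partial>lborel) = (\<integral>x. f x \<partial>lborel) * (\<integral>x. g x \<partial>lborel)"
proof -
  have "integrable (lborel \<Otimes>\<^sub>M lborel) (\<lambda>(x, y). f x * (1 * g y))"
    by (rule Fubini_kernel(2)[where C=1]) (auto intro: assms sigma_finite_lborel)
  then have I: "integrable (lborel \<Otimes>\<^sub>M lborel) (\<lambda>(x, y). f x * g y)" by simp
  then show "integrable lborel (\<lambda>x. f (fst x) * g (snd x))"
    unfolding lborel_prod case_prod_unfold .
  have "(\<integral>x. f (fst x) * g (snd x) \<partial>lborel) = (\<integral>x. (\<integral>y. f x * g y \<partial>lborel) \<partial>lborel)"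
    using lborel_pair.integral_fst[OF I] unfolding lborel_prod case_prod_unfold by simp
  then show "(\<integral>x. f (fst x) * g (snd x) \<partial>lborel) = (\<integral>x. f x \<partial>lborel) * (\<integral>x. g x \<partial>lborel)"
    by simp
qed

text \<open>The exponent 4 is 2 + 2: \<open>(1 + norm x) ^ 4\<close> dominates the product of 1 plus
  the square of each coordinate, whose inverse is a product of integrable functions of one
  variable.\<close>

lemma integrable_inverse_power4: "integrable lborel (\<lambda>x::R2. inverse ((1 + norm x) ^ 4))"
proof -
  have "integrable lborel (\<lambda>x::real. complex_of_real (inverse (1 + x\<^sup>2)))"
    using integrable_inverse_1_plus_square by (simp add: set_integrable_def del: of_real_inverse)
  from integrable_norm[OF integrable_prod_lborel(1)[OF this this]]
  have I: "integrable lborel (\<lambda>x::R2. inverse ((1 + (fst x)\<^sup>2) * (1 + (snd x)\<^sup>2)))"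
  proof (rule back_subst[of "integrable lborel"], intro ext)
    fix x :: R2
    have "\<bar>1 + (fst x)\<^sup>2\<bar> = 1 + (fst x)\<^sup>2" "\<bar>1 + (snd x)\<^sup>2\<bar> = 1 + (snd x)\<^sup>2" by (auto intro: add_nonneg_nonneg)
    then show "cmod (complex_of_real (inverse (1 + (fst x)\<^sup>2)) * complex_of_real (inverse (1 + (snd x)\<^sup>2)))
      = inverse ((1 + (fst x)\<^sup>2) * (1 + (snd x)\<^sup>2))"
      by (simp only: norm_mult norm_of_real abs_inverse inverse_mult_distrib)
  qed
  show ?thesis
  proof (rule Bochner_Integration.integrable_bound[OF I])
    have "inverse ((1 + norm x) ^ 4) \<le> inverse ((1 + (fst x)\<^sup>2) * (1 + (snd x)\<^sup>2))" for x :: R2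
    proof (rule le_imp_inverse_le)
      have a: "(fst x)\<^sup>2 \<le> (norm x)\<^sup>2" "(snd x)\<^sup>2 \<le> (norm x)\<^sup>2"
        by (simp_all add: norm_prod_def)
      have b: "1 + (norm x)\<^sup>2 \<le> (1 + norm x)\<^sup>2" by (simp add: power2_eq_square algebra_simps)
      have "(1 + (fst x)\<^sup>2) * (1 + (snd x)\<^sup>2) \<le> (1 + norm x)\<^sup>2 * (1 + norm x)\<^sup>2"
        using a b by (intro mult_mono) auto
      then show "(1 + (fst x)\<^sup>2) * (1 + (snd x)\<^sup>2) \<le> (1 + norm x) ^ 4"
        by (simp flip: power_add)
      show "0 < (1 + (fst x)\<^sup>2) * (1 + (snd x)\<^sup>2)"
        by (intro mult_pos_pos) (auto intro: add_pos_nonneg)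
    qed
    then show "AE x::R2 in lborel. norm (inverse ((1 + norm x) ^ 4)) \<le> norm (inverse ((1 + (fst x)\<^sup>2) * (1 + (snd x)\<^sup>2)))"
      by (intro AE_I2) (auto simp: abs_mult)
  qed measurable
qed

lemma rapid_integrable_mult:
  assumes "rapid f" "f \<in> borel_measurable borel"
  shows "integrable lborel (\<lambda>x. (1 + norm x) ^ n * norm (f x))"
proof -
  from assms obtain C where C: "\<And>x. (1 + norm x) ^ (n + 4) * norm (f x) \<le> C" unfolding rapid_def by meson
  show ?thesis
  proof (rule Bochner_Integration.integrable_bound[OF integrable_mult_right[OF integrable_inverse_power4, of C]])
    have "(1 + norm x) ^ n * norm (f x) \<le> C * inverse ((1 + norm x) ^ 4)" for x
    proof -
      have "(1 + norm x) ^ 4 > 0" by (simp add: add_pos_nonneg)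
      then have "(1 + norm x) ^ n * norm (f x) = ((1 + norm x) ^ (n + 4) * norm (f x)) * inverse ((1 + norm x) ^ 4)"
      proof -
        have "(1 + norm x) ^ 4 \<noteq> 0" by simp
        then show ?thesis unfolding power_add by (metis (no_types) mult.assoc mult.commute right_inverse mult_1_right)
      qed
      also have "\<dots> \<le> C * inverse ((1 + norm x) ^ 4)" using C[of x] by (intro mult_right_mono) auto
      finally show ?thesis .
    qed
    moreover have "0 \<le> (1 + norm x) ^ n * norm (f x)" for x by simp
    ultimately show "AE x in lborel. norm ((1 + norm x) ^ n * norm (f x)) \<le> norm (C * inverse ((1 + norm x) ^ 4))"
      unfolding real_norm_def by (intro AE_I2) (metis abs_ge_self abs_of_nonneg order_trans)
  qed (use assms in measurable)
qed

lemma schwartz_integrable: "f \<in> schwartz \<Longrightarrow> integrable lborel f"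
  using rapid_integrable_mult[OF schwartz_rapid schwartz_measurable, of f 0]
  by (subst integrable_norm_iff[symmetric]) (simp_all add: schwartz_measurable)

text \<open>The Lipschitz bound near \<open>h0\<close> dominates the difference quotients, so
  dominated convergence applies along every sequence tending to zero. The parameter ranges over a
  Euclidean space, which yields the total derivative at once.\<close>

lemma has_derivative_lebesgue_integral:
  fixes f :: "'a \<Rightarrow> 'b::euclidean_space \<Rightarrow> complex"
  assumes int: "\<And>h. integrable M (\<lambda>x. f x h)"
    and D: "\<And>x. x \<in> space M \<Longrightarrow> (f x has_derivative f' x) (at h0)"
    and r: "r > 0"
    and B: "\<And>x h. x \<in> space M \<Longrightarrow> norm h < r \<Longrightarrow> norm (f x (h0 + h) - f x h0) \<le> B x * norm h"
    and B': "\<And>x h. x \<in> space M \<Longrightarrow> norm (f' x h) \<le> B x * norm h"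
    and iB: "integrable M B"
    and int': "\<And>h. (\<lambda>x. f' x h) \<in> borel_measurable M"
  shows "((\<lambda>h. \<integral>x. f x h \<partial>M) has_derivative (\<lambda>h. \<integral>x. f' x h \<partial>M)) (at h0)"
proof -
  have if': "integrable M (\<lambda>x. f' x h)" for h
    by (intro Bochner_Integration.integrable_bound[OF integrable_mult_left[OF iB, of "norm h"] int'] AE_I2)
       (rule order_trans[OF B'], auto)
  have lin: "linear (f' x)" if "x \<in> space M" for x using D[OF that] by (rule has_derivative_linear)
  have "linear (\<lambda>h. \<integral>x. f' x h \<partial>M)"
  proof
    fix a b
    have "(\<integral>x. f' x (a + b) \<partial>M) = (\<integral>x. f' x a + f' x b \<partial>M)"
      using lin by (intro Bochner_Integration.integral_cong) (auto simp: linear_add)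
    then show "(\<integral>x. f' x (a + b) \<partial>M) = (\<integral>x. f' x a \<partial>M) + (\<integral>x. f' x b \<partial>M)" using if' by simp
  next
    fix c a
    have "(\<integral>x. f' x (c *\<^sub>R a) \<partial>M) = (\<integral>x. c *\<^sub>R f' x a \<partial>M)"
      using lin by (intro Bochner_Integration.integral_cong) (auto simp: linear_scale)
    then show "(\<integral>x. f' x (c *\<^sub>R a) \<partial>M) = c *\<^sub>R (\<integral>x. f' x a \<partial>M)" using if' by simp
  qed
  then have bl: "bounded_linear (\<lambda>h. \<integral>x. f' x h \<partial>M)" by (rule linear_conv_bounded_linear[THEN iffD1])
  define q where "q x h = (f x (h0 + h) - f x h0 - f' x h) /\<^sub>R norm h" for x h
  have q: "(q x \<longlongrightarrow> 0) (at 0)" if "x \<in> space M" for x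
  proof -
    have "((\<lambda>h. norm (f x (h0 + h) - f x h0 - f' x h) / norm h) \<longlongrightarrow> 0) (at 0)"
      using D[OF that] unfolding has_derivative_at by blast
    then show ?thesis unfolding q_def
      by (rule_tac tendsto_norm_zero_cancel) (simp add: divide_inverse mult.commute)
  qed
  have "((\<lambda>h. \<integral>x. q x h \<partial>M) \<longlongrightarrow> 0) (at 0)"
  proof (subst tendsto_at_iff_sequentially, intro allI impI, unfold comp_def)
    fix X :: "nat \<Rightarrow> 'b" assume X: "\<forall>i. X i \<in> UNIV - {0}" "X \<longlonglongrightarrow> 0"
    from X(2) r have "\<forall>\<^sub>F n in sequentially. norm (X n) < r"
      using tendstoD[OF X(2) r] by simp
    \<comment> \<open>The bound \<open>B\<close> controls increments only below \<open>r\<close>, so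
      the sequence is cut at \<open>N\<close>.\<close>
    then obtain N where N: "\<And>n. n \<ge> N \<Longrightarrow> norm (X n) < r" by (auto simp: eventually_sequentially)
    have "(\<lambda>n. \<integral>x. q x (X (n + N)) \<partial>M) \<longlonglongrightarrow> (\<integral>x. 0 \<partial>M)"
    proof (rule integral_dominated_convergence)
      show "integrable M (\<lambda>x. 2 * B x)" using iB by simp
      show "AE x in M. (\<lambda>n. q x (X (n + N))) \<longlonglongrightarrow> 0"
      proof (intro AE_I2)
        fix x assume "x \<in> space M"
        from q[OF this] have "(\<lambda>n. q x (X n)) \<longlonglongrightarrow> 0"
          using X unfolding tendsto_at_iff_sequentially comp_def by blast
        then show "(\<lambda>n. q x (X (n + N))) \<longlonglongrightarrow> 0" by (rule LIMSEQ_ignore_initial_segment)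
      qed
      show "AE x in M. norm (q x (X (n + N))) \<le> 2 * B x" for n
      proof (intro AE_I2)
        fix x assume x: "x \<in> space M"
        have "norm (f x (h0 + X (n + N)) - f x h0 - f' x (X (n + N))) \<le> 2 * B x * norm (X (n + N))"
          using B[OF x N[of "n+N"]] B'[OF x, of "X (n+N)"] norm_triangle_ineq4[of "f x (h0 + X (n + N)) - f x h0" "f' x (X (n + N))"] by simp
        then show "norm (q x (X (n + N))) \<le> 2 * B x"
          using X(1) unfolding q_def norm_scaleR by (simp add: divide_inverse[symmetric] pos_divide_le_eq mult.commute[of "inverse (norm _)"])
      qed
      show "(\<lambda>x. q x (X (n + N))) \<in> borel_measurable M" for n
        unfolding q_def using int if' by (auto intro!: borel_measurable_scaleR borel_measurable_diff)
    qed simp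
    then show "(\<lambda>n. \<integral>x. q x (X n) \<partial>M) \<longlonglongrightarrow> 0"
      using LIMSEQ_offset[of "\<lambda>n. \<integral>x. q x (X n) \<partial>M" N 0] by simp
  qed
  moreover have "(\<integral>x. q x h \<partial>M) = ((\<integral>x. f x (h0 + h) \<partial>M) - (\<integral>x. f x h0 \<partial>M) - (\<integral>x. f' x h \<partial>M)) /\<^sub>R norm h" for h
    unfolding q_def using int if' by simp
  ultimately have "((\<lambda>h. ((\<integral>x. f x (h0 + h) \<partial>M) - (\<integral>x. f x h0 \<partial>M) - (\<integral>x. f' x h \<partial>M)) /\<^sub>R norm h) \<longlongrightarrow> 0) (at 0)"
    by simp
  from tendsto_norm_zero[OF this] show ?thesis
    unfolding has_derivative_at using bl by (simp add: divide_inverse mult.commute)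
qed

text \<open>Decay of the gradient at power 4 and the mean value inequality bound increments over
  steps of length at most 1, with a factor that is integrable in \<open>x\<close>. This is the
  dominating function that differentiation under an integral asks for.\<close>

lemma schwartz_derivative_bound:
  assumes "f \<in> schwartz"
  shows "\<exists>C\<ge>0. (\<forall>x h. norm h \<le> 1 \<longrightarrow> norm (f (x + h) - f x) \<le> C * inverse ((1 + norm x) ^ 4) * norm h) \<and>
    (\<forall>x h. norm (of_real (fst h) * pd (1,0) f x + of_real (snd h) * pd (0,1) f x) \<le> C * inverse ((1 + norm x) ^ 4) * norm h)"
proof -
  let ?D = "\<lambda>x h. of_real (fst h) * pd (1,0) f x + of_real (snd h) * pd (0,1) f x"
  have "rapid (pd (1,0) f)" "rapid (pd (0,1) f)"
    by (intro schwartz_rapid schwartz_pd assms, simp add: Basis_R2)+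
  then obtain C1 C2 where C: "\<And>x. (1 + norm x) ^ 4 * norm (pd (1,0) f x) \<le> C1"
      "\<And>x. (1 + norm x) ^ 4 * norm (pd (0,1) f x) \<le> C2"
    unfolding rapid_def by meson
  have "0 \<le> C1" "0 \<le> C2" using order_trans[OF _ C(1)[of 0]] order_trans[OF _ C(2)[of 0]] by auto
  have D: "norm (?D x h) \<le> (C1 + C2) * inverse ((1 + norm x) ^ 4) * norm h" for x h
  proof -
    have "norm (?D x h) \<le> \<bar>fst h\<bar> * norm (pd (1,0) f x) + \<bar>snd h\<bar> * norm (pd (0,1) f x)"
      by (rule norm_triangle_le) (simp add: norm_mult)
    also have "\<dots> \<le> norm h * (C1 * inverse ((1 + norm x) ^ 4)) + norm h * (C2 * inverse ((1 + norm x) ^ 4))"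
    proof -
      have "\<bar>fst h\<bar> \<le> norm h" "\<bar>snd h\<bar> \<le> norm h"
        using norm_fst_le[of "fst h" "snd h"] norm_snd_le[of "snd h" "fst h"] by simp_all
      moreover have "a \<le> c * inverse ((1 + norm x) ^ 4)" if "(1 + norm x) ^ 4 * a \<le> c" for a c
      proof -
        have "(1 + norm x) ^ 4 > 0" by simp
        with that show ?thesis unfolding divide_inverse[symmetric] by (subst pos_le_divide_eq) (simp_all add: mult.commute)
      qed
      ultimately show ?thesis using C[of x]
        by (intro add_mono mult_mono) auto
    qed
    also have "\<dots> = (C1 + C2) * inverse ((1 + norm x) ^ 4) * norm h" by (simp add: algebra_simps)
    finally show ?thesis .
  qed
  have F: "norm (f (x + h) - f x) \<le> (C1 + C2) * 16 * inverse ((1 + norm x) ^ 4) * norm h" if h: "norm h \<le> 1" for x h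
  proof -
    have "norm (f (x + h) - f x) \<le> (C1 + C2) * 16 * inverse ((1 + norm x) ^ 4) * norm ((x + h) - x)"
    proof (rule differentiable_bound[of "cball x 1" f "?D"])
      show "(f has_derivative ?D y) (at y within cball x 1)" for y
        by (rule has_derivative_at_withinI, rule schwartz_has_derivative[OF assms])
      show "onorm (?D y) \<le> (C1 + C2) * 16 * inverse ((1 + norm x) ^ 4)" if y: "y \<in> cball x 1" for y
      proof (rule onorm_le)
        fix k :: R2
        \<comment> \<open>On the unit ball about \<open>x\<close> the quantity 1 + |x| changes by at
          most a factor 2, hence its fourth power by at most 16.\<close>
        have "norm x \<le> norm y + 1" using y norm_triangle_ineq3[of x y] by (simp add: dist_norm)
        then have "1 + norm x \<le> 2 * (1 + norm y)" by (smt (verit) norm_ge_zero)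
        then have "(1 + norm x) ^ 4 \<le> (2 * (1 + norm y)) ^ 4" by (intro power_mono) auto
        then have "inverse ((1 + norm y) ^ 4) \<le> 16 * inverse ((1 + norm x) ^ 4)"
        proof -
          have p: "(1 + norm x) ^ 4 > 0" "(1 + norm y) ^ 4 > 0" by simp_all
          from \<open>(1 + norm x) ^ 4 \<le> (2 * (1 + norm y)) ^ 4\<close> have "(1 + norm x) ^ 4 \<le> 16 * (1 + norm y) ^ 4"
            unfolding power_mult_distrib by simp
          with p show ?thesis by (simp only: inverse_eq_divide divide_simps) (simp add: mult.commute)
        qed
        then have "(C1 + C2) * inverse ((1 + norm y) ^ 4) * norm k \<le> (C1 + C2) * (16 * inverse ((1 + norm x) ^ 4)) * norm k"
          using \<open>0 \<le> C1\<close> \<open>0 \<le> C2\<close> by (intro mult_right_mono mult_left_mono) auto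
        with D[where x=y and h=k] show "norm (?D y k) \<le> (C1 + C2) * 16 * inverse ((1 + norm x) ^ 4) * norm k" by (simp only: mult.assoc)
      qed
    qed (use h in \<open>auto simp: dist_norm\<close>)
    then show ?thesis by simp
  qed
  show ?thesis
  proof (rule exI[of _ "(C1 + C2) * 16"], intro conjI allI impI)
    show "norm (f (x + h) - f x) \<le> (C1 + C2) * 16 * inverse ((1 + norm x) ^ 4) * norm h"
      if "norm h \<le> 1" for x h using F[OF that] .
    show "norm (?D x h) \<le> (C1 + C2) * 16 * inverse ((1 + norm x) ^ 4) * norm h" for x h :: R2
    proof -
      have "(C1 + C2) * (inverse ((1 + norm x) ^ 4) * norm h) \<le> (C1 + C2) * 16 * (inverse ((1 + norm x) ^ 4) * norm h)"
        using \<open>0 \<le> C1\<close> \<open>0 \<le> C2\<close> by (intro mult_right_mono) simp_all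
      then show ?thesis
        using D[where x=x and h=h] by (simp only: mult.assoc)
    qed
    show "0 \<le> (C1 + C2) * 16" using \<open>0 \<le> C1\<close> \<open>0 \<le> C2\<close> by simp
  qed
qed

text \<open>The integral of a translate of \<open>f\<close> does not depend on the translation. Its
  derivative at zero, computed under the integral sign, is the integral of the derivative of
  \<open>f\<close>. This stands in for integration by parts.\<close>

lemma integral_pd_zero:
  assumes f: "f \<in> schwartz" and v: "v \<in> Basis"
  shows "(\<integral>x. pd v f x \<partial>lborel) = 0"
proof -
  obtain C where "\<forall>x h. norm h \<le> 1 \<longrightarrow> norm (f (x + h) - f x) \<le> C * inverse ((1 + norm x) ^ 4) * norm h"
    and "\<forall>x h. norm (of_real (fst h) * pd (1,0) f x + of_real (snd h) * pd (0,1) f x) \<le> C * inverse ((1 + norm x) ^ 4) * norm h"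
    using schwartz_derivative_bound[OF f] by (elim exE conjE)
  then have C: "\<And>x h. norm h \<le> 1 \<Longrightarrow> norm (f (x + h) - f x) \<le> C * inverse ((1 + norm x) ^ 4) * norm h"
    and C': "\<And>x h. norm (of_real (fst h) * pd (1,0) f x + of_real (snd h) * pd (0,1) f x) \<le> C * inverse ((1 + norm x) ^ 4) * norm h"
    by blast+
  have m[measurable]: "pd (1,0) f \<in> borel_measurable borel" "pd (0,1) f \<in> borel_measurable borel"
    by (intro schwartz_measurable schwartz_pd f, simp add: Basis_R2)+
  note [measurable] = schwartz_measurable[OF f]
  have shift: "(\<integral>x. f (x + h) \<partial>lborel) = (\<integral>x. f x \<partial>lborel)" 
     and ishift: "integrable lborel (\<lambda>x. f (x + h))" for h
  proof -
    have "(\<integral>x. f x \<partial>lborel) = (\<integral>x. f x \<partial>distr lborel borel ((+) h))" by (simp add: lborel_distr_plus)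
    then show "(\<integral>x. f (x + h) \<partial>lborel) = (\<integral>x. f x \<partial>lborel)" by (simp add: integral_distr add.commute)
    have "integrable (distr lborel borel ((+) h)) f" by (simp add: lborel_distr_plus schwartz_integrable f)
    then show "integrable lborel (\<lambda>x. f (x + h))" by (simp add: integrable_distr_eq add.commute)
  qed
  have "((\<lambda>h. \<integral>x. f (x + h) \<partial>lborel) has_derivative (\<lambda>h. \<integral>x. (of_real (fst h) * pd (1,0) f x + of_real (snd h) * pd (0,1) f x) \<partial>lborel)) (at 0)"
  proof (rule has_derivative_lebesgue_integral[where r=1 and B="\<lambda>x. C * inverse ((1 + norm x) ^ 4)"])
    show "((\<lambda>h. f (x + h)) has_derivative (\<lambda>h. of_real (fst h) * pd (1,0) f x + of_real (snd h) * pd (0,1) f x)) (at 0)" for x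
    proof -
      have "((\<lambda>h. x + h) has_derivative (\<lambda>h. h)) (at (0::R2))" by (auto intro!: derivative_eq_intros)
      then show ?thesis using has_derivative_compose[of "\<lambda>h. x + h" "\<lambda>h. h" 0 UNIV f "\<lambda>h. of_real (fst h) * pd (1,0) f x + of_real (snd h) * pd (0,1) f x"]
         schwartz_has_derivative[OF f, of x] by simp
    qed
    show "norm (f (x + (0 + h)) - f (x + 0)) \<le> C * inverse ((1 + norm x) ^ 4) * norm h" if "norm h < 1" for x h
      using C[where x=x and h=h] that by simp
    show "(\<lambda>x. of_real (fst h) * pd (1,0) f x + of_real (snd h) * pd (0,1) f x) \<in> borel_measurable lborel" for h
      by measurable
    show "integrable lborel (\<lambda>x::R2. C * inverse ((1 + norm x) ^ 4))"
      by (intro integrable_mult_right integrable_inverse_power4)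
  qed (rule ishift C' zero_less_one)+
  then have "((\<lambda>h. \<integral>x. f x \<partial>lborel) has_derivative (\<lambda>h. \<integral>x. (of_real (fst h) * pd (1,0) f x + of_real (snd h) * pd (0,1) f x) \<partial>lborel)) (at 0)"
    unfolding shift .
  then have "(\<lambda>h. \<integral>x. (of_real (fst h) * pd (1,0) f x + of_real (snd h) * pd (0,1) f x) \<partial>lborel) = (\<lambda>h. 0)"
    by (rule has_derivative_unique) (rule has_derivative_const)
  from fun_cong[OF this, of v] v show ?thesis by (auto simp: Basis_R2)
qed

section \<open>Fourier inversion\<close>

definition FT :: "real \<Rightarrow> (R2 \<Rightarrow> complex) \<Rightarrow> R2 \<Rightarrow> complex" where
  "FT c f \<xi> = (\<integral>x. cis (c * (x \<bullet> \<xi>)) * f x \<partial>lborel) / (2 * pi)"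

lemma fourier_fun_FT: "fourier_fun f = FT (-1) f"
  by (simp add: fourier_fun_def FT_def fun_eq_iff)

lemma inv_fourier_fun_FT: "inv_fourier_fun f = FT 1 f"
  by (simp add: inv_fourier_fun_def FT_def fun_eq_iff inner_commute)

lemma cis_inner_measurable [measurable]:
  "(\<lambda>x. cis (c * (x \<bullet> \<xi>))) \<in> borel_measurable borel" for \<xi> :: R2
  by measurable

lemma FT_integrable: "integrable lborel f \<Longrightarrow> integrable lborel (\<lambda>x. cis (c * (x \<bullet> \<xi>)) * f x)" for f :: "R2 \<Rightarrow> complex"
  by (rule integrable_mult_bounded(1)[where C=1]) simp_all

lemma FT_bound: 
  shows "norm (FT c f \<xi>) \<le> (\<integral>x. norm (f x) \<partial>lborel) / (2 * pi)"
proof -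
  have "norm (\<integral>x. cis (c * (x \<bullet> \<xi>)) * f x \<partial>lborel) \<le> (\<integral>x. norm (cis (c * (x \<bullet> \<xi>)) * f x) \<partial>lborel)"
    by (rule integral_norm_bound)
  also have "\<dots> = (\<integral>x. norm (f x) \<partial>lborel)" by (simp add: norm_mult)
  finally show ?thesis by (simp add: FT_def norm_divide divide_right_mono)
qed

lemma FT_measurable [measurable]:
  assumes [measurable]: "f \<in> borel_measurable borel"
  shows "FT c f \<in> borel_measurable borel"
  unfolding FT_def by measurable

lemma FT_cong_add:
  assumes "integrable lborel f" "integrable lborel g"
  shows "FT c (\<lambda>x. a * f x + b * g x) \<xi> = a * FT c f \<xi> + b * FT c g \<xi>"
proof -
  have "(\<integral>x. cis (c * (x \<bullet> \<xi>)) * (a * f x + b * g x) \<partial>lborel)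
     = (\<integral>x. a * (cis (c * (x \<bullet> \<xi>)) * f x) + b * (cis (c * (x \<bullet> \<xi>)) * g x) \<partial>lborel)"
    by (simp only: algebra_simps)
  also have "\<dots> = a * (\<integral>x. cis (c * (x \<bullet> \<xi>)) * f x \<partial>lborel) + b * (\<integral>x. cis (c * (x \<bullet> \<xi>)) * g x \<partial>lborel)"
    using FT_integrable[OF assms(1)] FT_integrable[OF assms(2)] by simp
  finally show ?thesis by (simp add: FT_def add_divide_distrib)
qed

lemma has_derivative_cis_compose:
  assumes "(g has_derivative g') (at x within s)"
  shows "((\<lambda>x. cis (g x)) has_derivative (\<lambda>h. \<i> * of_real (g' h) * cis (g x))) (at x within s)"
  using has_derivative_compose[OF has_derivative_mult_right[OF has_derivative_of_real[OF assms], of \<i>]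
      has_field_derivative_imp_has_derivative[OF DERIV_exp]]
  unfolding cis_conv_exp by (simp add: mult_ac)

lemma norm_cis_diff: "norm (cis a - cis b) \<le> \<bar>a - b\<bar>"
proof -
  have "norm (cis a - cis b) \<le> 1 * norm (a - b)"
    by (rule differentiable_bound[of UNIV cis "\<lambda>x h. \<i> * of_real h * cis x"])
       (auto intro!: has_derivative_cis_compose[of "\<lambda>x. x" "\<lambda>x. x"] derivative_eq_intros onorm_le simp: norm_mult)
  then show ?thesis by simp
qed

lemma FT_has_derivative:
  assumes f: "f \<in> schwartz"
  shows "(FT c f has_derivative (\<lambda>h. FT c (\<lambda>x. \<i> * of_real (c * (h \<bullet> x)) * f x) \<xi>)) (at \<xi>)"
proof -
  note [measurable] = schwartz_measurable[OF f]
  have "((\<lambda>\<xi>. \<integral>x. cis (c * (x \<bullet> \<xi>)) * f x \<partial>lborel) has_derivative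
     (\<lambda>h. \<integral>x. (\<i> * of_real (c * (h \<bullet> x)) * cis (c * (x \<bullet> \<xi>))) * f x \<partial>lborel)) (at \<xi>)"
  proof (rule has_derivative_lebesgue_integral[where r=1 and B="\<lambda>x. \<bar>c\<bar> * ((1 + norm x) ^ 1 * norm (f x))"])
    show "integrable lborel (\<lambda>x. cis (c * (x \<bullet> \<xi>)) * f x)" for \<xi>
      by (intro FT_integrable schwartz_integrable f)
    show "((\<lambda>\<xi>. cis (c * (x \<bullet> \<xi>)) * f x) has_derivative (\<lambda>h. \<i> * of_real (c * (h \<bullet> x)) * cis (c * (x \<bullet> \<xi>)) * f x)) (at \<xi>)" for x
    proof -
      have "((\<lambda>\<xi>. c * (x \<bullet> \<xi>)) has_derivative (\<lambda>h. c * (x \<bullet> h))) (at \<xi>)"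
        by (auto intro!: derivative_eq_intros)
      from has_derivative_cis_compose[OF this]
      have "((\<lambda>\<xi>. cis (c * (x \<bullet> \<xi>))) has_derivative (\<lambda>h. \<i> * of_real (c * (h \<bullet> x)) * cis (c * (x \<bullet> \<xi>)))) (at \<xi>)"
        by (simp add: inner_commute)
      from has_derivative_mult_left[OF this] show ?thesis .
    qed
    show "norm (cis (c * (x \<bullet> (\<xi> + h))) * f x - cis (c * (x \<bullet> \<xi>)) * f x) \<le> \<bar>c\<bar> * ((1 + norm x) ^ 1 * norm (f x)) * norm h" for x h
    proof -
      have "norm (cis (c * (x \<bullet> (\<xi> + h))) * f x - cis (c * (x \<bullet> \<xi>)) * f x) = norm (cis (c * (x \<bullet> (\<xi> + h))) - cis (c * (x \<bullet> \<xi>))) * norm (f x)"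
        by (simp only: left_diff_distrib[symmetric] norm_mult)
      also have "\<dots> \<le> \<bar>c * (x \<bullet> (\<xi> + h)) - c * (x \<bullet> \<xi>)\<bar> * norm (f x)"
        by (intro mult_right_mono norm_cis_diff norm_ge_zero)
      also have "\<bar>c * (x \<bullet> (\<xi> + h)) - c * (x \<bullet> \<xi>)\<bar> = \<bar>c\<bar> * \<bar>x \<bullet> h\<bar>"
        by (simp add: inner_add_right algebra_simps abs_mult)
      also have "\<dots> \<le> \<bar>c\<bar> * ((1 + norm x) * norm h)"
        using Cauchy_Schwarz_ineq2[of x h] by (intro mult_left_mono) (auto simp: distrib_right intro: order_trans)[2]
      finally show ?thesis by (simp add: mult_ac mult_right_mono)
    qed
    show "norm (\<i> * of_real (c * (h \<bullet> x)) * cis (c * (x \<bullet> \<xi>)) * f x) \<le> \<bar>c\<bar> * ((1 + norm x) ^ 1 * norm (f x)) * norm h" for x h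
    proof -
      have "\<bar>h \<bullet> x\<bar> \<le> (1 + norm x) * norm h"
        using Cauchy_Schwarz_ineq2[of h x] norm_ge_zero[of h] unfolding distrib_right mult.commute[of "norm x"] by linarith
      then have "\<bar>c\<bar> * \<bar>h \<bullet> x\<bar> * norm (f x) \<le> \<bar>c\<bar> * ((1 + norm x) * norm h) * norm (f x)"
        by (intro mult_right_mono mult_left_mono) auto
      then show ?thesis by (simp add: norm_mult abs_mult mult_ac)
    qed
    show "integrable lborel (\<lambda>x. \<bar>c\<bar> * ((1 + norm x) ^ 1 * norm (f x)))"
      using rapid_integrable_mult[OF schwartz_rapid[OF f] schwartz_measurable[OF f], of 1] by (rule integrable_mult_right)
    show "(\<lambda>x. \<i> * of_real (c * (h \<bullet> x)) * cis (c * (x \<bullet> \<xi>)) * f x) \<in> borel_measurable lborel" for h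
      by measurable
  qed simp
  from has_derivative_mult_left[OF this, of "1 / (2 * pi)"]
  show ?thesis unfolding FT_def[abs_def] by (simp add: mult_ac)
qed

text \<open>The product of \<open>f\<close> with the character is again Schwartz, so its derivative
  integrates to zero; the two terms of the product rule give the identity.\<close>

lemma FT_pd:
  assumes f: "f \<in> schwartz" and v: "v \<in> Basis"
  shows "of_real (c * (v \<bullet> \<xi>)) * FT c f \<xi> = \<i> * FT c (pd v f) \<xi>"
proof -
  let ?e = "\<lambda>x. cis (c * (x \<bullet> \<xi>))"
  have De: "(?e has_derivative (\<lambda>h. \<i> * of_real (c * (h \<bullet> \<xi>)) * ?e x)) (at x)" for x
  proof -
    have "((\<lambda>x. c * (x \<bullet> \<xi>)) has_derivative (\<lambda>h. c * (h \<bullet> \<xi>))) (at x)"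
      by (auto intro!: derivative_eq_intros)
    from has_derivative_cis_compose[OF this] show ?thesis .
  qed
  have pde: "pd w (\<lambda>x. ?e x * g x) = (\<lambda>x. ?e x * (pd w g x + \<i> * of_real (c * (w \<bullet> \<xi>)) * g x))"
    if "g \<in> schwartz" for w g
    by (subst pd_eqI[OF has_derivative_mult[OF De has_derivative_pd_fun[OF schwartz_differentiable[OF that]]]])
       (simp add: algebra_simps)
  have "(\<lambda>x. ?e x * f x) \<in> schwartz"
  proof (rule schwartz_coinduct[of _ "{(\<lambda>x. ?e x * f x) |f. f \<in> schwartz}"], goal_cases)
    case 1 then show ?case using f by blast
  next
    case (2 h x)
    then obtain f where "h = (\<lambda>x. ?e x * f x)" "f \<in> schwartz" by auto
    moreover have "?e differentiable at x" using De differentiable_def by blast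
    ultimately show ?case by (simp add: differentiable_mult schwartz_differentiable)
  next
    case (3 h)
    then show ?case using schwartz_rapid by (auto simp: rapid_def norm_mult)
  next
    case (4 h w)
    then obtain g where g: "h = (\<lambda>x. ?e x * g x)" "g \<in> schwartz" by auto
    have "(\<lambda>x. 1 * pd w g x + \<i> * of_real (c * (w \<bullet> \<xi>)) * g x) \<in> schwartz"
      by (intro schwartz_lincomb schwartz_pd g 4)
    then have "(\<lambda>x. pd w g x + \<i> * of_real (c * (w \<bullet> \<xi>)) * g x) \<in> schwartz" by simp
    then show ?case unfolding g(1) pde[OF g(2)] by (intro CollectI exI conjI) (rule refl)
  qed
  from integral_pd_zero[OF this v]
  have "0 = (\<integral>x. ?e x * pd v f x + \<i> * of_real (c * (v \<bullet> \<xi>)) * (?e x * f x) \<partial>lborel)"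
    unfolding pde[OF f] by (simp add: algebra_simps)
  also have "\<dots> = (\<integral>x. ?e x * pd v f x \<partial>lborel) + \<i> * of_real (c * (v \<bullet> \<xi>)) * (\<integral>x. ?e x * f x \<partial>lborel)"
    by (subst Bochner_Integration.integral_add)
       (simp_all add: FT_integrable schwartz_integrable f schwartz_pd v del: of_real_mult)
  finally have "\<i> * (\<integral>x. ?e x * pd v f x \<partial>lborel) = of_real (c * (v \<bullet> \<xi>)) * (\<integral>x. ?e x * f x \<partial>lborel)"
    by (metis (no_types, lifting) add.commute add_eq_0_iff complex_i_mult_minus mult.assoc minus_minus mult_minus_right)
  then show ?thesis by (simp add: FT_def del: of_real_mult)
qed

text \<open>Induction on the power, for all Schwartz functions together: one factor 1 + |x| is at
  most 1 plus the moduli of both coordinates, and each coordinate is traded for a derivative of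
  \<open>f\<close> through \<open>FT_pd\<close>.\<close>

lemma FT_rapid:
  assumes c: "\<bar>c\<bar> = 1" and f: "f \<in> schwartz"
  shows "rapid (FT c f)"
proof -
  have "\<forall>f\<in>schwartz. \<exists>C. \<forall>x. (1 + norm x) ^ n * norm (FT c f x) \<le> C" for n
  proof (induction n)
    case 0 show ?case unfolding power_0 mult_1 using FT_bound by blast
  next
    case (Suc n)
    show ?case
    proof
      fix f assume f: "f \<in> schwartz"
      have "pd (1,0) f \<in> schwartz" "pd (0,1) f \<in> schwartz"
        by (intro schwartz_pd f, simp add: Basis_R2)+
      with Suc f obtain C0 C1 C2 where C: "\<And>x. (1 + norm x) ^ n * norm (FT c f x) \<le> C0"
        "\<And>x. (1 + norm x) ^ n * norm (FT c (pd (1,0) f) x) \<le> C1"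
        "\<And>x. (1 + norm x) ^ n * norm (FT c (pd (0,1) f) x) \<le> C2" by meson
      have e: "\<bar>fst x\<bar> * norm (FT c f x) = norm (FT c (pd (1,0) f) x)"
          "\<bar>snd x\<bar> * norm (FT c f x) = norm (FT c (pd (0,1) f) x)" for x
        using arg_cong[OF FT_pd[OF f, of "(1,0)" c x], of norm] arg_cong[OF FT_pd[OF f, of "(0,1)" c x], of norm] c
        by (simp_all add: Basis_R2 norm_mult abs_mult inner_prod_def)
      have "(1 + norm x) ^ Suc n * norm (FT c f x) \<le> C0 + C1 + C2" for x
      proof -
        have "norm x \<le> \<bar>fst x\<bar> + \<bar>snd x\<bar>" using norm_Pair_le[of "fst x" "snd x"] by simp
        then have "(1 + norm x) * norm (FT c f x) \<le> (1 + (\<bar>fst x\<bar> + \<bar>snd x\<bar>)) * norm (FT c f x)"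
          by (intro mult_right_mono) auto
        also have "\<dots> = norm (FT c f x) + norm (FT c (pd (1,0) f) x) + norm (FT c (pd (0,1) f) x)"
          using e[of x] by (simp add: algebra_simps)
        finally have "(1 + norm x) ^ n * ((1 + norm x) * norm (FT c f x)) \<le> 
           (1 + norm x) ^ n * (norm (FT c f x) + norm (FT c (pd (1,0) f) x) + norm (FT c (pd (0,1) f) x))"
          by (intro mult_left_mono) auto
        then show ?thesis using C[of x] by (simp add: algebra_simps)
      qed
      then show "\<exists>C. \<forall>x. (1 + norm x) ^ Suc n * norm (FT c f x) \<le> C" by blast
    qed
  qed
  then show ?thesis using f unfolding rapid_def by blast
qed

text \<open>Differentiating a transform multiplies the transformed function by a linear form, so the
  image of the Schwartz space is a stable class.\<close>

lemma FT_schwartz: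
  assumes c: "\<bar>c\<bar> = 1" and f: "f \<in> schwartz"
  shows "FT c f \<in> schwartz"
proof (rule schwartz_coinduct[of _ "FT c ` schwartz"], goal_cases)
  case 1 then show ?case using f by blast
next
  case (2 h x) then show ?case using FT_has_derivative differentiable_def by blast
next
  case (3 h) then show ?case using FT_rapid[OF c] by blast
next
  case (4 h v)
  then obtain g where g: "h = FT c g" "g \<in> schwartz" by auto
  have "(\<lambda>x. (\<i> * of_real c) * (of_real (v \<bullet> x) * g x)) \<in> schwartz"
    by (intro schwartz_cmult schwartz_mult_inner g)
  then have "(\<lambda>x. \<i> * of_real (c * (v \<bullet> x)) * g x) \<in> schwartz" by (simp add: mult_ac)
  moreover have "pd v h = FT c (\<lambda>x. \<i> * of_real (c * (v \<bullet> x)) * g x)"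
    unfolding g(1) by (subst pd_eqI[OF FT_has_derivative[OF g(2)]]) (rule refl)
  ultimately show ?case by blast
qed

lemma fourier_fun_schwartz: "f \<in> schwartz \<Longrightarrow> fourier_fun f \<in> schwartz"
  unfolding fourier_fun_FT by (rule FT_schwartz) simp_all

lemma inv_fourier_fun_schwartz: "f \<in> schwartz \<Longrightarrow> inv_fourier_fun f \<in> schwartz"
  unfolding inv_fourier_fun_FT by (rule FT_schwartz) simp_all

lemma FT_swap:
  assumes f: "integrable lborel f" and g: "integrable lborel g"
  shows "(\<integral>x. f x * FT c g x \<partial>lborel) = (\<integral>x. g x * FT c f x \<partial>lborel)"
proof -
  have "(\<integral>x. f x * (\<integral>y. cis (c * (y \<bullet> x)) * g y \<partial>lborel) \<partial>lborel)
     = (\<integral>y. g y * (\<integral>x. cis (c * (y \<bullet> x)) * f x \<partial>lborel) \<partial>lborel)"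
    by (rule Fubini_kernel(1)[where C=1]) (auto intro: assms sigma_finite_lborel)
  then show ?thesis unfolding FT_def by (simp add: inner_commute)
qed

lemma integral_scale:
  fixes f :: "R2 \<Rightarrow> complex"
  assumes [measurable]: "f \<in> borel_measurable borel" and "e \<noteq> 0"
  shows "(\<integral>x. f x \<partial>lborel) = e\<^sup>2 * (\<integral>x. f (t + e *\<^sub>R x) \<partial>lborel)"
proof -
  have "(\<integral>x. f x \<partial>lborel) = (\<integral>x. f x \<partial>density (distr lborel borel (\<lambda>x. t + e *\<^sub>R x)) (\<lambda>_. ennreal (\<bar>e\<bar>^DIM(R2))))"
    using lborel_affine[OF assms(2), of t] by simp
  also have "\<dots> = (\<integral>x. e\<^sup>2 *\<^sub>R f x \<partial>distr lborel borel (\<lambda>x. t + e *\<^sub>R x))"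
    by (subst integral_density) (simp_all add: power2_eq_square)
  also have "\<dots> = (\<integral>x. e\<^sup>2 *\<^sub>R f (t + e *\<^sub>R x) \<partial>lborel)"
    by (subst integral_distr) simp_all
  finally show ?thesis by (simp add: scaleR_conv_of_real)
qed

section \<open>The Gaussian and its role in the inversion formula\<close>

definition gauss :: "R2 \<Rightarrow> complex" where "gauss x = of_real (exp (- (norm x)\<^sup>2 / 2))"

lemma gauss_prod: "gauss x = of_real (exp (- (fst x)\<^sup>2 / 2)) * of_real (exp (- (snd x)\<^sup>2 / 2))"
proof -
  have "exp (- (norm x)\<^sup>2 / 2) = exp (- (fst x)\<^sup>2 / 2) * exp (- (snd x)\<^sup>2 / 2)"
    unfolding exp_add[symmetric] by (simp add: norm_prod_def field_simps)
  then show ?thesis by (simp add: gauss_def)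
qed

lemma gauss_measurable [measurable]: "gauss \<in> borel_measurable borel"
  unfolding gauss_def[abs_def] by measurable

text \<open>The transform is the characteristic function of the standard normal distribution, up to
  the factor sqrt (2 pi) in its density.\<close>

lemma gauss_1d:
  "integrable lborel (\<lambda>x. complex_of_real (exp (- x\<^sup>2 / 2)))"
  "(\<integral>x. cis (t * x) * complex_of_real (exp (- x\<^sup>2 / 2)) \<partial>lborel) = sqrt (2 * pi) * exp (- t\<^sup>2 / 2)"
proof -
  have "integrable lborel (\<lambda>x. sqrt (2 * pi) * (std_normal_density x))"
    by (intro integrable_mult_right integrable_normal_density) simp
  moreover have "(\<lambda>x. sqrt (2 * pi) * std_normal_density x) = (\<lambda>x. exp (- x\<^sup>2 / 2))"
    by (simp add: std_normal_density_def)
  ultimately have "integrable lborel (\<lambda>x::real. exp (- x\<^sup>2 / 2))" by simp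
  then show "integrable lborel (\<lambda>x. complex_of_real (exp (- x\<^sup>2 / 2)))"
    by (rule integrable_of_real)
  have "(\<integral>x. std_normal_density x *\<^sub>R cis (t * x) \<partial>lborel) = exp (- t\<^sup>2 / 2)"
    using fun_cong[OF char_std_normal_distribution, of t] unfolding char_def
    by (subst (asm) integral_density) (auto simp: cis_conv_exp)
  then have "(\<integral>x. sqrt (2 * pi) * (std_normal_density x *\<^sub>R cis (t * x)) \<partial>lborel) = sqrt (2 * pi) * exp (- t\<^sup>2 / 2)"
    by (subst integral_mult_right_zero) simp
  moreover have "sqrt (2 * pi) * (std_normal_density x *\<^sub>R cis (t * x)) = cis (t * x) * complex_of_real (exp (- x\<^sup>2 / 2))" for x
    by (simp add: std_normal_density_def scaleR_conv_of_real)
  ultimately show "(\<integral>x. cis (t * x) * complex_of_real (exp (- x\<^sup>2 / 2)) \<partial>lborel) = sqrt (2 * pi) * exp (- t\<^sup>2 / 2)"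
    by simp
qed

lemma gauss_integrable: "integrable lborel gauss"
  unfolding gauss_prod[abs_def] by (rule integrable_prod_lborel gauss_1d)+

lemma FT_gauss: "(\<integral>x. cis (x \<bullet> w) * gauss x \<partial>lborel) = 2 * pi * gauss w"
proof -
  have g: "integrable lborel (\<lambda>x. cis (a * x) * of_real (exp (- x\<^sup>2 / 2)))" for a
    by (rule integrable_mult_bounded(1)[where C=1, OF gauss_1d(1)]) simp_all
  have "cis (x \<bullet> w) * gauss x = (cis (fst w * fst x) * of_real (exp (- (fst x)\<^sup>2 / 2))) * (cis (snd w * snd x) * of_real (exp (- (snd x)\<^sup>2 / 2)))" for x
    by (simp add: gauss_prod inner_prod_def mult_ac flip: cis_mult)
  then have "(\<integral>x. cis (x \<bullet> w) * gauss x \<partial>lborel) = (\<integral>x. (cis (fst w * fst x) * of_real (exp (- (fst x)\<^sup>2 / 2))) * (cis (snd w * snd x) * of_real (exp (- (snd x)\<^sup>2 / 2))) \<partial>lborel)"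
    by simp
  also have "\<dots> = (sqrt (2 * pi) * exp (- (fst w)\<^sup>2 / 2)) * (sqrt (2 * pi) * exp (- (snd w)\<^sup>2 / 2))"
    unfolding of_real_mult[of "sqrt (2 * pi) * _"] gauss_1d(2)[symmetric]
    by (rule integrable_prod_lborel(2)[OF g g])
  also have "\<dots> = (sqrt (2 * pi) * sqrt (2 * pi)) * gauss w"
    by (simp only: gauss_prod of_real_mult mult_ac)
  finally show ?thesis by simp
qed

text \<open>Gaussian summation: a Gaussian in \<open>e n\<close> times the frequency is inserted so
  that Fubini applies, and the double integral becomes an average of \<open>f\<close> around
  \<open>x\<close> at scale \<open>e n\<close>. Both sides converge by dominance as the scale tends
  to zero.\<close>

theorem FT_inversion:
  assumes f: "f \<in> schwartz"
  shows "FT 1 (FT (-1) f) x = f x"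
proof -
  note [measurable] = schwartz_measurable[OF f]
  have F: "FT (-1) f \<in> schwartz" by (rule FT_schwartz[OF _ f]) simp
  note [measurable] = schwartz_measurable[OF F]
  define e where "e n = 1 / real (Suc n)" for n
  have e0: "e n \<noteq> 0" for n by (simp add: e_def)
  have elim: "e \<longlonglongrightarrow> 0" unfolding e_def by (rule LIMSEQ_Suc[OF lim_1_over_n])
  \<comment> \<open>Fubini, the transform of the Gaussian, and the substitution y = x +
    \<open>e n\<close> z.\<close>
  have I: "(\<integral>\<xi>. cis (\<xi> \<bullet> x) * FT (-1) f \<xi> * gauss (e n *\<^sub>R \<xi>) \<partial>lborel) = (\<integral>z. gauss z * f (x + e n *\<^sub>R z) \<partial>lborel)" for n
  proof -
    have ge: "integrable lborel (\<lambda>\<xi>. gauss (e n *\<^sub>R \<xi>))"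
    proof -
      have "integrable lborel (\<lambda>\<xi>. gauss (0 + e n *\<^sub>R \<xi>))"
      proof -
        have "integrable (density (distr lborel borel (\<lambda>x. 0 + e n *\<^sub>R x)) (\<lambda>_. ennreal (\<bar>e n\<bar>^DIM(R2)))) gauss"
          using gauss_integrable lborel_affine[OF e0[of n], of "0::R2"] by simp
        then have "integrable lborel (\<lambda>x. (\<bar>e n\<bar>^DIM(R2)) *\<^sub>R gauss (0 + e n *\<^sub>R x))"
          by (subst (asm) integrable_density, measurable, simp) (subst (asm) integrable_distr_eq, measurable)
        then have "integrable lborel (\<lambda>x. inverse (\<bar>e n\<bar>^DIM(R2)) *\<^sub>R ((\<bar>e n\<bar>^DIM(R2)) *\<^sub>R gauss (0 + e n *\<^sub>R x)))"
          by (rule integrable_scaleR_right)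
        moreover have "inverse (\<bar>e n\<bar>^DIM(R2)) * (\<bar>e n\<bar>^DIM(R2)) = 1" using e0[of n] by (intro left_inverse) simp
        ultimately show ?thesis unfolding scaleR_scaleR by (simp only: scaleR_one)
      qed
      then show ?thesis by simp
    qed
    have "(\<integral>\<xi>. cis (\<xi> \<bullet> x) * FT (-1) f \<xi> * gauss (e n *\<^sub>R \<xi>) \<partial>lborel)
       = (\<integral>\<xi>. (gauss (e n *\<^sub>R \<xi>) * cis (\<xi> \<bullet> x)) * (\<integral>y. cis (- (y \<bullet> \<xi>)) * f y \<partial>lborel) \<partial>lborel) / (2 * pi)"
      unfolding FT_def by (subst integral_divide_zero[symmetric]) (simp add: mult_ac)
    also have "(\<integral>\<xi>. (gauss (e n *\<^sub>R \<xi>) * cis (\<xi> \<bullet> x)) * (\<integral>y. cis (- (y \<bullet> \<xi>)) * f y \<partial>lborel) \<partial>lborel)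
       = (\<integral>y. f y * (\<integral>\<xi>. cis (- (y \<bullet> \<xi>)) * (gauss (e n *\<^sub>R \<xi>) * cis (\<xi> \<bullet> x)) \<partial>lborel) \<partial>lborel)"
      by (rule Fubini_kernel(1)[where C=1])
         (auto intro!: sigma_finite_lborel schwartz_integrable[OF f] integrable_mult_bounded(2)[where C=1] ge)
    also have "\<dots> = (\<integral>y. f y * (2 * pi * gauss ((x - y) /\<^sub>R e n) / (e n)\<^sup>2) \<partial>lborel)"
    proof (rule Bochner_Integration.integral_cong[OF refl], rule arg_cong2[where f="(*)", OF refl])
      fix y
      have "(\<integral>\<xi>. cis (\<xi> \<bullet> ((x - y) /\<^sub>R e n)) * gauss \<xi> \<partial>lborel)
        = (e n)\<^sup>2 * (\<integral>\<xi>. cis ((0 + e n *\<^sub>R \<xi>) \<bullet> ((x - y) /\<^sub>R e n)) * gauss (0 + e n *\<^sub>R \<xi>) \<partial>lborel)"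
        using integral_scale[of "\<lambda>\<xi>. cis (\<xi> \<bullet> ((x - y) /\<^sub>R e n)) * gauss \<xi>" "e n" 0] e0[of n] by simp
      also have "(\<lambda>\<xi>. cis ((0 + e n *\<^sub>R \<xi>) \<bullet> ((x - y) /\<^sub>R e n)) * gauss (0 + e n *\<^sub>R \<xi>)) = 
         (\<lambda>\<xi>. cis (- (y \<bullet> \<xi>)) * (gauss (e n *\<^sub>R \<xi>) * cis (\<xi> \<bullet> x)))"
      proof
        fix \<xi>
        have "(0 + e n *\<^sub>R \<xi>) \<bullet> ((x - y) /\<^sub>R e n) = - (y \<bullet> \<xi>) + \<xi> \<bullet> x"
          using e0[of n] by (simp add: inner_diff_right inner_commute)
        then show "cis ((0 + e n *\<^sub>R \<xi>) \<bullet> ((x - y) /\<^sub>R e n)) * gauss (0 + e n *\<^sub>R \<xi>) = 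
           cis (- (y \<bullet> \<xi>)) * (gauss (e n *\<^sub>R \<xi>) * cis (\<xi> \<bullet> x))"
          by (simp only: cis_mult[symmetric] mult_ac add_0)
      qed
      finally show "(\<integral>\<xi>. cis (- (y \<bullet> \<xi>)) * (gauss (e n *\<^sub>R \<xi>) * cis (\<xi> \<bullet> x)) \<partial>lborel) = 2 * pi * gauss ((x - y) /\<^sub>R e n) / (e n)\<^sup>2"
        using e0[of n] unfolding FT_gauss by (simp add: field_simps)
    qed
    also have "\<dots> = (e n)\<^sup>2 * (\<integral>z. f (x + e n *\<^sub>R z) * (2 * pi * gauss ((x - (x + e n *\<^sub>R z)) /\<^sub>R e n) / (e n)\<^sup>2) \<partial>lborel)"
      using integral_scale[of "\<lambda>y. f y * (2 * pi * gauss ((x - y) /\<^sub>R e n) / (e n)\<^sup>2)" "e n" x] e0[of n] by simp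
    also have "\<dots> = (\<integral>z. 2 * pi * (gauss z * f (x + e n *\<^sub>R z)) \<partial>lborel)"
      using e0[of n] by (subst integral_mult_right_zero[symmetric]) (simp add: gauss_def mult_ac)
    finally show ?thesis by simp
  qed
  have L1: "(\<lambda>n. \<integral>\<xi>. cis (\<xi> \<bullet> x) * FT (-1) f \<xi> * gauss (e n *\<^sub>R \<xi>) \<partial>lborel) \<longlonglongrightarrow> (\<integral>\<xi>. cis (\<xi> \<bullet> x) * FT (-1) f \<xi> \<partial>lborel)"
  proof (rule integral_dominated_convergence[where w="\<lambda>\<xi>. norm (FT (-1) f \<xi>)"])
    show "integrable lborel (\<lambda>\<xi>. norm (FT (-1) f \<xi>))" using schwartz_integrable[OF F] by simp
    show "AE \<xi> in lborel. (\<lambda>n. cis (\<xi> \<bullet> x) * FT (-1) f \<xi> * gauss (e n *\<^sub>R \<xi>)) \<longlonglongrightarrow> cis (\<xi> \<bullet> x) * FT (-1) f \<xi>"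
    proof (rule AE_I2)
      fix \<xi>
      have "(\<lambda>n. cis (\<xi> \<bullet> x) * FT (-1) f \<xi> * gauss (e n *\<^sub>R \<xi>)) \<longlonglongrightarrow> cis (\<xi> \<bullet> x) * FT (-1) f \<xi> * of_real (exp (- (norm (0 *\<^sub>R \<xi>))\<^sup>2 / 2))"
        unfolding gauss_def by (intro tendsto_intros elim) simp_all
      then show "(\<lambda>n. cis (\<xi> \<bullet> x) * FT (-1) f \<xi> * gauss (e n *\<^sub>R \<xi>)) \<longlonglongrightarrow> cis (\<xi> \<bullet> x) * FT (-1) f \<xi>" by simp
    qed
    show "AE \<xi> in lborel. norm (cis (\<xi> \<bullet> x) * FT (-1) f \<xi> * gauss (e n *\<^sub>R \<xi>)) \<le> norm (FT (-1) f \<xi>)" for n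
      by (intro AE_I2) (simp add: norm_mult gauss_def mult_left_le)
  qed measurable
  obtain B where B: "\<And>x. norm (f x) \<le> B"
    using schwartz_rapid[OF f] unfolding rapid_def by (metis mult_1 power_0)
  have "(\<lambda>n. \<integral>z. gauss z * f (x + e n *\<^sub>R z) \<partial>lborel) \<longlonglongrightarrow> (\<integral>z. gauss z * f x \<partial>lborel)"
  proof (rule integral_dominated_convergence[where w="\<lambda>z. B * norm (gauss z)"])
    show "integrable lborel (\<lambda>z. B * norm (gauss z))" using gauss_integrable by simp
    show "AE z in lborel. (\<lambda>n. gauss z * f (x + e n *\<^sub>R z)) \<longlonglongrightarrow> gauss z * f x"
    proof (rule AE_I2)
      fix z
      have "(\<lambda>n. x + e n *\<^sub>R z) \<longlonglongrightarrow> x + 0 *\<^sub>R z" by (intro tendsto_intros elim)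
      then have "(\<lambda>n. f (x + e n *\<^sub>R z)) \<longlonglongrightarrow> f x"
        using isCont_tendsto_compose[OF differentiable_imp_continuous_within[OF schwartz_differentiable[OF f]]] by simp
      then show "(\<lambda>n. gauss z * f (x + e n *\<^sub>R z)) \<longlonglongrightarrow> gauss z * f x" by (intro tendsto_intros)
    qed
    show "AE z in lborel. norm (gauss z * f (x + e n *\<^sub>R z)) \<le> B * norm (gauss z)" for n
      unfolding norm_mult by (intro AE_I2) (subst mult.commute, intro mult_right_mono B norm_ge_zero)
  qed measurable
  with L1 have "(\<integral>\<xi>. cis (\<xi> \<bullet> x) * FT (-1) f \<xi> \<partial>lborel) = (\<integral>z. gauss z * f x \<partial>lborel)"
    unfolding I by (rule LIMSEQ_unique)
  also have "\<dots> = 2 * pi * f x"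
    using FT_gauss[of 0] by (simp add: gauss_def)
  finally show ?thesis by (simp add: FT_def)
qed

lemma inv_fourier_fourier: "f \<in> schwartz \<Longrightarrow> inv_fourier_fun (fourier_fun f) = f"
  unfolding fourier_fun_FT inv_fourier_fun_FT by (intro ext FT_inversion)

section \<open>Schwartz functions with a single angular mode\<close>

definition zz :: "R2 \<Rightarrow> complex" where "zz x = Complex (fst x) (snd x)"

lemma norm_zz [simp]: "norm (zz x) = norm x"
  by (simp add: zz_def cmod_def norm_prod_def)

lemma zz_linear: "bounded_linear zz"
proof (rule bounded_linear_intro[of _ 1])
  show "zz (x + y) = zz x + zz y" for x y by (simp add: zz_def complex_eq_iff)
  show "zz (r *\<^sub>R x) = r *\<^sub>R zz x" for r x by (simp add: zz_def complex_eq_iff)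
qed simp

lemma zz_has_derivative: "(zz has_derivative zz) (at x)"
  using bounded_linear_imp_has_derivative[OF zz_linear] .

lemma inner_zz: "of_real (x \<bullet> v) = (zz x * cnj (zz v) + cnj (zz x) * zz v) / 2"
  by (simp add: zz_def complex_eq_iff inner_prod_def)

text \<open>The factor \<open>exp (- 1 / |x|\<^sup>2)\<close> makes the product with any angular factor \<open>(z / |z|) ^ l\<close> smooth at the
  origin.\<close>

definition gam :: "R2 \<Rightarrow> real" where
  "gam x = (if x = 0 then 0 else exp (- (inverse (norm x))\<^sup>2 - (norm x)\<^sup>2))"

lemma gam_radial: "norm x = norm y \<Longrightarrow> gam x = gam y"
  by (auto simp: gam_def)

lemma gam_nonneg: "gam x \<ge> 0" by (simp add: gam_def)

lemma gam_pos: "x \<noteq> 0 \<Longrightarrow> gam x > 0" by (simp add: gam_def)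

text \<open>Products of powers of z, of its conjugate and of 1 / |x| with \<open>gam\<close>. The
  three exponents are free so that differentiation stays within the family; with b = 0 and c = a one
  has a pure angular mode times \<open>gam\<close>.\<close>

definition Gm :: "nat \<Rightarrow> nat \<Rightarrow> nat \<Rightarrow> R2 \<Rightarrow> complex" where
  "Gm a b c x = zz x ^ a * cnj (zz x) ^ b * of_real ((inverse (norm x)) ^ c * gam x)"

lemma power_le_fact_exp: "x ^ n \<le> fact n * exp x" if "x \<ge> 0" for x :: real
proof -
  have "x ^ n / fact n \<le> exp x"
  proof -
    have s: "summable (\<lambda>k. x ^ k /\<^sub>R fact k)" using summable_exp_generic[of x] by simp
    have "(\<Sum>k\<in>{n}. x ^ k /\<^sub>R fact k) \<le> (\<Sum>k. x ^ k /\<^sub>R fact k)"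
      using that by (intro sum_le_suminf s) auto
    then show ?thesis by (simp add: exp_def divide_inverse mult.commute)
  qed
  then show ?thesis by (simp add: field_simps)
qed

lemma norm_Gm: "norm (Gm a b c x) = norm x ^ a * norm x ^ b * (inverse (norm x) ^ c * gam x)"
  unfolding Gm_def norm_mult norm_power complex_mod_cnj norm_zz norm_of_real
  by (simp add: abs_mult power_abs gam_nonneg)

text \<open>Positive powers of r = |x| are absorbed by exp (- r^2), negative ones by exp (- q^2)
  with q = 1 / r. A power is first exchanged for an exponential by \<open>power_le_fact_exp\<close>;
  it remains that 1 + r - r^2 and q - q^2 are bounded above.\<close>

lemma Gm_bounded:
  "\<exists>C. \<forall>x. (1 + norm x) ^ n * norm (Gm a b c x) \<le> C"
proof (intro exI allI)
  fix x :: R2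
  define N where "N = n + a + b"
  show "(1 + norm x) ^ n * norm (Gm a b c x) \<le> (fact N * exp 2) * (fact c * exp 1)"
  proof (cases "x = 0")
    case True then show ?thesis by (simp add: Gm_def gam_def)
  next
    case False
    define q where "q = inverse (norm x)"
    define r where "r = norm x"
    have r: "r > 0" "q > 0" using False by (auto simp: r_def q_def)
    have "(1 + norm x) ^ n * norm (Gm a b c x) = ((1 + r) ^ n * r ^ a * r ^ b * exp (- r\<^sup>2)) * (q ^ c * exp (- q\<^sup>2))"
    proof -
      have "gam x = exp (- r\<^sup>2) * exp (- q\<^sup>2)"
        using False by (simp add: gam_def r_def q_def flip: exp_add)
      then show ?thesis unfolding norm_Gm unfolding q_def[symmetric] unfolding r_def[symmetric] by (simp only: mult_ac)
    qed
    also have "\<dots> \<le> (fact N * exp 2) * (fact c * exp 1)"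
    proof (rule mult_mono)
      have "(1 + r) ^ n * r ^ a * r ^ b \<le> (1 + r) ^ n * (1 + r) ^ a * (1 + r) ^ b"
        using r by (intro mult_mono power_mono) auto
      also have "\<dots> \<le> fact N * exp (1 + r)"
        unfolding N_def power_add[symmetric] by (rule power_le_fact_exp) (use r in simp)
      finally have "(1 + r) ^ n * r ^ a * r ^ b * exp (- r\<^sup>2) \<le> fact N * exp (1 + r) * exp (- r\<^sup>2)"
        by (intro mult_right_mono) auto
      also have "\<dots> = fact N * exp (1 + r - r\<^sup>2)" by (simp add: exp_add[symmetric])
      also have "\<dots> \<le> fact N * exp 2"
        using sum_power2_ge_zero[of "r - 1" 0] zero_le_power2[of "2 * r - 1"] by (intro mult_left_mono) (auto simp: power2_eq_square algebra_simps)
      finally show "(1 + r) ^ n * r ^ a * r ^ b * exp (- r\<^sup>2) \<le> fact N * exp 2" .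
      have "q ^ c * exp (- q\<^sup>2) \<le> fact c * exp q * exp (- q\<^sup>2)"
        using r by (intro mult_right_mono power_le_fact_exp) auto
      also have "\<dots> = fact c * exp (q - q\<^sup>2)" by (simp add: exp_add[symmetric])
      also have "\<dots> \<le> fact c * exp 1"
        using zero_le_power2[of "2 * q - 1"] by (intro mult_left_mono) (auto simp: power2_eq_square algebra_simps)
      finally show "q ^ c * exp (- q\<^sup>2) \<le> fact c * exp 1" .
    qed (use r in auto)
    finally show ?thesis .
  qed
qed

text \<open>The four lines collect the derivatives of the powers of z and its conjugate, of
  |x|^(-c), of exp (- |x|^(-2)) and of exp (- |x|^2). The radial ones contain the inner product of x
  and h, rewritten by \<open>inner_zz\<close> so that each term lies in the family again.\<close>

definition Gm_deriv :: "nat \<Rightarrow> nat \<Rightarrow> nat \<Rightarrow> R2 \<Rightarrow> R2 \<Rightarrow> complex" where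
  "Gm_deriv a b c x h = of_nat a * zz h * Gm (a - 1) b c x + of_nat b * cnj (zz h) * Gm a (b - 1) c x
     + (cnj (zz h) * (- of_nat c / 2) * Gm (Suc a) b (c + 2) x + zz h * (- of_nat c / 2) * Gm a (Suc b) (c + 2) x)
     + (cnj (zz h) * Gm (Suc a) b (c + 4) x + zz h * Gm a (Suc b) (c + 4) x)
     + (- cnj (zz h) * Gm (Suc a) b c x + - zz h * Gm a (Suc b) c x)"

lemma Gm_has_derivative: "(Gm a b c has_derivative Gm_deriv a b c x) (at x)"
proof (cases "x = 0")
  case True
  have [simp]: "Gm a b c 0 = 0" for a b c by (simp add: Gm_def gam_def)
  have D0: "Gm_deriv a b c 0 = (\<lambda>h. 0)" by (simp add: Gm_deriv_def fun_eq_iff)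
  \<comment> \<open>Two more negative powers of the radius are still bounded, so the function is
    O(|h|^2) at the origin and its derivative there vanishes.\<close>
  obtain C where C: "\<And>x. norm (Gm a b (c + 2) x) \<le> C" using Gm_bounded[of 0 a b "c+2"] by auto
  have le: "norm (Gm a b c h) / norm h \<le> C * norm h" if "h \<noteq> 0" for h
  proof -
    have "norm (Gm a b c h) = norm (Gm a b (c + 2) h) * (norm h)\<^sup>2"
    proof -
      have "inverse (norm h) ^ 2 * (norm h)\<^sup>2 = 1" using that by (simp add: power_inverse)
      then show ?thesis unfolding norm_Gm power_add by (simp add: mult.assoc mult.left_commute)
    qed
    also have "\<dots> \<le> C * (norm h)\<^sup>2" by (intro mult_right_mono C) simp
    finally show ?thesis using that by (simp add: field_simps power2_eq_square)
  qed
  have "((\<lambda>h. norm (Gm a b c h) / norm h) \<longlongrightarrow> 0) (at 0)"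
  proof (rule tendsto_sandwich[of "\<lambda>_. 0" _ _ "\<lambda>h. C * norm h"])
    show "((\<lambda>h::R2. C * norm h) \<longlongrightarrow> 0) (at 0)" by (auto intro!: tendsto_eq_intros)
    show "\<forall>\<^sub>F h in at 0. norm (Gm a b c h) / norm h \<le> C * norm h"
      unfolding eventually_at using le by (intro exI[of _ 1]) auto
  qed (auto intro!: always_eventually)
  then show ?thesis unfolding True D0 has_derivative_at by simp
next
  case False
  define t q where "t = norm x" and "q = inverse t"
  have t: "t > 0" "t * q = 1" using False by (auto simp: t_def q_def)
  define E where "E = exp (- q\<^sup>2 - t\<^sup>2)"
  define g where "g = (\<lambda>t::real. inverse t ^ c * exp (- (inverse t)\<^sup>2 - t\<^sup>2))"
  define g' where "g' = - of_nat c * q ^ (c + 1) * E + q ^ c * E * (2 * q ^ 3 - 2 * t)"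
  have di: "(inverse has_real_derivative - (q * q)) (at t)"
    using DERIV_inverse[of t UNIV] t(1) by (simp add: q_def power2_eq_square)
  have "(g has_real_derivative g') (at t)"
  proof -
    have "((\<lambda>t. inverse t ^ c) has_real_derivative of_nat c * (- (q * q) * q ^ (c - Suc 0))) (at t)"
      using DERIV_power[OF di, of c] by (simp add: q_def)
    moreover have "((\<lambda>t. exp (- (inverse t)\<^sup>2 - t\<^sup>2)) has_real_derivative E * (2 * q ^ 3 - 2 * t)) (at t)"
      unfolding E_def q_def using t(1) by (auto intro!: derivative_eq_intros di simp: q_def power2_eq_square power3_eq_cube algebra_simps)
    ultimately have "(g has_real_derivative of_nat c * (- (q * q) * q ^ (c - Suc 0)) * E + E * (2 * q ^ 3 - 2 * t) * q ^ c) (at t)"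
      unfolding g_def by (auto dest: DERIV_mult simp: E_def q_def)
    moreover have "of_nat c * (- (q * q) * q ^ (c - Suc 0)) * E + E * (2 * q ^ 3 - 2 * t) * q ^ c = g'"
      unfolding g'_def by (cases c) (simp_all add: algebra_simps)
    ultimately show ?thesis by simp
  qed
  moreover have N: "(norm has_derivative (\<lambda>h. h \<bullet> sgn x)) (at x)" using False by (rule has_derivative_norm)
  ultimately have "((\<lambda>y. g (norm y)) has_derivative (\<lambda>h. (h \<bullet> sgn x) * g')) (at x)"
    using DERIV_compose_FDERIV[of g g' norm x "\<lambda>h. h \<bullet> sgn x" UNIV] by (simp add: t_def)
  moreover have "(h \<bullet> sgn x) * g' = (x \<bullet> h) * (- of_nat c * q ^ (c + 2) * E + 2 * q ^ (c + 4) * E - 2 * q ^ c * E)" for h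
  proof -
    have "(h \<bullet> sgn x) * g' = (x \<bullet> h) * q * g'" by (simp add: sgn_div_norm q_def t_def inner_commute)
    also have "\<dots> = (x \<bullet> h) * (- of_nat c * q ^ (c + 2) * E + 2 * q ^ (c + 4) * E - 2 * q ^ c * E * (t * q))"
      unfolding g'_def by (simp add: power_add algebra_simps eval_nat_numeral)
    finally show ?thesis using t by simp
  qed
  ultimately have G: "((\<lambda>y. complex_of_real (g (norm y))) has_derivative (\<lambda>h. of_real ((x \<bullet> h) * (- of_nat c * q ^ (c + 2) * E + 2 * q ^ (c + 4) * E - 2 * q ^ c * E)))) (at x)"
    by (intro has_derivative_of_real) simp
  have P: "((\<lambda>y. zz y ^ a) has_derivative (\<lambda>h. of_nat a * zz h * zz x ^ (a - 1))) (at x)" for a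
    using has_derivative_power[OF zz_has_derivative] .
  have Q: "((\<lambda>y. cnj (zz y) ^ b) has_derivative (\<lambda>h. of_nat b * cnj (zz h) * cnj (zz x) ^ (b - 1))) (at x)"
    using has_derivative_power[OF bounded_linear.has_derivative[OF bounded_linear_cnj zz_has_derivative]] .
  have eq: "gam x = E" "inverse (norm x) = q" using False by (simp_all add: gam_def E_def q_def t_def)
  have "((\<lambda>y. zz y ^ a * cnj (zz y) ^ b * of_real (g (norm y))) has_derivative Gm_deriv a b c x) (at x)"
  proof (rule has_derivative_eq_rhs[OF has_derivative_mult[OF has_derivative_mult[OF P Q] G]], rule ext)
    fix h
    show "zz x ^ a * cnj (zz x) ^ b * of_real ((x \<bullet> h) * (- of_nat c * q ^ (c + 2) * E + 2 * q ^ (c + 4) * E - 2 * q ^ c * E))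
       + (zz x ^ a * (of_nat b * cnj (zz h) * cnj (zz x) ^ (b - 1)) + of_nat a * zz h * zz x ^ (a - 1) * cnj (zz x) ^ b) * of_real (g (norm x))
       = Gm_deriv a b c x h"
    proof -
      have "g (norm x) = q ^ c * E" unfolding g_def E_def q_def t_def ..
      then show ?thesis
        unfolding Gm_deriv_def Gm_def eq of_real_mult[of "x \<bullet> h"] inner_zz
        by (simp add: field_simps)
    qed
  qed
  moreover have "zz y ^ a * cnj (zz y) ^ b * of_real (g (norm y)) = Gm a b c y" if "y \<in> - {0}" for y
    using that by (simp add: Gm_def gam_def g_def)
  ultimately show ?thesis
    using False by (elim has_derivative_transform_within_open[where s="- {0}"]) auto
qed

lemma sums_of_scale_intros: "(\<lambda>x. k * f x) \<in> sums_of {(\<lambda>x. k * f x) |k f. f \<in> X}" if "f \<in> X"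
  using that by (intro sums_of.base) blast

lemma Gm_schwartz: "Gm a b c \<in> schwartz"
proof -
  let ?X = "{(\<lambda>x. k * f x) |k f. f \<in> {Gm a b c |a b c. True}}"
  have *: "(\<lambda>x. k * Gm a b c x) \<in> sums_of ?X" for k a b c by (rule sums_of_scale_intros) blast
  have "(\<lambda>x. 1 * Gm a b c x) \<in> schwartz"
  proof (rule schwartz_coinduct_sums[of _ ?X], goal_cases)
    case 1 show ?case by (intro CollectI exI[of _ 1]) blast
  next
    case (2 h x)
    then obtain k a b c where "h = (\<lambda>x. k * Gm a b c x)" by blast
    moreover have "Gm a b c differentiable at x" using Gm_has_derivative differentiable_def by blast
    ultimately show ?case by (simp add: differentiable_mult)
  next
    case (3 h)
    then obtain k a b c where h: "h = (\<lambda>x. k * Gm a b c x)" by blast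
    have "rapid (Gm a b c)" using Gm_bounded unfolding rapid_def by blast
    then show ?case unfolding h by (rule rapid_le[of _ _ "norm k" 0]) (simp add: norm_mult)
  next
    case (4 h v)
    then obtain k a b c where h: "h = (\<lambda>x. k * Gm a b c x)" by blast
    have "pd v h = (\<lambda>x. k * Gm_deriv a b c x v)" unfolding h
      by (rule pd_eqI[where f' = "\<lambda>x h. k * Gm_deriv a b c x h"]) (intro has_derivative_mult_right Gm_has_derivative)
    also have "\<dots> \<in> sums_of ?X"
      unfolding Gm_deriv_def distrib_left mult.assoc[symmetric] by (intro sums_of.plus *)
    finally show ?case .
  qed
  then show ?thesis by simp
qed

lemma gam_schwartz: "(\<lambda>x. complex_of_real (gam x)) \<in> schwartz"
  using Gm_schwartz[of 0 0 0] by (simp add: Gm_def[abs_def])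

section \<open>Functions are determined by their pairings with Schwartz functions\<close>

definition logistic :: "real \<Rightarrow> real" where "logistic t = inverse (1 + exp (- t))"

lemma logistic_range: "0 < logistic t" "logistic t < 1"
  unfolding logistic_def by (simp_all add: add_pos_pos field_simps)

lemma logistic_deriv: "(logistic has_real_derivative logistic t * (1 - logistic t)) (at t)"
proof -
  have p: "1 + exp (- t) > 0" by (simp add: add_pos_pos)
  then have "1 + exp (- t) \<noteq> 0" by simp
  then show ?thesis unfolding logistic_def[abs_def]
    by (auto intro!: derivative_eq_intros simp: field_simps power2_eq_square)
qed

text \<open>The logistic function satisfies L' = L (1 - L), so the polynomials in it are bounded
  multipliers that form a class stable under derivatives. For large \<open>k\<close> it approximates
  the indicator of a half plane and serves as a smooth cut-off.\<close>

lemma schwartz_mult_logistic: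
  assumes f: "f \<in> schwartz"
  shows "(\<lambda>x. of_real (logistic (k * (a - x \<bullet> b))) * f x) \<in> schwartz"
proof -
  let ?L = "\<lambda>x. complex_of_real (logistic (k * (a - x \<bullet> b)))"
  let ?M = "{\<lambda>x. poly q (?L x) |q. True}"
  have L: "(?L has_derivative (\<lambda>h. of_real (- k * (h \<bullet> b)) * (?L x * (1 - ?L x)))) (at x)" for x
  proof -
    have "((\<lambda>x. k * (a - x \<bullet> b)) has_derivative (\<lambda>h. - k * (h \<bullet> b))) (at x)"
      by (auto intro!: derivative_eq_intros)
    from has_derivative_of_real[OF DERIV_compose_FDERIV[OF logistic_deriv this]] show ?thesis by simp
  qed
  have P: "((\<lambda>x. poly q (?L x)) has_derivative (\<lambda>h. poly (smult (of_real (- k * (h \<bullet> b))) (pderiv q * [:0, 1:] * [:1, -1:])) (?L x))) (at x)" for q x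
  proof (rule has_derivative_eq_rhs)
    show "((\<lambda>x. poly q (?L x)) has_derivative (\<lambda>h. poly (pderiv q) (?L x) * (of_real (- k * (h \<bullet> b)) * (?L x * (1 - ?L x))))) (at x)"
      using has_derivative_compose[OF L has_field_derivative_imp_has_derivative[OF poly_DERIV]] .
  qed (simp add: fun_eq_iff algebra_simps)
  have "(\<lambda>x. poly [:0, 1:] (?L x) * f x) \<in> schwartz"
  proof (rule schwartz_mult[of _ ?M])
    show "(\<lambda>x. poly [:0, 1:] (?L x)) \<in> ?M" by (intro CollectI exI[of _ "[:0, 1:]"]) simp
    show "f \<in> schwartz" by fact
  next
    fix m x assume "m \<in> ?M"
    then obtain q where "m = (\<lambda>x. poly q (?L x))" by blast
    then show "m differentiable at x" using P differentiable_def by blast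
  next
    fix m assume "m \<in> ?M"
    then obtain q where m: "m = (\<lambda>x. poly q (?L x))" by blast
    have "norm (m x) \<le> (\<Sum>i\<le>degree q. norm (coeff q i))" for x
    proof -
      have "norm (?L x) \<le> 1" using logistic_range[of "k * (a - x \<bullet> b)"] by simp
      then have "norm (?L x) ^ i \<le> 1" for i by (intro power_le_one) auto
      then show ?thesis unfolding m poly_altdef
        by (intro order_trans[OF norm_sum] sum_mono) (simp add: norm_mult norm_power mult_left_le)
    qed
    then show "\<exists>C k. \<forall>x. norm (m x) \<le> C * (1 + norm x) ^ k"
      by (intro exI[of _ "\<Sum>i\<le>degree q. norm (coeff q i)"] exI[of _ 0]) simp
  next
    fix m v assume "m \<in> ?M"
    then obtain q where m: "m = (\<lambda>x. poly q (?L x))" by blast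
    show "pd v m \<in> ?M" unfolding m pd_eqI[OF P] by blast
  qed
  then show ?thesis by simp
qed

lemma mem_box_R2: "x \<in> box a b \<longleftrightarrow> fst a < fst x \<and> fst x < fst b \<and> snd a < snd x \<and> snd x < snd b" for a b x :: R2
  by (auto simp: box_def Basis_R2 inner_prod_def)

text \<open>Boxes generate the Borel sets and are stable under intersection, so the vanishing
  extends to all Borel sets by a Dynkin argument. Complements require the integral over the whole
  plane, which comes from an exhaustion by boxes.\<close>

lemma AE_zero_of_boxes:
  fixes g :: "R2 \<Rightarrow> complex"
  assumes g: "integrable lborel g"
    and z: "\<And>a b. set_lebesgue_integral lborel (box a b) g = 0"
  shows "AE x in lborel. g x = 0"
proof (rule sigma_finite_measure.density_zero[OF sigma_finite_lborel g])
  let ?G = "range (\<lambda>(a, b::R2). box a b)"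
  have borel: "sets lborel = sigma_sets UNIV ?G"
    using arg_cong[OF borel_eq_box[where 'a=R2], of sets] by simp
  have gA: "set_integrable lborel A g" if "A \<in> sets lborel" for A
    unfolding set_integrable_def using g that by (intro integrable_mult_indicator)
  have tot: "set_lebesgue_integral lborel UNIV g = 0"
  proof -
    let ?B = "\<lambda>i. box (- real i, - real i) (real i, real i)"
    have "(\<lambda>i. set_lebesgue_integral lborel (?B i) g) \<longlonglongrightarrow> set_lebesgue_integral lborel (\<Union>i. ?B i) g"
      by (rule set_integral_cont_up) (auto simp: incseq_def mem_box_R2 intro!: gA)
    moreover have "(\<Union>i. ?B i) = (UNIV :: R2 set)"
    proof -
      have "\<exists>i. x \<in> ?B i" for x :: R2
      proof -
        obtain i where "\<bar>fst x\<bar> + \<bar>snd x\<bar> < real i" using reals_Archimedean2 by blast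
        then show ?thesis by (intro exI[of _ i]) (auto simp: mem_box_R2)
      qed
      then show ?thesis by blast
    qed
    ultimately show ?thesis unfolding z using LIMSEQ_unique[OF tendsto_const] by fastforce
  qed
  have st: "Int_stable ?G"
  proof (rule Int_stableI, clarsimp)
    fix a b c d a' b' c' d' :: real
    have "box (a, b) (c, d) \<inter> box (a', b') (c', d') = box (max a a', max b b') (min c c', min d d')"
      by (auto simp: mem_box_R2)
    then show "box (a, b) (c, d) \<inter> box (a', b') (c', d') \<in> ?G" by (intro image_eqI[of _ _ "((_, _), (_, _))"]) auto
  qed
  fix A :: "R2 set" assume "A \<in> sets lborel"
  then have "A \<in> sigma_sets UNIV ?G" unfolding borel .
  have sub: "?G \<subseteq> Pow UNIV" by simp
  from st sub \<open>A \<in> sigma_sets UNIV ?G\<close> show "set_lebesgue_integral lborel A g = 0"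
  proof (induction rule: sigma_sets_induct_disjoint)
    case (basic A) then show ?case using z by auto
  next
    case empty then show ?case by (simp add: set_lebesgue_integral_def)
  next
    case (compl A)
    have A: "A \<in> sets lborel" using compl(1) unfolding borel .
    have "set_lebesgue_integral lborel UNIV g = set_lebesgue_integral lborel (A \<union> (UNIV - A)) g" by simp
    also have "\<dots> = set_lebesgue_integral lborel A g + set_lebesgue_integral lborel (UNIV - A) g"
      using A by (intro set_integral_Un gA) auto
    finally show ?case using tot compl by simp
  next
    case (union A)
    have A: "\<And>i. A i \<in> sets lborel" using union(2) unfolding borel by blast
    have "set_lebesgue_integral lborel (\<Union>i. A i) g = (\<Sum>i. set_lebesgue_integral lborel (A i) g)"
      by (rule lebesgue_integral_countable_add) (use A union(1) in \<open>auto intro!: gA simp: disjoint_family_on_def\<close>)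
    then show ?case using union(3) by simp
  qed
qed

text \<open>The logistic cut-offs have the wrong limit on the lines that bound their half planes;
  these lines are null sets.\<close>

lemma AE_lborel_coordinate:
  fixes c :: real
  shows "AE x::R2 in lborel. fst x \<noteq> c" "AE x::R2 in lborel. snd x \<noteq> c"
proof -
  have "AE x in lborel. x \<bullet> i \<noteq> c" if i: "i \<in> Basis" for i :: R2
  proof -
    have "{x. x \<bullet> i = c} \<in> null_sets lebesgue"
      using negligible_standard_hyperplane[OF i, of c] by (simp add: negligible_iff_null_sets)
    moreover have "{x. x \<bullet> i = c} \<in> sets lborel" by measurable
    ultimately have "{x. x \<bullet> i = c} \<in> null_sets lborel" by (simp add: null_sets_def)
    then show ?thesis by (rule AE_I') auto
  qed
  from this[of "(1,0)"] this[of "(0,1)"] show "AE x::R2 in lborel. fst x \<noteq> c" "AE x::R2 in lborel. snd x \<noteq> c"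
    by (simp_all add: Basis_R2 inner_prod_def)
qed

lemma logistic_limit:
  assumes "t \<noteq> 0"
  shows "(\<lambda>k. logistic (real k * t)) \<longlonglongrightarrow> (if t > 0 then 1 else 0)"
  unfolding logistic_def using assms by (cases "t > 0") (auto, real_asymp+)

text \<open>Testing with products of \<open>gam\<close> and logistic cut-offs gives the integrals over boxes.\<close>

lemma AE_zero_of_schwartz:
  fixes g :: "R2 \<Rightarrow> complex"
  assumes gi: "\<And>f. f \<in> schwartz \<Longrightarrow> integrable lborel (\<lambda>x. g x * f x)"
    and z: "\<And>f. f \<in> schwartz \<Longrightarrow> (\<integral>x. g x * f x \<partial>lborel) = 0"
  shows "AE x in lborel. g x = 0"
proof -
  let ?h = "\<lambda>x. g x * of_real (gam x)"
  have hi: "integrable lborel ?h" by (rule gi[OF gam_schwartz])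
  have "AE x in lborel. ?h x = 0"
  proof (rule AE_zero_of_boxes[OF hi])
    fix a b :: R2
    \<comment> \<open>One factor for each side of the box. Off the lines through the sides the
      product tends to the indicator of the box.\<close>
    define l where "l k x = logistic (real k * (fst b - x \<bullet> (1,0))) * (logistic (real k * (- fst a - x \<bullet> (-1,0)))
       * (logistic (real k * (snd b - x \<bullet> (0,1))) * logistic (real k * (- snd a - x \<bullet> (0,-1)))))" for k and x :: R2
    have l_meas [measurable]: "l k \<in> borel_measurable borel" for k
      unfolding l_def logistic_def by measurable
    have l01: "0 \<le> l k x \<and> l k x \<le> 1" for k x
      using logistic_range less_imp_le unfolding l_def by (intro conjI mult_nonneg_nonneg mult_le_one) auto
    have "(\<lambda>x. of_real (l k x) * of_real (gam x)) \<in> schwartz" for k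
      unfolding l_def of_real_mult mult.assoc by (intro schwartz_mult_logistic gam_schwartz)
    from z[OF this] have z': "(\<integral>x. of_real (l k x) * ?h x \<partial>lborel) = 0" for k
      by (simp add: mult_ac)
    have "(\<lambda>k. \<integral>x. of_real (l k x) * ?h x \<partial>lborel) \<longlonglongrightarrow> (\<integral>x. indicator (box a b) x *\<^sub>R ?h x \<partial>lborel)"
    proof (rule integral_dominated_convergence[where w="\<lambda>x. norm (?h x)"])
      show "integrable lborel (\<lambda>x. norm (?h x))" using hi by (rule integrable_norm)
      show "(\<lambda>x. indicat_real (box a b) x *\<^sub>R ?h x) \<in> borel_measurable lborel"
        using hi by measurable
      show "(\<lambda>x. of_real (l k x) * ?h x) \<in> borel_measurable lborel" for k
        using hi by measurable
      show "AE x in lborel. norm (of_real (l k x) * ?h x) \<le> norm (?h x)" for k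
        using l01 unfolding norm_mult[of "of_real _"] norm_of_real by (intro AE_I2 mult_left_le_one_le) auto
      note N = AE_lborel_coordinate
      show "AE x in lborel. (\<lambda>k. of_real (l k x) * ?h x) \<longlonglongrightarrow> indicat_real (box a b) x *\<^sub>R ?h x"
        using N(1)[of "fst a"] N(1)[of "fst b"] N(2)[of "snd a"] N(2)[of "snd b"]
      proof eventually_elim
        case (elim x)
        have L: "(\<lambda>k. l k x) \<longlonglongrightarrow> (if fst b - x \<bullet> (1,0) > 0 then 1 else 0) * ((if - fst a - x \<bullet> (-1,0) > 0 then 1 else 0)
          * ((if snd b - x \<bullet> (0,1) > 0 then 1 else 0) * (if - snd a - x \<bullet> (0,-1) > 0 then 1 else 0)))"
          unfolding l_def by (intro tendsto_mult logistic_limit) (use elim in \<open>auto simp: inner_prod_def\<close>)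
        have "(if fst b - x \<bullet> (1,0) > 0 then 1 else 0) * ((if - fst a - x \<bullet> (-1,0) > 0 then 1 else 0)
          * ((if snd b - x \<bullet> (0,1) > 0 then 1 else 0) * (if - snd a - x \<bullet> (0,-1) > 0 then 1 else 0))) = indicat_real (box a b) x"
          by (auto simp: indicator_def mem_box_R2 inner_prod_def)
        then show ?case using L unfolding scaleR_conv_of_real by (intro tendsto_intros) simp
      qed
    qed
    then show "set_lebesgue_integral lborel (box a b) ?h = 0"
      unfolding z' set_lebesgue_integral_def using LIMSEQ_unique[OF tendsto_const] by metis
  qed
  \<comment> \<open>\<open>gam\<close> is positive off the origin and can be divided out
    there.\<close>
  moreover have "AE x in lborel. x \<noteq> (0::R2)" by (rule AE_lborel_singleton)
  ultimately show ?thesis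
  proof eventually_elim
    case (elim x)
    then show ?case using gam_pos[of x] by simp
  qed
qed

section \<open>Distributions with integrable Fourier transform\<close>

lemma schwartz_bounded: "f \<in> schwartz \<Longrightarrow> \<exists>B. \<forall>x. norm (f x) \<le> B"
  using schwartz_rapid[of f] unfolding rapid_def by (metis mult_1 power_0)

lemma integrable_mult_schwartz:
  assumes "integrable lborel m" "f \<in> schwartz"
  shows "integrable lborel (\<lambda>x. m x * f x)"
proof -
  obtain B where "\<And>x. norm (f x) \<le> B" using schwartz_bounded[OF assms(2)] by blast
  then show ?thesis
    by (intro integrable_mult_bounded(2)[OF assms(1)]) (simp_all add: schwartz_measurable assms(2))
qed

lemma represents_integrable: "integrable lborel m \<Longrightarrow> represents m (distr_of_fun m)"
  unfolding represents_def using integrable_mult_schwartz by auto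

lemma represents_bounded:
  assumes [measurable]: "g \<in> borel_measurable borel" and "\<And>x. norm (g x) \<le> B"
  shows "represents g (distr_of_fun g)"
  unfolding represents_def
  by (intro conjI ballI integrable_mult_bounded(1) schwartz_integrable) (use assms in auto)

text \<open>This makes the choice in \<open>fun_of_distr\<close> harmless: what is computed from a
  representing function up to null sets may use any other one.\<close>

lemma represents_unique:
  assumes "represents g u" "represents g' u"
  shows "AE x in lborel. g x = g' x"
proof -
  have "AE x in lborel. g x - g' x = 0"
  proof (rule AE_zero_of_schwartz)
    fix f assume f: "f \<in> schwartz"
    then have i: "integrable lborel (\<lambda>x. g x * f x)" "integrable lborel (\<lambda>x. g' x * f x)"
      using assms by (auto simp: represents_def)
    then show "integrable lborel (\<lambda>x. (g x - g' x) * f x)" by (simp add: left_diff_distrib)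
    have "distr_of_fun g f = distr_of_fun g' f" using assms by (simp add: represents_def)
    then show "(\<integral>x. (g x - g' x) * f x \<partial>lborel) = 0"
      using i f by (simp add: left_diff_distrib distr_of_fun_def)
  qed
  then show ?thesis by simp
qed

lemma represents_fun_of_distr: "represents g u \<Longrightarrow> represents (fun_of_distr u) u"
  unfolding fun_of_distr_def by (rule someI[where P = "\<lambda>g. represents g u"])

lemma fun_of_distr_AE: "represents g u \<Longrightarrow> AE x in lborel. fun_of_distr u x = g x"
  using represents_unique represents_fun_of_distr by blast

lemma sobolev_norm_eq:
  assumes "represents g (fourier u)"
  shows "sobolev_norm s u = sqrt (\<integral>\<xi>. (1 + (norm \<xi>)\<^sup>2) powr s * (norm (g \<xi>))\<^sup>2 \<partial>lborel)"
proof -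
  have [measurable]: "g \<in> borel_measurable borel" "fun_of_distr (fourier u) \<in> borel_measurable borel"
    using assms represents_fun_of_distr[OF assms] by (auto simp: represents_def)
  have "(\<integral>\<xi>. (1 + (norm \<xi>)\<^sup>2) powr s * (norm (fun_of_distr (fourier u) \<xi>))\<^sup>2 \<partial>lborel)
     = (\<integral>\<xi>. (1 + (norm \<xi>)\<^sup>2) powr s * (norm (g \<xi>))\<^sup>2 \<partial>lborel)"
    by (rule integral_cong_AE) (use fun_of_distr_AE[OF assms] in auto)
  then show ?thesis by (simp add: sobolev_norm_def)
qed

text \<open>The distribution whose Fourier transform is the function \<open>m\<close>, obtained by
  moving the inverse transform to the test function. Data and solutions are handled in this form
  throughout.\<close>

definition distr_of_FT :: "(R2 \<Rightarrow> complex) \<Rightarrow> distr" where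
  "distr_of_FT m = (\<lambda>f. if f \<in> schwartz then \<integral>\<xi>. m \<xi> * inv_fourier_fun f \<xi> \<partial>lborel else 0)"

lemma inv_fourier_fun_measurable [measurable]:
  "f \<in> borel_measurable borel \<Longrightarrow> inv_fourier_fun f \<in> borel_measurable borel"
  unfolding inv_fourier_fun_FT by (rule FT_measurable)

lemma inv_fourier_fun_bound: "norm (inv_fourier_fun f x) \<le> (\<integral>x. norm (f x) \<partial>lborel) / (2 * pi)"
  unfolding inv_fourier_fun_FT by (rule FT_bound)

lemma distr_of_FT_eq: "integrable lborel m \<Longrightarrow> distr_of_FT m = distr_of_fun (inv_fourier_fun m)"
  unfolding distr_of_FT_def distr_of_fun_def inv_fourier_fun_FT
  by (intro ext if_cong refl) (simp add: FT_swap[OF _ schwartz_integrable] mult.commute[of "FT 1 m _"])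

lemma distr_of_FT_diff:
  assumes "integrable lborel m" "integrable lborel m'"
  shows "distr_of_FT m - distr_of_FT m' = distr_of_FT (\<lambda>\<xi>. m \<xi> - m' \<xi>)"
  using assms by (auto simp: fun_eq_iff distr_of_FT_def left_diff_distrib integrable_mult_schwartz inv_fourier_fun_schwartz)

lemma schwartz_seminorm_ge:
  assumes "f \<in> schwartz"
  shows "(1 + norm x) ^ n * norm (f x) \<le> schwartz_seminorm n f"
proof -
  let ?V = "{vs. set vs \<subseteq> (Basis :: R2 set) \<and> length vs \<le> n}"
  let ?S = "\<lambda>vs. SUP x. (1 + norm x) ^ n * norm (iter_pderiv vs f x)"
  have bdd: "bdd_above (range (\<lambda>x. (1 + norm x) ^ n * norm (iter_pderiv vs f x)))" if "vs \<in> ?V" for vs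
  proof -
    have "set vs \<subseteq> Basis" using that by simp
    with assms show ?thesis unfolding schwartz_def mem_Collect_eq by (elim allE[of _ vs]) simp
  qed
  have "(1 + norm x) ^ n * norm (f x) \<le> ?S []"
    using cSUP_upper[OF UNIV_I bdd[of "[]"], of x] by simp
  also have "?S [] \<le> (\<Sum>vs\<in>?V. ?S vs)"
  proof (rule member_le_sum)
    show "finite ?V" by (rule finite_lists_length_le) simp
    show "0 \<le> ?S vs" if "vs \<in> ?V - {[]}" for vs
      using that by (intro cSUP_upper2[OF bdd UNIV_I, of _ 0]) auto
  qed simp
  finally show ?thesis by (simp add: schwartz_seminorm_def)
qed

text \<open>The supremum of the transform of \<open>f\<close> is at most its L^1 norm over 2 pi, and
  the seminorm of order 4 controls the L^1 norm because \<open>(1 + norm x) ^ 4\<close> has an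
  integrable inverse.\<close>

lemma distr_of_FT_tempered:
  assumes m: "integrable lborel m"
  shows "distr_of_FT m \<in> tempered"
  unfolding tempered_def
proof (intro CollectI conjI)
  show "\<forall>f. f \<notin> schwartz \<longrightarrow> distr_of_FT m f = 0" by (simp add: distr_of_FT_def)
  show "\<forall>f\<in>schwartz. \<forall>g\<in>schwartz. \<forall>a b. distr_of_FT m (\<lambda>x. a * f x + b * g x) = a * distr_of_FT m f + b * distr_of_FT m g"
  proof (intro ballI allI)
    fix f g a b assume fg: "f \<in> schwartz" "g \<in> schwartz"
    have "inv_fourier_fun (\<lambda>x. a * f x + b * g x) = (\<lambda>x. a * inv_fourier_fun f x + b * inv_fourier_fun g x)"
      unfolding inv_fourier_fun_FT by (intro ext FT_cong_add schwartz_integrable fg)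
    then have "distr_of_FT m (\<lambda>x. a * f x + b * g x) = (\<integral>\<xi>. a * (m \<xi> * inv_fourier_fun f \<xi>) + b * (m \<xi> * inv_fourier_fun g \<xi>) \<partial>lborel)"
      using fg by (simp add: distr_of_FT_def schwartz_lincomb algebra_simps)
    also have "\<dots> = a * distr_of_FT m f + b * distr_of_FT m g"
      using integrable_mult_schwartz[OF m inv_fourier_fun_schwartz] fg by (simp add: distr_of_FT_def)
    finally show "distr_of_FT m (\<lambda>x. a * f x + b * g x) = a * distr_of_FT m f + b * distr_of_FT m g" .
  qed
  show "\<exists>n C. \<forall>f\<in>schwartz. norm (distr_of_FT m f) \<le> C * schwartz_seminorm n f"
  proof (rule exI[of _ 4], rule exI[of _ "(\<integral>\<xi>. norm (m \<xi>) \<partial>lborel) * (\<integral>x. inverse ((1 + norm (x::R2)) ^ 4) \<partial>lborel) / (2 * pi)"], rule ballI)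
    fix f assume f: "f \<in> schwartz"
    let ?J = "\<integral>x. inverse ((1 + norm (x::R2)) ^ 4) \<partial>lborel"
    let ?N = "schwartz_seminorm 4 f"
    have "norm (f x) \<le> ?N * inverse ((1 + norm x) ^ 4)" for x
    proof -
      have "(1 + norm x) ^ 4 > 0" by simp
      then show ?thesis using schwartz_seminorm_ge[OF f, of x 4] unfolding divide_inverse[symmetric]
        by (subst pos_le_divide_eq) (simp_all add: mult.commute)
    qed
    then have "(\<integral>x. norm (f x) \<partial>lborel) \<le> (\<integral>x. ?N * inverse ((1 + norm (x::R2)) ^ 4) \<partial>lborel)"
      by (intro integral_mono integrable_norm schwartz_integrable[OF f] integrable_mult_right integrable_inverse_power4)
    also have "\<dots> = ?N * ?J" by simp
    finally have F: "norm (inv_fourier_fun f x) \<le> ?N * ?J / (2 * pi)" for x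
      by (intro order_trans[OF inv_fourier_fun_bound] divide_right_mono) simp_all
    have "norm (distr_of_FT m f) \<le> (\<integral>\<xi>. norm (m \<xi> * inv_fourier_fun f \<xi>) \<partial>lborel)"
      using f by (simp add: distr_of_FT_def)
    also have "\<dots> \<le> (\<integral>\<xi>. norm (m \<xi>) * (?N * ?J / (2 * pi)) \<partial>lborel)"
      unfolding norm_mult using integrable_norm[OF integrable_mult_schwartz[OF m inv_fourier_fun_schwartz[OF f]]] m
      by (intro integral_mono mult_left_mono F integrable_mult_left integrable_norm) (simp_all add: norm_mult)
    also have "\<dots> = ((\<integral>\<xi>. norm (m \<xi>) \<partial>lborel) * ?J / (2 * pi)) * ?N" by simp
    finally show "norm (distr_of_FT m f) \<le> ((\<integral>\<xi>. norm (m \<xi>) \<partial>lborel) * ?J / (2 * pi)) * ?N" .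
  qed
qed

lemma fourier_distr_of_FT: "fourier (distr_of_FT m) = distr_of_fun m"
  by (auto simp: fun_eq_iff fourier_def by_duality_def distr_of_FT_def distr_of_fun_def fourier_fun_schwartz inv_fourier_fourier)

lemma represents_fourier_distr_of_FT: "integrable lborel m \<Longrightarrow> represents m (fourier (distr_of_FT m))"
  unfolding fourier_distr_of_FT by (rule represents_integrable)

lemma sobolev_distr_of_FT:
  assumes "integrable lborel m" "integrable lborel (\<lambda>\<xi>. (1 + (norm \<xi>)\<^sup>2) powr s * (norm (m \<xi>))\<^sup>2)"
  shows "distr_of_FT m \<in> sobolev s"
  unfolding sobolev_def using assms distr_of_FT_tempered represents_fourier_distr_of_FT by blast

lemma sobolev_norm_distr_of_FT:
  "integrable lborel m \<Longrightarrow> sobolev_norm s (distr_of_FT m) = sqrt (\<integral>\<xi>. (1 + (norm \<xi>)\<^sup>2) powr s * (norm (m \<xi>))\<^sup>2 \<partial>lborel)"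
  by (rule sobolev_norm_eq[OF represents_fourier_distr_of_FT])

lemma propagator_distr_of_FT: "propagator t (distr_of_FT m) = distr_of_FT (\<lambda>\<xi>. cis (t * (norm \<xi>)\<^sup>2) * m \<xi>)"
proof
  fix f
  show "propagator t (distr_of_FT m) f = distr_of_FT (\<lambda>\<xi>. cis (t * (norm \<xi>)\<^sup>2) * m \<xi>) f"
  proof (cases "f \<in> schwartz")
    case True
    then have s: "(\<lambda>\<xi>. cis (t * (norm \<xi>)\<^sup>2) * inv_fourier_fun f \<xi>) \<in> schwartz"
      by (intro schwartz_mult_unimodular inv_fourier_fun_schwartz)
    have "propagator t (distr_of_FT m) f = fourier (distr_of_FT m) (\<lambda>\<xi>. cis (t * (norm \<xi>)\<^sup>2) * inv_fourier_fun f \<xi>)"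
      using True by (simp add: propagator_def inv_fourier_def by_duality_def inv_fourier_fun_schwartz)
    also have "\<dots> = (\<integral>\<xi>. m \<xi> * (cis (t * (norm \<xi>)\<^sup>2) * inv_fourier_fun f \<xi>) \<partial>lborel)"
      unfolding fourier_distr_of_FT distr_of_fun_def using s by simp
    also have "\<dots> = distr_of_FT (\<lambda>\<xi>. cis (t * (norm \<xi>)\<^sup>2) * m \<xi>) f"
      using True by (simp add: distr_of_FT_def mult_ac)
    finally show ?thesis .
  qed (simp add: propagator_def inv_fourier_def by_duality_def distr_of_FT_def)
qed

section \<open>The nonlinearity in Fourier variables\<close>

definition corr :: "(R2 \<Rightarrow> complex) \<Rightarrow> R2 \<Rightarrow> complex" where
  "corr m \<xi> = (\<integral>\<zeta>. m (\<xi> + \<zeta>) * cnj (m \<zeta>) \<partial>lborel) / (2 * pi)"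

lemma lborel_shift:
  fixes f :: "R2 \<Rightarrow> 'b::{banach, second_countable_topology}"
  assumes [measurable]: "f \<in> borel_measurable borel"
  shows "(\<integral>x. f (x + h) \<partial>lborel) = (\<integral>x. f x \<partial>lborel)"
    and "integrable lborel f \<Longrightarrow> integrable lborel (\<lambda>x. f (x + h))"
proof -
  have "(\<integral>x. f x \<partial>lborel) = (\<integral>x. f x \<partial>distr lborel borel ((+) h))" by (simp add: lborel_distr_plus)
  then show "(\<integral>x. f (x + h) \<partial>lborel) = (\<integral>x. f x \<partial>lborel)" by (simp add: integral_distr add.commute)
  assume "integrable lborel f"
  then have "integrable (distr lborel borel ((+) h)) f" by (simp add: lborel_distr_plus)
  then show "integrable lborel (\<lambda>x. f (x + h))" by (simp add: integrable_distr_eq add.commute)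
qed

lemma corr_integrable:
  fixes f g :: "R2 \<Rightarrow> complex"
  assumes f: "integrable lborel f" and g: "integrable lborel g"
  shows "integrable (lborel \<Otimes>\<^sub>M lborel) (\<lambda>(\<zeta>, \<xi>). f (\<xi> + \<zeta>) * g \<zeta>)"
    and "integrable (lborel \<Otimes>\<^sub>M lborel) (\<lambda>(\<xi>, \<zeta>). f (\<xi> + \<zeta>) * g \<zeta>)"
proof -
  have [measurable]: "f \<in> borel_measurable borel" "g \<in> borel_measurable borel" using f g by auto
  show I: "integrable (lborel \<Otimes>\<^sub>M lborel) (\<lambda>(\<zeta>, \<xi>). f (\<xi> + \<zeta>) * g \<zeta>)"
  proof (rule lborel_pair.Fubini_integrable)
    have "(\<integral>\<xi>. norm (f (\<xi> + \<zeta>) * g \<zeta>) \<partial>lborel) = (\<integral>\<xi>. norm (f \<xi>) \<partial>lborel) * norm (g \<zeta>)" for \<zeta>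
      using lborel_shift(1)[of "\<lambda>x. norm (f x)" \<zeta>] by (simp add: norm_mult)
    then show "integrable lborel (\<lambda>\<zeta>. \<integral>\<xi>. norm (case (\<zeta>, \<xi>) of (\<zeta>, \<xi>) \<Rightarrow> f (\<xi> + \<zeta>) * g \<zeta>) \<partial>lborel)"
      using g by simp
    show "AE \<zeta> in lborel. integrable lborel (\<lambda>\<xi>. case (\<zeta>, \<xi>) of (\<zeta>, \<xi>) \<Rightarrow> f (\<xi> + \<zeta>) * g \<zeta>)"
      using lborel_shift(2)[of f] f by (intro AE_I2) simp
  qed measurable
  from lborel_pair.integrable_product_swap[OF I]
  show "integrable (lborel \<Otimes>\<^sub>M lborel) (\<lambda>(\<xi>, \<zeta>). f (\<xi> + \<zeta>) * g \<zeta>)"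
    by (simp add: case_prod_unfold)
qed

lemma integrable_cnj: "integrable M f \<Longrightarrow> integrable M (\<lambda>x. cnj (f x))"
  by simp

lemma corr_integrable_fun:
  assumes m: "integrable lborel m"
  shows "integrable lborel (corr m)"
  unfolding corr_def[abs_def]
  using lborel_pair.integrable_fst'[OF corr_integrable(2)[OF m integrable_cnj[OF m]]] by simp

text \<open>The character at \<xi> is the character at \<xi> + \<zeta> times the conjugate of the
  one at \<zeta>. Integrating in \<xi> removes the shift, and the transform times its conjugate
  remains.\<close>

lemma inv_fourier_corr:
  assumes m: "integrable lborel m"
  shows "inv_fourier_fun (corr m) x = of_real ((norm (inv_fourier_fun m x))\<^sup>2)"
proof -
  have [measurable]: "m \<in> borel_measurable borel" using m by auto
  have ie: "integrable lborel (\<lambda>\<xi>. cis (x \<bullet> \<xi>) * m \<xi>)"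
    by (rule integrable_mult_bounded(1)[OF m, where C=1]) simp_all
  let ?F = "\<integral>\<xi>. cis (x \<bullet> \<xi>) * m \<xi> \<partial>lborel"
  have I: "integrable (lborel \<Otimes>\<^sub>M lborel) (\<lambda>(\<zeta>, \<xi>). cis (x \<bullet> \<xi>) * (m (\<xi> + \<zeta>) * cnj (m \<zeta>)))"
    using integrable_mult_bounded(1)[OF corr_integrable(1)[OF m integrable_cnj[OF m]], of "\<lambda>(\<zeta>, \<xi>). cis (x \<bullet> \<xi>)" 1]
    by (simp add: case_prod_unfold)
  have "(\<integral>\<xi>. cis (x \<bullet> \<xi>) * (\<integral>\<zeta>. m (\<xi> + \<zeta>) * cnj (m \<zeta>) \<partial>lborel) \<partial>lborel)
     = (\<integral>\<xi>. (\<integral>\<zeta>. cis (x \<bullet> \<xi>) * (m (\<xi> + \<zeta>) * cnj (m \<zeta>)) \<partial>lborel) \<partial>lborel)" by simp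
  also have "\<dots> = (\<integral>\<zeta>. (\<integral>\<xi>. cis (x \<bullet> \<xi>) * (m (\<xi> + \<zeta>) * cnj (m \<zeta>)) \<partial>lborel) \<partial>lborel)"
    by (rule lborel_pair.Fubini_integral[OF I])
  also have "\<dots> = (\<integral>\<zeta>. ?F * cnj (cis (x \<bullet> \<zeta>) * m \<zeta>) \<partial>lborel)"
  proof (rule Bochner_Integration.integral_cong[OF refl])
    fix \<zeta>
    have "cis (x \<bullet> \<xi>) * (m (\<xi> + \<zeta>) * cnj (m \<zeta>)) = (cis (x \<bullet> (\<xi> + \<zeta>)) * m (\<xi> + \<zeta>)) * cnj (cis (x \<bullet> \<zeta>) * m \<zeta>)" for \<xi>
    proof -
      have "cis (x \<bullet> \<xi>) = cis (x \<bullet> (\<xi> + \<zeta>)) * cnj (cis (x \<bullet> \<zeta>))"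
        by (simp add: cis_cnj cis_mult inner_add_right)
      then show ?thesis by simp
    qed
    then have "(\<integral>\<xi>. cis (x \<bullet> \<xi>) * (m (\<xi> + \<zeta>) * cnj (m \<zeta>)) \<partial>lborel) = (\<integral>\<xi>. (cis (x \<bullet> (\<xi> + \<zeta>)) * m (\<xi> + \<zeta>)) * cnj (cis (x \<bullet> \<zeta>) * m \<zeta>) \<partial>lborel)"
      by (intro Bochner_Integration.integral_cong refl)
    also have "\<dots> = (\<integral>\<xi>. (cis (x \<bullet> (\<xi> + \<zeta>)) * m (\<xi> + \<zeta>)) \<partial>lborel) * cnj (cis (x \<bullet> \<zeta>) * m \<zeta>)"
      by (rule integral_mult_left_zero)
    also have "(\<integral>\<xi>. (cis (x \<bullet> (\<xi> + \<zeta>)) * m (\<xi> + \<zeta>)) \<partial>lborel) = ?F"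
      by (rule lborel_shift(1)) measurable
    finally show "(\<integral>\<xi>. cis (x \<bullet> \<xi>) * (m (\<xi> + \<zeta>) * cnj (m \<zeta>)) \<partial>lborel) = ?F * cnj (cis (x \<bullet> \<zeta>) * m \<zeta>)" .
  qed
  also have "\<dots> = ?F * cnj ?F"
    by (subst integral_mult_right_zero) (simp del: complex_cnj_mult)
  finally have "inv_fourier_fun (corr m) x = (?F / (2 * pi)) * cnj (?F / (2 * pi))"
    by (simp add: inv_fourier_fun_def corr_def)
  then show ?thesis unfolding complex_norm_square by (simp add: inv_fourier_fun_def)
qed

text \<open>\<open>abs_square\<close> squares a representative chosen arbitrarily; it agrees almost
  everywhere with the inverse transform of \<open>m\<close>, to which
  \<open>inv_fourier_corr\<close> applies.\<close>

lemma abs_square_distr_of_FT: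
  assumes m: "integrable lborel m"
  shows "abs_square (distr_of_FT m) = distr_of_FT (corr m)"
proof -
  have [measurable]: "m \<in> borel_measurable borel" using m by auto
  have r: "represents (inv_fourier_fun m) (distr_of_FT m)"
    unfolding distr_of_FT_eq[OF m] by (rule represents_bounded[OF _ inv_fourier_fun_bound]) measurable
  have [measurable]: "fun_of_distr (distr_of_FT m) \<in> borel_measurable borel"
    using represents_fun_of_distr[OF r] by (auto simp: represents_def)
  have "abs_square (distr_of_FT m) = distr_of_fun (\<lambda>x. of_real ((norm (inv_fourier_fun m x))\<^sup>2))"
  proof
    fix f
    show "abs_square (distr_of_FT m) f = distr_of_fun (\<lambda>x. of_real ((norm (inv_fourier_fun m x))\<^sup>2)) f"
    proof (cases "f \<in> schwartz")
      case True
      note [measurable] = schwartz_measurable[OF True]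
      have "(\<integral>x. of_real ((norm (fun_of_distr (distr_of_FT m) x))\<^sup>2) * f x \<partial>lborel)
          = (\<integral>x. of_real ((norm (inv_fourier_fun m x))\<^sup>2) * f x \<partial>lborel)"
        by (rule integral_cong_AE) (use fun_of_distr_AE[OF r] in auto)
      then show ?thesis using True by (simp add: abs_square_def distr_of_fun_def)
    qed (simp add: abs_square_def distr_of_fun_def)
  qed
  also have "\<dots> = distr_of_fun (inv_fourier_fun (corr m))"
    by (simp add: inv_fourier_corr[OF m, abs_def])
  also have "\<dots> = distr_of_FT (corr m)"
    by (rule distr_of_FT_eq[OF corr_integrable_fun[OF m], symmetric])
  finally show ?thesis .
qed

section \<open>Rotations and the angular operator\<close>

definition rot :: "real \<Rightarrow> R2 \<Rightarrow> R2" where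
  "rot \<theta> x = (cos \<theta> * fst x - sin \<theta> * snd x, sin \<theta> * fst x + cos \<theta> * snd x)"

lemma zz_eq_iff: "zz x = zz y \<longleftrightarrow> x = y"
  by (simp add: zz_def prod_eq_iff)

lemma zz_rot: "zz (rot \<theta> x) = cis \<theta> * zz x"
  by (simp add: zz_def rot_def complex_eq_iff)

lemma norm_rot [simp]: "norm (rot \<theta> x) = norm x"
  by (metis norm_zz zz_rot norm_mult norm_cis mult_1)

lemma rot_rot: "rot \<theta> (rot \<phi> x) = rot (\<theta> + \<phi>) x"
  unfolding zz_eq_iff[symmetric] zz_rot by (simp add: cis_mult[symmetric])

lemma rot_0 [simp]: "rot 0 x = x"
  by (simp add: rot_def)

lemma rot_linear: "linear (rot \<theta>)"
  by unfold_locales (simp_all add: rot_def algebra_simps)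

lemma inner_rot: "rot \<theta> x \<bullet> rot \<theta> y = x \<bullet> y"
proof -
  have "rot \<theta> x \<bullet> rot \<theta> y = ((cos \<theta>)\<^sup>2 + (sin \<theta>)\<^sup>2) * (fst x * fst y + snd x * snd y)"
    unfolding rot_def inner_prod_def fst_conv snd_conv inner_real_def power2_eq_square by algebra
  then show ?thesis by (simp add: inner_prod_def)
qed

lemma rot_continuous [continuous_intros]:
  fixes t :: "'a::t2_space \<Rightarrow> real"
  shows "continuous_on S t \<Longrightarrow> continuous_on S x \<Longrightarrow> continuous_on S (\<lambda>p. rot (t p) (x p))"
  unfolding rot_def[abs_def] by (intro continuous_intros continuous_on_cos continuous_on_sin)

lemma rot_measurable [measurable]: "rot \<theta> \<in> borel_measurable borel"
  by (intro borel_measurable_continuous_onI continuous_intros)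

lemma rot_measurable2 [measurable (raw)]:
  assumes [measurable]: "t \<in> borel_measurable M" "x \<in> borel_measurable M"
  shows "(\<lambda>p. rot (t p) (x p)) \<in> borel_measurable M"
proof -
  have "(\<lambda>p. rot (fst p) (snd p)) \<in> borel_measurable borel"
    by (intro borel_measurable_continuous_onI continuous_intros)
  from measurable_compose[OF borel_measurable_Pair[OF assms] this] show ?thesis by simp
qed

lemma nn_integral_shear1:
  fixes f :: "R2 \<Rightarrow> ennreal"
  assumes [measurable]: "f \<in> borel_measurable borel"
  shows "(\<integral>\<^sup>+x. f (fst x + a * snd x, snd x) \<partial>lborel) = (\<integral>\<^sup>+x. f x \<partial>lborel)"
proof -
  have [measurable]: "f \<in> borel_measurable (lborel \<Otimes>\<^sub>M lborel)" unfolding lborel_prod by simp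
  have "(\<integral>\<^sup>+x. f (fst x + a * snd x, snd x) \<partial>lborel) = (\<integral>\<^sup>+y. (\<integral>\<^sup>+x. f (x + a * y, y) \<partial>lborel) \<partial>lborel)"
    by (subst lborel_prod[symmetric], subst lborel_pair.nn_integral_snd[symmetric]) simp_all
  also have "\<dots> = (\<integral>\<^sup>+y. (\<integral>\<^sup>+x. f (x, y) \<partial>lborel) \<partial>lborel)"
  proof (rule nn_integral_cong)
    fix y
    have "(\<integral>\<^sup>+x. f (x, y) \<partial>lborel) = (\<integral>\<^sup>+x. f (x, y) \<partial>distr lborel borel ((+) (a * y)))"
      by (simp add: lborel_distr_plus)
    also have "\<dots> = (\<integral>\<^sup>+x. f (x + a * y, y) \<partial>lborel)"
      by (subst nn_integral_distr) (simp_all add: add.commute)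
    finally show "(\<integral>\<^sup>+x. f (x + a * y, y) \<partial>lborel) = (\<integral>\<^sup>+x. f (x, y) \<partial>lborel)" by simp
  qed
  also have "\<dots> = (\<integral>\<^sup>+x. f x \<partial>lborel)"
    by (subst lborel_pair.nn_integral_snd) (simp_all add: lborel_prod)
  finally show ?thesis .
qed

lemma nn_integral_shear2:
  fixes f :: "R2 \<Rightarrow> ennreal"
  assumes [measurable]: "f \<in> borel_measurable borel"
  shows "(\<integral>\<^sup>+x. f (fst x, snd x + a * fst x) \<partial>lborel) = (\<integral>\<^sup>+x. f x \<partial>lborel)"
proof -
  have [measurable]: "f \<in> borel_measurable (lborel \<Otimes>\<^sub>M lborel)" unfolding lborel_prod by simp
  have "(\<integral>\<^sup>+x. f (fst x, snd x + a * fst x) \<partial>lborel) = (\<integral>\<^sup>+x. (\<integral>\<^sup>+y. f (x, y + a * x) \<partial>lborel) \<partial>lborel)"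
    by (subst lborel_prod[symmetric], subst lborel.nn_integral_fst[symmetric]) simp_all
  also have "\<dots> = (\<integral>\<^sup>+x. (\<integral>\<^sup>+y. f (x, y) \<partial>lborel) \<partial>lborel)"
  proof (rule nn_integral_cong)
    fix x
    have "(\<integral>\<^sup>+y. f (x, y) \<partial>lborel) = (\<integral>\<^sup>+y. f (x, y) \<partial>distr lborel borel ((+) (a * x)))"
      by (simp add: lborel_distr_plus)
    also have "\<dots> = (\<integral>\<^sup>+y. f (x, y + a * x) \<partial>lborel)"
      by (subst nn_integral_distr) (simp_all add: add.commute)
    finally show "(\<integral>\<^sup>+y. f (x, y + a * x) \<partial>lborel) = (\<integral>\<^sup>+y. f (x, y) \<partial>lborel)" by simp
  qed
  also have "\<dots> = (\<integral>\<^sup>+x. f x \<partial>lborel)"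
    by (subst lborel.nn_integral_fst) (simp_all add: lborel_prod)
  finally show ?thesis .
qed

text \<open>A rotation by an angle that is not an odd multiple of \<open>\<pi>\<close> is a product of three shears.\<close>

lemma nn_integral_rot_aux:
  fixes f :: "R2 \<Rightarrow> ennreal"
  assumes [measurable]: "f \<in> borel_measurable borel" and c: "cos (\<theta> / 2) \<noteq> 0"
  shows "(\<integral>\<^sup>+x. f (rot \<theta> x) \<partial>lborel) = (\<integral>\<^sup>+x. f x \<partial>lborel)"
proof -
  define t where "t = - tan (\<theta> / 2)"
  define S where "S = (\<lambda>x::R2. (fst x + t * snd x, snd x))"
  define R where "R = (\<lambda>x::R2. (fst x, snd x + sin \<theta> * fst x))"
  have [measurable]: "S \<in> borel_measurable borel" "R \<in> borel_measurable borel"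
    unfolding S_def R_def by (intro borel_measurable_continuous_onI continuous_intros)+
  have s: "sin \<theta> = 2 * sin (\<theta> / 2) * cos (\<theta> / 2)" using sin_double[of "\<theta> / 2"] by simp
  have ts: "1 + t * sin \<theta> = cos \<theta>"
    using c cos_double_sin[of "\<theta> / 2"] by (simp add: t_def tan_def s power2_eq_square)
  have "t * cos \<theta> + t = - sin \<theta>"
  proof -
    have "cos \<theta> + 1 = 2 * (cos (\<theta> / 2))\<^sup>2" using cos_double_cos[of "\<theta> / 2"] by simp
    moreover have "t * cos \<theta> + t = t * (cos \<theta> + 1)" by (simp add: algebra_simps)
    ultimately show ?thesis using c by (simp add: t_def tan_def s power2_eq_square)
  qed
  then have t2: "t + cos \<theta> * t = - sin \<theta>" by (simp add: algebra_simps)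
  have "S (R (S x)) = rot \<theta> x" for x
  proof -
    have "fst (S (R (S x))) = (1 + t * sin \<theta>) * fst x + (t + (1 + t * sin \<theta>) * t) * snd x"
      by (simp add: S_def R_def algebra_simps)
    moreover have "snd (S (R (S x))) = sin \<theta> * fst x + (1 + t * sin \<theta>) * snd x"
      by (simp add: S_def R_def algebra_simps)
    ultimately show ?thesis unfolding ts t2 by (simp add: rot_def prod_eq_iff)
  qed
  then have "(\<integral>\<^sup>+x. f (rot \<theta> x) \<partial>lborel) = (\<integral>\<^sup>+x. f (S (R (S x))) \<partial>lborel)" by simp
  also have "\<dots> = (\<integral>\<^sup>+x. f (S (R x)) \<partial>lborel)"
  proof -
    have "(\<lambda>x. f (S (R x))) \<in> borel_measurable borel" by measurable
    from nn_integral_shear1[OF this, of t] show ?thesis by (simp add: S_def)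
  qed
  also have "\<dots> = (\<integral>\<^sup>+x. f (S x) \<partial>lborel)"
    using nn_integral_shear2[of "\<lambda>x. f (S x)" "sin \<theta>"] by (simp add: R_def)
  also have "\<dots> = (\<integral>\<^sup>+x. f x \<partial>lborel)"
    using nn_integral_shear1[of f t] by (simp add: S_def)
  finally show ?thesis .
qed

lemma distr_lborel_rot: "distr lborel borel (rot \<theta>) = lborel"
proof (rule measure_eqI)
  fix A assume "A \<in> sets (distr lborel borel (rot \<theta>))"
  then have [measurable]: "A \<in> sets borel" by simp
  have "(\<integral>\<^sup>+x. indicator A (rot \<theta> x) \<partial>lborel) = (\<integral>\<^sup>+x. indicator A x \<partial>lborel)"
  proof (cases "cos (\<theta> / 2) = 0")
    case False then show ?thesis by (intro nn_integral_rot_aux) measurable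
  next
    case True
    \<comment> \<open>The decomposition into shears degenerates at odd multiples of pi; two
      rotations by half the angle avoid it.\<close>
    have "cos (\<theta> / 2 / 2) \<noteq> 0" using True cos_double_cos[of "\<theta> / 4"] by auto
    then have "(\<integral>\<^sup>+x. indicator A (rot (\<theta> / 2) (rot (\<theta> / 2) x)) \<partial>lborel) = (\<integral>\<^sup>+x. indicator A (rot (\<theta> / 2) x) \<partial>lborel)"
      by (intro nn_integral_rot_aux[of "\<lambda>x. indicator A (rot (\<theta> / 2) x)"]) measurable
    also have "\<dots> = (\<integral>\<^sup>+x. indicator A x \<partial>lborel)"
      using \<open>cos (\<theta> / 2 / 2) \<noteq> 0\<close> by (intro nn_integral_rot_aux) measurable
    finally have "(\<integral>\<^sup>+x. indicator A (rot (\<theta> / 2) (rot (\<theta> / 2) x)) \<partial>lborel) = (\<integral>\<^sup>+x. indicator A x \<partial>lborel)" .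
    then show ?thesis by (simp add: rot_rot)
  qed
  moreover have "(\<integral>\<^sup>+x. indicator A (rot \<theta> x) \<partial>lborel) = emeasure (distr lborel borel (rot \<theta>)) A"
    by (subst nn_integral_distr[of "rot \<theta>" lborel borel "indicator A", symmetric]) simp_all
  ultimately show "emeasure (distr lborel borel (rot \<theta>)) A = emeasure lborel A" by simp
qed simp

lemma integral_rot:
  fixes f :: "R2 \<Rightarrow> 'b::{banach, second_countable_topology}"
  assumes [measurable]: "f \<in> borel_measurable borel"
  shows "(\<integral>x. f (rot \<theta> x) \<partial>lborel) = (\<integral>x. f x \<partial>lborel)"
  using integral_distr[of "rot \<theta>" lborel borel f] by (simp add: distr_lborel_rot)

definition angular_mode :: "int \<Rightarrow> (R2 \<Rightarrow> complex) \<Rightarrow> bool" where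
  "angular_mode l f \<longleftrightarrow> (\<forall>\<theta> x. f (rot \<theta> x) = cis (of_int l * \<theta>) * f x)"

text \<open>Rotations preserve the inner product and Lebesgue measure, so the transform commutes
  with them.\<close>

lemma angular_mode_FT:
  assumes [measurable]: "f \<in> borel_measurable borel" and m: "angular_mode l f"
  shows "angular_mode l (FT c f)"
  unfolding angular_mode_def
proof (intro allI)
  fix \<theta> \<xi>
  have "(\<integral>x. cis (c * (x \<bullet> rot \<theta> \<xi>)) * f x \<partial>lborel) = (\<integral>x. cis (c * (rot \<theta> x \<bullet> rot \<theta> \<xi>)) * f (rot \<theta> x) \<partial>lborel)"
    by (rule integral_rot[symmetric]) measurable
  also have "\<dots> = (\<integral>x. cis (of_int l * \<theta>) * (cis (c * (x \<bullet> \<xi>)) * f x) \<partial>lborel)"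
    using m[unfolded angular_mode_def, rule_format, of \<theta>]
    by (intro Bochner_Integration.integral_cong refl) (simp only: inner_rot mult_ac)
  finally show "FT c f (rot \<theta> \<xi>) = cis (of_int l * \<theta>) * FT c f \<xi>"
    by (simp add: FT_def)
qed

definition ang_weight :: "real \<Rightarrow> int \<Rightarrow> real" where
  "ang_weight \<sigma> l = (1 + (of_int l)\<^sup>2) powr (\<sigma> / 2)"

lemma integral_cis_int:
  "((\<lambda>\<theta>. cis (of_int k * \<theta>)) has_integral (if k = 0 then of_real (2 * pi) else 0)) {0..2 * pi}"
proof (cases "k = 0")
  case True
  then show ?thesis using has_integral_const_real[of "1::complex" 0 "2 * pi"] by (simp add: scaleR_conv_of_real)
next
  case False
  have "((\<lambda>\<theta>. cis (of_int k * \<theta>)) has_integral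
     (cis (of_int k * (2 * pi)) / (\<i> * of_int k) - cis (of_int k * 0) / (\<i> * of_int k))) {0..2 * pi}"
  proof (rule fundamental_theorem_of_calculus)
    fix x
    have "((\<lambda>\<theta>. of_int k * \<theta>) has_derivative (\<lambda>h. of_int k * h)) (at x within {0..2 * pi})"
      by (auto intro!: derivative_eq_intros)
    from has_derivative_mult_left[OF has_derivative_cis_compose[OF this], of "1 / (\<i> * of_int k)"]
    show "((\<lambda>\<theta>. cis (of_int k * \<theta>) / (\<i> * of_int k)) has_vector_derivative cis (of_int k * x)) (at x within {0..2 * pi})"
      using False unfolding has_vector_derivative_def by (simp add: scaleR_conv_of_real)
  qed simp
  moreover have "cis (of_int k * (2 * pi)) = 1"
    using cis_multiple_2pi[of "of_int k"] by (simp add: mult_ac)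
  ultimately show ?thesis using False by simp
qed

lemma zz_polar: "x = rot (Arg (Complex (fst x) (snd x))) (norm x, 0)"
proof -
  have "zz (norm x, 0) = of_real (norm x)" by (simp add: zz_def complex_eq_iff)
  then have "zz (rot (Arg (Complex (fst x) (snd x))) (norm x, 0)) = cis (Arg (zz x)) * of_real (norm (zz x))"
    unfolding zz_rot by (simp add: zz_def[symmetric])
  also have "\<dots> = zz x" using rcis_cmod_Arg[of "zz x"] by (simp add: rcis_def mult.commute)
  finally show ?thesis unfolding zz_eq_iff by simp
qed

text \<open>Orthogonality of the exponentials on the circle leaves in the infinite sum only the
  terms with index in \<open>L\<close>. The polar form of x and the mode property turn the value on
  the horizontal axis into the value at x.\<close>

lemma angular_op_fun_modes:
  assumes L: "finite L" and m: "\<And>l. l \<in> L \<Longrightarrow> angular_mode l (F l)"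
  shows "angular_op_fun \<sigma> (\<lambda>x. \<Sum>l\<in>L. F l x) = (\<lambda>x. \<Sum>l\<in>L. of_real (ang_weight \<sigma> l) * F l x)"
proof
  fix x
  have c: "angular_coeff (\<lambda>x. \<Sum>l\<in>L. F l x) k r = (if k \<in> L then F k (r, 0) else 0)" for k r
  proof -
    have "(\<Sum>l\<in>L. F l (r * cos \<theta>, r * sin \<theta>)) * cis (- of_int k * \<theta>) = (\<Sum>l\<in>L. F l (r, 0) * cis (of_int (l - k) * \<theta>))" for \<theta>
    proof -
      have "(r * cos \<theta>, r * sin \<theta>) = rot \<theta> (r, 0)" by (simp add: rot_def mult.commute)
      then have "(\<Sum>l\<in>L. F l (r * cos \<theta>, r * sin \<theta>)) = (\<Sum>l\<in>L. cis (of_int l * \<theta>) * F l (r, 0))"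
        using m by (simp add: angular_mode_def)
      then show ?thesis
      proof -
        have "cis (of_int l * \<theta>) * F l (r, 0) * cis (- of_int k * \<theta>) = F l (r, 0) * cis (of_int (l - k) * \<theta>)" for l
        proof -
          have "cis (of_int (l - k) * \<theta>) = cis (of_int l * \<theta>) * cis (- of_int k * \<theta>)"
            unfolding cis_mult by (simp add: left_diff_distrib)
          then show ?thesis by (simp only: mult_ac)
        qed
        then show ?thesis using \<open>(\<Sum>l\<in>L. F l (r * cos \<theta>, r * sin \<theta>)) = (\<Sum>l\<in>L. cis (of_int l * \<theta>) * F l (r, 0))\<close>
          by (simp only: sum_distrib_right)
      qed
    qed
    moreover have "((\<lambda>\<theta>. \<Sum>l\<in>L. F l (r, 0) * cis (of_int (l - k) * \<theta>)) has_integral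
       (\<Sum>l\<in>L. F l (r, 0) * (if l - k = 0 then of_real (2 * pi) else 0))) {0..2 * pi}"
      by (intro has_integral_sum L has_integral_mult_right integral_cis_int)
    ultimately have "integral {0..2 * pi} (\<lambda>\<theta>. (\<Sum>l\<in>L. F l (r * cos \<theta>, r * sin \<theta>)) * cis (- of_int k * \<theta>))
       = (\<Sum>l\<in>L. F l (r, 0) * (if l - k = 0 then of_real (2 * pi) else 0))"
      by (simp only: integral_unique)
    also have "\<dots> = (\<Sum>l\<in>L. if l = k then F l (r, 0) * of_real (2 * pi) else 0)" by (intro sum.cong) auto
    also have "\<dots> = (if k \<in> L then F k (r, 0) * of_real (2 * pi) else 0)" using L by simp
    finally show ?thesis by (simp add: angular_coeff_def)
  qed
  let ?a = "Arg (Complex (fst x) (snd x))"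
  have "angular_op_fun \<sigma> (\<lambda>x. \<Sum>l\<in>L. F l x) x = (\<Sum>\<^sub>\<infinity>l\<in>L. of_real (ang_weight \<sigma> l) * F l x)"
    unfolding angular_op_fun_def
  proof (rule infsum_cong_neutral)
    fix l assume "l \<in> UNIV \<inter> L"
    then have "F l x = cis (of_int l * ?a) * F l (norm x, 0)" 
      using arg_cong[OF zz_polar[of x], of "F l"] m[of l] by (simp add: angular_mode_def)
    then show "of_real ((1 + (of_int l)\<^sup>2) powr (\<sigma> / 2)) * angular_coeff (\<lambda>x. \<Sum>l\<in>L. F l x) l (norm x) * cis (of_int l * ?a)
       = of_real (ang_weight \<sigma> l) * F l x"
      using \<open>l \<in> UNIV \<inter> L\<close> by (simp add: c ang_weight_def)
  qed (auto simp: c)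
  also have "\<dots> = (\<Sum>l\<in>L. of_real (ang_weight \<sigma> l) * F l x)" using L by (rule infsum_finite)
  finally show "angular_op_fun \<sigma> (\<lambda>x. \<Sum>l\<in>L. F l x) x = (\<Sum>l\<in>L. of_real (ang_weight \<sigma> l) * F l x)" .
qed

section \<open>Averages over rotations; the angular operator on Schwartz functions\<close>

definition circ :: "real measure" where "circ = restrict_space lborel {0..2 * pi}"

lemma space_circ [simp]: "space circ = {0..2 * pi}"
  by (simp add: circ_def space_restrict_space)

lemma finite_circ: "finite_measure circ"
  unfolding circ_def by (rule finite_measureI) (simp add: emeasure_restrict_space space_restrict_space)

lemma circ_measurable: "f \<in> borel_measurable borel \<Longrightarrow> f \<in> borel_measurable circ"
  unfolding circ_def by (rule measurable_restrict_space1) simp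

text \<open>Links the gauge integral of \<open>angular_coeff\<close> to a finite measure, for which
  dominated convergence and Fubini are at hand.\<close>

lemma circ_integral:
  fixes h :: "real \<Rightarrow> complex"
  assumes "continuous_on UNIV h"
  shows "integrable circ h" "integral {0..2 * pi} h = (\<integral>\<theta>. h \<theta> \<partial>circ)"
proof -
  have c: "continuous_on {0..2 * pi} h" using assms continuous_on_subset by blast
  then have s: "set_integrable lborel {0..2 * pi} h"
    by (rule borel_integrable_atLeastAtMost')
  then show "integrable circ h"
    unfolding circ_def set_integrable_def by (subst integrable_restrict_space) auto
  show "integral {0..2 * pi} h = (\<integral>\<theta>. h \<theta> \<partial>circ)"
    unfolding circ_def using set_borel_integral_eq_integral(2)[OF s]
    by (subst integral_restrict_space) (auto simp: set_lebesgue_integral_def)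
qed

text \<open>A convolution with \<open>k\<close> along circles. \<open>angular_op_fun\<close> will be
  brought to this form with a continuous kernel, which shows that it preserves the Schwartz
  space.\<close>

definition rot_avg :: "(real \<Rightarrow> complex) \<Rightarrow> (R2 \<Rightarrow> complex) \<Rightarrow> R2 \<Rightarrow> complex" where
  "rot_avg k g x = integral {0..2 * pi} (\<lambda>\<theta>. k \<theta> * g (rot \<theta> x))"

lemma continuous_on_schwartz_compose:
  "g \<in> schwartz \<Longrightarrow> continuous_on S f \<Longrightarrow> continuous_on S (\<lambda>x. g (f x))"
  using continuous_on_compose2[OF schwartz_continuous] by blast

lemma rot_avg_continuous:
  assumes k: "continuous_on UNIV k" and g: "g \<in> schwartz"
  shows "continuous_on UNIV (\<lambda>\<theta>. k \<theta> * g (rot \<theta> x))"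
  by (intro continuous_on_mult k continuous_on_schwartz_compose[OF g] continuous_intros)

lemmas rot_avg_eq = circ_integral(2)[OF rot_avg_continuous, folded rot_avg_def]

text \<open>Differentiation passes under the average, and since \<open>rot\<close> is linear the
  chain rule only multiplies the weight by a coordinate of the rotated direction. Averages are thus
  closed under derivatives up to sums.\<close>

lemma rot_avg_pd:
  assumes k: "continuous_on UNIV k" and g: "g \<in> schwartz"
  shows "(rot_avg k g has_derivative (\<lambda>h. rot_avg (\<lambda>\<theta>. k \<theta> * of_real (fst (rot \<theta> h))) (pd (1,0) g) x
     + rot_avg (\<lambda>\<theta>. k \<theta> * of_real (snd (rot \<theta> h))) (pd (0,1) g) x)) (at x)"
proof -
  have g1: "pd (1,0) g \<in> schwartz" and g2: "pd (0,1) g \<in> schwartz"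
    by (intro schwartz_pd g, simp add: Basis_R2)+
  obtain C where "C \<ge> 0" and C: "\<forall>x h. norm h \<le> 1 \<longrightarrow> norm (g (x + h) - g x) \<le> C * inverse ((1 + norm x) ^ 4) * norm h"
    and C': "\<forall>x h. norm (of_real (fst h) * pd (1,0) g x + of_real (snd h) * pd (0,1) g x) \<le> C * inverse ((1 + norm x) ^ 4) * norm h"
    using schwartz_derivative_bound[OF g] by (elim exE conjE)
  have le: "C * inverse ((1 + norm y) ^ 4) * norm (h::R2) \<le> C * norm h" for y h :: R2
  proof -
    have "inverse ((1 + norm y) ^ 4) \<le> 1" by (simp add: inverse_le_1_iff one_le_power)
    then have "C * (inverse ((1 + norm y) ^ 4) * norm h) \<le> C * (1 * norm h)"
      using \<open>C \<ge> 0\<close> by (intro mult_left_mono mult_right_mono) auto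
    then show ?thesis by (simp add: mult.assoc)
  qed
  have ck: "continuous_on UNIV (\<lambda>\<theta>. k \<theta> * of_real (fst (rot \<theta> h)))" "continuous_on UNIV (\<lambda>\<theta>. k \<theta> * of_real (snd (rot \<theta> h)))" for h
    by (intro continuous_intros k)+
  have cD: "continuous_on UNIV (\<lambda>\<theta>. k \<theta> * (of_real (fst (rot \<theta> h)) * pd (1,0) g (rot \<theta> x) + of_real (snd (rot \<theta> h)) * pd (0,1) g (rot \<theta> x)))" for h
    by (intro continuous_intros k continuous_on_schwartz_compose[OF g1] continuous_on_schwartz_compose[OF g2])
  have "((\<lambda>x. \<integral>\<theta>. k \<theta> * g (rot \<theta> x) \<partial>circ) has_derivative
    (\<lambda>h. \<integral>\<theta>. k \<theta> * (of_real (fst (rot \<theta> h)) * pd (1,0) g (rot \<theta> x) + of_real (snd (rot \<theta> h)) * pd (0,1) g (rot \<theta> x)) \<partial>circ)) (at x)"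
  proof (rule has_derivative_lebesgue_integral[where r=1 and B="\<lambda>\<theta>. norm (k \<theta>) * C"])
    show "integrable circ (\<lambda>\<theta>. k \<theta> * g (rot \<theta> h))" for h
      by (rule circ_integral(1)[OF rot_avg_continuous[OF k g]])
    show "((\<lambda>x. k \<theta> * g (rot \<theta> x)) has_derivative (\<lambda>h. k \<theta> * (of_real (fst (rot \<theta> h)) * pd (1,0) g (rot \<theta> x) + of_real (snd (rot \<theta> h)) * pd (0,1) g (rot \<theta> x)))) (at x)" for \<theta>
    proof (rule has_derivative_mult_right)
      have "(rot \<theta> has_derivative rot \<theta>) (at x)"
        by (rule linear_imp_has_derivative[OF rot_linear])
      from has_derivative_compose[OF this schwartz_has_derivative[OF g]]
      show "((\<lambda>x. g (rot \<theta> x)) has_derivative (\<lambda>h. of_real (fst (rot \<theta> h)) * pd (1,0) g (rot \<theta> x) + of_real (snd (rot \<theta> h)) * pd (0,1) g (rot \<theta> x))) (at x)" .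
    qed
    show "norm (k \<theta> * g (rot \<theta> (x + h)) - k \<theta> * g (rot \<theta> x)) \<le> norm (k \<theta>) * C * norm h" if "norm h < 1" for \<theta> h
    proof -
      have "norm (g (rot \<theta> (x + h)) - g (rot \<theta> x)) \<le> C * norm (rot \<theta> h)"
        unfolding linear_add[OF rot_linear] using that
        by (intro order_trans[OF C[rule_format] le]) simp
      then show ?thesis
        unfolding right_diff_distrib[symmetric] norm_mult mult.assoc norm_rot by (intro mult_left_mono) simp_all
    qed
    show "norm (k \<theta> * (of_real (fst (rot \<theta> h)) * pd (1,0) g (rot \<theta> x) + of_real (snd (rot \<theta> h)) * pd (0,1) g (rot \<theta> x))) \<le> norm (k \<theta>) * C * norm h" for \<theta> h
    proof -
      have "norm (of_real (fst (rot \<theta> h)) * pd (1,0) g (rot \<theta> x) + of_real (snd (rot \<theta> h)) * pd (0,1) g (rot \<theta> x)) \<le> C * norm (rot \<theta> h)"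
        by (rule order_trans[OF C'[rule_format] le])
      then show ?thesis unfolding norm_mult[of "k \<theta>"] mult.assoc norm_rot by (intro mult_left_mono) simp_all
    qed
    show "integrable circ (\<lambda>\<theta>. norm (k \<theta>) * C)"
      by (intro integrable_mult_left integrable_norm circ_integral(1) k)
    show "(\<lambda>\<theta>. k \<theta> * (of_real (fst (rot \<theta> h)) * pd (1,0) g (rot \<theta> x) + of_real (snd (rot \<theta> h)) * pd (0,1) g (rot \<theta> x))) \<in> borel_measurable circ" for h
      by (intro circ_measurable borel_measurable_continuous_onI cD)
  qed simp
  moreover have "(\<integral>\<theta>. k \<theta> * (of_real (fst (rot \<theta> h)) * pd (1,0) g (rot \<theta> x) + of_real (snd (rot \<theta> h)) * pd (0,1) g (rot \<theta> x)) \<partial>circ)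
     = rot_avg (\<lambda>\<theta>. k \<theta> * of_real (fst (rot \<theta> h))) (pd (1,0) g) x + rot_avg (\<lambda>\<theta>. k \<theta> * of_real (snd (rot \<theta> h))) (pd (0,1) g) x" for h
    unfolding rot_avg_eq[OF ck(1) g1] rot_avg_eq[OF ck(2) g2]
    by (subst Bochner_Integration.integral_add[symmetric, OF
          circ_integral(1)[OF rot_avg_continuous[OF ck(1) g1]] circ_integral(1)[OF rot_avg_continuous[OF ck(2) g2]]])
       (simp add: algebra_simps)
  moreover have "(\<lambda>x. \<integral>\<theta>. k \<theta> * g (rot \<theta> x) \<partial>circ) = rot_avg k g"
    using rot_avg_eq[OF k g] by auto
  ultimately show ?thesis by simp
qed

lemma rot_avg_schwartz:
  assumes k: "continuous_on UNIV k" and g: "g \<in> schwartz"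
  shows "rot_avg k g \<in> schwartz"
proof (rule schwartz_coinduct_sums[of _ "{rot_avg k g |k g. continuous_on UNIV k \<and> g \<in> schwartz}"], goal_cases)
  case 1 then show ?case using k g by blast
next
  case (2 f x)
  then obtain k g where "f = rot_avg k g" "continuous_on UNIV k" "g \<in> schwartz" by auto
  then show ?case using rot_avg_pd differentiable_def by blast
next
  case (3 f)
  then obtain k g where f: "f = rot_avg k g" "continuous_on UNIV k" "g \<in> schwartz" by auto
  show ?case unfolding rapid_def
  proof
    fix n
    obtain C where C: "\<And>x. (1 + norm x) ^ n * norm (g x) \<le> C"
      using schwartz_rapid[OF f(3)] unfolding rapid_def by blast
    have "(1 + norm x) ^ n * norm (f x) \<le> C * (\<integral>\<theta>. norm (k \<theta>) \<partial>circ)" for x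
    proof -
      have "norm (f x) \<le> (\<integral>\<theta>. norm (k \<theta> * g (rot \<theta> x)) \<partial>circ)"
        unfolding f(1) rot_avg_eq[OF f(2,3)] by (rule integral_norm_bound)
      then have "(1 + norm x) ^ n * norm (f x) \<le> (1 + norm x) ^ n * (\<integral>\<theta>. norm (k \<theta> * g (rot \<theta> x)) \<partial>circ)"
        by (intro mult_left_mono) auto
      also have "\<dots> = (\<integral>\<theta>. norm (k \<theta>) * ((1 + norm (rot \<theta> x)) ^ n * norm (g (rot \<theta> x))) \<partial>circ)"
        by (subst integral_mult_right_zero[symmetric]) (simp add: norm_mult mult_ac)
      also have "\<dots> \<le> (\<integral>\<theta>. norm (k \<theta>) * C \<partial>circ)"
      proof (intro integral_mono mult_left_mono C)
        have "integrable circ (\<lambda>\<theta>. (1 + norm x) ^ n * norm (k \<theta> * g (rot \<theta> x)))"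
          by (intro integrable_mult_right integrable_norm circ_integral(1)[OF rot_avg_continuous[OF f(2,3)]])
        then show "integrable circ (\<lambda>\<theta>. norm (k \<theta>) * ((1 + norm (rot \<theta> x)) ^ n * norm (g (rot \<theta> x))))"
          by (simp add: norm_mult mult_ac)
        show "integrable circ (\<lambda>\<theta>. norm (k \<theta>) * C)"
          by (intro integrable_mult_left integrable_norm circ_integral(1) f)
      qed simp
      finally show ?thesis by (simp add: mult.commute)
    qed
    then show "\<exists>C. \<forall>x. (1 + norm x) ^ n * norm (f x) \<le> C" by blast
  qed
next
  case (4 f v)
  then obtain k g where f: "f = rot_avg k g" "continuous_on UNIV k" "g \<in> schwartz" by auto
  have g1: "pd (1,0) g \<in> schwartz" and g2: "pd (0,1) g \<in> schwartz"
    by (intro schwartz_pd f, simp add: Basis_R2)+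
  have ck: "continuous_on UNIV (\<lambda>\<theta>. k \<theta> * of_real (fst (rot \<theta> v)))" "continuous_on UNIV (\<lambda>\<theta>. k \<theta> * of_real (snd (rot \<theta> v)))"
    by (intro continuous_intros f(2))+
  show ?case unfolding f(1) pd_eqI[OF rot_avg_pd[OF f(2,3)]]
    by (rule sums_of.plus; rule sums_of.base) (use ck g1 g2 in blast)+
qed

text \<open>The generator of rotations, whose square is the angular Laplacian.\<close>

definition Om :: "(R2 \<Rightarrow> complex) \<Rightarrow> R2 \<Rightarrow> complex" where
  "Om f x = of_real (- snd x) * pd (1,0) f x + of_real (fst x) * pd (0,1) f x"

lemma Om_schwartz: "f \<in> schwartz \<Longrightarrow> Om f \<in> schwartz"
proof -
  assume f: "f \<in> schwartz"
  have g1: "pd (1,0) f \<in> schwartz" and g2: "pd (0,1) f \<in> schwartz"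
    by (intro schwartz_pd f, simp add: Basis_R2)+
  have "(\<lambda>x. of_real ((0,-1) \<bullet> x) * pd (1,0) f x + of_real ((1,0) \<bullet> x) * pd (0,1) f x) \<in> schwartz"
    by (intro schwartz_add schwartz_mult_inner g1 g2)
  then show "Om f \<in> schwartz" by (simp add: Om_def[abs_def] inner_prod_def)
qed

lemma Om_has_vector_derivative:
  assumes f: "f \<in> schwartz"
  shows "((\<lambda>\<theta>. f (rot \<theta> x)) has_vector_derivative Om f (rot \<theta> x)) (at \<theta> within S)"
proof -
  have "((\<lambda>\<theta>. rot \<theta> x) has_derivative (\<lambda>h. h *\<^sub>R (- snd (rot \<theta> x), fst (rot \<theta> x)))) (at \<theta> within S)"
  proof -
    have "((\<lambda>\<theta>. cos \<theta> * fst x - sin \<theta> * snd x) has_derivative (\<lambda>h. h * - snd (rot \<theta> x))) (at \<theta> within S)"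
      "((\<lambda>\<theta>. sin \<theta> * fst x + cos \<theta> * snd x) has_derivative (\<lambda>h. h * fst (rot \<theta> x))) (at \<theta> within S)"
      by (auto intro!: derivative_eq_intros simp: rot_def algebra_simps)
    from has_derivative_Pair[OF this] show ?thesis by (simp add: rot_def)
  qed
  from has_derivative_compose[OF this schwartz_has_derivative[OF f]]
  show ?thesis unfolding has_vector_derivative_def Om_def by (simp add: scaleR_conv_of_real algebra_simps)
qed

text \<open>The projection to the angular mode \<open>l\<close>, written as an average over
  rotations so that the results on \<open>rot_avg\<close> apply.\<close>

definition Pm :: "int \<Rightarrow> (R2 \<Rightarrow> complex) \<Rightarrow> R2 \<Rightarrow> complex" where
  "Pm l f x = rot_avg (\<lambda>\<theta>. cis (- of_int l * \<theta>) / (2 * pi)) f x"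

lemma continuous_cis_mult: "continuous_on UNIV (\<lambda>\<theta>. cis (a * \<theta>) / c)"
  by (cases "c = 0") (auto intro!: continuous_intros)

text \<open>A continuous periodic function has the same integral over every period. The bound on the
  shift matches the range of \<open>Arg\<close>; a negative shift is replaced by its sum with 2
  pi.\<close>

lemma periodic_integral_shift:
  fixes h :: "real \<Rightarrow> complex"
  assumes h: "continuous_on UNIV h" and p: "\<And>t. h (t + 2 * pi) = h t" and a: "\<bar>a\<bar> \<le> pi"
  shows "integral {0..2 * pi} (\<lambda>t. h (t + a)) = integral {0..2 * pi} h"
proof -
  have hi: "h integrable_on {u..v}" for u v
    by (rule integrable_continuous_real) (use h continuous_on_subset in blast)
  have sh: "integral {u..v} (\<lambda>t. h (t + a)) = integral {u + a..v + a} h" for u v a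
    using integral_shift_real_ivl[of "u + a" a "v + a" h] by simp
  have *: "integral {a..2 * pi + a} h = integral {0..2 * pi} h" if "0 \<le> a" "a \<le> 2 * pi" for a
  proof -
    have "integral {a..2 * pi + a} h = integral {a..2 * pi} h + integral {2 * pi..2 * pi + a} h"
      using that hi by (intro Henstock_Kurzweil_Integration.integral_combine[symmetric]) auto
    also have "integral {2 * pi..2 * pi + a} h = integral {0..a} h"
      using sh[of 0 a "2 * pi"] by (simp add: p add.commute)
    also have "integral {a..2 * pi} h + integral {0..a} h = integral {0..2 * pi} h"
      using that hi Henstock_Kurzweil_Integration.integral_combine[of 0 a "2 * pi" h] by (simp add: add.commute)
    finally show ?thesis .
  qed
  show ?thesis
  proof (cases "a \<ge> 0")
    case True then show ?thesis using *[of a] sh[of 0 "2*pi" a] a pi_gt_zero by simp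
  next
    case False
    have "integral {0..2 * pi} (\<lambda>t. h (t + a)) = integral {0..2 * pi} (\<lambda>t. h (t + (a + 2 * pi)))"
      using p[of "_ + a"] by (simp add: add.assoc)
    then show ?thesis using *[of "a + 2 * pi"] sh[of 0 "2*pi" "a + 2 * pi"] a False by simp
  qed
qed

text \<open>The coefficient measures the angle from the positive horizontal axis, the projection
  from the direction of x. The two differ by a shift by the argument of x along the circle.\<close>

lemma angular_coeff_Pm:
  assumes f: "f \<in> schwartz"
  shows "angular_coeff f l (norm x) * cis (of_int l * Arg (Complex (fst x) (snd x))) = Pm l f x"
proof -
  define a where "a = Arg (Complex (fst x) (snd x))"
  define h where "h t = f (rot t (norm x, 0)) * cis (- of_int l * t)" for t
  have hc: "continuous_on UNIV h" unfolding h_def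
    by (intro continuous_intros continuous_on_schwartz_compose[OF f])
  have hp: "h (t + 2 * pi) = h t" for t
  proof -
    have "rot (t + 2 * pi) y = rot t y" for y by (simp add: rot_def)
    moreover have "cis (- of_int l * (t + 2 * pi)) = cis (- of_int l * t)"
    proof -
      have "cis (- of_int l * (t + 2 * pi)) = cis (- of_int l * t) * cis (2 * pi * of_int (- l))"
        by (simp add: cis_mult algebra_simps)
      also have "cis (2 * pi * of_int (- l)) = 1" by (rule cis_multiple_2pi) simp
      finally show ?thesis by simp
    qed
    ultimately show ?thesis by (simp add: h_def)
  qed
  have "\<bar>a\<bar> \<le> pi" unfolding a_def using Arg_bounded[of "Complex (fst x) (snd x)"] by auto
  note s = periodic_integral_shift[OF hc hp this]
  have e: "h (t + a) * cis (of_int l * a) = f (rot t x) * cis (- of_int l * t)" for t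
  proof -
    have "rot (t + a) (norm x, 0) = rot t x"
      using zz_polar[of x] rot_rot[of t a "(norm x, 0)"] by (simp add: a_def)
    moreover have "cis (- of_int l * (t + a)) * cis (of_int l * a) = cis (- of_int l * t)"
      by (simp add: cis_mult algebra_simps)
    ultimately show ?thesis by (simp add: h_def mult.assoc)
  qed
  have "angular_coeff f l (norm x) = integral {0..2 * pi} h / (2 * pi)"
    unfolding angular_coeff_def h_def by (simp add: rot_def mult.commute)
  also have "\<dots> = integral {0..2 * pi} (\<lambda>t. h (t + a)) / (2 * pi)" by (simp only: s)
  finally have "angular_coeff f l (norm x) * cis (of_int l * a) = integral {0..2 * pi} (\<lambda>t. h (t + a)) * (cis (of_int l * a) / (2 * pi))"
    by simp
  also have "\<dots> = integral {0..2 * pi} (\<lambda>t. h (t + a) * (cis (of_int l * a) / (2 * pi)))"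
    by (rule integral_mult_left[symmetric])
  also have "\<dots> = Pm l f x"
    unfolding Pm_def rot_avg_def using e by (simp add: mult_ac)
  finally show ?thesis unfolding a_def .
qed

text \<open>Integration by parts over the circle; the boundary terms cancel by periodicity.\<close>

lemma Pm_Om:
  assumes f: "f \<in> schwartz"
  shows "Pm l (Om f) x = \<i> * of_int l * Pm l f x"
proof -
  let ?c = "\<lambda>\<theta>. cis (- of_int l * \<theta>) / (2 * pi)"
  let ?I = "{0..2 * pi}"
  have D: "((\<lambda>\<theta>. ?c \<theta> * f (rot \<theta> x)) has_vector_derivative
     (?c \<theta> * Om f (rot \<theta> x) + (- \<i> * of_int l * ?c \<theta>) * f (rot \<theta> x))) (at \<theta> within ?I)" for \<theta>
  proof (rule has_vector_derivative_mult[OF _ Om_has_vector_derivative[OF f]])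
    have "((\<lambda>\<theta>. - of_int l * \<theta>) has_derivative (\<lambda>h. - of_int l * h)) (at \<theta> within ?I)"
      by (auto intro!: derivative_eq_intros)
    from has_derivative_mult_left[OF has_derivative_cis_compose[OF this], of "1 / (2 * pi)"]
    show "(?c has_vector_derivative - \<i> * of_int l * ?c \<theta>) (at \<theta> within ?I)"
      unfolding has_vector_derivative_def by (simp add: scaleR_conv_of_real mult_ac)
  qed
  have "((\<lambda>\<theta>. ?c \<theta> * Om f (rot \<theta> x) + (- \<i> * of_int l * ?c \<theta>) * f (rot \<theta> x)) has_integral
     (?c (2 * pi) * f (rot (2 * pi) x) - ?c 0 * f (rot 0 x))) ?I"
    by (rule fundamental_theorem_of_calculus) (use D in auto)
  moreover have "cis (- of_int l * (2 * pi)) = 1" using cis_multiple_2pi[of "of_int (- l)"] by (simp add: mult_ac)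
  moreover have "rot (2 * pi) x = x" by (simp add: rot_def)
  ultimately have "integral ?I (\<lambda>\<theta>. ?c \<theta> * Om f (rot \<theta> x) + (- \<i> * of_int l) * (?c \<theta> * f (rot \<theta> x))) = 0"
    by (simp add: integral_unique mult.assoc)
  moreover have "(\<lambda>\<theta>. ?c \<theta> * g (rot \<theta> x)) integrable_on ?I" if "g \<in> schwartz" for g
    by (intro integrable_continuous_real continuous_on_subset[OF rot_avg_continuous[OF continuous_cis_mult that] subset_UNIV])
  note I = this[OF Om_schwartz[OF f]] this[OF f]
  ultimately have "Pm l (Om f) x + (- \<i> * of_int l) * Pm l f x = 0"
    unfolding Pm_def rot_avg_def
    by (subst (asm) Henstock_Kurzweil_Integration.integral_add[OF I(1) integrable_on_mult_right[OF I(2)]])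
       (simp only: integral_mult_right)
  then show ?thesis by simp
qed

text \<open>One minus the angular Laplacian, in the shape that \<open>schwartz_lincomb\<close>
  expects. It multiplies the mode l by 1 + l^2.\<close>

definition Jm :: "(R2 \<Rightarrow> complex) \<Rightarrow> R2 \<Rightarrow> complex" where
  "Jm f x = 1 * f x + (- 1) * Om (Om f) x"

lemma Jm_schwartz: "f \<in> schwartz \<Longrightarrow> Jm f \<in> schwartz"
  unfolding Jm_def[abs_def] by (intro schwartz_lincomb Om_schwartz)

lemma one_plus_int_square_ne_0:
  "1 + (of_int l)\<^sup>2 \<noteq> (0::real)" "1 + (of_int l)\<^sup>2 \<noteq> (0::complex)"
proof -
  have "1 + (of_int l)\<^sup>2 > (0::real)" by (rule add_pos_nonneg) simp_all
  then show r: "1 + (of_int l)\<^sup>2 \<noteq> (0::real)" by simp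
  have "1 + (of_int l)\<^sup>2 = complex_of_real (1 + (of_int l)\<^sup>2)" by simp
  then show "1 + (of_int l)\<^sup>2 \<noteq> (0::complex)" using r by (simp only: of_real_eq_0_iff not_False_eq_True)
qed

text \<open>The weights themselves are not summable for \<sigma> \<ge> 0. Dividing by 1 + l^2, the
  symbol of \<open>Jm\<close>, leaves a summable family as long as \<sigma> < 1.\<close>

definition ang_a :: "real \<Rightarrow> int \<Rightarrow> real" where
  "ang_a \<sigma> l = ang_weight \<sigma> l / (1 + (of_int l)\<^sup>2)"

lemma ang_a_nonneg: "0 \<le> ang_a \<sigma> l"
  by (simp add: ang_a_def ang_weight_def)

lemma ang_a_summable:
  assumes "\<sigma> < 1"
  shows "ang_a \<sigma> summable_on UNIV"
proof -
  have b: "ang_a \<sigma> l \<le> \<bar>of_int l\<bar> powr (\<sigma> - 2)" if "l \<noteq> 0" for l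
  proof -
    have "ang_a \<sigma> l = (1 + (of_int l)\<^sup>2) powr (\<sigma> / 2 - 1)"
      by (simp add: ang_a_def ang_weight_def powr_diff one_plus_int_square_ne_0 add_nonneg_nonneg)
    also have "\<dots> \<le> ((of_int l)\<^sup>2) powr (\<sigma> / 2 - 1)"
      using assms that by (intro powr_mono2') auto
    also have "\<dots> = \<bar>of_int l\<bar> powr (\<sigma> - 2)"
    proof -
      have "(of_int l)\<^sup>2 = \<bar>of_int l :: real\<bar> powr 2" using that by (simp add: powr_numeral)
      then show ?thesis by (simp only: powr_powr) (simp add: algebra_simps)
    qed
    finally show ?thesis .
  qed
  have s: "(\<lambda>n. real n powr (\<sigma> - 2)) summable_on UNIV"
    using assms by (subst summable_on_UNIV_nonneg_real_iff) (simp_all add: summable_real_powr_iff)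
  have s1: "(\<lambda>l. \<bar>of_int l\<bar> powr (\<sigma> - 2)) summable_on range int"
    by (subst summable_on_reindex) (simp_all add: o_def s)
  have s2: "(\<lambda>l. \<bar>of_int l\<bar> powr (\<sigma> - 2)) summable_on range (\<lambda>n. - int n)"
    by (subst summable_on_reindex) (simp_all add: o_def s inj_on_def)
  have U: "(UNIV :: int set) = range int \<union> range (\<lambda>n. - int n)"
  proof -
    have "x \<in> range int \<union> range (\<lambda>n. - int n)" for x
      by (cases x rule: int_cases2) auto
    then show ?thesis by blast
  qed
  have "(\<lambda>l. \<bar>of_int l\<bar> powr (\<sigma> - 2)) summable_on (UNIV :: int set)"
    unfolding U using s1 s2 by (rule summable_on_union)
  then have "(\<lambda>l. \<bar>of_int l\<bar> powr (\<sigma> - 2)) summable_on (UNIV - {0::int})"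
    by (rule summable_on_subset_banach) simp
  then have "ang_a \<sigma> summable_on (UNIV - {0})"
    by (rule summable_on_comparison_test) (auto simp: b ang_a_nonneg)
  from summable_on_insert_iff[of "ang_a \<sigma>" 0 "UNIV - {0}"] this show ?thesis by (simp add: insert_absorb)
qed

text \<open>The convolution kernel on the circle of the operator with symbol \<open>ang_a\<close>,
  which has the negative order \<sigma> - 2 when \<sigma> < 2.\<close>

definition ang_K :: "real \<Rightarrow> real \<Rightarrow> complex" where
  "ang_K \<sigma> \<theta> = (\<Sum>\<^sub>\<infinity>l\<in>UNIV. of_real (ang_a \<sigma> l) * cis (- of_int l * \<theta>)) / (2 * pi)"

lemma ang_term_summable: "\<sigma> < 1 \<Longrightarrow> (\<lambda>l. of_real (ang_a \<sigma> l) * cis (- of_int l * \<theta>)) summable_on UNIV"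
  by (rule abs_summable_summable) (simp add: norm_mult ang_a_nonneg ang_a_summable)

lemma ang_K_continuous:
  assumes "\<sigma> < 1"
  shows "continuous_on UNIV (ang_K \<sigma>)"
proof -
  have "uniform_limit UNIV (\<lambda>X \<theta>. \<Sum>l\<in>X. of_real (ang_a \<sigma> l) * cis (- of_int l * \<theta>))
     (\<lambda>\<theta>. \<Sum>\<^sub>\<infinity>l\<in>UNIV. of_real (ang_a \<sigma> l) * cis (- of_int l * \<theta>)) (finite_subsets_at_top UNIV)"
    by (rule Weierstrass_m_test_general[where M = "ang_a \<sigma>"])
       (simp_all add: norm_mult ang_a_nonneg ang_a_summable assms)
  then have "continuous_on UNIV (\<lambda>\<theta>. \<Sum>\<^sub>\<infinity>l\<in>UNIV. of_real (ang_a \<sigma> l) * cis (- of_int l * \<theta>))"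
    by (rule uniform_limit_theorem[rotated]) (auto intro!: always_eventually continuous_intros)
  then show ?thesis unfolding ang_K_def[abs_def] by (intro continuous_on_divide) auto
qed

text \<open>The series of the kernel converges uniformly by the M-test, so it may be integrated term
  by term against a continuous function.\<close>

lemma ang_K_integral:
  assumes \<sigma>: "\<sigma> < 1" and h: "continuous_on UNIV h"
  shows "((\<lambda>l. of_real (ang_a \<sigma> l) * integral {0..2 * pi} (\<lambda>\<theta>. cis (- of_int l * \<theta>) / (2 * pi) * h \<theta>)) has_sum
     integral {0..2 * pi} (\<lambda>\<theta>. ang_K \<sigma> \<theta> * h \<theta>)) UNIV"
proof -
  have hc: "continuous_on {0..2 * pi} h" using h continuous_on_subset by blast
  obtain B where B: "\<And>\<theta>. \<theta> \<in> {0..2 * pi} \<Longrightarrow> norm (h \<theta>) \<le> B" 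
    using compact_imp_bounded[OF compact_continuous_image[OF hc compact_Icc]] unfolding bounded_iff by blast
  have B0: "B \<ge> 0" using B[of 0] norm_ge_zero[of "h 0"] by (simp del: norm_ge_zero)
  let ?t = "\<lambda>l \<theta>. of_real (ang_a \<sigma> l) * (cis (- of_int l * \<theta>) / (2 * pi) * h \<theta>)"
  have e: "?t l \<theta> = of_real (ang_a \<sigma> l) * cis (- of_int l * \<theta>) * (h \<theta> / (2 * pi))" for l \<theta> by simp
  have S: "(\<Sum>\<^sub>\<infinity>l\<in>UNIV. ?t l \<theta>) = ang_K \<sigma> \<theta> * h \<theta>" for \<theta>
    unfolding e ang_K_def by (subst infsum_cmult_left, rule ang_term_summable[OF \<sigma>], simp)
  have ul: "uniform_limit {0..2 * pi} (\<lambda>X \<theta>. \<Sum>l\<in>X. ?t l \<theta>) (\<lambda>\<theta>. \<Sum>\<^sub>\<infinity>l\<in>UNIV. ?t l \<theta>) (finite_subsets_at_top UNIV)"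
  proof (rule Weierstrass_m_test_general[where M = "\<lambda>l. ang_a \<sigma> l * (B / (2 * pi))"])
    show "norm (?t l \<theta>) \<le> ang_a \<sigma> l * (B / (2 * pi))" if "\<theta> \<in> {0..2 * pi}" for l \<theta>
      using B[OF that] B0 ang_a_nonneg[of \<sigma> l]
      by (simp add: norm_mult norm_divide) (intro divide_right_mono mult_left_mono, auto)
    show "(\<lambda>l. ang_a \<sigma> l * (B / (2 * pi))) summable_on UNIV"
      by (intro summable_on_cmult_left ang_a_summable \<sigma>)
  qed
  have ct: "continuous_on {0..2 * pi} (?t l)" for l
    using hc by (intro continuous_intros) auto
  have cs: "continuous_on {0..2 * pi} (\<lambda>\<theta>. \<Sum>l\<in>X. ?t l \<theta>)" for X
    by (intro continuous_on_sum ct)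
  obtain I J where I: "\<And>X. ((\<lambda>\<theta>. \<Sum>l\<in>X. ?t l \<theta>) has_integral I X) {0..2 * pi}"
    and J: "((\<lambda>\<theta>. \<Sum>\<^sub>\<infinity>l\<in>UNIV. ?t l \<theta>) has_integral J) {0..2 * pi}"
    and IJ: "(I \<longlongrightarrow> J) (finite_subsets_at_top UNIV)"
    by (rule uniform_limit_integral[OF ul cs finite_subsets_at_top_neq_bot]) (rule that)
  have "I X = (\<Sum>l\<in>X. integral {0..2 * pi} (?t l))" if "finite X" for X
  proof -
    have "integral {0..2 * pi} (\<lambda>\<theta>. \<Sum>l\<in>X. ?t l \<theta>) = (\<Sum>l\<in>X. integral {0..2 * pi} (?t l))"
      by (intro Henstock_Kurzweil_Integration.integral_sum that integrable_continuous_real ct)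
    then show ?thesis using integral_unique[OF I[of X]] by simp
  qed
  then have "\<forall>\<^sub>F X in finite_subsets_at_top UNIV. I X = (\<Sum>l\<in>X. integral {0..2 * pi} (?t l))"
    by (intro eventually_finite_subsets_at_top_weakI) auto
  then have "((\<lambda>l. integral {0..2 * pi} (?t l)) has_sum J) UNIV"
    unfolding has_sum_def by (rule Lim_transform_eventually[OF IJ])
  moreover have "J = integral {0..2 * pi} (\<lambda>\<theta>. ang_K \<sigma> \<theta> * h \<theta>)"
    using J unfolding S by (simp add: integral_unique)
  moreover have "integral {0..2 * pi} (?t l) = of_real (ang_a \<sigma> l) * integral {0..2 * pi} (\<lambda>\<theta>. cis (- of_int l * \<theta>) / (2 * pi) * h \<theta>)" for l
    by (rule integral_mult_right)
  ultimately show ?thesis by simp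
qed

lemma Pm_Jm:
  assumes f: "f \<in> schwartz"
  shows "Pm l (Jm f) x = (1 + (of_int l)\<^sup>2) * Pm l f x"
proof -
  let ?c = "\<lambda>\<theta>. cis (- of_int l * \<theta>) / (2 * pi)"
  have I: "(\<lambda>\<theta>. ?c \<theta> * g (rot \<theta> x)) integrable_on {0..2 * pi}" if "g \<in> schwartz" for g
    by (intro integrable_continuous_real continuous_on_subset[OF rot_avg_continuous[OF continuous_cis_mult that] subset_UNIV])
  have "(\<lambda>\<theta>. ?c \<theta> * Jm f (rot \<theta> x)) = (\<lambda>\<theta>. ?c \<theta> * f (rot \<theta> x) - ?c \<theta> * Om (Om f) (rot \<theta> x))"
    by (simp add: Jm_def right_diff_distrib)
  then have "Pm l (Jm f) x = Pm l f x - Pm l (Om (Om f)) x"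
    unfolding Pm_def rot_avg_def using Henstock_Kurzweil_Integration.integral_diff[OF I[OF f] I[OF Om_schwartz[OF Om_schwartz[OF f]]]] by simp
  also have "Pm l (Om (Om f)) x = - (of_int l)\<^sup>2 * Pm l f x"
  proof -
    have "\<i> * a * (\<i> * a * p) = (\<i> * \<i>) * (a\<^sup>2 * p)" for a p by (simp only: power2_eq_square mult_ac)
    then show ?thesis unfolding Pm_Om[OF Om_schwartz[OF f]] Pm_Om[OF f] by simp
  qed
  finally show ?thesis by (simp add: algebra_simps)
qed

text \<open>The operator of order \<sigma> is factored into the differential operator
  \<open>Jm\<close>, which preserves the Schwartz space, and a convolution with summable
  coefficients. This identifies the series in \<open>angular_op_fun\<close> with an average over
  rotations.\<close>

lemma angular_op_fun_schwartz_eq: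
  assumes f: "f \<in> schwartz" and \<sigma>: "\<sigma> < 1"
  shows "angular_op_fun \<sigma> f = rot_avg (ang_K \<sigma>) (Jm f)"
proof
  fix x
  have "continuous_on UNIV (\<lambda>\<theta>. Jm f (rot \<theta> x))"
    by (intro continuous_on_schwartz_compose[OF Jm_schwartz[OF f]] continuous_intros)
  from ang_K_integral[OF \<sigma> this]
  have "((\<lambda>l. of_real (ang_a \<sigma> l) * Pm l (Jm f) x) has_sum rot_avg (ang_K \<sigma>) (Jm f) x) UNIV"
    by (simp only: Pm_def rot_avg_def)
  moreover have "of_real (ang_a \<sigma> l) * Pm l (Jm f) x = of_real ((1 + (of_int l)\<^sup>2) powr (\<sigma> / 2)) * angular_coeff f l (norm x)
        * cis (of_int l * Arg (Complex (fst x) (snd x)))" for l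
  proof -
    show ?thesis unfolding Pm_Jm[OF f] mult.assoc angular_coeff_Pm[OF f] by (simp add: ang_a_def ang_weight_def one_plus_int_square_ne_0)
  qed
  ultimately show "angular_op_fun \<sigma> f x = rot_avg (ang_K \<sigma>) (Jm f) x"
    unfolding angular_op_fun_def by (simp add: infsumI)
qed

lemma angular_op_fun_schwartz:
  "f \<in> schwartz \<Longrightarrow> \<sigma> < 1 \<Longrightarrow> angular_op_fun \<sigma> f \<in> schwartz"
  unfolding angular_op_fun_schwartz_eq by (intro rot_avg_schwartz ang_K_continuous Jm_schwartz)

text \<open>Rotation invariance of the measure moves the rotation from \<open>g\<close> to
  \<open>U\<close>, where the mode property turns it into the scalar cis (- l \<theta>).\<close>

lemma integral_mode_rot_avg:
  assumes [measurable]: "U \<in> borel_measurable borel" and UB: "\<And>x. norm (U x) \<le> B" and U: "angular_mode l U"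
    and k: "continuous_on UNIV k" and g: "g \<in> schwartz"
  shows "(\<integral>x. U x * rot_avg k g x \<partial>lborel) = integral {0..2 * pi} (\<lambda>\<theta>. k \<theta> * cis (- of_int l * \<theta>)) * (\<integral>x. U x * g x \<partial>lborel)"
proof -
  interpret circ: finite_measure circ by (rule finite_circ)
  note [measurable] = schwartz_measurable[OF g]
  obtain C where C: "\<And>x. (1 + norm x) ^ 4 * norm (g x) \<le> C"
    using schwartz_rapid[OF g] unfolding rapid_def by blast
  have C0: "C \<ge> 0" using order_trans[OF _ C[of 0]] by auto
  have B0: "B \<ge> 0" using order_trans[OF norm_ge_zero UB] .
  \<comment> \<open>\<open>U\<close> is only bounded. An integrable weight is split off, and the
    decay of \<open>g\<close> at power 4 keeps the remaining kernel bounded, as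
    \<open>Fubini_kernel\<close> requires.\<close>
  let ?w = "\<lambda>x::R2. complex_of_real (inverse ((1 + norm x) ^ 4))"
  let ?k = "\<lambda>x \<theta>. of_real ((1 + norm x) ^ 4) * U x * g (rot \<theta> x)"
  have w: "?w x * of_real ((1 + norm x) ^ 4) = 1" for x :: R2
    by (simp only: of_real_mult[symmetric]) simp
  have [measurable]: "(\<lambda>x. x) \<in> borel_measurable circ" by (rule circ_measurable) simp
  have "(\<integral>x. U x * rot_avg k g x \<partial>lborel) = (\<integral>x. ?w x * (\<integral>\<theta>. ?k x \<theta> * k \<theta> \<partial>circ) \<partial>lborel)"
  proof (rule Bochner_Integration.integral_cong[OF refl])
    fix x
    have "?w x * (\<integral>\<theta>. ?k x \<theta> * k \<theta> \<partial>circ) = (?w x * of_real ((1 + norm x) ^ 4)) * (U x * (\<integral>\<theta>. k \<theta> * g (rot \<theta> x) \<partial>circ))"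
      by (simp add: mult_ac flip: integral_mult_right_zero)
    then show "U x * rot_avg k g x = ?w x * (\<integral>\<theta>. ?k x \<theta> * k \<theta> \<partial>circ)"
      unfolding w rot_avg_eq[OF k g] by simp
  qed
  also have "\<dots> = (\<integral>\<theta>. k \<theta> * (\<integral>x. ?k x \<theta> * ?w x \<partial>lborel) \<partial>circ)"
  proof (rule Fubini_kernel(1)[where C = "B * C"])
    show "integrable lborel ?w" by (intro integrable_of_real integrable_inverse_power4)
    show "integrable circ k" by (rule circ_integral(1)[OF k])
    show "norm (?k x \<theta>) \<le> B * C" for x \<theta>
    proof -
      have "norm (?k x \<theta>) = norm (U x) * ((1 + norm (rot \<theta> x)) ^ 4 * norm (g (rot \<theta> x)))"
        by (simp add: norm_mult norm_power abs_of_pos del: of_real_add of_real_power)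
      also have "\<dots> \<le> B * C" by (intro mult_mono UB C B0) auto
      finally show ?thesis .
    qed
  qed (auto simp: sigma_finite_lborel circ.sigma_finite_measure_axioms)
  also have "\<dots> = (\<integral>\<theta>. k \<theta> * cis (- of_int l * \<theta>) * (\<integral>x. U x * g x \<partial>lborel) \<partial>circ)"
  proof (rule Bochner_Integration.integral_cong[OF refl])
    fix \<theta>
    have "(\<integral>x. ?k x \<theta> * ?w x \<partial>lborel) = (\<integral>x. U x * g (rot \<theta> x) \<partial>lborel)"
    proof (rule Bochner_Integration.integral_cong[OF refl])
      fix x
      have "?k x \<theta> * ?w x = (?w x * of_real ((1 + norm x) ^ 4)) * (U x * g (rot \<theta> x))" by simp
      then show "?k x \<theta> * ?w x = U x * g (rot \<theta> x)" unfolding w by simp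
    qed
    also have "\<dots> = (\<integral>x. cis (- of_int l * \<theta>) * (U (rot \<theta> x) * g (rot \<theta> x)) \<partial>lborel)"
    proof (rule Bochner_Integration.integral_cong[OF refl])
      fix x
      have "cis (- of_int l * \<theta>) * U (rot \<theta> x) = U x"
        unfolding U[unfolded angular_mode_def, rule_format] by (simp add: cis_mult flip: mult.assoc)
      then show "U x * g (rot \<theta> x) = cis (- of_int l * \<theta>) * (U (rot \<theta> x) * g (rot \<theta> x))"
        by (simp only: mult.assoc[symmetric])
    qed
    also have "\<dots> = (\<integral>x. cis (- of_int l * \<theta>) * (U x * g x) \<partial>lborel)"
      by (rule integral_rot[of "\<lambda>x. cis (- of_int l * \<theta>) * (U x * g x)"]) measurable
    finally show "k \<theta> * (\<integral>x. ?k x \<theta> * ?w x \<partial>lborel) = k \<theta> * cis (- of_int l * \<theta>) * (\<integral>x. U x * g x \<partial>lborel)"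
      by simp
  qed
  also have "\<dots> = integral {0..2 * pi} (\<lambda>\<theta>. k \<theta> * cis (- of_int l * \<theta>)) * (\<integral>x. U x * g x \<partial>lborel)"
    by (subst circ_integral(2)) (auto intro!: continuous_intros k)
  finally show ?thesis .
qed

text \<open>In the factorization of the operator the kernel contributes \<open>ang_a\<close> by
  \<open>integral_mode_rot_avg\<close> and \<open>Jm\<close> contributes 1 + l^2; the product is the
  weight.\<close>

lemma integral_mode_angular_op:
  assumes \<sigma>: "\<sigma> < 1" and U[measurable]: "U \<in> borel_measurable borel" and UB: "\<And>x. norm (U x) \<le> B" and m: "angular_mode l U"
    and f: "f \<in> schwartz"
  shows "(\<integral>x. U x * angular_op_fun \<sigma> f x \<partial>lborel) = of_real (ang_weight \<sigma> l) * (\<integral>x. U x * f x \<partial>lborel)"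
proof -
  note R = integral_mode_rot_avg[OF U UB m]
  have c1: "integral {0..2 * pi} (\<lambda>\<theta>. cis (- of_int j * \<theta>) / (2 * pi) * cis (- of_int l * \<theta>)) = (if j = - l then 1 else 0)" for j
  proof -
    have "cis (- of_int j * \<theta>) / (2 * pi) * cis (- of_int l * \<theta>) = cis (of_int (- j - l) * \<theta>) * (1 / (2 * pi))" for \<theta>
    proof -
      have "cis (of_int (- j - l) * \<theta>) = cis (- of_int j * \<theta>) * cis (- of_int l * \<theta>)"
        unfolding cis_mult by (simp add: algebra_simps)
      then show ?thesis by simp
    qed
    moreover have "((\<lambda>\<theta>. cis (of_int (- j - l) * \<theta>) * (1 / (2 * pi))) has_integral (if - j - l = 0 then complex_of_real (2 * pi) else 0) * complex_of_real (1 / (2 * pi))) {0..2 * pi}"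
      by (intro has_integral_mult_left integral_cis_int)
    ultimately show ?thesis by (simp only: integral_unique) auto
  qed
  \<comment> \<open>The pairing is bilinear, so a function of mode \<open>l\<close> sees only the
    component of mode \<open>- l\<close> of the test function. The weights are even in
    \<open>l\<close>.\<close>
  have P: "(\<integral>x. U x * Pm (- l) g x \<partial>lborel) = (\<integral>x. U x * g x \<partial>lborel)" if "g \<in> schwartz" for g
    using R[OF continuous_cis_mult that, of "- of_int (- l)" "2 * pi"] c1[of "- l"] by (simp add: Pm_def)
  have "(\<integral>x. U x * Jm f x \<partial>lborel) = (\<integral>x. (1 + (of_int l)\<^sup>2) * (U x * Pm (- l) f x) \<partial>lborel)"
    unfolding P[OF Jm_schwartz[OF f], symmetric] Pm_Jm[OF f] by (simp add: mult_ac)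
  also have "\<dots> = (1 + (of_int l)\<^sup>2) * (\<integral>x. U x * f x \<partial>lborel)"
    by (subst integral_mult_right_zero) (simp only: P[OF f])
  finally have J: "(\<integral>x. U x * Jm f x \<partial>lborel) = (1 + (of_int l)\<^sup>2) * (\<integral>x. U x * f x \<partial>lborel)" .
  have "continuous_on UNIV (\<lambda>\<theta>. cis (- of_int l * \<theta>))" by (intro continuous_intros)
  from ang_K_integral[OF \<sigma> this]
  have "((\<lambda>j. of_real (ang_a \<sigma> j) * (if j = - l then 1 else 0)) has_sum integral {0..2 * pi} (\<lambda>\<theta>. ang_K \<sigma> \<theta> * cis (- of_int l * \<theta>))) UNIV"
    unfolding c1 .
  moreover have "((\<lambda>j. of_real (ang_a \<sigma> j) * (if j = - l then 1 else 0)) has_sum (complex_of_real (ang_a \<sigma> (- l)))) UNIV"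
  proof -
    have "((\<lambda>j. complex_of_real (ang_a \<sigma> j)) has_sum (complex_of_real (ang_a \<sigma> (- l)))) {- l}"
      by (rule has_sum_finiteI) simp_all
    then show ?thesis by (rule has_sum_cong_neutral[THEN iffD1, rotated -1]) auto
  qed
  ultimately have "integral {0..2 * pi} (\<lambda>\<theta>. ang_K \<sigma> \<theta> * cis (- of_int l * \<theta>)) = of_real (ang_a \<sigma> (- l))"
    by (rule has_sum_unique)
  then have K: "integral {0..2 * pi} (\<lambda>\<theta>. ang_K \<sigma> \<theta> * cis (- of_int l * \<theta>)) = of_real (ang_a \<sigma> l)"
    by (simp add: ang_a_def ang_weight_def)
  show ?thesis
    unfolding angular_op_fun_schwartz_eq[OF f \<sigma>] R[OF ang_K_continuous[OF \<sigma>] Jm_schwartz[OF f]] K J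
    by (simp add: ang_a_def one_plus_int_square_ne_0)
qed

text \<open>Each term has a bounded inverse transform of the same mode, to which
  \<open>integral_mode_angular_op\<close> applies. The operator defined by duality hence multiplies
  each mode of the Fourier transform by its weight.\<close>

lemma angular_op_distr_of_FT:
  assumes \<sigma>: "\<sigma> < 1" and L: "finite L"
    and i: "\<And>l. l \<in> L \<Longrightarrow> integrable lborel (F l)" and m: "\<And>l. l \<in> L \<Longrightarrow> angular_mode l (F l)"
  shows "angular_op \<sigma> (distr_of_FT (\<lambda>x. \<Sum>l\<in>L. F l x)) = distr_of_FT (\<lambda>x. \<Sum>l\<in>L. of_real (ang_weight \<sigma> l) * F l x)"
proof
  fix f
  show "angular_op \<sigma> (distr_of_FT (\<lambda>x. \<Sum>l\<in>L. F l x)) f = distr_of_FT (\<lambda>x. \<Sum>l\<in>L. of_real (ang_weight \<sigma> l) * F l x) f"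
  proof (cases "f \<in> schwartz")
    case True
    note A = angular_op_fun_schwartz[OF True \<sigma>]
    have D: "distr_of_FT (\<lambda>x. \<Sum>l\<in>L. c l * F l x) h = (\<Sum>l\<in>L. c l * (\<integral>x. FT 1 (F l) x * h x \<partial>lborel))" if h: "h \<in> schwartz" for c h
    proof -
      have "distr_of_FT (\<lambda>x. \<Sum>l\<in>L. c l * F l x) h = (\<integral>x. (\<Sum>l\<in>L. c l * (F l x * FT 1 h x)) \<partial>lborel)"
        using h by (simp add: distr_of_FT_def inv_fourier_fun_FT sum_distrib_right mult.assoc)
      also have "\<dots> = (\<Sum>l\<in>L. (\<integral>x. c l * (F l x * FT 1 h x) \<partial>lborel))"
        by (intro Bochner_Integration.integral_sum integrable_mult_right integrable_mult_schwartz i FT_schwartz h) simp_all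
      also have "\<dots> = (\<Sum>l\<in>L. c l * (\<integral>x. FT 1 (F l) x * h x \<partial>lborel))"
        by (intro sum.cong refl) (simp add: FT_swap[OF i schwartz_integrable[OF h]] mult.commute[of "h _"])
      finally show ?thesis .
    qed
    have "angular_op \<sigma> (distr_of_FT (\<lambda>x. \<Sum>l\<in>L. F l x)) f = (\<Sum>l\<in>L. (\<integral>x. FT 1 (F l) x * angular_op_fun \<sigma> f x \<partial>lborel))"
      using True D[OF A, of "\<lambda>_. 1"] by (simp add: angular_op_def by_duality_def)
    also have "\<dots> = (\<Sum>l\<in>L. of_real (ang_weight \<sigma> l) * (\<integral>x. FT 1 (F l) x * f x \<partial>lborel))"
    proof (rule sum.cong[OF refl])
      fix l assume l: "l \<in> L"
      have [measurable]: "F l \<in> borel_measurable borel" using i[OF l] by auto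
      show "(\<integral>x. FT 1 (F l) x * angular_op_fun \<sigma> f x \<partial>lborel) = of_real (ang_weight \<sigma> l) * (\<integral>x. FT 1 (F l) x * f x \<partial>lborel)"
        by (rule integral_mode_angular_op[OF \<sigma> _ FT_bound angular_mode_FT True]) (use m[OF l] in auto)
    qed
    also have "\<dots> = distr_of_FT (\<lambda>x. \<Sum>l\<in>L. of_real (ang_weight \<sigma> l) * F l x) f"
      by (rule D[OF True, symmetric])
    finally show ?thesis .
  qed (simp add: angular_op_def by_duality_def distr_of_FT_def)
qed

section \<open>Majorants\<close>

lemma borel_measurable_pair_lborel:
  fixes f :: "'a::second_countable_topology \<times> 'b::euclidean_space \<Rightarrow> 'c::topological_space"
  assumes "f \<in> borel_measurable borel"
  shows "f \<in> borel_measurable (borel \<Otimes>\<^sub>M lborel)"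
proof -
  have "sets (borel \<Otimes>\<^sub>M lborel) = sets (borel :: ('a \<times> 'b) measure)"
    unfolding borel_prod[symmetric] by (rule sets_pair_measure_cong) simp_all
  then show ?thesis using assms measurable_cong_sets by blast
qed

lemma measurable_sum_arg:
  assumes "m \<in> borel_measurable (borel :: R2 measure)"
  shows "(\<lambda>p::R2 \<times> R2. m (fst p + snd p)) \<in> borel_measurable borel"
  by (rule measurable_compose[OF _ assms]) (intro borel_measurable_continuous_onI continuous_intros)

lemma measurable_snd_arg:
  assumes "m \<in> borel_measurable (borel :: R2 measure)"
  shows "(\<lambda>p::'a::second_countable_topology \<times> R2. m (snd p)) \<in> borel_measurable borel"
  by (rule measurable_compose[OF _ assms]) (intro borel_measurable_continuous_onI continuous_intros)

lemma nn_integral_shift: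
  fixes f :: "R2 \<Rightarrow> ennreal"
  assumes [measurable]: "f \<in> borel_measurable borel"
  shows "(\<integral>\<^sup>+x. f (x + h) \<partial>lborel) = (\<integral>\<^sup>+x. f x \<partial>lborel)"
proof -
  have "(\<integral>\<^sup>+x. f x \<partial>lborel) = (\<integral>\<^sup>+x. f x \<partial>distr lborel borel ((+) h))" by (simp add: lborel_distr_plus)
  then show ?thesis by (simp add: nn_integral_distr add.commute)
qed

text \<open>The correlation of a nonnegative function with itself, in \<open>ennreal\<close> so that
  the monotone iteration carries no integrability conditions.\<close>

definition ncorr :: "(R2 \<Rightarrow> ennreal) \<Rightarrow> R2 \<Rightarrow> ennreal" where
  "ncorr m \<xi> = (\<integral>\<^sup>+\<zeta>. m (\<xi> + \<zeta>) * m \<zeta> \<partial>lborel)"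

lemma ncorr_borel_measurable:
  fixes m :: "R2 \<Rightarrow> ennreal"
  assumes "m \<in> borel_measurable borel"
  shows "(\<lambda>p. m (fst p + snd p) * m (snd p)) \<in> borel_measurable borel"
  by (rule borel_measurable_times_ennreal[OF measurable_sum_arg[OF assms] measurable_snd_arg[OF assms]])

lemma ncorr_pair_measurable:
  fixes m :: "R2 \<Rightarrow> ennreal"
  assumes "m \<in> borel_measurable borel"
  shows "(\<lambda>p. m (fst p + snd p) * m (snd p)) \<in> borel_measurable (borel \<Otimes>\<^sub>M (lborel :: R2 measure))"
  by (rule borel_measurable_pair_lborel[OF ncorr_borel_measurable[OF assms]])

lemma ncorr_measurable:
  assumes "m \<in> borel_measurable borel"
  shows "ncorr m \<in> borel_measurable borel"
  unfolding ncorr_def[abs_def]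
  unfolding split_def by (rule lborel.borel_measurable_nn_integral)
    (unfold split_def, rule ncorr_pair_measurable[OF assms])

lemma nn_integral_ncorr:
  assumes [measurable]: "m \<in> borel_measurable borel"
  shows "(\<integral>\<^sup>+\<xi>. ncorr m \<xi> \<partial>lborel) = (\<integral>\<^sup>+\<xi>. m \<xi> \<partial>lborel)\<^sup>2"
proof -
  have "(\<lambda>p. m (fst p + snd p) * m (snd p)) \<in> borel_measurable (lborel \<Otimes>\<^sub>M lborel)"
    using ncorr_borel_measurable[OF assms] by (simp add: lborel_prod)
  from lborel_pair.Fubini'[of "\<lambda>x y. m (x + y) * m y"] this
  have "(\<integral>\<^sup>+\<xi>. ncorr m \<xi> \<partial>lborel) = (\<integral>\<^sup>+\<zeta>. (\<integral>\<^sup>+\<xi>. m (\<xi> + \<zeta>) * m \<zeta> \<partial>lborel) \<partial>lborel)"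
    unfolding ncorr_def by (simp add: case_prod_unfold)
  also have "\<dots> = (\<integral>\<^sup>+\<zeta>. (\<integral>\<^sup>+\<xi>. m \<xi> \<partial>lborel) * m \<zeta> \<partial>lborel)"
    by (simp add: nn_integral_multc nn_integral_shift)
  also have "\<dots> = (\<integral>\<^sup>+\<xi>. m \<xi> \<partial>lborel)\<^sup>2"
    by (simp add: nn_integral_cmult power2_eq_square)
  finally show ?thesis .
qed

text \<open>Monotone iteration from zero for the equation M = p + c \<open>ncorr\<close> M; the
  supremum will be the majorant.\<close>

fun maj :: "real \<Rightarrow> (R2 \<Rightarrow> ennreal) \<Rightarrow> nat \<Rightarrow> R2 \<Rightarrow> ennreal" where
  "maj c p 0 = (\<lambda>\<xi>. 0)"
| "maj c p (Suc n) = (\<lambda>\<xi>. p \<xi> + ennreal c * ncorr (maj c p n) \<xi>)"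

lemma maj_measurable:
  "p \<in> borel_measurable borel \<Longrightarrow> maj c p n \<in> borel_measurable borel"
  proof (induction n)
  case (Suc n)
  then have [measurable]: "ncorr (maj c p n) \<in> borel_measurable borel" by (intro ncorr_measurable) simp
  from Suc(2) show ?case by simp
qed simp

lemma maj_mono: "maj c p n \<xi> \<le> maj c p (Suc n) \<xi>"
proof (induction n arbitrary: \<xi>)
  case (Suc n)
  have "ncorr (maj c p n) \<xi> \<le> ncorr (maj c p (Suc n)) \<xi>"
    unfolding ncorr_def by (intro nn_integral_mono mult_mono Suc) auto
  then show ?case by (simp add: add_left_mono mult_left_mono)
qed simp

lemma maj_incseq: "incseq (\<lambda>n. maj c p n \<xi>)"
  using maj_mono by (rule incseq_SucI)

text \<open>With 4 c P \<le> 1 the map sending x to P + c x^2 preserves the interval [0, 2 P], which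
  bounds the mass. A correlation is at most the supremum times the mass, so the supremum stays below
  S + 4 c P S \<le> 2 S.\<close>

lemma maj_bounds:
  assumes p: "p \<in> borel_measurable borel" and P: "(\<integral>\<^sup>+\<xi>. p \<xi> \<partial>lborel) \<le> ennreal P" and S: "\<And>\<xi>. p \<xi> \<le> ennreal S"
    and c: "c \<ge> 0" "P \<ge> 0" "S \<ge> 0" "4 * c * P \<le> 1"
  shows "(\<integral>\<^sup>+\<xi>. maj c p n \<xi> \<partial>lborel) \<le> ennreal (2 * P) \<and> (\<forall>\<xi>. maj c p n \<xi> \<le> ennreal (2 * S))"
proof (induction n)
  case 0 show ?case using c by simp
next
  case (Suc n)
  have m: "maj c p n \<in> borel_measurable borel" using p by (rule maj_measurable)
  have "(\<integral>\<^sup>+\<xi>. maj c p (Suc n) \<xi> \<partial>lborel) = (\<integral>\<^sup>+\<xi>. p \<xi> \<partial>lborel) + ennreal c * (\<integral>\<^sup>+\<xi>. maj c p n \<xi> \<partial>lborel)\<^sup>2"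
    using p ncorr_measurable[OF m] by (simp add: nn_integral_add nn_integral_cmult nn_integral_ncorr[OF m])
  also have "\<dots> \<le> ennreal P + ennreal c * (ennreal (2 * P))\<^sup>2"
    using Suc by (intro add_mono P mult_left_mono power_mono) auto
  also have "\<dots> = ennreal (P + c * (2 * P)\<^sup>2)"
    using c by (simp add: ennreal_power ennreal_mult'[symmetric] ennreal_plus[symmetric] del: ennreal_plus)
  also have "\<dots> \<le> ennreal (2 * P)"
    using mult_right_mono[OF c(4,2)] c by (intro ennreal_leI) (simp add: power2_eq_square)
  finally have 1: "(\<integral>\<^sup>+\<xi>. maj c p (Suc n) \<xi> \<partial>lborel) \<le> ennreal (2 * P)" .
  have 2: "maj c p (Suc n) \<xi> \<le> ennreal (2 * S)" for \<xi>
  proof -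
    have "ncorr (maj c p n) \<xi> \<le> (\<integral>\<^sup>+\<zeta>. ennreal (2 * S) * maj c p n \<zeta> \<partial>lborel)"
      unfolding ncorr_def using Suc by (intro nn_integral_mono mult_right_mono) (blast, simp)
    also have "\<dots> = ennreal (2 * S) * (\<integral>\<^sup>+\<zeta>. maj c p n \<zeta> \<partial>lborel)"
      using m by (simp add: nn_integral_cmult)
    also have "\<dots> \<le> ennreal (2 * S) * ennreal (2 * P)" using Suc by (intro mult_left_mono) auto
    finally have "maj c p (Suc n) \<xi> \<le> ennreal S + ennreal c * (ennreal (2 * S) * ennreal (2 * P))"
      unfolding maj.simps by (intro add_mono S mult_left_mono) simp_all
    also have "\<dots> = ennreal (S + c * (2 * S * (2 * P)))"
      using c by (simp add: ennreal_mult'[symmetric] ennreal_plus[symmetric] del: ennreal_plus)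
    also have "\<dots> \<le> ennreal (2 * S)"
      using mult_right_mono[OF c(4,3)] c by (intro ennreal_leI) (simp add: algebra_simps)
    finally show ?thesis .
  qed
  show ?case using 1 2 by blast
qed

lemma majorant_ennreal:
  assumes p: "p \<in> borel_measurable borel" and P: "(\<integral>\<^sup>+\<xi>. p \<xi> \<partial>lborel) \<le> ennreal P" and S: "\<And>\<xi>. p \<xi> \<le> ennreal S"
    and c: "c \<ge> 0" "P \<ge> 0" "S \<ge> 0" "4 * c * P \<le> 1"
  obtains M where "M \<in> borel_measurable borel" "\<And>\<xi>. p \<xi> \<le> M \<xi>" "\<And>\<xi>. M \<xi> \<le> ennreal (2 * S)"
    "(\<integral>\<^sup>+\<xi>. M \<xi> \<partial>lborel) \<le> ennreal (2 * P)" "\<And>\<xi>. ennreal c * ncorr M \<xi> \<le> M \<xi>"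
proof -
  define M where "M \<xi> = (SUP n. maj c p n \<xi>)" for \<xi>
  note b = maj_bounds[OF assms]
  have mm: "maj c p n \<in> borel_measurable borel" for n using p by (rule maj_measurable)
  have up: "maj c p n \<xi> \<le> M \<xi>" for n \<xi> unfolding M_def by (rule SUP_upper) simp
  show ?thesis
  proof (rule that[of M])
    show "M \<in> borel_measurable borel" unfolding M_def[abs_def] using mm by (intro borel_measurable_SUP) auto
    show "p \<xi> \<le> M \<xi>" for \<xi> using up[of 1 \<xi>] by (auto intro: order_trans[rotated])
    show "M \<xi> \<le> ennreal (2 * S)" for \<xi> unfolding M_def using b by (intro SUP_least) blast
    have "(\<integral>\<^sup>+\<xi>. M \<xi> \<partial>lborel) = (SUP n. \<integral>\<^sup>+\<xi>. maj c p n \<xi> \<partial>lborel)"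
      unfolding M_def using mm maj_mono by (intro nn_integral_monotone_convergence_SUP) (auto intro!: incseq_SucI le_funI)
    also have "\<dots> \<le> ennreal (2 * P)" using b by (intro SUP_least) auto
    finally show "(\<integral>\<^sup>+\<xi>. M \<xi> \<partial>lborel) \<le> ennreal (2 * P)" .
    fix \<xi>
    \<comment> \<open>Both factors increase with the index, so a product of two suprema is the
      supremum along the diagonal. Monotone convergence then carries the inequality to the
      limit.\<close>
    have prod: "M x * M y \<le> (SUP n. maj c p n x * maj c p n y)" for x y
    proof -
      have "M x * M y = (SUP i. SUP j. maj c p i x * maj c p j y)"
        unfolding M_def SUP_mult_right_ennreal unfolding SUP_mult_left_ennreal ..
      also have "\<dots> \<le> (SUP n. maj c p n x * maj c p n y)"
      proof (intro SUP_least)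
        fix i j
        have "maj c p i x * maj c p j y \<le> maj c p (max i j) x * maj c p (max i j) y"
          by (intro mult_mono incseqD[OF maj_incseq]) auto
        also have "\<dots> \<le> (SUP n. maj c p n x * maj c p n y)" by (rule SUP_upper) simp
        finally show "maj c p i x * maj c p j y \<le> (SUP n. maj c p n x * maj c p n y)" .
      qed
      finally show ?thesis .
    qed
    have mp: "(\<lambda>\<zeta>. maj c p n (\<xi> + \<zeta>) * maj c p n \<zeta>) \<in> borel_measurable lborel" for n
      using mm by measurable
    have "ncorr M \<xi> \<le> (\<integral>\<^sup>+\<zeta>. (SUP n. maj c p n (\<xi> + \<zeta>) * maj c p n \<zeta>) \<partial>lborel)"
      unfolding ncorr_def by (intro nn_integral_mono prod)
    also have "\<dots> = (SUP n. ncorr (maj c p n) \<xi>)"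
      unfolding ncorr_def using mp maj_mono
      by (intro nn_integral_monotone_convergence_SUP incseq_SucI le_funI mult_mono) simp_all
    finally have "ennreal c * ncorr M \<xi> \<le> ennreal c * (SUP n. ncorr (maj c p n) \<xi>)" by (intro mult_left_mono) auto
    also have "\<dots> = (SUP n. ennreal c * ncorr (maj c p n) \<xi>)" by (simp add: SUP_mult_left_ennreal)
    also have "\<dots> \<le> M \<xi>"
    proof (rule SUP_least)
      fix n
      have "ennreal c * ncorr (maj c p n) \<xi> \<le> maj c p (Suc n) \<xi>" by simp
      then show "ennreal c * ncorr (maj c p n) \<xi> \<le> M \<xi>" using up order_trans by blast
    qed
    finally show "ennreal c * ncorr M \<xi> \<le> M \<xi>" .
  qed
qed

text \<open>The last property makes the functions below a multiple of \<open>W\<close> a class that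
  the quadratic interaction preserves. The weighted square integrability places the measurable ones
  among them in every Sobolev space on the Fourier side.\<close>

definition majorant :: "real \<Rightarrow> (R2 \<Rightarrow> real) \<Rightarrow> bool" where
  "majorant c W \<longleftrightarrow> W \<in> borel_measurable borel \<and> (\<forall>\<xi>. 0 \<le> W \<xi>) \<and> (\<exists>B. \<forall>\<xi>. W \<xi> \<le> B) \<and> integrable lborel W \<and>
     (\<forall>k::nat. integrable lborel (\<lambda>\<xi>. (1 + (norm \<xi>)\<^sup>2) ^ k * (W \<xi>)\<^sup>2)) \<and>
     (\<forall>\<xi>. c * (\<integral>\<zeta>. W (\<xi> + \<zeta>) * W \<zeta> \<partial>lborel) \<le> W \<xi>)"

text \<open>The exponential weight is submultiplicative, hence compatible with the convolution
  inequality; it turns into decay of the majorant.\<close>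

lemma majorant_exists:
  fixes \<phi> :: "R2 \<Rightarrow> complex"
  assumes [measurable]: "\<phi> \<in> borel_measurable borel" and a: "a > 0"
    and i: "integrable lborel (\<lambda>\<xi>. norm (\<phi> \<xi>) * exp (a * norm \<xi>))"
    and P: "(\<integral>\<xi>. norm (\<phi> \<xi>) * exp (a * norm \<xi>) \<partial>lborel) \<le> P"
    and S: "\<And>\<xi>. norm (\<phi> \<xi>) * exp (a * norm \<xi>) \<le> S"
    and c: "c > 0" "4 * c * P \<le> 1"
  obtains W where "majorant c W" "\<And>\<xi>. norm (\<phi> \<xi>) \<le> W \<xi>" "(\<integral>\<xi>. W \<xi> \<partial>lborel) \<le> 2 * P"
proof -
  let ?p = "\<lambda>\<xi>. norm (\<phi> \<xi>) * exp (a * norm \<xi>)"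
  have S0: "S \<ge> 0" using S[of 0] by (rule order_trans[rotated]) simp
  have P0: "P \<ge> 0" using P by (rule order_trans[rotated]) (intro integral_nonneg_AE, simp)
  obtain M where M[measurable]: "M \<in> borel_measurable borel" and pM: "\<And>\<xi>. ennreal (?p \<xi>) \<le> M \<xi>" and MS: "\<And>\<xi>. M \<xi> \<le> ennreal (2 * S)"
    and MP: "(\<integral>\<^sup>+\<xi>. M \<xi> \<partial>lborel) \<le> ennreal (2 * P)" and Mc: "\<And>\<xi>. ennreal c * ncorr M \<xi> \<le> M \<xi>"
  proof (rule majorant_ennreal[of "\<lambda>\<xi>. ennreal (?p \<xi>)" P S c])
    show "(\<lambda>\<xi>. ennreal (?p \<xi>)) \<in> borel_measurable borel" by measurable
    show "(\<integral>\<^sup>+\<xi>. ennreal (?p \<xi>) \<partial>lborel) \<le> ennreal P"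
      using P by (subst nn_integral_eq_integral[OF i]) (auto intro: ennreal_leI)
    show "ennreal (?p \<xi>) \<le> ennreal S" for \<xi> using S by (rule ennreal_leI)
  qed (use c S0 P0 in auto)
  define R where "R \<xi> = enn2real (M \<xi>)" for \<xi>
  have Mfin: "M \<xi> < \<top>" for \<xi> using MS[of \<xi>] by (rule le_less_trans) simp
  have MR: "M \<xi> = ennreal (R \<xi>)" for \<xi> using Mfin[of \<xi>] by (simp add: R_def less_top)
  have R0: "0 \<le> R \<xi>" for \<xi> by (simp add: R_def)
  have Rm[measurable]: "R \<in> borel_measurable borel" unfolding R_def[abs_def] by measurable
  have RS: "R \<xi> \<le> 2 * S" for \<xi> using MS[of \<xi>] S0 unfolding MR by simp
  have pR: "?p \<xi> \<le> R \<xi>" for \<xi> using pM[of \<xi>] R0 unfolding MR by (simp add: ennreal_le_iff)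
  have Rn: "(\<integral>\<^sup>+\<xi>. ennreal (R \<xi>) \<partial>lborel) \<le> ennreal (2 * P)" using MP unfolding MR .
  have Ri: "integrable lborel R"
    by (rule integrableI_bounded) (use Rn R0 in \<open>auto intro: le_less_trans\<close>)
  have RP: "(\<integral>\<xi>. R \<xi> \<partial>lborel) \<le> 2 * P"
    using Rn P0 R0 by (subst (asm) nn_integral_eq_integral[OF Ri]) (auto simp: ennreal_le_iff)
  have Rc_int: "integrable lborel (\<lambda>\<zeta>. R (\<xi> + \<zeta>) * R \<zeta>)" for \<xi>
  proof (rule Bochner_Integration.integrable_bound[OF integrable_mult_right[OF Ri, of "2 * S"]])
    show "AE \<zeta> in lborel. norm (R (\<xi> + \<zeta>) * R \<zeta>) \<le> norm (2 * S * R \<zeta>)"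
      using R0 RS S0 by (intro AE_I2) (simp add: abs_mult abs_of_nonneg mult_right_mono)
  qed measurable
  have Rc: "c * (\<integral>\<zeta>. R (\<xi> + \<zeta>) * R \<zeta> \<partial>lborel) \<le> R \<xi>" for \<xi>
  proof -
    have "ncorr M \<xi> = ennreal (\<integral>\<zeta>. R (\<xi> + \<zeta>) * R \<zeta> \<partial>lborel)"
      unfolding ncorr_def MR using R0 by (simp add: ennreal_mult'[symmetric] nn_integral_eq_integral[OF Rc_int])
    then have "ennreal (c * (\<integral>\<zeta>. R (\<xi> + \<zeta>) * R \<zeta> \<partial>lborel)) \<le> ennreal (R \<xi>)"
      using Mc[of \<xi>] c unfolding MR by (simp add: ennreal_mult')
    then show ?thesis using R0 by (simp add: ennreal_le_iff)
  qed
  \<comment> \<open>The exponential weight is divided out again, and what remains of it is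
    decay.\<close>
  define W where "W \<xi> = R \<xi> * exp (- a * norm \<xi>)" for \<xi>
  have W0: "0 \<le> W \<xi>" for \<xi> using R0 by (simp add: W_def)
  have Wm[measurable]: "W \<in> borel_measurable borel" unfolding W_def[abs_def] by measurable
  have WR: "W \<xi> \<le> R \<xi>" for \<xi>
    unfolding W_def using R0 a by (intro mult_left_le) auto
  have Wi: "integrable lborel W"
    by (rule Bochner_Integration.integrable_bound[OF Ri]) (use W0 WR R0 in auto)
  have WP: "(\<integral>\<xi>. W \<xi> \<partial>lborel) \<le> 2 * P"
    using integral_mono[OF Wi Ri WR] RP by simp
  have Wk: "integrable lborel (\<lambda>\<xi>. (1 + (norm \<xi>)\<^sup>2) ^ k * (W \<xi>)\<^sup>2)" for k
  proof -
    have "\<exists>D. \<forall>r\<ge>0. (1 + r\<^sup>2) ^ k * exp (- a * r) \<le> D"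
    proof -
      have "(1 + r\<^sup>2) ^ k * exp (- a * r) \<le> fact (2 * k) * exp a / a ^ (2 * k)" if r: "r \<ge> 0" for r
      proof -
        have "1 + r\<^sup>2 \<le> (1 + r)\<^sup>2" using r by (simp add: power2_eq_square algebra_simps)
        then have "(1 + r\<^sup>2) ^ k \<le> ((1 + r)\<^sup>2) ^ k" by (intro power_mono) auto
        also have "\<dots> = (a * (1 + r)) ^ (2 * k) / a ^ (2 * k)" using a by (simp add: power_mult_distrib power_mult)
        also have "\<dots> \<le> fact (2 * k) * exp (a * (1 + r)) / a ^ (2 * k)"
          using a r by (intro divide_right_mono power_le_fact_exp) auto
        finally have "(1 + r\<^sup>2) ^ k * exp (- a * r) \<le> fact (2 * k) * exp (a * (1 + r)) / a ^ (2 * k) * exp (- a * r)"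
          by (intro mult_right_mono) auto
        also have "\<dots> = fact (2 * k) * exp a / a ^ (2 * k)"
          by (simp add: distrib_left exp_add exp_minus)
        finally show ?thesis .
      qed
      then show ?thesis by blast
    qed
    then obtain D where D: "\<And>r. r \<ge> 0 \<Longrightarrow> (1 + r\<^sup>2) ^ k * exp (- a * r) \<le> D" by blast
    have D0: "D \<ge> 0" using D[of 0] by simp
    show ?thesis
    proof (rule Bochner_Integration.integrable_bound[OF integrable_mult_right[OF Wi, of "2 * S * D"]])
      have "(1 + (norm \<xi>)\<^sup>2) ^ k * (W \<xi>)\<^sup>2 \<le> 2 * S * D * W \<xi>" for \<xi>
      proof -
        have "(1 + (norm \<xi>)\<^sup>2) ^ k * (W \<xi>)\<^sup>2 = ((1 + (norm \<xi>)\<^sup>2) ^ k * exp (- a * norm \<xi>)) * R \<xi> * W \<xi>"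
          by (simp add: W_def power2_eq_square mult_ac)
        also have "\<dots> \<le> D * (2 * S) * W \<xi>"
          using D[of "norm \<xi>"] RS[of \<xi>] R0 D0 W0 by (intro mult_right_mono mult_mono) auto
        finally show ?thesis by (simp add: mult_ac)
      qed
      then show "AE \<xi> in lborel. norm ((1 + (norm \<xi>)\<^sup>2) ^ k * (W \<xi>)\<^sup>2) \<le> norm (2 * S * D * W \<xi>)"
        using S0 D0 W0 by (intro AE_I2) (simp add: abs_mult abs_of_nonneg)
    qed measurable
  qed
  have Wc: "c * (\<integral>\<zeta>. W (\<xi> + \<zeta>) * W \<zeta> \<partial>lborel) \<le> W \<xi>" for \<xi>
  proof -
    have "(\<integral>\<zeta>. W (\<xi> + \<zeta>) * W \<zeta> \<partial>lborel) \<le> (\<integral>\<zeta>. exp (- a * norm \<xi>) * (R (\<xi> + \<zeta>) * R \<zeta>) \<partial>lborel)"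
    proof (rule integral_mono)
      show "integrable lborel (\<lambda>\<zeta>. W (\<xi> + \<zeta>) * W \<zeta>)"
        by (rule Bochner_Integration.integrable_bound[OF Rc_int[of \<xi>]])
           (measurable, intro AE_I2, simp only: real_norm_def abs_mult abs_of_nonneg W0 R0, intro mult_mono WR W0 R0)
      show "integrable lborel (\<lambda>\<zeta>. exp (- a * norm \<xi>) * (R (\<xi> + \<zeta>) * R \<zeta>))"
        by (intro integrable_mult_right Rc_int)
      show "W (\<xi> + \<zeta>) * W \<zeta> \<le> exp (- a * norm \<xi>) * (R (\<xi> + \<zeta>) * R \<zeta>)" for \<zeta>
      proof -
        have "norm \<xi> \<le> norm (\<xi> + \<zeta>) + norm \<zeta>" using norm_triangle_ineq4[of "\<xi> + \<zeta>" \<zeta>] by simp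
        then have "exp (- a * (norm (\<xi> + \<zeta>) + norm \<zeta>)) \<le> exp (- a * norm \<xi>)" using a by simp
        moreover have "W (\<xi> + \<zeta>) * W \<zeta> = exp (- a * (norm (\<xi> + \<zeta>) + norm \<zeta>)) * (R (\<xi> + \<zeta>) * R \<zeta>)"
          unfolding W_def distrib_left exp_add by (simp only: mult_ac)
        ultimately show ?thesis using R0 by (simp add: mult_right_mono)
      qed
    qed
    then have "c * (\<integral>\<zeta>. W (\<xi> + \<zeta>) * W \<zeta> \<partial>lborel) \<le> exp (- a * norm \<xi>) * (c * (\<integral>\<zeta>. R (\<xi> + \<zeta>) * R \<zeta> \<partial>lborel))"
      unfolding integral_mult_right_zero mult.left_commute[of _ c] using c by (intro mult_left_mono) simp_all
    also have "\<dots> \<le> exp (- a * norm \<xi>) * R \<xi>" using Rc by (intro mult_left_mono) auto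
    finally show ?thesis by (simp add: W_def mult.commute)
  qed
  show ?thesis
  proof (rule that[of W])
    have "W \<xi> \<le> 2 * S" for \<xi> using WR RS order_trans by blast
    then show "majorant c W" unfolding majorant_def using W0 Wi Wk Wc Wm by blast
    show "norm (\<phi> \<xi>) \<le> W \<xi>" for \<xi>
    proof -
      have "norm (\<phi> \<xi>) = ?p \<xi> * exp (- a * norm \<xi>)" by (simp add: exp_minus)
      also have "\<dots> \<le> W \<xi>" unfolding W_def by (intro mult_right_mono pR) simp
      finally show ?thesis .
    qed
    show "(\<integral>\<xi>. W \<xi> \<partial>lborel) \<le> 2 * P" by (rule WP)
  qed
qed

section \<open>The integral equation in Fourier variables\<close>

lemma majorantD:
  assumes "majorant c W"
  shows "W \<in> borel_measurable borel" "0 \<le> W \<xi>" "\<exists>B. \<forall>\<xi>. W \<xi> \<le> B" "integrable lborel W"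
    "integrable lborel (\<lambda>\<xi>. (1 + (norm \<xi>)\<^sup>2) ^ k * (W \<xi>)\<^sup>2)"
    "c * (\<integral>\<zeta>. W (\<xi> + \<zeta>) * W \<zeta> \<partial>lborel) \<le> W \<xi>"
  using assms unfolding majorant_def by blast+

lemma majorant_corr_integrable:
  assumes "majorant c W"
  shows "integrable lborel (\<lambda>\<zeta>. W (\<xi> + \<zeta>) * W \<zeta>)"
proof -
  note [measurable] = majorantD(1)[OF assms]
  obtain B where B: "\<And>\<xi>. W \<xi> \<le> B" using majorantD(3)[OF assms] by blast
  have W0: "0 \<le> W \<xi>" for \<xi> by (rule majorantD(2)[OF assms])
  have B0: "0 \<le> B" using order_trans[OF W0 B] .
  show ?thesis
  proof (rule Bochner_Integration.integrable_bound[OF integrable_mult_right[OF majorantD(4)[OF assms], of B]])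
    show "AE \<zeta> in lborel. norm (W (\<xi> + \<zeta>) * W \<zeta>) \<le> norm (B * W \<zeta>)"
      by (intro AE_I2) (simp only: real_norm_def abs_mult abs_of_nonneg W0 B0 mult_right_mono B)
  qed measurable
qed

lemma borel_measurable_cnj [measurable (raw)]:
  "f \<in> borel_measurable M \<Longrightarrow> (\<lambda>x. cnj (f x)) \<in> borel_measurable M"
  by (rule measurable_compose[of f M borel cnj]) (auto intro!: borel_measurable_continuous_onI continuous_intros)

lemma integrable_indicator_Icc: "integrable lborel (indicat_real {a..b::real})"
  by (intro integrable_real_indicator) (auto simp: emeasure_lborel_Icc_eq)

text \<open>The phase is \<open>|\<xi> + \<zeta>|\<^sup>2 - |\<zeta>|\<^sup>2 - |\<xi>|\<^sup>2 = 2 (\<xi> \<bullet> \<zeta>)\<close>, from conjugating the nonlinearity with the free evolution.\<close>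

definition Qf :: "(real \<times> R2 \<Rightarrow> complex) \<Rightarrow> real \<Rightarrow> R2 \<Rightarrow> complex" where
  "Qf v s \<xi> = (\<integral>\<zeta>. cis (2 * s * (\<xi> \<bullet> \<zeta>)) * (v (s, \<xi> + \<zeta>) * cnj (v (s, \<zeta>))) \<partial>lborel)"

text \<open>The time integral is cut off at \<open>T\<close> as well as at the current time. The
  function is then defined for all real times with bounds uniform in time, so the iteration can run
  on the whole line.\<close>

definition Bf :: "real \<Rightarrow> (real \<times> R2 \<Rightarrow> complex) \<Rightarrow> real \<times> R2 \<Rightarrow> complex" where
  "Bf T v p = (\<integral>s. (if 0 \<le> s \<and> s \<le> fst p \<and> s \<le> T then Qf v s (snd p) else 0) \<partial>lborel)"

lemma measurable_compose_continuous:
  assumes "f \<in> borel_measurable borel" "continuous_on UNIV g"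
  shows "(\<lambda>x. f (g x)) \<in> borel_measurable borel"
  by (rule measurable_compose[OF borel_measurable_continuous_onI[OF assms(2)] assms(1)])

lemma Qf_measurable:
  assumes v: "v \<in> borel_measurable borel"
  shows "(\<lambda>p. Qf v (fst p) (snd p)) \<in> borel_measurable borel"
proof -
  have "(\<lambda>q::(real \<times> R2) \<times> R2. cis (2 * fst (fst q) * (snd (fst q) \<bullet> snd q)) *
      (v (fst (fst q), snd (fst q) + snd q) * cnj (v (fst (fst q), snd q)))) \<in> borel_measurable borel"
  proof (intro borel_measurable_times)
    show "(\<lambda>q::(real \<times> R2) \<times> R2. cis (2 * fst (fst q) * (snd (fst q) \<bullet> snd q))) \<in> borel_measurable borel"
      by (intro borel_measurable_continuous_onI continuous_intros)
    show "(\<lambda>q::(real \<times> R2) \<times> R2. v (fst (fst q), snd (fst q) + snd q)) \<in> borel_measurable borel"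
      by (rule measurable_compose_continuous[OF v]) (intro continuous_intros)
    have "(\<lambda>q::(real \<times> R2) \<times> R2. v (fst (fst q), snd q)) \<in> borel_measurable borel"
      by (rule measurable_compose_continuous[OF v]) (intro continuous_intros)
    then show "(\<lambda>q::(real \<times> R2) \<times> R2. cnj (v (fst (fst q), snd q))) \<in> borel_measurable borel" by measurable
  qed
  from borel_measurable_pair_lborel[OF this] show ?thesis
    unfolding Qf_def by (intro lborel.borel_measurable_lebesgue_integral) (simp add: split_def)
qed

lemma Qf_measurable_slice:
  assumes v: "v \<in> borel_measurable borel"
  shows "Qf v s \<in> borel_measurable borel" "(\<lambda>s. Qf v s \<xi>) \<in> borel_measurable borel"
  using measurable_compose_continuous[OF Qf_measurable[OF v], of "\<lambda>\<xi>. (s, \<xi>)"]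
    measurable_compose_continuous[OF Qf_measurable[OF v], of "\<lambda>s. (s, \<xi>)"]
  by (simp_all add: continuous_intros eta_contract_eq)

lemma Bf_measurable:
  assumes v: "v \<in> borel_measurable borel"
  shows "Bf T v \<in> borel_measurable borel"
proof -
  have m: "(\<lambda>q::(real \<times> R2) \<times> real. Qf v (snd q) (snd (fst q))) \<in> borel_measurable borel"
    using measurable_compose_continuous[OF Qf_measurable[OF v], of "\<lambda>q. (snd q, snd (fst q))"]
    by (simp add: continuous_intros)
  have "closed {q::(real \<times> R2) \<times> real. 0 \<le> snd q \<and> snd q \<le> fst (fst q) \<and> snd q \<le> T}"
    by (intro closed_Collect_conj closed_Collect_le continuous_intros)
  then have s: "{q::(real \<times> R2) \<times> real. 0 \<le> snd q \<and> snd q \<le> fst (fst q) \<and> snd q \<le> T} \<in> sets borel" by (rule borel_closed)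
  have "(\<lambda>q::(real \<times> R2) \<times> real. if 0 \<le> snd q \<and> snd q \<le> fst (fst q) \<and> snd q \<le> T then Qf v (snd q) (snd (fst q)) else 0) \<in> borel_measurable borel"
    using measurable_If_set[OF m borel_measurable_const[of 0], of "{q. 0 \<le> snd q \<and> snd q \<le> fst (fst q) \<and> snd q \<le> T}"] s by simp
  from borel_measurable_pair_lborel[OF this] show ?thesis
    unfolding Bf_def[abs_def] by (intro lborel.borel_measurable_lebesgue_integral) (simp add: split_def)
qed

lemma Qf_integrable:
  assumes W: "majorant c W" and v: "v \<in> borel_measurable borel" and b: "\<And>s \<xi>. norm (v (s, \<xi>)) \<le> D * W \<xi>"
  shows "integrable lborel (\<lambda>\<zeta>. cis (2 * s * (\<xi> \<bullet> \<zeta>)) * (v (s, \<xi> + \<zeta>) * cnj (v (s, \<zeta>))))"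
proof (rule Bochner_Integration.integrable_bound[OF integrable_mult_right[OF majorant_corr_integrable[OF W, of \<xi>], of "D * D"]])
  have "(\<lambda>\<zeta>::R2. v (s, \<xi> + \<zeta>)) \<in> borel_measurable borel" "(\<lambda>\<zeta>::R2. v (s, \<zeta>)) \<in> borel_measurable borel"
    by (rule measurable_compose_continuous[OF v], intro continuous_intros)+
  then show "(\<lambda>\<zeta>. cis (2 * s * (\<xi> \<bullet> \<zeta>)) * (v (s, \<xi> + \<zeta>) * cnj (v (s, \<zeta>)))) \<in> borel_measurable lborel"
    by measurable
  have "norm (cis (2 * s * (\<xi> \<bullet> \<zeta>)) * (v (s, \<xi> + \<zeta>) * cnj (v (s, \<zeta>)))) \<le> (D * W (\<xi> + \<zeta>)) * (D * W \<zeta>)" for \<zeta>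
    unfolding norm_mult norm_cis mult_1 complex_mod_cnj
    using b by (intro mult_mono) (auto intro: order_trans[OF norm_ge_zero b])
  then show "AE \<zeta> in lborel. norm (cis (2 * s * (\<xi> \<bullet> \<zeta>)) * (v (s, \<xi> + \<zeta>) * cnj (v (s, \<zeta>)))) \<le> norm (D * D * (W (\<xi> + \<zeta>) * W \<zeta>))"
    by (intro AE_I2) (rule order_trans, assumption, simp add: mult_ac)
qed

text \<open>A difference of two products splits into two products with one difference each, both
  bounded by D d times the product of the two values of \<open>W\<close>. The majorant property
  exchanges the correlation of \<open>W\<close> for W / c.\<close>

lemma Qf_diff_bound:
  assumes W: "majorant c W" and c: "c > 0"
    and v: "v \<in> borel_measurable borel" and bv: "\<And>s \<xi>. norm (v (s, \<xi>)) \<le> D * W \<xi>"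
    and w: "w \<in> borel_measurable borel" and bw: "\<And>s \<xi>. norm (w (s, \<xi>)) \<le> D * W \<xi>"
    and d: "\<And>s \<xi>. norm (v (s, \<xi>) - w (s, \<xi>)) \<le> d * W \<xi>"
  shows "norm (Qf v s \<xi> - Qf w s \<xi>) \<le> 2 * D * d / c * W \<xi>"
proof -
  let ?W2 = "\<integral>\<zeta>. W (\<xi> + \<zeta>) * W \<zeta> \<partial>lborel"
  have W0: "0 \<le> W \<xi>" for \<xi> by (rule majorantD(2)[OF W])
  note iv = Qf_integrable[OF W v bv, where s=s and \<xi>=\<xi>] and iw = Qf_integrable[OF W w bw, where s=s and \<xi>=\<xi>]
  let ?I = "\<lambda>\<zeta>. cis (2 * s * (\<xi> \<bullet> \<zeta>)) * (v (s, \<xi> + \<zeta>) * cnj (v (s, \<zeta>))) - cis (2 * s * (\<xi> \<bullet> \<zeta>)) * (w (s, \<xi> + \<zeta>) * cnj (w (s, \<zeta>)))"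
  have "norm (Qf v s \<xi> - Qf w s \<xi>) = norm (\<integral>\<zeta>. ?I \<zeta> \<partial>lborel)"
    unfolding Qf_def by (subst Bochner_Integration.integral_diff[OF iv iw]) simp
  also have "\<dots> \<le> (\<integral>\<zeta>. norm (?I \<zeta>) \<partial>lborel)" by (rule integral_norm_bound)
  also have "\<dots> \<le> (\<integral>\<zeta>. 2 * D * d * (W (\<xi> + \<zeta>) * W \<zeta>) \<partial>lborel)"
  proof (rule integral_mono)
    show "integrable lborel (\<lambda>\<zeta>. norm (?I \<zeta>))" using iv iw by (intro integrable_norm Bochner_Integration.integrable_diff)
    show "integrable lborel (\<lambda>\<zeta>. 2 * D * d * (W (\<xi> + \<zeta>) * W \<zeta>))"
      by (intro integrable_mult_right majorant_corr_integrable[OF W])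
    show "norm (?I \<zeta>) \<le> 2 * D * d * (W (\<xi> + \<zeta>) * W \<zeta>)" for \<zeta>
    proof -
      have e: "x * cnj y - x' * cnj y' = (x - x') * cnj y + x' * cnj (y - y')" for x y x' y' :: complex
        by (simp add: algebra_simps)
      have "norm (?I \<zeta>) = norm (v (s, \<xi> + \<zeta>) * cnj (v (s, \<zeta>)) - w (s, \<xi> + \<zeta>) * cnj (w (s, \<zeta>)))"
        unfolding right_diff_distrib[symmetric] norm_mult norm_cis by simp
      also have "\<dots> \<le> norm (v (s, \<xi> + \<zeta>) - w (s, \<xi> + \<zeta>)) * norm (v (s, \<zeta>)) + norm (w (s, \<xi> + \<zeta>)) * norm (v (s, \<zeta>) - w (s, \<zeta>))"
        unfolding e by (rule norm_triangle_le) (simp only: norm_mult complex_mod_cnj order_refl)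
      also have "\<dots> \<le> (d * W (\<xi> + \<zeta>)) * (D * W \<zeta>) + (D * W (\<xi> + \<zeta>)) * (d * W \<zeta>)"
        by (intro add_mono mult_mono d bv bw norm_ge_zero order_trans[OF norm_ge_zero d] order_trans[OF norm_ge_zero bw])
      finally show ?thesis by (simp add: algebra_simps)
    qed
  qed
  also have "\<dots> = 2 * D * d * ?W2" by simp
  also have "\<dots> \<le> 2 * D * d * (W \<xi> / c)"
  \<comment> \<open>The signs of \<open>D\<close> and \<open>d\<close> are read off from the bounds
    at a point where \<open>W\<close> is positive; if there is none, both sides vanish.\<close>
  proof (cases "\<exists>\<zeta>. W \<zeta> \<noteq> 0")
    case True
    then obtain \<zeta> where "W \<zeta> > 0" using W0 by (metis order_le_less)
    moreover have "0 \<le> D * W \<zeta>" "0 \<le> d * W \<zeta>" using order_trans[OF norm_ge_zero bv] order_trans[OF norm_ge_zero d] by blast+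
    ultimately have "0 \<le> D" "0 \<le> d" by (simp_all add: zero_le_mult_iff)
    moreover have "?W2 \<le> W \<xi> / c" using majorantD(6)[OF W, of \<xi>] c by (simp add: pos_le_divide_eq mult.commute)
    ultimately show ?thesis by (intro mult_left_mono) auto
  next
    case False
    then have "W = (\<lambda>_. 0)" by auto
    then show ?thesis by simp
  qed
  finally show ?thesis by simp
qed

lemma Bf_integrable:
  assumes W: "majorant c W" and c: "c > 0" and v: "v \<in> borel_measurable borel" and b: "\<And>s \<xi>. norm (v (s, \<xi>)) \<le> D * W \<xi>"
  shows "integrable lborel (\<lambda>s. if 0 \<le> s \<and> s \<le> t \<and> s \<le> T then Qf v s \<xi> else 0)"
proof -
  have "(\<lambda>s. if 0 \<le> s \<and> s \<le> t \<and> s \<le> T then Qf v s \<xi> else 0) = (\<lambda>s. indicat_real {0..min t T} s *\<^sub>R Qf v s \<xi>)"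
    by (auto simp: fun_eq_iff indicator_def)
  moreover have "integrable lborel (\<lambda>s. indicat_real {0..min t T} s *\<^sub>R Qf v s \<xi>)"
  proof (rule Bochner_Integration.integrable_bound[of lborel "\<lambda>s. indicat_real {0..min t T} s * (2 * D * D / c * W \<xi>)"])
    have "norm (Qf v s \<xi> - Qf (\<lambda>_. 0) s \<xi>) \<le> 2 * D * D / c * W \<xi>" for s
      by (rule Qf_diff_bound[OF W c v b]) (use b order_trans[OF norm_ge_zero b] in auto)
    then have Q: "norm (Qf v s \<xi>) \<le> 2 * D * D / c * W \<xi>" for s by (simp add: Qf_def)
    have "norm (indicat_real {0..min t T} s *\<^sub>R Qf v s \<xi>) \<le> norm (indicat_real {0..min t T} s * (2 * D * D / c * W \<xi>))" for s
      using order_trans[OF Q abs_ge_self, of s] by (cases "s \<in> {0..min t T}") (simp_all add: indicator_def)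
    then show "AE s in lborel. norm (indicat_real {0..min t T} s *\<^sub>R Qf v s \<xi>) \<le> norm (indicat_real {0..min t T} s * (2 * D * D / c * W \<xi>))"
      by (rule AE_I2)
    show "(\<lambda>s. indicat_real {0..min t T} s *\<^sub>R Qf v s \<xi>) \<in> borel_measurable lborel"
      using Qf_measurable_slice(2)[OF v] by measurable
    show "integrable lborel (\<lambda>s. indicat_real {0..min t T} s * (2 * D * D / c * W \<xi>))"
      by (intro integrable_mult_left integrable_indicator_Icc)
  qed
  ultimately show ?thesis by simp
qed

lemma Bf_diff_bound:
  assumes W: "majorant c W" and c: "c > 0" and T: "T \<ge> 0"
    and v: "v \<in> borel_measurable borel" and bv: "\<And>s \<xi>. norm (v (s, \<xi>)) \<le> D * W \<xi>"
    and w: "w \<in> borel_measurable borel" and bw: "\<And>s \<xi>. norm (w (s, \<xi>)) \<le> D * W \<xi>"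
    and d: "\<And>s \<xi>. norm (v (s, \<xi>) - w (s, \<xi>)) \<le> d * W \<xi>"
  shows "norm (Bf T v (t, \<xi>) - Bf T w (t, \<xi>)) \<le> T * (2 * D * d / c * W \<xi>)"
proof -
  note iv = Bf_integrable[OF W c v bv, where t=t and T=T and \<xi>=\<xi>] and iw = Bf_integrable[OF W c w bw, where t=t and T=T and \<xi>=\<xi>]
  note Q = Qf_diff_bound[OF W c v bv w bw d]
  let ?K = "2 * D * d / c * W \<xi>"
  have K0: "0 \<le> ?K" using order_trans[OF norm_ge_zero Q] .
  let ?I = "\<lambda>s. (if 0 \<le> s \<and> s \<le> t \<and> s \<le> T then Qf v s \<xi> else 0) - (if 0 \<le> s \<and> s \<le> t \<and> s \<le> T then Qf w s \<xi> else 0)"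
  have "norm (Bf T v (t, \<xi>) - Bf T w (t, \<xi>)) = norm (\<integral>s. ?I s \<partial>lborel)"
    unfolding Bf_def fst_conv snd_conv by (subst Bochner_Integration.integral_diff[OF iv iw]) simp
  also have "\<dots> \<le> (\<integral>s. norm (?I s) \<partial>lborel)" by (rule integral_norm_bound)
  also have "\<dots> \<le> (\<integral>s. indicat_real {0..T} s * ?K \<partial>lborel)"
  proof (rule integral_mono)
    show "integrable lborel (\<lambda>s. norm (?I s))" using iv iw by (intro integrable_norm Bochner_Integration.integrable_diff)
    show "integrable lborel (\<lambda>s. indicat_real {0..T} s * ?K)"
      by (intro integrable_mult_left integrable_indicator_Icc)
    show "norm (?I s) \<le> indicat_real {0..T} s * ?K" for s
      using Q[of s \<xi>] K0 by (auto simp: indicator_def)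
  qed
  also have "\<dots> = T * ?K" using T by simp
  finally show ?thesis .
qed

section \<open>Picard iteration below a majorant\<close>

fun picard :: "complex \<Rightarrow> real \<Rightarrow> (R2 \<Rightarrow> complex) \<Rightarrow> nat \<Rightarrow> real \<times> R2 \<Rightarrow> complex" where
  "picard k T \<phi> 0 = (\<lambda>_. 0)"
| "picard k T \<phi> (Suc n) = (\<lambda>p. \<phi> (snd p) + k * Bf T (picard k T \<phi> n) p)"

lemma picard_measurable:
  assumes "\<phi> \<in> borel_measurable borel"
  shows "picard k T \<phi> n \<in> borel_measurable borel"
proof (induction n)
  case (Suc n)
  note [measurable] = Bf_measurable[OF Suc] measurable_snd_arg[OF assms]
  have "(\<lambda>p. \<phi> (snd p)) \<in> borel_measurable (borel :: (real \<times> R2) measure)"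
    using measurable_compose_continuous[OF assms, of snd] by (simp add: continuous_intros)
  then show ?case by simp
qed simp

text \<open>By the bilinear estimate with D = 2 a step of size (1/2)^n W leads to one of size (4 T
  |k| / c) (1/2)^n W, and 8 T |k| \<le> c halves it. The steps sum to 2 (1 - (1/2)^n) W, which keeps
  all iterates below 2 W.\<close>

lemma picard_bounds:
  assumes W: "majorant c W" and T: "T > 0" and c: "c > 0" "8 * T * norm k \<le> c"
    and \<phi>: "\<phi> \<in> borel_measurable borel" "\<And>\<xi>. norm (\<phi> \<xi>) \<le> W \<xi>"
  shows "(\<forall>p. norm (picard k T \<phi> n p) \<le> 2 * (1 - (1/2) ^ n) * W (snd p)) \<and>
    (\<forall>p. norm (picard k T \<phi> (Suc n) p - picard k T \<phi> n p) \<le> (1/2) ^ n * W (snd p))"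
proof (induction n)
  case 0
  show ?case using \<phi>(2) by (auto simp: Bf_def Qf_def cong: if_cong)
next
  case (Suc n)
  have W0: "0 \<le> W \<xi>" for \<xi> by (rule majorantD(2)[OF W])
  have 1: "norm (picard k T \<phi> (Suc n) p) \<le> 2 * (1 - (1/2) ^ Suc n) * W (snd p)" for p
  proof -
    have "norm (picard k T \<phi> (Suc n) p) \<le> norm (picard k T \<phi> n p) + norm (picard k T \<phi> (Suc n) p - picard k T \<phi> n p)"
      by (rule norm_triangle_sub)
    also have "\<dots> \<le> 2 * (1 - (1/2) ^ n) * W (snd p) + (1/2) ^ n * W (snd p)"
      using Suc by (intro add_mono) blast+
    also have "\<dots> = 2 * (1 - (1/2) ^ Suc n) * W (snd p)" by (simp add: algebra_simps)
    finally show ?thesis .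
  qed
  have le2: "2 * (1 - (1/2) ^ m) * W \<xi> \<le> 2 * W \<xi>" for m \<xi>
    using W0[of \<xi>] by (intro mult_right_mono) auto
  have b0: "norm (picard k T \<phi> n (s, \<xi>)) \<le> 2 * W \<xi>" for s \<xi>
  proof (rule order_trans[OF _ le2[of n \<xi>]])
    show "norm (picard k T \<phi> n (s, \<xi>)) \<le> 2 * (1 - (1/2) ^ n) * W \<xi>"
      using Suc[THEN conjunct1, rule_format, of "(s, \<xi>)"] by simp
  qed
  have b1: "norm (picard k T \<phi> (Suc n) (s, \<xi>)) \<le> 2 * W \<xi>" for s \<xi>
    using order_trans[OF 1[of "(s, \<xi>)"]] le2[of "Suc n" \<xi>] by simp
  have d: "norm (picard k T \<phi> (Suc n) (s, \<xi>) - picard k T \<phi> n (s, \<xi>)) \<le> (1/2) ^ n * W \<xi>" for s \<xi>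
    using Suc by (metis snd_conv)
  have 2: "norm (picard k T \<phi> (Suc (Suc n)) p - picard k T \<phi> (Suc n) p) \<le> (1/2) ^ Suc n * W (snd p)" for p
  proof -
    obtain t \<xi> where p: "p = (t, \<xi>)" by (cases p)
    have "norm (picard k T \<phi> (Suc (Suc n)) p - picard k T \<phi> (Suc n) p) = norm k * norm (Bf T (picard k T \<phi> (Suc n)) p - Bf T (picard k T \<phi> n) p)"
      unfolding picard.simps(2)[of k T \<phi> "Suc n"] picard.simps(2)[of k T \<phi> n, THEN fun_cong, of p]
      by (simp add: right_diff_distrib[symmetric] norm_mult del: picard.simps)
    also have "\<dots> \<le> norm k * (T * (2 * 2 * (1/2) ^ n / c * W \<xi>))"
      unfolding p using T by (intro mult_left_mono Bf_diff_bound[OF W c(1)] picard_measurable \<phi> b0 b1 d) auto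
    also have "\<dots> = (8 * T * norm k / c) * ((1/2) ^ Suc n * W \<xi>)" by (simp add: field_simps)
    also have "\<dots> \<le> 1 * ((1/2) ^ Suc n * W \<xi>)"
      using c W0 by (intro mult_right_mono) (auto simp: divide_le_eq)
    finally show ?thesis by (simp add: p)
  qed
  show ?case using 1 2 by blast
qed

text \<open>The iterates converge pointwise at a geometric rate proportional to W \<xi> and uniform
  in time, so \<open>Bf_diff_bound\<close> carries the limit through \<open>Bf\<close> and no norm
  on a space of curves enters.\<close>

lemma picard_fixed_point:
  assumes W: "majorant c W" and T: "T > 0" and c: "c > 0" "8 * T * norm k \<le> c"
    and \<phi>: "\<phi> \<in> borel_measurable borel" "\<And>\<xi>. norm (\<phi> \<xi>) \<le> W \<xi>"
  obtains v where "v \<in> borel_measurable borel" "\<And>s \<xi>. norm (v (s, \<xi>)) \<le> 2 * W \<xi>"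
    "\<And>p. v p = \<phi> (snd p) + k * Bf T v p"
proof -
  let ?v = "picard k T \<phi>"
  have W0: "0 \<le> W \<xi>" for \<xi> by (rule majorantD(2)[OF W])
  note b = picard_bounds[OF assms]
  have d: "norm (?v (Suc n) p - ?v n p) \<le> (1/2) ^ n * W (snd p)" for n p using b by blast
  have v2: "norm (?v n p) \<le> 2 * W (snd p)" for n p
  proof -
    have "norm (?v n p) \<le> 2 * (1 - (1/2) ^ n) * W (snd p)" using b by blast
    also have "\<dots> \<le> 2 * W (snd p)" using W0[of "snd p"] by (intro mult_right_mono) auto
    finally show ?thesis .
  qed
  have dd: "norm (?v (n + m) p - ?v n p) \<le> 2 * ((1/2) ^ n - (1/2) ^ (n + m)) * W (snd p)" for n m p
  proof (induction m)
    case (Suc m)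
    have "norm (?v (n + Suc m) p - ?v n p) \<le> norm (?v (n + m) p - ?v n p) + norm (?v (Suc (n + m)) p - ?v (n + m) p)"
      using norm_triangle_ineq[of "?v (n + m) p - ?v n p" "?v (Suc (n + m)) p - ?v (n + m) p"] by (simp del: picard.simps)
    also have "\<dots> \<le> 2 * ((1/2) ^ n - (1/2) ^ (n + m)) * W (snd p) + (1/2) ^ (n + m) * W (snd p)"
      by (intro add_mono Suc d)
    also have "\<dots> = 2 * ((1/2) ^ n - (1/2) ^ (n + Suc m)) * W (snd p)" by (simp add: algebra_simps)
    finally show ?case .
  qed simp
  have dd': "norm (?v (n + m) p - ?v n p) \<le> 2 * (1/2) ^ n * W (snd p)" for n m p
    using dd[of n m p] W0[of "snd p"] by (elim order_trans) (intro mult_right_mono, auto)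
  have lim0: "(\<lambda>n. 2 * (1/2) ^ n * w) \<longlonglongrightarrow> 0" for w :: real
    using tendsto_mult_right[OF LIMSEQ_power_zero[of "1/2::real"], of "2 * w"] by (simp add: mult_ac)
  have "Cauchy (\<lambda>n. ?v n p)" for p
  proof (rule metric_CauchyI)
    fix e :: real assume "e > 0"
    then have "\<forall>\<^sub>F n in sequentially. 2 * (1/2) ^ n * W (snd p) < e / 2"
      using order_tendstoD(2)[OF lim0[of "W (snd p)"], of "e / 2"] by simp
    then obtain N where N: "2 * (1/2) ^ N * W (snd p) < e / 2" by (auto simp: eventually_sequentially)
    show "\<exists>M. \<forall>m\<ge>M. \<forall>n\<ge>M. dist (?v m p) (?v n p) < e"
    proof (intro exI[of _ N] allI impI)
      fix m n assume mn: "N \<le> m" "N \<le> n"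
      have "dist (?v m p) (?v n p) \<le> dist (?v m p) (?v N p) + dist (?v n p) (?v N p)" by (rule dist_triangle2)
      also have "\<dots> < e / 2 + e / 2"
        using dd'[of N "m - N" p] dd'[of N "n - N" p] mn N unfolding dist_norm by (intro add_strict_mono) auto
      finally show "dist (?v m p) (?v n p) < e" by simp
    qed
  qed
  then have "\<exists>l. (\<lambda>n. ?v n p) \<longlonglongrightarrow> l" for p using Cauchy_convergent convergent_def by blast
  then obtain v where lim: "\<And>p. (\<lambda>n. ?v n p) \<longlonglongrightarrow> v p" by metis
  have vm: "v \<in> borel_measurable borel"
    by (rule borel_measurable_LIMSEQ_metric[OF picard_measurable[OF \<phi>(1)] lim])
  have vb: "norm (v p) \<le> 2 * W (snd p)" for p
    by (rule LIMSEQ_le_const2[OF tendsto_norm[OF lim]]) (use v2 in blast)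
  have vd: "norm (v p - ?v n p) \<le> 2 * (1/2) ^ n * W (snd p)" for n p
  proof (rule LIMSEQ_le_const2)
    show "(\<lambda>m. norm (?v (m + n) p - ?v n p)) \<longlonglongrightarrow> norm (v p - ?v n p)"
      by (intro tendsto_intros LIMSEQ_ignore_initial_segment lim)
    show "\<exists>N. \<forall>m\<ge>N. norm (?v (m + n) p - ?v n p) \<le> 2 * (1/2) ^ n * W (snd p)"
      using dd'[of n _ p] by (auto simp: add.commute)
  qed
  have "v p = \<phi> (snd p) + k * Bf T v p" for p
  proof -
    obtain t \<xi> where p: "p = (t, \<xi>)" by (cases p)
    have "(\<lambda>n. Bf T (?v n) p - Bf T v p) \<longlonglongrightarrow> 0"
    proof (rule Lim_null_comparison)
      have "norm (Bf T v (t, \<xi>) - Bf T (?v n) (t, \<xi>)) \<le> T * (2 * 2 * (2 * (1/2) ^ n) / c * W \<xi>)" for n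
        using T vb v2 vd by (intro Bf_diff_bound[OF W c(1)] vm picard_measurable \<phi>) force+
      then have "norm (Bf T (?v n) p - Bf T v p) \<le> 2 * (1/2) ^ n * (4 * T / c * W \<xi>)" for n
        unfolding p norm_minus_commute[of "Bf T (?v n) (t, \<xi>)"] by (simp add: field_simps)
      then show "\<forall>\<^sub>F n in sequentially. norm (Bf T (?v n) p - Bf T v p) \<le> 2 * (1/2) ^ n * (4 * T / c * W \<xi>)" by simp
      show "(\<lambda>n. 2 * (1/2) ^ n * (4 * T / c * W \<xi>)) \<longlonglongrightarrow> 0" by (rule lim0)
    qed
    then have "(\<lambda>n. Bf T (?v n) p) \<longlonglongrightarrow> Bf T v p" by (rule LIM_zero_cancel)
    then have "(\<lambda>n. ?v (Suc n) p) \<longlonglongrightarrow> \<phi> (snd p) + k * Bf T v p"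
      unfolding picard.simps by (intro tendsto_intros)
    then show ?thesis using LIMSEQ_Suc[OF lim] LIMSEQ_unique by blast
  qed
  then show ?thesis using that[of v] vm vb by force
qed

text \<open>Here \<open>v (t, \<xi>)\<close> is the Fourier transform of \<open>e\<^sup>i\<^sup>t\<^sup>\<Delta> u t\<close>, and \<open>uhat v t\<close> that of \<open>u t\<close>.\<close>

definition uhat :: "(real \<times> R2 \<Rightarrow> complex) \<Rightarrow> real \<Rightarrow> R2 \<Rightarrow> complex" where
  "uhat v t \<xi> = cis (t * (norm \<xi>)\<^sup>2) * v (t, \<xi>)"

lemma norm_uhat: "norm (uhat v t \<xi>) = norm (v (t, \<xi>))"
  by (simp add: uhat_def norm_mult)

lemma slice_measurable:
  assumes v: "v \<in> borel_measurable borel"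
  shows "(\<lambda>\<xi>::R2. v (t::real, \<xi>)) \<in> borel_measurable borel"
  by (rule measurable_compose_continuous[OF v]) (intro continuous_intros)

lemma uhat_measurable:
  assumes v: "v \<in> borel_measurable borel"
  shows "uhat v t \<in> borel_measurable borel"
  unfolding uhat_def[abs_def] using slice_measurable[OF v, of t] by measurable

lemma uhat_integrable:
  assumes W: "majorant c W" and v: "v \<in> borel_measurable borel" and b: "\<And>s \<xi>. norm (v (s, \<xi>)) \<le> D * W \<xi>"
  shows "integrable lborel (uhat v t)"
proof (rule Bochner_Integration.integrable_bound[OF integrable_mult_right[OF majorantD(4)[OF W], of D]])
  show "AE \<xi> in lborel. norm (uhat v t \<xi>) \<le> norm (D * W \<xi>)"
    unfolding norm_uhat using order_trans[OF b abs_ge_self] by (intro AE_I2) (simp only: real_norm_def)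
qed (use uhat_measurable[OF v] in simp)

lemma weighted_square_integrable:
  assumes W: "majorant c W" and m: "m \<in> borel_measurable borel" and b: "\<And>\<xi>. norm (m \<xi>) \<le> D * W \<xi>"
  shows "integrable lborel (\<lambda>\<xi>. (1 + (norm \<xi>)\<^sup>2) powr real k * (norm (m \<xi>))\<^sup>2)"
proof (rule Bochner_Integration.integrable_bound[OF integrable_mult_right[OF majorantD(5)[OF W, of k], of "D\<^sup>2"]])
  have p: "(1 + (norm \<xi>)\<^sup>2) powr real k = (1 + (norm \<xi>)\<^sup>2) ^ k" for \<xi> :: R2
    by (rule powr_realpow) (simp add: add_pos_nonneg)
  have "(1 + (norm \<xi>)\<^sup>2) ^ k * (norm (m \<xi>))\<^sup>2 \<le> D\<^sup>2 * ((1 + (norm \<xi>)\<^sup>2) ^ k * (W \<xi>)\<^sup>2)" for \<xi>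
  proof -
    have "(norm (m \<xi>))\<^sup>2 \<le> (D * W \<xi>)\<^sup>2" by (intro power_mono b norm_ge_zero)
    then have "(1 + (norm \<xi>)\<^sup>2) ^ k * (norm (m \<xi>))\<^sup>2 \<le> (1 + (norm \<xi>)\<^sup>2) ^ k * (D * W \<xi>)\<^sup>2" by (intro mult_left_mono) auto
    then show ?thesis by (simp add: power_mult_distrib mult_ac)
  qed
  then show "AE \<xi> in lborel. norm ((1 + (norm \<xi>)\<^sup>2) powr real k * (norm (m \<xi>))\<^sup>2) \<le> norm (D\<^sup>2 * ((1 + (norm \<xi>)\<^sup>2) ^ k * (W \<xi>)\<^sup>2))"
    unfolding p by (intro AE_I2) (simp add: abs_mult)
qed (use m in measurable)

lemma uhat_sobolev:
  assumes W: "majorant c W" and v: "v \<in> borel_measurable borel" and b: "\<And>s \<xi>. norm (v (s, \<xi>)) \<le> D * W \<xi>"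
  shows "distr_of_FT (uhat v t) \<in> sobolev (real k)"
  by (rule sobolev_distr_of_FT[OF uhat_integrable[OF W v b] weighted_square_integrable[OF W uhat_measurable[OF v], where D=D]])
     (unfold norm_uhat, rule b)

lemma Qf_bound:
  assumes W: "majorant c W" and c: "c > 0" and v: "v \<in> borel_measurable borel" and b: "\<And>s \<xi>. norm (v (s, \<xi>)) \<le> D * W \<xi>"
  shows "norm (Qf v s \<xi>) \<le> 2 * D * D / c * W \<xi>"
proof -
  have "norm (Qf v s \<xi> - Qf (\<lambda>_. 0) s \<xi>) \<le> 2 * D * D / c * W \<xi>"
    by (rule Qf_diff_bound[OF W c v b]) (use b order_trans[OF norm_ge_zero b] in auto)
  then show ?thesis by (simp add: Qf_def)
qed

lemma corr_uhat: "corr (uhat v s) \<xi> = cis (s * (norm \<xi>)\<^sup>2) * Qf v s \<xi> / (2 * pi)"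
proof -
  have "uhat v s (\<xi> + \<zeta>) * cnj (uhat v s \<zeta>) = cis (s * (norm \<xi>)\<^sup>2) * (cis (2 * s * (\<xi> \<bullet> \<zeta>)) * (v (s, \<xi> + \<zeta>) * cnj (v (s, \<zeta>))))" for \<zeta>
  proof -
    have "(norm (\<xi> + \<zeta>))\<^sup>2 = (norm \<xi>)\<^sup>2 + 2 * (\<xi> \<bullet> \<zeta>) + (norm \<zeta>)\<^sup>2"
      unfolding power2_norm_eq_inner by (simp add: inner_add inner_commute)
    then have "cis (s * (norm (\<xi> + \<zeta>))\<^sup>2) * cnj (cis (s * (norm \<zeta>)\<^sup>2)) = cis (s * (norm \<xi>)\<^sup>2) * cis (2 * s * (\<xi> \<bullet> \<zeta>))"
      by (simp add: cis_cnj cis_mult algebra_simps)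
    moreover have "uhat v s (\<xi> + \<zeta>) * cnj (uhat v s \<zeta>) = (cis (s * (norm (\<xi> + \<zeta>))\<^sup>2) * cnj (cis (s * (norm \<zeta>)\<^sup>2))) * (v (s, \<xi> + \<zeta>) * cnj (v (s, \<zeta>)))"
      unfolding uhat_def complex_cnj_mult by (simp only: mult_ac)
    ultimately show ?thesis by (simp only: mult.assoc)
  qed
  then show ?thesis unfolding corr_def Qf_def by simp
qed

text \<open>Duhamel's formula after the free evolution has been undone; the factor 1 / (2 pi) is
  that of \<open>corr\<close>.\<close>

definition mild_profile :: "complex \<Rightarrow> real \<Rightarrow> (R2 \<Rightarrow> complex) \<Rightarrow> (real \<times> R2 \<Rightarrow> complex) \<Rightarrow> bool" where
  "mild_profile \<eta> T \<phi> v \<longleftrightarrow> v \<in> borel_measurable borel \<and>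
     (\<forall>p. v p = \<phi> (snd p) + (- \<i> * \<eta> / (2 * pi)) * Bf T v p)"

lemma Bf_lipschitz:
  assumes W: "majorant c W" and c: "c > 0" and v: "v \<in> borel_measurable borel" and b: "\<And>s \<xi>. norm (v (s, \<xi>)) \<le> D * W \<xi>"
  shows "norm (Bf T v (t, \<xi>) - Bf T v (t', \<xi>)) \<le> \<bar>t - t'\<bar> * (2 * D * D / c * W \<xi>)"
proof -
  let ?K = "2 * D * D / c * W \<xi>"
  note i = Bf_integrable[OF W c v b, where T=T and \<xi>=\<xi>]
  note Q = Qf_bound[OF W c v b]
  have K0: "0 \<le> ?K" using order_trans[OF norm_ge_zero Q] .
  let ?I = "\<lambda>s. (if 0 \<le> s \<and> s \<le> t \<and> s \<le> T then Qf v s \<xi> else 0) - (if 0 \<le> s \<and> s \<le> t' \<and> s \<le> T then Qf v s \<xi> else 0)"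
  have "norm (Bf T v (t, \<xi>) - Bf T v (t', \<xi>)) = norm (\<integral>s. ?I s \<partial>lborel)"
    unfolding Bf_def fst_conv snd_conv by (subst Bochner_Integration.integral_diff[OF i i]) simp
  also have "\<dots> \<le> (\<integral>s. norm (?I s) \<partial>lborel)" by (rule integral_norm_bound)
  also have "\<dots> \<le> (\<integral>s. indicat_real {min t t'..max t t'} s * ?K \<partial>lborel)"
  proof (rule integral_mono)
    show "integrable lborel (\<lambda>s. norm (?I s))" using i by (intro integrable_norm Bochner_Integration.integrable_diff)
    show "integrable lborel (\<lambda>s. indicat_real {min t t'..max t t'} s * ?K)"
      by (intro integrable_mult_left integrable_indicator_Icc)
    show "norm (?I s) \<le> indicat_real {min t t'..max t t'} s * ?K" for s
      using Q[of s \<xi>] K0 by (auto simp: indicator_def)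
  qed
  also have "\<dots> = \<bar>t - t'\<bar> * ?K" by (auto simp: max_def min_def)
  finally show ?thesis .
qed

text \<open>At each fixed frequency the profile is Lipschitz in time, and differences are at most 2
  D W. The weighted square of this bound is integrable for every order, so dominated convergence
  gives continuity in each Sobolev norm.\<close>

lemma uhat_continuous_curve:
  assumes W: "majorant c W" and c: "c > 0" and v: "mild_profile \<eta> T \<phi> v" and b: "\<And>s \<xi>. norm (v (s, \<xi>)) \<le> D * W \<xi>"
  shows "(\<lambda>t. distr_of_FT (uhat v t)) \<in> C_sobolev_inf T"
  unfolding C_sobolev_inf_def continuous_curve_def
proof (intro CollectI allI ballI conjI)
  have vm: "v \<in> borel_measurable borel" using v by (simp add: mild_profile_def)
  note ui = uhat_integrable[OF W vm b]
  fix k :: nat and t assume "t \<in> {0..T}"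
  show "distr_of_FT (uhat v t) \<in> sobolev (real k)" by (rule uhat_sobolev[OF W vm b])
  have W0: "0 \<le> W \<xi>" for \<xi> by (rule majorantD(2)[OF W])
  have vt: "((\<lambda>t'. v (t', \<xi>)) \<longlongrightarrow> v (t, \<xi>)) (at t)" for \<xi>
  proof -
    have "((\<lambda>t'. Bf T v (t', \<xi>) - Bf T v (t, \<xi>)) \<longlongrightarrow> 0) (at t)"
    proof (rule Lim_null_comparison)
      show "\<forall>\<^sub>F t' in at t. norm (Bf T v (t', \<xi>) - Bf T v (t, \<xi>)) \<le> \<bar>t' - t\<bar> * (2 * D * D / c * W \<xi>)"
        by (intro always_eventually allI Bf_lipschitz[OF W c vm b])
      show "((\<lambda>t'. \<bar>t' - t\<bar> * (2 * D * D / c * W \<xi>)) \<longlongrightarrow> 0) (at t)"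
        using c by (auto intro!: tendsto_eq_intros)
    qed
    then have "((\<lambda>t'. Bf T v (t', \<xi>)) \<longlongrightarrow> Bf T v (t, \<xi>)) (at t)" by (rule LIM_zero_cancel)
    then have "((\<lambda>t'. \<phi> \<xi> + (- \<i> * \<eta> / (2 * pi)) * Bf T v (t', \<xi>)) \<longlongrightarrow> \<phi> \<xi> + (- \<i> * \<eta> / (2 * pi)) * Bf T v (t, \<xi>)) (at t)"
      by (intro tendsto_intros)
    moreover have e: "v (t', \<xi>) = \<phi> \<xi> + (- \<i> * \<eta> / (2 * pi)) * Bf T v (t', \<xi>)" for t'
      using v[unfolded mild_profile_def, THEN conjunct2, rule_format, of "(t', \<xi>)"] by simp
    moreover have "(\<lambda>t'. v (t', \<xi>)) = (\<lambda>t'. \<phi> \<xi> + (- \<i> * \<eta> / (2 * pi)) * Bf T v (t', \<xi>))"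
      by (intro ext e)
    ultimately show ?thesis by (simp only: e[of t])
  qed
  have ut: "((\<lambda>t'. uhat v t' \<xi>) \<longlongrightarrow> uhat v t \<xi>) (at t)" for \<xi>
  proof -
    have "continuous_on UNIV (\<lambda>t'. cis (t' * (norm \<xi>)\<^sup>2))" by (intro continuous_intros)
    then have "((\<lambda>t'. cis (t' * (norm \<xi>)\<^sup>2)) \<longlongrightarrow> cis (t * (norm \<xi>)\<^sup>2)) (at t)"
      by (simp add: continuous_on_eq_continuous_at isCont_def)
    then show ?thesis unfolding uhat_def by (intro tendsto_mult vt)
  qed
  have N: "sobolev_norm (real k) (distr_of_FT (uhat v t') - distr_of_FT (uhat v t)) =
     sqrt (\<integral>\<xi>. (1 + (norm \<xi>)\<^sup>2) powr real k * (norm (uhat v t' \<xi> - uhat v t \<xi>))\<^sup>2 \<partial>lborel)" for t'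
    unfolding distr_of_FT_diff[OF ui ui] using ui by (intro sobolev_norm_distr_of_FT) simp
  have dm: "(\<lambda>\<xi>. uhat v t' \<xi> - uhat v t \<xi>) \<in> borel_measurable borel" for t'
    by (intro borel_measurable_diff uhat_measurable vm)
  have db: "norm (uhat v t' \<xi> - uhat v t \<xi>) \<le> 2 * D * W \<xi>" for t' \<xi>
    using norm_triangle_ineq4[of "uhat v t' \<xi>" "uhat v t \<xi>"] b[of t' \<xi>] b[of t \<xi>] by (simp add: norm_uhat)
  show "((\<lambda>t'. sobolev_norm (real k) (distr_of_FT (uhat v t') - distr_of_FT (uhat v t))) \<longlongrightarrow> 0) (at t within {0..T})"
    unfolding N
  proof (subst tendsto_at_iff_sequentially, intro allI impI, unfold comp_def)
    fix X :: "nat \<Rightarrow> real" assume X: "\<forall>i. X i \<in> {0..T} - {t}" "X \<longlonglongrightarrow> t"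
    let ?g = "\<lambda>t' \<xi>. (1 + (norm \<xi>)\<^sup>2) powr real k * (norm (uhat v t' \<xi> - uhat v t \<xi>))\<^sup>2"
    have "(\<lambda>i. \<integral>\<xi>. ?g (X i) \<xi> \<partial>lborel) \<longlonglongrightarrow> (\<integral>\<xi>. (0::real) \<partial>(lborel :: R2 measure))"
    proof (rule integral_dominated_convergence)
      show "integrable lborel (\<lambda>\<xi>. (1 + (norm \<xi>)\<^sup>2) powr real k * (norm (complex_of_real (2 * D * W \<xi>)))\<^sup>2)"
        by (rule weighted_square_integrable[OF W, of _ "\<bar>2 * D\<bar>"]) (use majorantD(1)[OF W] W0 in \<open>auto simp: norm_mult abs_mult\<close>)
      show "AE \<xi> in lborel. norm (?g (X i) \<xi>) \<le> (1 + (norm \<xi>)\<^sup>2) powr real k * (norm (complex_of_real (2 * D * W \<xi>)))\<^sup>2" for i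
      proof (intro AE_I2)
        fix \<xi>
        have "norm (uhat v (X i) \<xi> - uhat v t \<xi>) \<le> norm (complex_of_real (2 * D * W \<xi>))"
          unfolding norm_of_real by (rule order_trans[OF db abs_ge_self])
        then show "norm (?g (X i) \<xi>) \<le> (1 + (norm \<xi>)\<^sup>2) powr real k * (norm (complex_of_real (2 * D * W \<xi>)))\<^sup>2"
          by (simp only: real_norm_def abs_mult abs_of_nonneg powr_ge_zero zero_le_power2) (intro mult_left_mono power_mono, auto)
      qed
      show "AE \<xi> in lborel. (\<lambda>i. ?g (X i) \<xi>) \<longlonglongrightarrow> 0"
      proof (intro AE_I2)
        fix \<xi>
        have "(\<lambda>i. uhat v (X i) \<xi>) \<longlonglongrightarrow> uhat v t \<xi>"
          by (rule ut[of \<xi>, unfolded tendsto_at_iff_sequentially comp_def, rule_format]) (use X in auto)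
        then have "(\<lambda>i. ?g (X i) \<xi>) \<longlonglongrightarrow> (1 + (norm \<xi>)\<^sup>2) powr real k * (norm (uhat v t \<xi> - uhat v t \<xi>))\<^sup>2"
          by (intro tendsto_intros)
        then show "(\<lambda>i. ?g (X i) \<xi>) \<longlonglongrightarrow> 0" by simp
      qed
      show "?g (X i) \<in> borel_measurable lborel" for i using dm[of "X i"] by measurable
    qed simp
    from tendsto_real_sqrt[OF this] show "(\<lambda>i. sqrt (\<integral>\<xi>. ?g (X i) \<xi> \<partial>lborel)) \<longlonglongrightarrow> 0" by simp
  qed
qed

lemma Bf_pairing_integrable:
  assumes W: "majorant c W" and c: "c > 0" and v: "v \<in> borel_measurable borel" and b: "\<And>s \<xi>. norm (v (s, \<xi>)) \<le> D * W \<xi>"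
    and g: "g \<in> borel_measurable borel" "\<And>\<xi>. norm (g \<xi>) \<le> B"
  shows "integrable (lborel \<Otimes>\<^sub>M lborel) (\<lambda>(s, \<xi>). if 0 \<le> s \<and> s \<le> t \<and> s \<le> T then g \<xi> * Qf v s \<xi> else 0)"
proof -
  let ?q = "\<lambda>s \<xi>. if 0 \<le> s \<and> s \<le> t \<and> s \<le> T then g \<xi> * Qf v s \<xi> else 0"
  note Q = Qf_bound[OF W c v b]
  have "integrable (lborel \<Otimes>\<^sub>M lborel) (\<lambda>(s, \<xi>). complex_of_real (indicat_real {0..t} s) * (1 * complex_of_real (2 * D * D / c * B * W \<xi>)))"
    by (rule Fubini_kernel(2)[where C=1])
       (auto intro!: sigma_finite_lborel integrable_of_real integrable_indicator_Icc integrable_mult_right majorantD(4)[OF W] simp del: of_real_mult)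
  then show ?thesis
  proof (rule Bochner_Integration.integrable_bound)
    let ?S = "{p::real \<times> R2. 0 \<le> fst p \<and> fst p \<le> t \<and> fst p \<le> T}"
    have "closed ?S" by (intro closed_Collect_conj closed_Collect_le continuous_intros)
    then have s: "?S \<in> sets borel" by (rule borel_closed)
    have gm: "(\<lambda>p::real \<times> R2. g (snd p) * Qf v (fst p) (snd p)) \<in> borel_measurable borel"
      by (intro borel_measurable_times Qf_measurable v measurable_snd_arg g)
    have "(\<lambda>p. if 0 \<le> fst p \<and> fst p \<le> t \<and> fst p \<le> T then g (snd p) * Qf v (fst p) (snd p) else 0) \<in> borel_measurable borel"
      using measurable_If_set[OF gm borel_measurable_const[of 0], of ?S] s by simp
    then show "(\<lambda>(s, \<xi>). ?q s \<xi>) \<in> borel_measurable (lborel \<Otimes>\<^sub>M lborel)"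
      by (simp add: lborel_prod split_def)
    have "norm (?q s \<xi>) \<le> norm (complex_of_real (indicat_real {0..t} s) * (1 * complex_of_real (2 * D * D / c * B * W \<xi>)))" for s \<xi>
    proof (cases "0 \<le> s \<and> s \<le> t \<and> s \<le> T")
      case True
      have "norm (g \<xi> * Qf v s \<xi>) \<le> B * (2 * D * D / c * W \<xi>)"
        unfolding norm_mult by (intro mult_mono g Q norm_ge_zero order_trans[OF norm_ge_zero g(2)])
      also have "\<dots> \<le> \<bar>2 * D * D / c * B * W \<xi>\<bar>" by (simp only: mult_ac times_divide_eq_right times_divide_eq_left) (rule abs_ge_self)
      finally show ?thesis using True by (simp add: norm_mult del: of_real_mult of_real_divide)
    next
      case False
      then show ?thesis by (simp only: if_False norm_zero norm_ge_zero)
    qed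
    then show "AE p in lborel \<Otimes>\<^sub>M lborel. norm (case p of (s, \<xi>) \<Rightarrow> ?q s \<xi>) \<le>
        norm (case p of (s, \<xi>) \<Rightarrow> complex_of_real (indicat_real {0..t} s) * (1 * complex_of_real (2 * D * D / c * B * W \<xi>)))"
      by (intro AE_I2) (simp only: split_def)
  qed
qed

text \<open>\<open>smooth_solution\<close> tests the integrand of the Duhamel term before
  integrating in time, whereas \<open>Bf\<close> integrates in time at fixed frequency. Fubini
  reconciles the two.\<close>

lemma Bf_pairing:
  assumes W: "majorant c W" and c: "c > 0" and v: "v \<in> borel_measurable borel" and b: "\<And>s \<xi>. norm (v (s, \<xi>)) \<le> D * W \<xi>"
    and g: "g \<in> borel_measurable borel" "\<And>\<xi>. norm (g \<xi>) \<le> B"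
  shows "integrable lborel (\<lambda>s. if 0 \<le> s \<and> s \<le> t \<and> s \<le> T then (\<integral>\<xi>. g \<xi> * Qf v s \<xi> \<partial>lborel) else 0)"
    and "(\<integral>\<xi>. g \<xi> * Bf T v (t, \<xi>) \<partial>lborel) = (\<integral>s. (if 0 \<le> s \<and> s \<le> t \<and> s \<le> T then (\<integral>\<xi>. g \<xi> * Qf v s \<xi> \<partial>lborel) else 0) \<partial>lborel)"
proof -
  let ?q = "\<lambda>s \<xi>. if 0 \<le> s \<and> s \<le> t \<and> s \<le> T then g \<xi> * Qf v s \<xi> else 0"
  note I = Bf_pairing_integrable[OF assms, of t T]
  have e: "(\<integral>\<xi>. ?q s \<xi> \<partial>lborel) = (if 0 \<le> s \<and> s \<le> t \<and> s \<le> T then (\<integral>\<xi>. g \<xi> * Qf v s \<xi> \<partial>lborel) else 0)" for s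
    by (cases "0 \<le> s \<and> s \<le> t \<and> s \<le> T") (simp_all only: simp_thms if_True if_False Bochner_Integration.integral_zero)
  show "integrable lborel (\<lambda>s. if 0 \<le> s \<and> s \<le> t \<and> s \<le> T then (\<integral>\<xi>. g \<xi> * Qf v s \<xi> \<partial>lborel) else 0)"
    unfolding e[symmetric] by (rule lborel_pair.integrable_fst[OF I])
  have "(\<integral>\<xi>. g \<xi> * Bf T v (t, \<xi>) \<partial>lborel) = (\<integral>\<xi>. (\<integral>s. ?q s \<xi> \<partial>lborel) \<partial>lborel)"
  proof (rule Bochner_Integration.integral_cong[OF refl])
    fix \<xi>
    have "?q s \<xi> = g \<xi> * (if 0 \<le> s \<and> s \<le> t \<and> s \<le> T then Qf v s \<xi> else 0)" for s by simp
    then show "g \<xi> * Bf T v (t, \<xi>) = (\<integral>s. ?q s \<xi> \<partial>lborel)" by (simp only: Bf_def fst_conv snd_conv integral_mult_right_zero)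
  qed
  also have "\<dots> = (\<integral>s. (\<integral>\<xi>. ?q s \<xi> \<partial>lborel) \<partial>lborel)"
    by (rule lborel_pair.Fubini_integral[OF I])
  finally show "(\<integral>\<xi>. g \<xi> * Bf T v (t, \<xi>) \<partial>lborel) = (\<integral>s. (if 0 \<le> s \<and> s \<le> t \<and> s \<le> T then (\<integral>\<xi>. g \<xi> * Qf v s \<xi> \<partial>lborel) else 0) \<partial>lborel)"
    unfolding e .
qed

text \<open>The profile equation is multiplied by cis (t |\<xi>|^2). Splitting this phase into those
  for t - s and for s gives Duhamel's formula, with the propagator over t - s acting on the square
  at time s.\<close>

lemma uhat_smooth_solution:
  assumes W: "majorant c W" and c: "c > 0" and v: "mild_profile \<eta> T \<phi> v" and b: "\<And>s \<xi>. norm (v (s, \<xi>)) \<le> D * W \<xi>"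
    and \<phi>i: "integrable lborel \<phi>"
  shows "smooth_solution \<eta> T (distr_of_FT \<phi>) (\<lambda>t. distr_of_FT (uhat v t))"
  unfolding smooth_solution_def
proof (intro conjI ballI uhat_continuous_curve[OF W c v b])
  have vm: "v \<in> borel_measurable borel" using v by (simp add: mild_profile_def)
  note ui = uhat_integrable[OF W vm b]
  fix t f assume t: "t \<in> {0..T}" and f: "f \<in> schwartz"
  let ?h = "inv_fourier_fun f"
  have h: "?h \<in> schwartz" using f by (rule inv_fourier_fun_schwartz)
  note [measurable] = schwartz_measurable[OF h]
  obtain Bh where Bh: "\<And>\<xi>. norm (?h \<xi>) \<le> Bh" using schwartz_bounded[OF h] by blast
  note Q = Qf_bound[OF W c vm b]
  have W0: "0 \<le> W \<xi>" for \<xi> by (rule majorantD(2)[OF W])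
  have qm: "(\<lambda>p. Qf v (fst p) (snd p)) \<in> borel_measurable borel" by (rule Qf_measurable[OF vm])
  let ?g = "\<lambda>\<xi>. cis (t * (norm \<xi>)\<^sup>2) * ?h \<xi>"
  have P: "propagator (t - s) (abs_square (distr_of_FT (uhat v s))) f = (\<integral>\<xi>. ?g \<xi> * Qf v s \<xi> \<partial>lborel) / (2 * pi)" for s
  proof -
    have "cis ((t - s) * (norm \<xi>)\<^sup>2) * corr (uhat v s) \<xi> * ?h \<xi> = ?g \<xi> * Qf v s \<xi> / (2 * pi)" for \<xi>
    proof -
      have "cis ((t - s) * (norm \<xi>)\<^sup>2) * cis (s * (norm \<xi>)\<^sup>2) = cis (t * (norm \<xi>)\<^sup>2)"
        by (simp add: cis_mult algebra_simps)
      then show ?thesis unfolding corr_uhat \<open>_ = cis (t * (norm \<xi>)\<^sup>2)\<close>[symmetric] by (simp only: times_divide_eq_right times_divide_eq_left mult_ac)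
    qed
    then show ?thesis
      unfolding abs_square_distr_of_FT[OF ui] propagator_distr_of_FT using f by (simp add: distr_of_FT_def)
  qed
  have gm: "?g \<in> borel_measurable borel" by measurable
  have gb: "norm (?g \<xi>) \<le> Bh" for \<xi> using Bh by (simp add: norm_mult)
  have D: "integral {0..t} (\<lambda>s. propagator (t - s) (abs_square (distr_of_FT (uhat v s))) f) = (\<integral>\<xi>. ?g \<xi> * Bf T v (t, \<xi>) \<partial>lborel) / (2 * pi)"
  proof -
    have e: "(if 0 \<le> s \<and> s \<le> t \<and> s \<le> T then (\<integral>\<xi>. ?g \<xi> * Qf v s \<xi> \<partial>lborel) else 0) / (2 * pi)
       = indicat_real {0..t} s *\<^sub>R propagator (t - s) (abs_square (distr_of_FT (uhat v s))) f" for s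
      using t unfolding P by (auto simp: indicator_def)
    note B = Bf_pairing[OF W c vm b gm gb, where t=t and T=T]
    have "integrable lborel (\<lambda>s. (if 0 \<le> s \<and> s \<le> t \<and> s \<le> T then (\<integral>\<xi>. ?g \<xi> * Qf v s \<xi> \<partial>lborel) else 0) / (2 * pi))"
      by (rule integrable_divide_zero) (use B(1) in simp)
    then have "set_integrable lborel {0..t} (\<lambda>s. propagator (t - s) (abs_square (distr_of_FT (uhat v s))) f)"
      unfolding e set_integrable_def .
    from set_borel_integral_eq_integral(2)[OF this]
    have "integral {0..t} (\<lambda>s. propagator (t - s) (abs_square (distr_of_FT (uhat v s))) f) =
      (\<integral>s. (if 0 \<le> s \<and> s \<le> t \<and> s \<le> T then (\<integral>\<xi>. ?g \<xi> * Qf v s \<xi> \<partial>lborel) else 0) / (2 * pi) \<partial>lborel)"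
      unfolding set_lebesgue_integral_def e by simp
    also have "\<dots> = (\<integral>\<xi>. ?g \<xi> * Bf T v (t, \<xi>) \<partial>lborel) / (2 * pi)"
      unfolding B(2) by (rule integral_divide_zero)
    finally show ?thesis .
  qed
  define k where "k = - \<i> * \<eta> / (2 * pi)"
  have i1: "integrable lborel (\<lambda>\<xi>. ?g \<xi> * \<phi> \<xi>)"
    using integrable_mult_bounded(1)[OF integrable_mult_schwartz[OF \<phi>i h], of "\<lambda>\<xi>. cis (t * (norm \<xi>)\<^sup>2)" 1] by (simp add: mult_ac)
  have i2: "integrable lborel (\<lambda>\<xi>. uhat v t \<xi> * ?h \<xi>)" by (rule integrable_mult_schwartz[OF ui h])
  have e: "uhat v t \<xi> * ?h \<xi> = ?g \<xi> * \<phi> \<xi> + k * (?g \<xi> * Bf T v (t, \<xi>))" for \<xi>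
  proof -
    have "v (t, \<xi>) = \<phi> \<xi> + k * Bf T v (t, \<xi>)" using v[unfolded mild_profile_def, THEN conjunct2, rule_format, of "(t, \<xi>)"] by (simp add: k_def)
    then show ?thesis unfolding uhat_def by (simp only: distrib_left distrib_right mult_ac)
  qed
  have i3: "integrable lborel (\<lambda>\<xi>. k * (?g \<xi> * Bf T v (t, \<xi>)))"
    using Bochner_Integration.integrable_diff[OF i2 i1] unfolding e by simp
  have "distr_of_FT (uhat v t) f = (\<integral>\<xi>. ?g \<xi> * \<phi> \<xi> \<partial>lborel) + (\<integral>\<xi>. k * (?g \<xi> * Bf T v (t, \<xi>)) \<partial>lborel)"
    using f unfolding distr_of_FT_def e by (simp only: Bochner_Integration.integral_add[OF i1 i3] if_True)
  also have "(\<integral>\<xi>. k * (?g \<xi> * Bf T v (t, \<xi>)) \<partial>lborel) = k * (\<integral>\<xi>. ?g \<xi> * Bf T v (t, \<xi>) \<partial>lborel)"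
    by (rule integral_mult_right_zero)
  also have "(\<integral>\<xi>. ?g \<xi> * \<phi> \<xi> \<partial>lborel) = propagator t (distr_of_FT \<phi>) f"
    unfolding propagator_distr_of_FT using f by (simp add: distr_of_FT_def mult_ac)
  finally have "distr_of_FT (uhat v t) f = propagator t (distr_of_FT \<phi>) f + k * (\<integral>\<xi>. ?g \<xi> * Bf T v (t, \<xi>) \<partial>lborel)"
    by (simp only: add.commute)
  then show "distr_of_FT (uhat v t) f = propagator t (distr_of_FT \<phi>) f - \<i> * \<eta> *
      integral {0..t} (\<lambda>t'. propagator (t - t') (abs_square (distr_of_FT (uhat v t'))) f)"
    unfolding D k_def by simp
qed

section \<open>The remainder of the quadratic iterate\<close>

text \<open>With |k| = |\<eta>| / (2 pi) the iteration asks for 8 T |k| \<le> c, which c = 4 T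
  |\<eta>| / pi meets with equality. The majorant then asks for 4 c P \<le> 1, which is the
  hypothesis \<open>small\<close>.\<close>

lemma solution_exists:
  fixes \<phi> :: "R2 \<Rightarrow> complex"
  assumes \<eta>: "\<eta> \<noteq> 0" and T: "T > 0" and \<phi>m: "\<phi> \<in> borel_measurable borel" and a: "a > 0"
    and i: "integrable lborel (\<lambda>\<xi>. norm (\<phi> \<xi>) * exp (a * norm \<xi>))"
    and P: "(\<integral>\<xi>. norm (\<phi> \<xi>) * exp (a * norm \<xi>) \<partial>lborel) \<le> P"
    and S: "\<And>\<xi>. norm (\<phi> \<xi>) * exp (a * norm \<xi>) \<le> S"
    and small: "16 * T * norm \<eta> / pi * P \<le> 1"
  obtains W v where "majorant (4 * T * norm \<eta> / pi) W" "\<And>\<xi>. norm (\<phi> \<xi>) \<le> W \<xi>" "(\<integral>\<xi>. W \<xi> \<partial>lborel) \<le> 2 * P"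
    "mild_profile \<eta> T \<phi> v" "\<And>s \<xi>. norm (v (s, \<xi>)) \<le> 2 * W \<xi>"
proof -
  let ?c = "4 * T * norm \<eta> / pi"
  have c: "?c > 0" using \<eta> T by simp
  obtain W where W: "majorant ?c W" "\<And>\<xi>. norm (\<phi> \<xi>) \<le> W \<xi>" "(\<integral>\<xi>. W \<xi> \<partial>lborel) \<le> 2 * P"
    by (rule majorant_exists[OF \<phi>m a i P S c]) (use small in \<open>auto simp: mult_ac\<close>)
  have k: "8 * T * norm (- \<i> * \<eta> / (2 * pi)) \<le> ?c"
    by (simp add: norm_mult norm_divide)
  obtain v where "v \<in> borel_measurable borel" "\<And>s \<xi>. norm (v (s, \<xi>)) \<le> 2 * W \<xi>"
    "\<And>p. v p = \<phi> (snd p) + (- \<i> * \<eta> / (2 * pi)) * Bf T v p"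
    by (rule picard_fixed_point[OF W(1) T c k \<phi>m W(2)]) (rule that)
  then show ?thesis using that W unfolding mild_profile_def by blast
qed

definition rcorr :: "(R2 \<Rightarrow> real) \<Rightarrow> (R2 \<Rightarrow> real) \<Rightarrow> R2 \<Rightarrow> real" where
  "rcorr f g \<xi> = (\<integral>\<zeta>. f (\<xi> + \<zeta>) * g \<zeta> \<partial>lborel)"

lemma rcorr_integral:
  assumes f: "integrable lborel f" and g: "integrable lborel g"
  shows "integrable lborel (rcorr f g)" "(\<integral>\<xi>. rcorr f g \<xi> \<partial>lborel) = (\<integral>\<xi>. f \<xi> \<partial>lborel) * (\<integral>\<xi>. g \<xi> \<partial>lborel)"
proof -
  have [measurable]: "f \<in> borel_measurable borel" using f by auto
  have "integrable (lborel \<Otimes>\<^sub>M lborel) (\<lambda>(\<xi>, \<zeta>). complex_of_real (f (\<xi> + \<zeta>)) * complex_of_real (g \<zeta>))"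
    by (rule corr_integrable(2)) (intro integrable_of_real f g)+
  from integrable_Re[OF this] have I: "integrable (lborel \<Otimes>\<^sub>M lborel) (\<lambda>(\<xi>, \<zeta>). f (\<xi> + \<zeta>) * g \<zeta>)"
    by (simp add: split_def)
  show "integrable lborel (rcorr f g)"
    unfolding rcorr_def[abs_def] by (rule lborel_pair.integrable_fst[OF I])
  have "(\<integral>\<xi>. rcorr f g \<xi> \<partial>lborel) = (\<integral>\<zeta>. (\<integral>\<xi>. f (\<xi> + \<zeta>) * g \<zeta> \<partial>lborel) \<partial>lborel)"
    unfolding rcorr_def using lborel_pair.Fubini_integral[OF I] by simp
  also have "\<dots> = (\<integral>\<zeta>. (\<integral>\<xi>. f \<xi> \<partial>lborel) * g \<zeta> \<partial>lborel)"
    by (simp add: lborel_shift)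
  finally show "(\<integral>\<xi>. rcorr f g \<xi> \<partial>lborel) = (\<integral>\<xi>. f \<xi> \<partial>lborel) * (\<integral>\<xi>. g \<xi> \<partial>lborel)" by simp
qed

lemma Bf_le:
  assumes W: "majorant c W" and c: "c > 0" and T: "T \<ge> 0"
    and v: "v \<in> borel_measurable borel" and bv: "\<And>s \<xi>. norm (v (s, \<xi>)) \<le> D * W \<xi>"
    and w: "w \<in> borel_measurable borel" and bw: "\<And>s \<xi>. norm (w (s, \<xi>)) \<le> D * W \<xi>"
    and K: "\<And>s. norm (Qf v s \<xi> - Qf w s \<xi>) \<le> K"
  shows "norm (Bf T v (t, \<xi>) - Bf T w (t, \<xi>)) \<le> T * K"
proof -
  note iv = Bf_integrable[OF W c v bv, where t=t and T=T and \<xi>=\<xi>] and iw = Bf_integrable[OF W c w bw, where t=t and T=T and \<xi>=\<xi>]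
  have K0: "0 \<le> K" using order_trans[OF norm_ge_zero K] .
  let ?I = "\<lambda>s. (if 0 \<le> s \<and> s \<le> t \<and> s \<le> T then Qf v s \<xi> else 0) - (if 0 \<le> s \<and> s \<le> t \<and> s \<le> T then Qf w s \<xi> else 0)"
  have "norm (Bf T v (t, \<xi>) - Bf T w (t, \<xi>)) = norm (\<integral>s. ?I s \<partial>lborel)"
    unfolding Bf_def fst_conv snd_conv by (subst Bochner_Integration.integral_diff[OF iv iw]) simp
  also have "\<dots> \<le> (\<integral>s. norm (?I s) \<partial>lborel)" by (rule integral_norm_bound)
  also have "\<dots> \<le> (\<integral>s. indicat_real {0..T} s * K \<partial>lborel)"
  proof (rule integral_mono)
    show "integrable lborel (\<lambda>s. norm (?I s))" using iv iw by (intro integrable_norm Bochner_Integration.integrable_diff)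
    show "integrable lborel (\<lambda>s. indicat_real {0..T} s * K)"
      by (intro integrable_mult_left integrable_indicator_Icc)
    show "norm (?I s) \<le> indicat_real {0..T} s * K" for s
      using K[of s] K0 by (auto simp: indicator_def)
  qed
  also have "\<dots> = T * K" using T by simp
  finally show ?thesis .
qed

text \<open>The bound is cubic in the \<open>L\<^sup>1\<close> norm of the majorant, which is what makes the cubic and higher
  iterates negligible for data whose Fourier transform is concentrated near a direction.\<close>

lemma remainder_bound:
  assumes W: "majorant c W" and c: "c > 0" and T: "T > 0" and k: "k = - \<i> * \<eta> / (2 * pi)" "8 * T * norm k = c"
    and v: "mild_profile \<eta> T \<phi> v" and bv: "\<And>s \<xi>. norm (v (s, \<xi>)) \<le> 2 * W \<xi>"
    and \<phi>m: "\<phi> \<in> borel_measurable borel" and \<phi>: "\<And>\<xi>. norm (\<phi> \<xi>) \<le> W \<xi>"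
    and \<psi>m: "\<psi> \<in> borel_measurable borel" and \<psi>: "\<And>\<xi>. norm (\<psi> \<xi>) \<le> B"
  shows "norm ((\<integral>\<xi>. \<psi> \<xi> * Bf T v (t, \<xi>) \<partial>lborel) - (\<integral>\<xi>. \<psi> \<xi> * Bf T (\<lambda>p. \<phi> (snd p)) (t, \<xi>) \<partial>lborel))
     \<le> 12 * T\<^sup>2 * norm k * B * (\<integral>\<xi>. W \<xi> \<partial>lborel) ^ 3"
proof -
  let ?w = "\<lambda>p::real \<times> R2. \<phi> (snd p)"
  let ?J = "\<integral>\<xi>. W \<xi> \<partial>lborel"
  note Wi = majorantD(4)[OF W]
  note [measurable] = majorantD(1)[OF W]
  have W0: "0 \<le> W \<xi>" for \<xi> by (rule majorantD(2)[OF W])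
  have vm: "v \<in> borel_measurable borel" using v by (simp add: mild_profile_def)
  have wm: "?w \<in> borel_measurable borel" by (rule measurable_snd_arg[OF \<phi>m])
  have bw1: "norm (?w (s, \<xi>)) \<le> W \<xi>" for s \<xi> using \<phi> by simp
  have bw: "norm (?w (s, \<xi>)) \<le> 2 * W \<xi>" for s \<xi> using bw1[of s \<xi>] W0[of \<xi>] by linarith
  have zm: "(\<lambda>_. 0) \<in> borel_measurable borel" by simp
  have bz: "norm ((\<lambda>_::real \<times> R2. 0::complex) (s, \<xi>)) \<le> 2 * W \<xi>" for s \<xi> using W0[of \<xi>] by simp
  \<comment> \<open>\<open>E\<close> bounds the deviation of the profile from the data:
    \<open>Bf\<close> of a profile below 2 W is at most 4 T times the correlation of
    \<open>W\<close>, and the equation multiplies it by |k|.\<close>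
  define E where "E \<xi> = 4 * T * norm k * rcorr W W \<xi>" for \<xi>
  have Ei: "integrable lborel E" "(\<integral>\<xi>. E \<xi> \<partial>lborel) = 4 * T * norm k * ?J\<^sup>2"
    unfolding E_def using rcorr_integral[OF Wi Wi] by (simp_all add: power2_eq_square)
  note [measurable] = borel_measurable_integrable[OF Ei(1)]
  have E0: "0 \<le> E \<xi>" for \<xi>
    unfolding E_def rcorr_def using T W0 by (intro mult_nonneg_nonneg integral_nonneg_AE AE_I2) auto
  \<comment> \<open>Lying below \<open>W\<close>, the function \<open>E\<close> has pointwise
    integrable correlations with it.\<close>
  have EW: "E \<xi> \<le> W \<xi>" for \<xi>
  proof -
    have "c * rcorr W W \<xi> \<le> W \<xi>" unfolding rcorr_def by (rule majorantD(6)[OF W])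
    then have "2 * E \<xi> \<le> W \<xi>" unfolding E_def k(2)[symmetric] by simp
    then show ?thesis using E0[of \<xi>] by linarith
  qed
  have iWW: "integrable lborel (\<lambda>\<zeta>. W (\<xi> + \<zeta>) * W \<zeta>)" for \<xi> by (rule majorant_corr_integrable[OF W])
  have iEW: "integrable lborel (\<lambda>\<zeta>. E (\<xi> + \<zeta>) * W \<zeta>)" for \<xi>
    by (rule Bochner_Integration.integrable_bound[OF iWW[of \<xi>]])
       (measurable, intro AE_I2, simp only: real_norm_def abs_mult abs_of_nonneg W0 E0, intro mult_mono EW order_refl W0 E0)
  have iWE: "integrable lborel (\<lambda>\<zeta>. W (\<xi> + \<zeta>) * E \<zeta>)" for \<xi>
    by (rule Bochner_Integration.integrable_bound[OF iWW[of \<xi>]])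
       (measurable, intro AE_I2, simp only: real_norm_def abs_mult abs_of_nonneg W0 E0, intro mult_mono EW order_refl W0 E0)
  have Qv: "norm (Qf v s \<xi>) \<le> 4 * rcorr W W \<xi>" for s \<xi>
  proof -
    have "norm (Qf v s \<xi>) \<le> (\<integral>\<zeta>. norm (cis (2 * s * (\<xi> \<bullet> \<zeta>)) * (v (s, \<xi> + \<zeta>) * cnj (v (s, \<zeta>)))) \<partial>lborel)"
      unfolding Qf_def by (rule integral_norm_bound)
    also have "\<dots> \<le> (\<integral>\<zeta>. 4 * (W (\<xi> + \<zeta>) * W \<zeta>) \<partial>lborel)"
    proof (rule integral_mono[OF integrable_norm[OF Qf_integrable[OF W vm bv]] integrable_mult_right[OF iWW]])
      fix \<zeta>
      have "norm (v (s, \<xi> + \<zeta>)) * norm (v (s, \<zeta>)) \<le> (2 * W (\<xi> + \<zeta>)) * (2 * W \<zeta>)"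
        using W0 by (intro mult_mono bv) auto
      then show "norm (cis (2 * s * (\<xi> \<bullet> \<zeta>)) * (v (s, \<xi> + \<zeta>) * cnj (v (s, \<zeta>)))) \<le> 4 * (W (\<xi> + \<zeta>) * W \<zeta>)"
        by (simp add: norm_mult)
    qed
    finally show ?thesis by (simp add: rcorr_def)
  qed
  have vE: "norm (v (s, \<xi>) - \<phi> \<xi>) \<le> E \<xi>" for s \<xi>
  proof -
    have "norm (Qf v s \<xi> - Qf (\<lambda>_. 0) s \<xi>) \<le> 4 * rcorr W W \<xi>" for s using Qv[of s \<xi>] by (simp add: Qf_def[of "\<lambda>_. 0"])
    from Bf_le[OF W c less_imp_le[OF T] vm bv zm bz this]
    have "norm (Bf T v (s, \<xi>)) \<le> T * (4 * rcorr W W \<xi>)" by (simp add: Bf_def[of T "\<lambda>_. 0"] Qf_def[of "\<lambda>_. 0"] cong: if_cong)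
    moreover have "v (s, \<xi>) - \<phi> \<xi> = k * Bf T v (s, \<xi>)"
      using v[unfolded mild_profile_def, THEN conjunct2, rule_format, of "(s, \<xi>)"] by (simp add: k(1))
    ultimately show ?thesis unfolding E_def using mult_left_mono[of "norm (Bf T v (s, \<xi>))" "T * (4 * rcorr W W \<xi>)" "norm k"]
      by (simp add: norm_mult mult_ac)
  qed
  \<comment> \<open>The factor 2 is the bound 2 W on the profile; the other term uses the bound W on
    the data. The masses add up to 8 + 4 = 12 times T |k| \<open>?J ^ 3\<close>.\<close>
  define G where "G \<xi> = 2 * rcorr E W \<xi> + rcorr W E \<xi>" for \<xi>
  have Gi: "integrable lborel G" "(\<integral>\<xi>. G \<xi> \<partial>lborel) = 12 * T * norm k * ?J ^ 3"
    unfolding G_def using rcorr_integral[OF Ei(1) Wi] rcorr_integral[OF Wi Ei(1)] Ei(2)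
    by (simp_all add: power2_eq_square power3_eq_cube)
  have Qd: "norm (Qf v s \<xi> - Qf ?w s \<xi>) \<le> G \<xi>" for s \<xi>
  proof -
    let ?I = "\<lambda>\<zeta>. cis (2 * s * (\<xi> \<bullet> \<zeta>)) * (v (s, \<xi> + \<zeta>) * cnj (v (s, \<zeta>))) - cis (2 * s * (\<xi> \<bullet> \<zeta>)) * (?w (s, \<xi> + \<zeta>) * cnj (?w (s, \<zeta>)))"
    note iv = Qf_integrable[OF W vm bv, of s \<xi>] and iw = Qf_integrable[OF W wm bw, of s \<xi>]
    have "norm (Qf v s \<xi> - Qf ?w s \<xi>) = norm (\<integral>\<zeta>. ?I \<zeta> \<partial>lborel)"
      unfolding Qf_def by (subst Bochner_Integration.integral_diff[OF iv iw]) simp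
    also have "\<dots> \<le> (\<integral>\<zeta>. norm (?I \<zeta>) \<partial>lborel)" by (rule integral_norm_bound)
    also have "\<dots> \<le> (\<integral>\<zeta>. 2 * (E (\<xi> + \<zeta>) * W \<zeta>) + W (\<xi> + \<zeta>) * E \<zeta> \<partial>lborel)"
    proof (rule integral_mono)
      show "integrable lborel (\<lambda>\<zeta>. norm (?I \<zeta>))" using iv iw by (intro integrable_norm Bochner_Integration.integrable_diff)
      show "integrable lborel (\<lambda>\<zeta>. 2 * (E (\<xi> + \<zeta>) * W \<zeta>) + W (\<xi> + \<zeta>) * E \<zeta>)"
        by (intro Bochner_Integration.integrable_add integrable_mult_right iEW iWE)
      show "norm (?I \<zeta>) \<le> 2 * (E (\<xi> + \<zeta>) * W \<zeta>) + W (\<xi> + \<zeta>) * E \<zeta>" for \<zeta>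
      proof -
        have e: "x * cnj y - x' * cnj y' = (x - x') * cnj y + x' * cnj (y - y')" for x y x' y' :: complex
          by (simp add: algebra_simps)
        have "norm (?I \<zeta>) = norm (v (s, \<xi> + \<zeta>) * cnj (v (s, \<zeta>)) - \<phi> (\<xi> + \<zeta>) * cnj (\<phi> \<zeta>))"
          unfolding right_diff_distrib[symmetric] norm_mult norm_cis by simp
        also have "\<dots> \<le> norm (v (s, \<xi> + \<zeta>) - \<phi> (\<xi> + \<zeta>)) * norm (v (s, \<zeta>)) + norm (\<phi> (\<xi> + \<zeta>)) * norm (v (s, \<zeta>) - \<phi> \<zeta>)"
          unfolding e by (rule norm_triangle_le) (simp only: norm_mult complex_mod_cnj order_refl)
        also have "\<dots> \<le> E (\<xi> + \<zeta>) * (2 * W \<zeta>) + W (\<xi> + \<zeta>) * E \<zeta>"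
          by (intro add_mono mult_mono vE bv \<phi> norm_ge_zero E0 W0)
        finally show ?thesis by simp
      qed
    qed
    also have "\<dots> = G \<xi>"
      unfolding G_def rcorr_def by (subst Bochner_Integration.integral_add[OF integrable_mult_right[OF iEW] iWE]) simp
    finally show ?thesis .
  qed
  have Bd: "norm (Bf T v (t, \<xi>) - Bf T ?w (t, \<xi>)) \<le> T * G \<xi>" for \<xi>
    by (rule Bf_le[OF W c less_imp_le[OF T] vm bv wm bw Qd])
  have Bi: "integrable lborel (\<lambda>\<xi>. \<psi> \<xi> * Bf T u (t, \<xi>))" if um: "u \<in> borel_measurable borel" and bu: "\<And>s \<xi>. norm (u (s, \<xi>)) \<le> 2 * W \<xi>" for u
  proof (rule integrable_mult_bounded(1)[OF _ _ \<psi>])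
    show "integrable lborel (\<lambda>\<xi>. Bf T u (t, \<xi>))"
    proof (rule Bochner_Integration.integrable_bound[OF integrable_mult_right[OF Wi, of "T * (8 / c)"]])
      show "(\<lambda>\<xi>. Bf T u (t, \<xi>)) \<in> borel_measurable lborel"
        using slice_measurable[OF Bf_measurable[OF um], of T t] by simp
      have "norm (Bf T u (t, \<xi>) - Bf T (\<lambda>_. 0) (t, \<xi>)) \<le> T * (8 / c * W \<xi>)" for \<xi>
        by (rule Bf_le[OF W c less_imp_le[OF T] um bu zm bz]) (use Qf_bound[OF W c um bu] in \<open>simp add: Qf_def[of "\<lambda>_. 0"]\<close>)
      then have "norm (Bf T u (t, \<xi>)) \<le> T * (8 / c) * W \<xi>" for \<xi>
        by (simp add: Bf_def[of T "\<lambda>_. 0"] Qf_def[of "\<lambda>_. 0"] mult_ac cong: if_cong)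
      then show "AE \<xi> in lborel. norm (Bf T u (t, \<xi>)) \<le> norm (T * (8 / c) * W \<xi>)"
        by (intro AE_I2) (rule order_trans[OF _ abs_ge_self[of "T * (8 / c) * W _", folded real_norm_def]])
    qed
  qed (use \<psi>m in simp)
  have B0: "0 \<le> B" using order_trans[OF norm_ge_zero \<psi>] .
  have "norm ((\<integral>\<xi>. \<psi> \<xi> * Bf T v (t, \<xi>) \<partial>lborel) - (\<integral>\<xi>. \<psi> \<xi> * Bf T ?w (t, \<xi>) \<partial>lborel))
     = norm (\<integral>\<xi>. \<psi> \<xi> * Bf T v (t, \<xi>) - \<psi> \<xi> * Bf T ?w (t, \<xi>) \<partial>lborel)"
    by (subst Bochner_Integration.integral_diff[OF Bi[OF vm bv] Bi[OF wm bw]]) simp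
  also have "\<dots> \<le> (\<integral>\<xi>. norm (\<psi> \<xi> * Bf T v (t, \<xi>) - \<psi> \<xi> * Bf T ?w (t, \<xi>)) \<partial>lborel)" by (rule integral_norm_bound)
  also have "\<dots> \<le> (\<integral>\<xi>. B * (T * G \<xi>) \<partial>lborel)"
  proof (rule integral_mono)
    show "integrable lborel (\<lambda>\<xi>. norm (\<psi> \<xi> * Bf T v (t, \<xi>) - \<psi> \<xi> * Bf T ?w (t, \<xi>)))"
      by (intro integrable_norm Bochner_Integration.integrable_diff Bi[OF vm bv] Bi[OF wm bw])
    show "integrable lborel (\<lambda>\<xi>. B * (T * G \<xi>))" by (intro integrable_mult_right Gi)
    show "norm (\<psi> \<xi> * Bf T v (t, \<xi>) - \<psi> \<xi> * Bf T ?w (t, \<xi>)) \<le> B * (T * G \<xi>)" for \<xi>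
      unfolding right_diff_distrib[symmetric] norm_mult by (intro mult_mono \<psi> Bd B0 norm_ge_zero)
  qed
  also have "\<dots> = 12 * T\<^sup>2 * norm k * B * ?J ^ 3"
    using Gi(2) by (simp add: power2_eq_square)
  finally show ?thesis .
qed

section \<open>Duality with the Sobolev norm\<close>

lemma Cauchy_Schwarz_pairing:
  fixes g \<kappa> :: "'a \<Rightarrow> complex"
  assumes w: "\<And>x. w x > 0" and i: "integrable M (\<lambda>x. g x * \<kappa> x)"
    and A: "integrable M (\<lambda>x. w x * (norm (g x))\<^sup>2)" and B: "integrable M (\<lambda>x. (norm (\<kappa> x))\<^sup>2 / w x)"
  shows "norm (\<integral>x. g x * \<kappa> x \<partial>M) \<le> sqrt (\<integral>x. w x * (norm (g x))\<^sup>2 \<partial>M) * sqrt (\<integral>x. (norm (\<kappa> x))\<^sup>2 / w x \<partial>M)"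
proof -
  let ?A = "\<integral>x. w x * (norm (g x))\<^sup>2 \<partial>M" and ?B = "\<integral>x. (norm (\<kappa> x))\<^sup>2 / w x \<partial>M"
  let ?I = "\<integral>x. norm (g x * \<kappa> x) \<partial>M"
  have A0: "?A \<ge> 0" using less_imp_le[OF w] by (intro integral_nonneg_AE AE_I2 mult_nonneg_nonneg) simp_all
  have B0: "?B \<ge> 0" using less_imp_le[OF w] by (intro integral_nonneg_AE AE_I2 divide_nonneg_nonneg) simp_all
  \<comment> \<open>The pointwise inequality 2 p q \<le> p^2 + q^2 with a free balance
    \<open>l\<close>; its best value will give the product of the square roots.\<close>
  have key: "2 * ?I \<le> l * ?A + ?B / l" if l: "l > 0" for l
  proof -
    have "2 * ?I = (\<integral>x. 2 * norm (g x * \<kappa> x) \<partial>M)" by simp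
    also have "\<dots> \<le> (\<integral>x. l * (w x * (norm (g x))\<^sup>2) + (norm (\<kappa> x))\<^sup>2 / w x / l \<partial>M)"
    proof (rule integral_mono)
      show "integrable M (\<lambda>x. 2 * norm (g x * \<kappa> x))" using i by (intro integrable_mult_right integrable_norm)
      show "integrable M (\<lambda>x. l * (w x * (norm (g x))\<^sup>2) + (norm (\<kappa> x))\<^sup>2 / w x / l)"
        using A B by (intro Bochner_Integration.integrable_add integrable_mult_right integrable_divide_zero) auto
      fix x
      define p q where "p = sqrt (l * w x) * norm (g x)" and "q = norm (\<kappa> x) / sqrt (l * w x)"
      have lw: "l * w x > 0" using l w by simp
      then have r: "sqrt (l * w x) \<noteq> 0" by (metis less_irrefl real_sqrt_gt_0_iff)
      have "c * a * (b / c) = a * b" if "c \<noteq> 0" for a b c :: real using that by simp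
      from this[OF r] have "p * q = norm (g x * \<kappa> x)" unfolding p_def q_def norm_mult .
      moreover have "p\<^sup>2 = l * (w x * (norm (g x))\<^sup>2)" "q\<^sup>2 = (norm (\<kappa> x))\<^sup>2 / w x / l"
        using lw by (simp_all add: p_def q_def power_mult_distrib power_divide mult.commute)
      moreover have "2 * (p * q) \<le> p\<^sup>2 + q\<^sup>2" using sum_squares_bound[of p q] by simp
      ultimately show "2 * norm (g x * \<kappa> x) \<le> l * (w x * (norm (g x))\<^sup>2) + (norm (\<kappa> x))\<^sup>2 / w x / l" by simp
    qed
    also have "\<dots> = l * ?A + ?B / l"
    proof -
      have "integrable M (\<lambda>x. (norm (\<kappa> x))\<^sup>2 / w x / l)" using B by (intro integrable_divide_zero) simp
      then show ?thesis
        by (subst Bochner_Integration.integral_add[OF integrable_mult_right[OF A]]) (simp_all only: integral_mult_right_zero integral_divide_zero)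
    qed
    finally show ?thesis .
  qed
  have "?I \<le> sqrt ?A * sqrt ?B"
  proof -
    \<comment> \<open>The shift by \<open>e\<close> makes both quantities positive so that the best
      \<open>l\<close> exists; a limit removes it afterwards.\<close>
    have lim: "?I \<le> sqrt (?A + e) * sqrt (?B + e)" if e: "e > 0" for e
    proof -
      define p q where "p = sqrt (?A + e)" and "q = sqrt (?B + e)"
      have pq: "p > 0" "q > 0" "?A + e = p * p" "?B + e = q * q" using A0 B0 e by (simp_all add: p_def q_def)
      define l where "l = q / p"
      have l: "l > 0" using pq by (simp add: l_def)
      have "2 * ?I \<le> l * ?A + ?B / l" by (rule key[OF l])
      also have "\<dots> \<le> l * (?A + e) + (?B + e) / l" using l e by (intro add_mono mult_left_mono divide_right_mono) auto
      also have "\<dots> = 2 * (p * q)" unfolding pq(3,4) l_def using pq(1,2) by simp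
      finally have "?I \<le> p * q" by linarith
      then show ?thesis by (simp only: p_def q_def)
    qed
    have "((\<lambda>e. sqrt (?A + e) * sqrt (?B + e)) \<longlongrightarrow> sqrt (?A + 0) * sqrt (?B + 0)) (at_right 0)"
      by (intro tendsto_intros)
    then have "?I \<le> sqrt (?A + 0) * sqrt (?B + 0)"
    proof (rule tendsto_lowerbound)
      show "\<forall>\<^sub>F e in at_right 0. ?I \<le> sqrt (?A + e) * sqrt (?B + e)"
        using lim by (auto simp: eventually_at_right_less intro: eventually_mono[OF eventually_at_right_less])
    qed simp
    then show ?thesis by simp
  qed
  moreover have "norm (\<integral>x. g x * \<kappa> x \<partial>M) \<le> ?I" by (rule integral_norm_bound)
  ultimately show ?thesis by linarith
qed

lemma sobolev_pairing_bound:
  assumes U: "U \<in> sobolev s" and \<kappa>: "\<kappa> \<in> schwartz"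
    and i: "integrable lborel (\<lambda>\<xi>. (norm (\<kappa> \<xi>))\<^sup>2 / (1 + (norm \<xi>)\<^sup>2) powr s)"
  shows "norm (fourier U \<kappa>) \<le> sobolev_norm s U * sqrt (\<integral>\<xi>. (norm (\<kappa> \<xi>))\<^sup>2 / (1 + (norm \<xi>)\<^sup>2) powr s \<partial>lborel)"
proof -
  obtain g where g: "represents g (fourier U)" and gi: "integrable lborel (\<lambda>\<xi>. (1 + (norm \<xi>)\<^sup>2) powr s * (norm (g \<xi>))\<^sup>2)"
    using U unfolding sobolev_def by blast
  have "fourier U \<kappa> = (\<integral>\<xi>. g \<xi> * \<kappa> \<xi> \<partial>lborel)"
    using g \<kappa> unfolding represents_def distr_of_fun_def by simp
  moreover have "norm (\<integral>\<xi>. g \<xi> * \<kappa> \<xi> \<partial>lborel) \<le> sqrt (\<integral>\<xi>. (1 + (norm \<xi>)\<^sup>2) powr s * (norm (g \<xi>))\<^sup>2 \<partial>lborel)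
      * sqrt (\<integral>\<xi>. (norm (\<kappa> \<xi>))\<^sup>2 / (1 + (norm \<xi>)\<^sup>2) powr s \<partial>lborel)"
  proof (rule Cauchy_Schwarz_pairing[OF _ _ gi i])
    show "(1 + (norm \<xi>)\<^sup>2) powr s > 0" for \<xi> :: R2
    proof -
      have "1 + (norm \<xi>)\<^sup>2 > 0" by (intro add_pos_nonneg) simp_all
      then show ?thesis by simp
    qed
    show "integrable lborel (\<lambda>\<xi>. g \<xi> * \<kappa> \<xi>)" using g \<kappa> unfolding represents_def by blast
  qed
  ultimately show ?thesis unfolding sobolev_norm_eq[OF g] by simp
qed

section \<open>Fejer kernels in the angle\<close>

text \<open>For unimodular z this is z^l. The conjugate replaces the inverse, which gives a
  polynomial in z and its conjugate, as in \<open>Gm\<close>.\<close>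

definition Em :: "int \<Rightarrow> complex \<Rightarrow> complex" where
  "Em l z = (if l \<ge> 0 then z ^ nat l else cnj z ^ nat (- l))"

lemma Em_diff:
  assumes "norm z = 1"
  shows "z ^ j * cnj z ^ k = Em (int j - int k) z"
proof -
  have zz: "z * cnj z = 1" using assms by (simp add: complex_norm_square[symmetric] flip: of_real_power)
  then have p: "z ^ m * cnj z ^ m = 1" for m by (simp add: power_mult_distrib[symmetric])
  show ?thesis
  proof (cases "k \<le> j")
    case True
    then have "z ^ j * cnj z ^ k = z ^ (j - k) * (z ^ k * cnj z ^ k)"
      by (simp add: mult.assoc[symmetric] power_add[symmetric])
    then show ?thesis using True by (simp add: p Em_def nat_diff_distrib)
  next
    case False
    then have "z ^ j * cnj z ^ k = (z ^ j * cnj z ^ j) * cnj z ^ (k - j)"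
      by (simp add: mult.assoc power_add[symmetric])
    then show ?thesis using False by (simp add: p Em_def nat_diff_distrib)
  qed
qed

lemma norm_Em: "norm z = 1 \<Longrightarrow> norm (Em l z) = 1"
  by (simp add: Em_def norm_power)

lemma Em_cis: "Em l (cis \<theta> * z) = cis (of_int l * \<theta>) * Em l z"
  by (auto simp: Em_def power_mult_distrib Complex.DeMoivre cis_cnj)

text \<open>The Fejer kernel without the normalizing factor \<open>1 / n\<close>: nonnegative and peaked at \<open>z = 1\<close>.\<close>

definition Fj :: "nat \<Rightarrow> complex \<Rightarrow> real" where
  "Fj n z = (norm (\<Sum>j<n. z ^ j))\<^sup>2"

text \<open>This equals n - |l| for |l| < n. It is kept as a cardinality because it arises from
  grouping the terms of the expanded square in \<open>Fj\<close>.\<close>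

definition fc :: "nat \<Rightarrow> int \<Rightarrow> nat" where
  "fc n l = card {p \<in> {..<n} \<times> {..<n}. int (fst p) - int (snd p) = l}"

definition modes :: "nat \<Rightarrow> int set" where "modes n = {- int n<..<int n}"

lemma finite_modes [simp]: "finite (modes n)" by (simp add: modes_def)

lemma Fj_modes:
  assumes "norm z = 1"
  shows "of_real (Fj n z) = (\<Sum>l\<in>modes n. of_nat (fc n l) * Em l z)"
proof -
  let ?S = "{..<n} \<times> {..<n}" and ?g = "\<lambda>p. int (fst p) - int (snd p)"
  have "of_real (Fj n z) = (\<Sum>j<n. z ^ j) * cnj (\<Sum>k<n. z ^ k)"
    unfolding Fj_def by (simp only: complex_norm_square)
  also have "\<dots> = (\<Sum>p\<in>?S. z ^ fst p * cnj z ^ snd p)"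
    by (simp add: sum_product sum.cartesian_product split_def)
  also have "\<dots> = (\<Sum>p\<in>?S. Em (?g p) z)" using assms by (simp add: Em_diff)
  also have "\<dots> = (\<Sum>l\<in>modes n. \<Sum>p\<in>{p \<in> ?S. ?g p = l}. Em (?g p) z)"
    by (rule sum.group[symmetric]) (auto simp: modes_def)
  also have "\<dots> = (\<Sum>l\<in>modes n. of_nat (fc n l) * Em l z)"
    by (intro sum.cong refl) (simp add: fc_def)
  finally show ?thesis .
qed

lemma fc_le: "fc n l \<le> n"
proof -
  have "card {p \<in> {..<n} \<times> {..<n}. int (fst p) - int (snd p) = l} \<le> card {..<n}"
    by (rule card_inj_on_le[where f=fst]) (auto simp: inj_on_def)
  then show ?thesis by (simp add: fc_def)
qed

lemma fc_0: "fc n 0 = n"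
proof -
  have "{p \<in> {..<n} \<times> {..<n}. int (fst p) - int (snd p) = 0} = (\<lambda>j. (j, j)) ` {..<n}" by auto
  then show ?thesis by (simp add: fc_def card_image inj_on_def)
qed

lemma Fj_bound: "norm z \<le> 1 \<Longrightarrow> Fj n z \<le> (real n)\<^sup>2"
proof -
  assume z: "norm z \<le> 1"
  have "norm (\<Sum>j<n. z ^ j) \<le> (\<Sum>j<n. 1)"
    by (rule order_trans[OF norm_sum sum_mono]) (simp add: norm_power power_le_one z)
  then show ?thesis unfolding Fj_def by (intro power_mono) auto
qed

lemma Fj_nonneg: "0 \<le> Fj n z" by (simp add: Fj_def)

lemma cos_ge_half: "\<bar>x\<bar> \<le> 1 \<Longrightarrow> cos x \<ge> 1 / 2" for x :: real
proof -
  assume x: "\<bar>x\<bar> \<le> 1"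
  have "(sin (x / 2))\<^sup>2 \<le> (x / 2)\<^sup>2" by (rule abs_le_square_iff[THEN iffD1, OF abs_sin_x_le_abs_x])
  moreover have "(x / 2)\<^sup>2 \<le> (1 / 2)\<^sup>2" using x by (intro abs_le_square_iff[THEN iffD1]) auto
  moreover have "cos x = 1 - 2 * (sin (x / 2))\<^sup>2" using cos_double_sin[of "x / 2"] by simp
  ultimately show ?thesis by (simp add: power2_eq_square)
qed

text \<open>Every term of the sum has real part at least 1/2 in this range of angles, so the sum has
  real part at least n / 2.\<close>

lemma Fj_lower:
  assumes "n * \<bar>\<theta>\<bar> \<le> 1"
  shows "(real n)\<^sup>2 / 4 \<le> Fj n (cis \<theta>)"
proof -
  have "real n / 2 = (\<Sum>j<n. 1 / 2)" by simp
  also have "\<dots> \<le> (\<Sum>j<n. cos (real j * \<theta>))"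
  proof (intro sum_mono cos_ge_half)
    fix j assume "j \<in> {..<n}"
    then have "real j * \<bar>\<theta>\<bar> \<le> real n * \<bar>\<theta>\<bar>" by (intro mult_right_mono) auto
    then show "\<bar>real j * \<theta>\<bar> \<le> 1" using assms by (simp add: abs_mult)
  qed
  also have "\<dots> = Re (\<Sum>j<n. cis \<theta> ^ j)" by (simp add: Complex.DeMoivre Re_sum)
  also have "\<dots> \<le> norm (\<Sum>j<n. cis \<theta> ^ j)" by (rule complex_Re_le_cmod)
  finally have "(real n / 2)\<^sup>2 \<le> Fj n (cis \<theta>)" unfolding Fj_def by (intro power_mono) auto
  then show ?thesis by (simp add: power_divide)
qed

lemma sgn_eq_cis_arctan:
  assumes "a > 0"
  shows "sgn (Complex a b) = cis (arctan (b / a))"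
proof -
  have "sqrt (1 + (b / a)\<^sup>2) = norm (Complex a b) / a"
  proof -
    have "1 + (b / a)\<^sup>2 = (a\<^sup>2 + b\<^sup>2) / a\<^sup>2" using assms by (simp add: field_simps)
    then show ?thesis using assms by (simp add: real_sqrt_divide cmod_def)
  qed
  moreover have "norm (Complex a b) > 0" using assms by (simp add: complex_eq_iff)
  ultimately show ?thesis using assms
    by (simp add: complex_eq_iff cos_arctan sin_arctan sgn_div_norm divide_inverse mult.commute)
qed

lemma Fj_lower_sgn:
  assumes "a > 0" "n * \<bar>b\<bar> \<le> a"
  shows "(real n)\<^sup>2 / 4 \<le> Fj n (sgn (Complex a b))"
proof -
  have "n * \<bar>arctan (b / a)\<bar> \<le> n * \<bar>b / a\<bar>" by (intro mult_left_mono abs_arctan_le) auto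
  also have "\<dots> \<le> 1" using assms by (simp add: abs_div_pos[symmetric] pos_divide_le_eq)
  finally show ?thesis unfolding sgn_eq_cis_arctan[OF assms(1)] by (rule Fj_lower)
qed

text \<open>A radial profile times an angular exponential. The Fejer kernel built from these modes
  peaks in the direction of the conjugate of \<open>w\<close>: \<open>w = 1\<close> gives the
  positive horizontal axis and \<open>w = - \<i>\<close> the positive vertical one.\<close>

definition mf :: "(R2 \<Rightarrow> real) \<Rightarrow> complex \<Rightarrow> int \<Rightarrow> R2 \<Rightarrow> complex" where
  "mf h w l x = of_real (h x) * Em l (w * sgn (zz x))"

lemma zz_measurable [measurable]: "zz \<in> borel_measurable borel"
  by (rule borel_measurable_continuous_onI) (simp add: linear_continuous_on zz_linear)

lemma sgn_zz_measurable [measurable]: "(\<lambda>x. sgn (zz x)) \<in> borel_measurable borel"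
  unfolding sgn_div_norm by measurable

lemma mf_measurable [measurable]:
  assumes [measurable]: "h \<in> borel_measurable borel"
  shows "mf h w l \<in> borel_measurable borel"
  unfolding mf_def[abs_def] Em_def by measurable

lemma Fj_measurable: "(\<lambda>x. Fj n (w * sgn (zz x))) \<in> borel_measurable borel"
  unfolding Fj_def by measurable

lemma norm_w_sgn: "norm w = 1 \<Longrightarrow> x \<noteq> 0 \<Longrightarrow> norm (w * sgn (zz x)) = 1"
  using norm_zz[of x] by (auto simp: norm_mult norm_sgn simp del: norm_zz)

lemma norm_mf:
  assumes "norm w = 1" "h 0 = 0"
  shows "norm (mf h w l x) = \<bar>h x\<bar>"
proof (cases "x = 0")
  case True
  then show ?thesis using assms by (simp add: mf_def)
next
  case False
  show ?thesis unfolding mf_def norm_mult norm_Em[OF norm_w_sgn[OF assms(1) False]] by simp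
qed

definition radial :: "(R2 \<Rightarrow> real) \<Rightarrow> bool" where "radial h \<longleftrightarrow> (\<forall>x y. norm x = norm y \<longrightarrow> h x = h y)"

lemma radial_rot: "radial h \<Longrightarrow> h (rot \<theta> x) = h x"
  unfolding radial_def by (meson norm_rot)

lemma mf_rot: "radial h \<Longrightarrow> mf h w l (rot \<theta> x) = cis (of_int l * \<theta>) * mf h w l x"
proof -
  assume h: "radial h"
  have e: "w * sgn (zz (rot \<theta> x)) = cis \<theta> * (w * sgn (zz x))"
    unfolding zz_rot sgn_mult by (simp add: sgn_div_norm)
  show ?thesis unfolding mf_def radial_rot[OF h] e Em_cis by (rule mult.left_commute)
qed

lemma mf_mode: "radial h \<Longrightarrow> angular_mode l (mf h w l)"
  unfolding angular_mode_def using mf_rot by blast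

lemma mf_sum:
  assumes "norm w = 1" "h 0 = 0"
  shows "(\<Sum>l\<in>modes n. of_nat (fc n l) * mf h w l x) = of_real (h x * Fj n (w * sgn (zz x)))"
proof (cases "x = 0")
  case True then show ?thesis using assms by (simp add: mf_def)
next
  case False
  show ?thesis
    unfolding of_real_mult Fj_modes[OF norm_w_sgn[OF assms(1) False]] mf_def
    by (simp add: sum_distrib_left mult_ac)
qed

text \<open>Rotation by pi / l changes the sign of the function and preserves the measure.\<close>

lemma mode_integral_zero:
  assumes [measurable]: "f \<in> borel_measurable borel" and m: "angular_mode l f" and l: "l \<noteq> 0"
  shows "(\<integral>x. f x \<partial>lborel) = 0"
proof -
  let ?t = "pi / of_int l"
  have "(\<integral>x. f x \<partial>lborel) = (\<integral>x. f (rot ?t x) \<partial>lborel)" by (rule integral_rot[symmetric]) measurable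
  also have "\<dots> = (\<integral>x. cis (of_int l * ?t) * f x \<partial>lborel)"
    by (simp only: m[unfolded angular_mode_def, rule_format])
  also have "\<dots> = - (\<integral>x. f x \<partial>lborel)" using l by simp
  finally have "2 * (\<integral>x. f x \<partial>lborel) = 0" by simp
  then show ?thesis by simp
qed

text \<open>Orthogonality of the modes: the cross term of l and m is itself of mode l - m and
  integrates to zero by \<open>mode_integral_zero\<close>, while each single mode has modulus
  |h|.\<close>

lemma mode_sum_norm:
  assumes h[measurable]: "h \<in> borel_measurable borel" "radial h" "h 0 = 0" and \<rho>[measurable]: "\<rho> \<in> borel_measurable borel" "radial \<rho>"
    and w: "norm w = 1" and L: "finite L" and i: "integrable lborel (\<lambda>x. \<rho> x * (h x)\<^sup>2)"
  shows "integrable lborel (\<lambda>x. \<rho> x * (norm (\<Sum>l\<in>L. a l * mf h w l x))\<^sup>2)"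
    and "(\<integral>x. \<rho> x * (norm (\<Sum>l\<in>L. a l * mf h w l x))\<^sup>2 \<partial>lborel) = (\<Sum>l\<in>L. (norm (a l))\<^sup>2) * (\<integral>x. \<rho> x * (h x)\<^sup>2 \<partial>lborel)"
proof -
  define t where "t l m x = of_real (\<rho> x) * ((a l * mf h w l x) * cnj (a m * mf h w m x))" for l m x
  have nm: "norm (mf h w l x) = \<bar>h x\<bar>" for l x by (rule norm_mf[where h=h, OF w h(3)])
  have [measurable]: "t l m \<in> borel_measurable borel" for l m unfolding t_def[abs_def] by measurable
  have ti: "integrable lborel (t l m)" for l m
  proof (rule Bochner_Integration.integrable_bound[OF integrable_mult_right[OF i, of "norm (a l) * norm (a m)"]])
    have "norm (t l m x) = norm (norm (a l) * norm (a m) * (\<rho> x * (h x)\<^sup>2))" for x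
      unfolding t_def norm_mult complex_mod_cnj nm
      by (simp add: abs_mult power2_eq_square)
    then show "AE x in lborel. norm (t l m x) \<le> norm (norm (a l) * norm (a m) * (\<rho> x * (h x)\<^sup>2))" by simp
  qed simp
  have t0: "(\<integral>x. t l m x \<partial>lborel) = (if l = m then of_real ((norm (a l))\<^sup>2 * (\<integral>x. \<rho> x * (h x)\<^sup>2 \<partial>lborel)) else 0)" for l m
  proof (cases "l = m")
    case True
    have "t l l x = of_real ((norm (a l))\<^sup>2 * (\<rho> x * (h x)\<^sup>2))" for x
      unfolding t_def complex_norm_square[symmetric] norm_mult nm
      by (simp add: power_mult_distrib)
    then have "(\<integral>x. t l l x \<partial>lborel) = (\<integral>x. complex_of_real ((norm (a l))\<^sup>2 * (\<rho> x * (h x)\<^sup>2)) \<partial>lborel)" by presburger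
   also have "\<dots> = of_real (\<integral>x. (norm (a l))\<^sup>2 * (\<rho> x * (h x)\<^sup>2) \<partial>lborel)" by (rule integral_of_real) (rule integrable_mult_right[OF i])
    finally show ?thesis using True by simp
  next
    case False
    have am: "angular_mode (l - m) (t l m)"
      unfolding angular_mode_def
    proof (intro allI)
      fix \<theta> x
      have "cis (of_int (l - m) * \<theta>) = cis (of_int l * \<theta>) * cnj (cis (of_int m * \<theta>))"
        by (simp add: cis_cnj cis_mult left_diff_distrib)
      then show "t l m (rot \<theta> x) = cis (of_int (l - m) * \<theta>) * t l m x"
        unfolding t_def mf_rot[OF h(2)] radial_rot[OF \<rho>(2)] complex_cnj_mult by (simp only: mult_ac)
    qed
    from mode_integral_zero[OF _ am] False show ?thesis by simp
  qed
  have e: "of_real (\<rho> x * (norm (\<Sum>l\<in>L. a l * mf h w l x))\<^sup>2) = (\<Sum>l\<in>L. \<Sum>m\<in>L. t l m x)" for x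
    unfolding of_real_mult complex_norm_square t_def cnj_sum sum_product unfolding sum_distrib_left ..
  have I: "integrable lborel (\<lambda>x. complex_of_real (\<rho> x * (norm (\<Sum>l\<in>L. a l * mf h w l x))\<^sup>2))"
    unfolding e by (intro Bochner_Integration.integrable_sum ti)
  from integrable_Re[OF this] show i1: "integrable lborel (\<lambda>x. \<rho> x * (norm (\<Sum>l\<in>L. a l * mf h w l x))\<^sup>2)" by simp
  have "complex_of_real (\<integral>x. \<rho> x * (norm (\<Sum>l\<in>L. a l * mf h w l x))\<^sup>2 \<partial>lborel) = (\<Sum>l\<in>L. \<Sum>m\<in>L. (\<integral>x. t l m x \<partial>lborel))"
    unfolding integral_of_real[OF i1, symmetric] e
    by (subst Bochner_Integration.integral_sum, intro Bochner_Integration.integrable_sum ti)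
       (intro sum.cong refl Bochner_Integration.integral_sum ti)
  also have "\<dots> = (\<Sum>l\<in>L. of_real ((norm (a l))\<^sup>2 * (\<integral>x. \<rho> x * (h x)\<^sup>2 \<partial>lborel)))"
    unfolding t0 using L by simp
  also have "\<dots> = of_real ((\<Sum>l\<in>L. (norm (a l))\<^sup>2) * (\<integral>x. \<rho> x * (h x)\<^sup>2 \<partial>lborel))"
    by (simp add: sum_distrib_right)
  finally show "(\<integral>x. \<rho> x * (norm (\<Sum>l\<in>L. a l * mf h w l x))\<^sup>2 \<partial>lborel) = (\<Sum>l\<in>L. (norm (a l))\<^sup>2) * (\<integral>x. \<rho> x * (h x)\<^sup>2 \<partial>lborel)"
    by (simp only: of_real_eq_iff)
qed

lemma ang_weight_pos: "ang_weight \<sigma> l > 0"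
  by (simp add: ang_weight_def add_pos_nonneg one_plus_int_square_ne_0)

lemma ang_weight_square: "(ang_weight \<sigma> l)\<^sup>2 = (1 + (of_int l)\<^sup>2) powr \<sigma>"
  by (simp add: ang_weight_def power2_eq_square powr_add[symmetric])

text \<open>Averaging the Duhamel kernel in time makes its real part nonnegative.\<close>

definition Kr :: "real \<Rightarrow> real \<Rightarrow> real" where
  "Kr \<tau> x = (\<integral>s. (\<tau> - s) * cos (2 * s * x) * indicator {0..\<tau>} s \<partial>lborel)"

lemma Kr_integrable: "integrable lborel (\<lambda>s::real. (\<tau> - s) * cos (2 * s * x) * indicator {0..\<tau>} s)"
proof -
  have "continuous_on {0..\<tau>} (\<lambda>s. (\<tau> - s) * cos (2 * s * x))" by (intro continuous_intros)
  from borel_integrable_atLeastAtMost'[OF this] show ?thesis by (simp add: set_integrable_def mult.commute)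
qed

text \<open>In closed form the kernel is (1 - cos (2 \<tau> x)) / (4 x^2), a Fejer kernel on the
  line. The factor \<tau> - s is what a second integration in time leaves on the cosine.\<close>

lemma Kr_nonneg:
  assumes \<tau>: "\<tau> \<ge> 0"
  shows "Kr \<tau> x \<ge> 0"
proof (cases "x = 0")
  case True
  then show ?thesis unfolding Kr_def
    by (intro integral_nonneg_AE AE_I2) (auto simp: indicator_def)
next
  case False
  define F where "F s = (\<tau> - s) * (sin (2 * s * x) / (2 * x)) - cos (2 * s * x) / (4 * x\<^sup>2)" for s
  have "Kr \<tau> x = F \<tau> - F 0" unfolding Kr_def
  proof (rule integral_FTC_Icc_real[OF \<tau>])
    fix s
    show "(F has_real_derivative (\<tau> - s) * cos (2 * s * x)) (at s)"
      unfolding F_def using False by (auto intro!: derivative_eq_intros simp: field_simps power2_eq_square)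
    show "isCont (\<lambda>s. (\<tau> - s) * cos (2 * s * x)) s" by (intro continuous_intros)
  qed
  also have "\<dots> = (1 - cos (2 * \<tau> * x)) / (4 * x\<^sup>2)" by (simp add: F_def diff_divide_distrib)
  also have "\<dots> \<ge> 0" by (intro divide_nonneg_nonneg) auto
  finally show ?thesis .
qed

text \<open>While the phase stays below 1 the cosine is at least 1/2, and the integral of (\<tau> -
  s) / 2 over [0, \<tau>] is \<tau>^2 / 4.\<close>

lemma Kr_lower:
  assumes \<tau>: "0 \<le> \<tau>" and x: "2 * \<tau> * \<bar>x\<bar> \<le> 1"
  shows "Kr \<tau> x \<ge> \<tau>\<^sup>2 / 4"
proof -
  have "(\<integral>s. (\<tau> - s) / 2 * indicator {0..\<tau>} s \<partial>lborel) = \<tau> * \<tau> / 2 - \<tau>\<^sup>2 / 4 - (\<tau> * 0 / 2 - 0\<^sup>2 / 4)"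
    by (rule integral_FTC_Icc_real[OF \<tau>, of "\<lambda>s. \<tau> * s / 2 - s\<^sup>2 / 4"])
       (auto intro!: derivative_eq_intros continuous_intros simp: field_simps)
  then have "\<tau>\<^sup>2 / 4 = (\<integral>s. (\<tau> - s) / 2 * indicator {0..\<tau>} s \<partial>lborel)" by (simp add: power2_eq_square)
  also have "\<dots> \<le> Kr \<tau> x" unfolding Kr_def
  proof (rule integral_mono[OF _ Kr_integrable])
    have "continuous_on {0..\<tau>} (\<lambda>s. (\<tau> - s) / 2)" by (intro continuous_intros) auto
    from borel_integrable_atLeastAtMost'[OF this] show "integrable lborel (\<lambda>s. (\<tau> - s) / 2 * indicator {0..\<tau>} s)"
      by (simp add: set_integrable_def mult.commute)
    show "(\<tau> - s) / 2 * indicator {0..\<tau>} s \<le> (\<tau> - s) * cos (2 * s * x) * indicator {0..\<tau>} s" for s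
    proof (cases "s \<in> {0..\<tau>}")
      case True
      have "2 * s * \<bar>x\<bar> \<le> 2 * \<tau> * \<bar>x\<bar>" using True by (intro mult_right_mono) auto
      then have "\<bar>2 * s * x\<bar> \<le> 1" using x True by (simp add: abs_mult)
      then have "1 / 2 \<le> cos (2 * s * x)" by (rule cos_ge_half)
      then have "(\<tau> - s) * (1 / 2) \<le> (\<tau> - s) * cos (2 * s * x)" using True by (intro mult_left_mono) auto
      then show ?thesis using True by simp
    qed simp
  qed
  finally show ?thesis .
qed

text \<open>A power of z / |z| is a power of z, or of its conjugate, times the same power of 1 /
  |x|, and \<open>Gm\<close> contains these products. Here the flatness of \<open>gam\<close> at the
  origin pays off.\<close>

lemma mf_gam_schwartz: "mf gam w l \<in> schwartz"
proof -
  have g0: "gam 0 = 0" by (simp add: gam_def)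
  have s: "sgn (zz x) = zz x * of_real (inverse (norm x))" for x
    by (simp add: sgn_div_norm scaleR_conv_of_real mult.commute)
  show ?thesis
  proof (cases "l \<ge> 0")
    case True
    have "mf gam w l = (\<lambda>x. w ^ nat l * Gm (nat l) 0 (nat l) x)"
      using True by (auto simp: fun_eq_iff mf_def Em_def Gm_def s power_mult_distrib)
    then show ?thesis using schwartz_cmult[OF Gm_schwartz] by metis
  next
    case False
    have "mf gam w l = (\<lambda>x. cnj w ^ nat (- l) * Gm 0 (nat (- l)) (nat (- l)) x)"
      using False by (auto simp: fun_eq_iff mf_def Em_def Gm_def s power_mult_distrib)
    then show ?thesis using schwartz_cmult[OF Gm_schwartz] by metis
  qed
qed

lemma radial_gam: "radial gam"
  unfolding radial_def using gam_radial by blast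

lemma gam_measurable [measurable]: "gam \<in> borel_measurable borel"
  unfolding gam_def[abs_def] by measurable

lemma gam_0: "gam 0 = 0" by (simp add: gam_def)

lemma gam_le_1: "gam x \<le> 1" by (simp add: gam_def)

text \<open>For s < 0 the inverse weight grows polynomially; the rapid decay of one factor
  \<open>gam\<close> absorbs it and the other factor is integrable.\<close>

lemma gam_square_weight_integrable:
  "integrable lborel (\<lambda>x. inverse ((1 + (norm x)\<^sup>2) powr s) * (gam x)\<^sup>2)"
proof -
  obtain k :: nat where k: "- s \<le> real k" using real_arch_simple by blast
  obtain C where C: "\<And>x. (1 + norm x) ^ (2 * k) * norm (complex_of_real (gam x)) \<le> C"
    using schwartz_rapid[OF gam_schwartz] unfolding rapid_def by blast
  have gi: "integrable lborel (\<lambda>x. C * gam x)"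
    using integrable_Re[OF schwartz_integrable[OF gam_schwartz]] by simp
  show ?thesis
  proof (rule Bochner_Integration.integrable_bound[OF gi])
    have "norm (inverse ((1 + (norm x)\<^sup>2) powr s) * (gam x)\<^sup>2) \<le> norm (C * gam x)" for x :: R2
    proof -
      have 1: "1 \<le> 1 + (norm x)\<^sup>2" by simp
      have "inverse ((1 + (norm x)\<^sup>2) powr s) = (1 + (norm x)\<^sup>2) powr (- s)" by (simp add: powr_minus)
      also have "\<dots> \<le> (1 + (norm x)\<^sup>2) powr real k" using 1 k by (intro powr_mono) auto
      also have "\<dots> = (1 + (norm x)\<^sup>2) ^ k" using 1 by (intro powr_realpow) linarith
      also have "\<dots> \<le> ((1 + norm x)\<^sup>2) ^ k" by (intro power_mono) (simp_all add: power2_eq_square algebra_simps)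
      also have "\<dots> = (1 + norm x) ^ (2 * k)" by (simp add: power_mult)
      finally have "inverse ((1 + (norm x)\<^sup>2) powr s) * gam x \<le> (1 + norm x) ^ (2 * k) * gam x"
        by (rule mult_right_mono) (rule gam_nonneg)
      also have "\<dots> \<le> C" using C[of x] gam_nonneg[of x] by simp
      finally have "inverse ((1 + (norm x)\<^sup>2) powr s) * gam x * gam x \<le> C * gam x"
        by (rule mult_right_mono) (rule gam_nonneg)
      then have "inverse ((1 + (norm x)\<^sup>2) powr s) * (gam x)\<^sup>2 \<le> C * gam x" by (simp add: power2_eq_square mult.assoc)
      then show ?thesis by simp
    qed
    then show "AE x in lborel. norm (inverse ((1 + (norm x)\<^sup>2) powr s) * (gam x)\<^sup>2) \<le> norm (C * gam x)" by simp
  qed simp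
qed

lemma angular_mode_cmult: "angular_mode l f \<Longrightarrow> angular_mode l (\<lambda>x. c * f x)"
  unfolding angular_mode_def by (simp add: mult.left_commute)

lemma angular_mode_radial_mult: "angular_mode l f \<Longrightarrow> angular_mode l (\<lambda>x. g (norm x) * f x)"
  unfolding angular_mode_def by (simp add: mult.left_commute norm_rot)

lemma FT_sum:
  assumes "finite L" "\<And>l. l \<in> L \<Longrightarrow> integrable lborel (F l)"
  shows "FT c (\<lambda>x. \<Sum>l\<in>L. F l x) \<xi> = (\<Sum>l\<in>L. FT c (F l) \<xi>)"
  unfolding FT_def sum_distrib_left
  by (subst Bochner_Integration.integral_sum) (auto intro: FT_integrable assms simp: sum_divide_distrib)

lemma FT_cmult: "FT c (\<lambda>x. a * f x) \<xi> = a * FT c f \<xi>"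
  unfolding FT_def by (simp add: mult.left_commute)

text \<open>The transform of the test function has the same modes, so \<open>angular_op_fun\<close>
  multiplies them by their weights, and inversion brings the result back. The finitely many modes
  belong to the test function; \<open>m\<close> may come from a solution of unknown angular
  spectrum.\<close>

lemma angular_op_pairing:
  assumes L: "finite L" and K: "\<And>l. l \<in> L \<Longrightarrow> K l \<in> schwartz" "\<And>l. l \<in> L \<Longrightarrow> angular_mode l (K l)"
  shows "fourier (angular_op \<sigma> (distr_of_FT m)) (\<lambda>x. \<Sum>l\<in>L. K l x)
     = (\<integral>\<xi>. m \<xi> * (\<Sum>l\<in>L. of_real (ang_weight \<sigma> l) * K l \<xi>) \<partial>lborel)"
proof -
  let ?k = "\<lambda>x. \<Sum>l\<in>L. K l x" and ?k' = "\<lambda>x. \<Sum>l\<in>L. of_real (ang_weight \<sigma> l) * K l x"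
  have ks: "?k \<in> schwartz" by (intro schwartz_sum K)
  have ks': "?k' \<in> schwartz" by (intro schwartz_sum schwartz_cmult K)
  have Ki: "integrable lborel (K l)" if "l \<in> L" for l using K(1)[OF that] by (rule schwartz_integrable)
  have "fourier_fun ?k = (\<lambda>x. \<Sum>l\<in>L. FT (-1) (K l) x)"
    unfolding fourier_fun_FT by (intro ext FT_sum L Ki)
  then have "angular_op_fun \<sigma> (fourier_fun ?k) = (\<lambda>x. \<Sum>l\<in>L. of_real (ang_weight \<sigma> l) * FT (-1) (K l) x)"
    using angular_op_fun_modes[OF L, where F="\<lambda>l. FT (-1) (K l)" and \<sigma>=\<sigma>]
      angular_mode_FT[OF schwartz_measurable[OF K(1)] K(2)] by simp
  also have "\<dots> = fourier_fun ?k'"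
    unfolding fourier_fun_FT FT_cmult[symmetric] by (intro ext FT_sum[symmetric] L integrable_mult_right Ki)
  finally have e: "angular_op_fun \<sigma> (fourier_fun ?k) = fourier_fun ?k'" .
  show ?thesis
    using ks ks' fourier_fun_schwartz[OF ks] fourier_fun_schwartz[OF ks']
    by (simp add: fourier_def angular_op_def by_duality_def e distr_of_FT_def inv_fourier_fourier[OF ks'])
qed

text \<open>The phase is there to undo the free evolution of a solution; being radial it keeps the
  modes. The coefficients are divided by the weights in advance, since
  \<open>angular_op_pairing\<close> multiplies them back, and orthogonality evaluates the dual norm
  of the test function.\<close>

lemma phase_pairing_bound:
  assumes U: "distr_of_FT m \<in> ang_sobolev s \<sigma>" and w: "norm w = 1" and L: "finite L"
  shows "norm (\<integral>\<xi>. m \<xi> * (cis (- t * (norm \<xi>)\<^sup>2) * (\<Sum>l\<in>L. d l * mf gam w l \<xi>)) \<partial>lborel)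
    \<le> ang_sobolev_norm s \<sigma> (distr_of_FT m) *
      sqrt ((\<Sum>l\<in>L. (norm (d l / of_real (ang_weight \<sigma> l)))\<^sup>2) * (\<integral>x. inverse ((1 + (norm x)\<^sup>2) powr s) * (gam x)\<^sup>2 \<partial>lborel))"
proof -
  define e where "e l = d l / complex_of_real (ang_weight \<sigma> l)" for l
  define K where "K l x = cis (- t * (norm x)\<^sup>2) * (e l * mf gam w l x)" for l and x :: R2
  have Ks: "K l \<in> schwartz" for l
    unfolding K_def[abs_def] by (intro schwartz_mult_unimodular schwartz_cmult mf_gam_schwartz)
  have Km: "angular_mode l (K l)" for l
    unfolding K_def[abs_def]
    by (rule angular_mode_radial_mult[where g="\<lambda>r. cis (- t * r\<^sup>2)"]) (intro angular_mode_cmult mf_mode radial_gam)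
  have nK: "norm (\<Sum>l\<in>L. K l x) = norm (\<Sum>l\<in>L. e l * mf gam w l x)" for x
    unfolding K_def sum_distrib_left[symmetric] norm_mult by simp
  have r: "radial (\<lambda>x. inverse ((1 + (norm x)\<^sup>2) powr s))" by (simp add: radial_def)
  have rm: "(\<lambda>x::R2. inverse ((1 + (norm x)\<^sup>2) powr s)) \<in> borel_measurable borel" by measurable
  note msn = mode_sum_norm[OF gam_measurable radial_gam gam_0 rm r w L gam_square_weight_integrable, where a=e]
  have q: "(norm (\<Sum>l\<in>L. K l \<xi>))\<^sup>2 / (1 + (norm \<xi>)\<^sup>2) powr s = inverse ((1 + (norm \<xi>)\<^sup>2) powr s) * (norm (\<Sum>l\<in>L. e l * mf gam w l \<xi>))\<^sup>2" for \<xi>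
    by (simp add: nK divide_inverse mult.commute)
  have wn: "complex_of_real (ang_weight \<sigma> l) \<noteq> 0" for l using ang_weight_pos[of \<sigma> l] by simp
  have wK: "complex_of_real (ang_weight \<sigma> l) * K l \<xi> = cis (- t * (norm \<xi>)\<^sup>2) * (d l * mf gam w l \<xi>)" for l \<xi>
    using wn[of l] by (simp add: K_def e_def)
  have "norm (fourier (angular_op \<sigma> (distr_of_FT m)) (\<lambda>x. \<Sum>l\<in>L. K l x)) \<le> sobolev_norm s (angular_op \<sigma> (distr_of_FT m))
     * sqrt (\<integral>\<xi>. (norm (\<Sum>l\<in>L. K l \<xi>))\<^sup>2 / (1 + (norm \<xi>)\<^sup>2) powr s \<partial>lborel)"
    by (rule sobolev_pairing_bound) (use U msn(1) in \<open>auto simp: ang_sobolev_def q intro!: schwartz_sum Ks\<close>)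
  then show ?thesis
    unfolding angular_op_pairing[OF L Ks Km] wK sum_distrib_left[symmetric] q msn(2) ang_sobolev_norm_def unfolding e_def .
qed

text \<open>On finitely many modes the operator acts by its weights, and orthogonality then computes
  the norm exactly.\<close>

lemma mode_data:
  fixes b :: "int \<Rightarrow> complex"
  assumes h[measurable]: "h \<in> borel_measurable borel" "radial h" "h 0 = 0" and hi: "integrable lborel h"
    and \<sigma>: "\<sigma> < 1" and w: "norm w = 1" and L: "finite L"
    and i: "integrable lborel (\<lambda>x. (1 + (norm x)\<^sup>2) powr s * (h x)\<^sup>2)"
  defines "u \<equiv> distr_of_FT (\<lambda>x. \<Sum>l\<in>L. b l * mf h w l x)"
  shows "u \<in> ang_sobolev s \<sigma>"
    and "ang_sobolev_norm s \<sigma> u = sqrt ((\<Sum>l\<in>L. (norm (of_real (ang_weight \<sigma> l) * b l))\<^sup>2) * (\<integral>x. (1 + (norm x)\<^sup>2) powr s * (h x)\<^sup>2 \<partial>lborel))"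
proof -
  have mi: "integrable lborel (mf h w l)" for l
  proof (rule Bochner_Integration.integrable_bound[OF hi])
    show "AE x in lborel. norm (mf h w l x) \<le> norm (h x)"
      using norm_mf[where h=h, OF w h(3)] by simp
  qed simp
  have o: "angular_op \<sigma> u = distr_of_FT (\<lambda>x. \<Sum>l\<in>L. (of_real (ang_weight \<sigma> l) * b l) * mf h w l x)"
    unfolding u_def mult.assoc
    by (rule angular_op_distr_of_FT[OF \<sigma> L]) (intro integrable_mult_right mi angular_mode_cmult mf_mode h)+
  have r: "radial (\<lambda>x. (1 + (norm x)\<^sup>2) powr s)" by (simp add: radial_def)
  have rm: "(\<lambda>x::R2. (1 + (norm x)\<^sup>2) powr s) \<in> borel_measurable borel" by measurable
  note msn = mode_sum_norm[OF h rm r w L i, where a="\<lambda>l. of_real (ang_weight \<sigma> l) * b l"]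
  have I: "integrable lborel (\<lambda>x. \<Sum>l\<in>L. c l * mf h w l x)" for c
    by (intro Bochner_Integration.integrable_sum integrable_mult_right mi)
  show "u \<in> ang_sobolev s \<sigma>"
  proof -
    have "u \<in> tempered" unfolding u_def by (rule distr_of_FT_tempered[OF I])
    moreover have "angular_op \<sigma> u \<in> sobolev s" unfolding o by (rule sobolev_distr_of_FT[OF I msn(1)])
    ultimately show ?thesis unfolding ang_sobolev_def by blast
  qed
  show "ang_sobolev_norm s \<sigma> u = sqrt ((\<Sum>l\<in>L. (norm (of_real (ang_weight \<sigma> l) * b l))\<^sup>2) * (\<integral>x. (1 + (norm x)\<^sup>2) powr s * (h x)\<^sup>2 \<partial>lborel))"
    unfolding ang_sobolev_norm_def o sobolev_norm_distr_of_FT[OF I] msn(2) ..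
qed

lemma distr_of_FT_0: "distr_of_FT (\<lambda>_. 0) = (\<lambda>_. 0)"
  by (simp add: distr_of_FT_def fun_eq_iff)

text \<open>This pins down the value at zero of any data-to-solution map, the reference point for
  continuity at the origin.\<close>

lemma zero_smooth_solution: "smooth_solution \<eta> T (\<lambda>_. 0) (\<lambda>_ _. 0)"
proof -
  have "smooth_solution \<eta> T (distr_of_FT (\<lambda>_. 0)) (\<lambda>t. distr_of_FT (uhat (\<lambda>_. 0) t))"
  proof (rule uhat_smooth_solution[where c=1 and W="\<lambda>_. 0" and D=0])
    show "majorant 1 (\<lambda>_. 0)" by (auto simp: majorant_def)
    have "Qf (\<lambda>_. 0) s \<xi> = 0" for s \<xi> by (simp add: Qf_def)
    then show "mild_profile \<eta> T (\<lambda>_. 0) (\<lambda>_. 0)" by (simp add: mild_profile_def Bf_def cong: if_cong)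
  qed simp_all
  moreover have "uhat (\<lambda>_. 0) t = (\<lambda>_. 0)" for t by (simp add: uhat_def fun_eq_iff)
  ultimately show ?thesis by (simp add: distr_of_FT_0)
qed

section \<open>The annulus that carries the data\<close>

definition ann :: "nat \<Rightarrow> R2 \<Rightarrow> real" where
  "ann n x = indicat_real {x. (real n)\<^sup>2 \<le> (norm x)\<^sup>2 \<and> (norm x)\<^sup>2 \<le> (real n)\<^sup>2 + 4} x"

lemma ann_measurable [measurable]: "ann n \<in> borel_measurable borel"
  unfolding ann_def[abs_def] by measurable

lemma ann_radial: "radial (ann n)"
  unfolding radial_def ann_def indicator_def mem_Collect_eq by (intro allI impI) (simp only:)

lemma ann_0: "n \<ge> 1 \<Longrightarrow> ann n 0 = 0" by (simp add: ann_def)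

lemma ann_range: "0 \<le> ann n x" "ann n x \<le> 1" "(ann n x)\<^sup>2 = ann n x" by (simp_all add: ann_def indicator_def)

text \<open>The area of a disc is pi times its squared radius, so a fixed gap 4 between the squared
  radii makes the area independent of \<open>n\<close>; the width is of order 1 / n.\<close>

lemma ann_integral: "integrable lborel (ann n)" "(\<integral>x. ann n x \<partial>lborel) = 4 * pi"
proof -
  let ?R = "sqrt ((real n)\<^sup>2 + 4)"
  let ?A = "cball 0 ?R :: R2 set" and ?B = "ball 0 (real n) :: R2 set"
  have R: "real n \<le> ?R" by (rule real_le_rsqrt) simp
  have "x \<in> ?A - ?B \<longleftrightarrow> (real n)\<^sup>2 \<le> (norm x)\<^sup>2 \<and> (norm x)\<^sup>2 \<le> (real n)\<^sup>2 + 4" for x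
  proof -
    have "norm x \<le> ?R \<longleftrightarrow> (norm x)\<^sup>2 \<le> (real n)\<^sup>2 + 4"
      using real_sqrt_le_iff[of "(norm x)\<^sup>2" "(real n)\<^sup>2 + 4"] by simp
    moreover have "real n \<le> norm x \<longleftrightarrow> (real n)\<^sup>2 \<le> (norm x)\<^sup>2"
      using abs_le_square_iff[of "real n" "norm x"] by (simp only: abs_norm_cancel abs_of_nat)
    ultimately show ?thesis by auto
  qed
  then have "{x. (real n)\<^sup>2 \<le> (norm x)\<^sup>2 \<and> (norm x)\<^sup>2 \<le> (real n)\<^sup>2 + 4} = ?A - ?B"
    by (intro set_eqI) (simp only: mem_Collect_eq)
  then have e: "ann n = indicat_real (?A - ?B)" unfolding ann_def[abs_def] by (simp only:)
  have BA: "?B \<subseteq> ?A" using R by (auto)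
  have fA: "emeasure lborel ?A \<noteq> \<infinity>" using emeasure_lborel_cball_finite[of "0::R2" ?R] by simp
  have "measure lborel (?A - ?B) = measure lborel ?A - measure lborel ?B"
    using BA fA by (intro measure_Diff) auto
  also have "\<dots> = pi * ?R\<^sup>2 - pi * (real n)\<^sup>2"
    using content_cball[of ?R "0::R2"] content_ball[of "real n" "0::R2"] by (simp add: unit_ball_vol_2 power2_eq_square)
  also have "\<dots> = 4 * pi" by (simp add: algebra_simps)
  finally have m: "measure lborel (?A - ?B) = 4 * pi" .
  have f: "emeasure lborel (?A - ?B) < \<infinity>"
    by (rule order_le_less_trans[OF emeasure_mono[of _ ?A]]) (use fA in \<open>auto simp: top.not_eq_extremum\<close>)
  show "integrable lborel (ann n)" unfolding e using f by (intro integrable_real_indicator) auto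
  show "(\<integral>x. ann n x \<partial>lborel) = 4 * pi" unfolding e using m by simp
qed

section \<open>The quadratic iterate\<close>

lemma sigma_finite_pair_lborel: "sigma_finite_measure (lborel \<Otimes>\<^sub>M lborel :: (R2 \<times> R2) measure)"
  using lborel.sigma_finite_measure_axioms by (simp add: lborel_prod)

lemma continuous_on_lborel_measurable:
  "continuous_on UNIV f \<Longrightarrow> f \<in> borel_measurable lborel" for f :: "'a::euclidean_space \<Rightarrow> 'b::topological_space"
  by (simp add: borel_measurable_continuous_onI)

text \<open>Integrating \<open>F\<close> over t in [0, \<tau>] counts an interaction at time s with
  the length \<tau> - s of the later times. Exchanging time and frequencies leaves a time integral
  whose real part is \<open>Kr\<close>. The last claim makes a uniform bound on \<open>F\<close> a
  bound on this real quantity.\<close>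

lemma averaged_Bf:
  fixes \<phi> \<psi> :: "R2 \<Rightarrow> real"
  assumes W: "majorant c W" and c: "c > 0" and \<phi>m[measurable]: "\<phi> \<in> borel_measurable borel" and \<phi>: "\<And>\<xi>. \<bar>\<phi> \<xi>\<bar> \<le> W \<xi>"
    and \<psi>m[measurable]: "\<psi> \<in> borel_measurable borel" and \<psi>: "\<And>\<xi>. \<bar>\<psi> \<xi>\<bar> \<le> B"
    and \<tau>: "0 \<le> \<tau>" "\<tau> \<le> T"
  defines "g \<equiv> \<lambda>p. \<psi> (fst p) * (\<phi> (fst p + snd p) * \<phi> (snd p))"
  defines "F \<equiv> \<lambda>t. \<integral>\<xi>. of_real (\<psi> \<xi>) * Bf T (\<lambda>p. of_real (\<phi> (snd p))) (t, \<xi>) \<partial>lborel"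
  shows "integrable (lborel \<Otimes>\<^sub>M lborel) (\<lambda>p. g p * Kr \<tau> (fst p \<bullet> snd p))"
    and "Re (\<integral>t. of_real (indicat_real {0..\<tau>} t) * F t \<partial>lborel) = (\<integral>p. g p * Kr \<tau> (fst p \<bullet> snd p) \<partial>(lborel \<Otimes>\<^sub>M lborel))"
    and "\<And>K. (\<And>t. 0 \<le> t \<Longrightarrow> t \<le> \<tau> \<Longrightarrow> norm (F t) \<le> K) \<Longrightarrow> (\<integral>p. g p * Kr \<tau> (fst p \<bullet> snd p) \<partial>(lborel \<Otimes>\<^sub>M lborel)) \<le> \<tau> * K"
proof -
  let ?w = "\<lambda>p::real \<times> R2. complex_of_real (\<phi> (snd p))"
  let ?L = "lborel \<Otimes>\<^sub>M lborel :: (R2 \<times> R2) measure"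
  have wm: "?w \<in> borel_measurable borel" using measurable_snd_arg[OF \<phi>m] by measurable
  have bw: "norm (?w (s, \<xi>)) \<le> 1 * W \<xi>" for s \<xi> using \<phi>[of \<xi>] by simp
  have \<psi>c: "(\<lambda>\<xi>. complex_of_real (\<psi> \<xi>)) \<in> borel_measurable borel" by measurable
  have \<psi>b: "norm (complex_of_real (\<psi> \<xi>)) \<le> B" for \<xi> using \<psi>[of \<xi>] by simp
  have \<phi>i: "integrable lborel (\<lambda>x. complex_of_real (\<phi> x))"
  proof (rule Bochner_Integration.integrable_bound[OF majorantD(4)[OF W]])
    show "AE x in lborel. norm (complex_of_real (\<phi> x)) \<le> norm (W x)"
      using order_trans[OF \<phi> abs_ge_self] by (intro AE_I2) simp
  qed simp
  have gi: "integrable ?L (\<lambda>p. complex_of_real (g p))"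
  proof -
    have "integrable ?L (\<lambda>p. complex_of_real (\<phi> (fst p + snd p)) * complex_of_real (\<phi> (snd p)))"
      using corr_integrable(2)[OF \<phi>i \<phi>i] by (simp add: split_def)
    moreover have "(\<lambda>p. complex_of_real (\<psi> (fst p))) \<in> borel_measurable ?L" by measurable
    ultimately have "integrable ?L (\<lambda>p. complex_of_real (\<psi> (fst p)) * (complex_of_real (\<phi> (fst p + snd p)) * complex_of_real (\<phi> (snd p))))"
      by (rule integrable_mult_bounded(1)) (rule \<psi>b)
    then show ?thesis by (simp add: g_def)
  qed
  define H where "H s = (\<integral>\<xi>. of_real (\<psi> \<xi>) * Qf ?w s \<xi> \<partial>lborel)" for s
  have Hp: "H s = (\<integral>p. cis (2 * s * (fst p \<bullet> snd p)) * of_real (g p) \<partial>?L)" for s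
  proof -
    have i: "integrable ?L (\<lambda>(\<xi>, \<zeta>). cis (2 * s * (\<xi> \<bullet> \<zeta>)) * of_real (g (\<xi>, \<zeta>)))"
    proof -
      have "(\<lambda>p. cis (2 * s * (fst p \<bullet> snd p))) \<in> borel_measurable ?L"
        unfolding lborel_prod by (rule continuous_on_lborel_measurable, intro continuous_intros)
      from integrable_mult_bounded(1)[OF gi this, of 1] show ?thesis by (simp add: split_def)
    qed
    have "(\<integral>p. cis (2 * s * (fst p \<bullet> snd p)) * of_real (g p) \<partial>?L) = (\<integral>\<xi>. \<integral>\<zeta>. cis (2 * s * (\<xi> \<bullet> \<zeta>)) * of_real (g (\<xi>, \<zeta>)) \<partial>lborel \<partial>lborel)"
      using lborel_pair.integral_fst[OF i] by (simp add: split_def)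
    also have "\<dots> = H s"
      unfolding H_def Qf_def g_def
      by (intro Bochner_Integration.integral_cong refl) (simp add: mult_ac flip: integral_mult_right_zero)
    finally show ?thesis ..
  qed
  define r where "r s = complex_of_real (indicat_real {0..\<tau>} s)" for s
  have rm[measurable]: "r \<in> borel_measurable borel" unfolding r_def[abs_def] by measurable
  have ri: "integrable lborel r" unfolding r_def[abs_def] by (intro integrable_of_real integrable_indicator_Icc)
  have Hi: "integrable lborel (\<lambda>s. r s * H s)"
  proof -
    have "r s * H s = (if 0 \<le> s \<and> s \<le> \<tau> \<and> s \<le> T then H s else 0)" for s
      using \<tau> by (auto simp: r_def indicator_def)
    then show ?thesis unfolding H_def
      using Bf_pairing(1)[OF W c wm bw \<psi>c \<psi>b, of \<tau> T] by presburger
  qed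
  \<comment> \<open>The condition s \<le> t becomes a kernel bounded by 1, so that
    \<open>Fubini_kernel\<close> can exchange the two times.\<close>
  have Ft: "r t * F t = r t * (\<integral>s. of_bool (s \<le> t) * (r s * H s) \<partial>lborel)" for t
  proof (cases "t \<in> {0..\<tau>}")
    case True
    have "(if 0 \<le> s \<and> s \<le> t \<and> s \<le> T then H s else 0) = of_bool (s \<le> t) * (r s * H s)" for s
      using \<tau> True by (auto simp: r_def indicator_def)
    then have "F t = (\<integral>s. of_bool (s \<le> t) * (r s * H s) \<partial>lborel)"
      unfolding F_def Bf_pairing(2)[OF W c wm bw \<psi>c \<psi>b] H_def[symmetric] by presburger
    then show ?thesis by simp
  qed (simp add: r_def)
  have k1: "(\<lambda>(t, s). of_bool (s \<le> t) :: complex) \<in> borel_measurable (lborel \<Otimes>\<^sub>M lborel :: (real \<times> real) measure)"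
    by measurable
  have "(\<integral>t. r t * F t \<partial>lborel) = (\<integral>s. (r s * H s) * (\<integral>t. of_bool (s \<le> t) * r t \<partial>lborel) \<partial>lborel)"
    unfolding Ft
    by (rule Fubini_kernel(1)[where C=1, OF lborel.sigma_finite_measure_axioms lborel.sigma_finite_measure_axioms ri Hi k1]) simp
  also have "\<dots> = (\<integral>s. ((\<tau> - s) * indicat_real {0..\<tau>} s) * (\<integral>p. cis (2 * s * (fst p \<bullet> snd p)) * of_real (g p) \<partial>?L) \<partial>lborel)"
  proof (intro Bochner_Integration.integral_cong refl)
    fix s :: real
    show "(r s * H s) * (\<integral>t. of_bool (s \<le> t) * r t \<partial>lborel) = ((\<tau> - s) * indicat_real {0..\<tau>} s) * (\<integral>p. cis (2 * s * (fst p \<bullet> snd p)) * of_real (g p) \<partial>?L)"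
    proof (cases "s \<in> {0..\<tau>}")
      case True
      have "of_bool (s \<le> t) * r t = complex_of_real (indicat_real {s..\<tau>} t)" for t
        using True by (auto simp: r_def indicator_def)
      then have "(\<integral>t. of_bool (s \<le> t) * r t \<partial>lborel) = complex_of_real (\<integral>t. indicat_real {s..\<tau>} t \<partial>lborel)"
        by (simp only: integral_of_real[OF integrable_indicator_Icc])
      also have "\<dots> = of_real (\<tau> - s)" using True by simp
      finally show ?thesis unfolding Hp by (simp add: r_def)
    qed (simp add: r_def)
  qed
  also have "\<dots> = (\<integral>p. of_real (g p) * (\<integral>s. cis (2 * s * (fst p \<bullet> snd p)) * ((\<tau> - s) * indicat_real {0..\<tau>} s) \<partial>lborel) \<partial>?L)"
  proof (rule Fubini_kernel(1)[where C=1, OF lborel.sigma_finite_measure_axioms sigma_finite_pair_lborel _ gi])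
    show "integrable lborel (\<lambda>s. complex_of_real ((\<tau> - s) * indicat_real {0..\<tau>} s))"
      using Kr_integrable[of \<tau> 0] by (intro integrable_of_real) simp
    have "(\<lambda>q::real \<times> (R2 \<times> R2). cis (2 * fst q * (fst (snd q) \<bullet> snd (snd q)))) \<in> borel_measurable lborel"
      by (rule continuous_on_lborel_measurable, intro continuous_intros)
    then show "(\<lambda>(s, p). cis (2 * s * (fst p \<bullet> snd p))) \<in> borel_measurable (lborel \<Otimes>\<^sub>M ?L)"
      by (simp add: split_def lborel_prod)
  qed simp
  finally have E: "(\<integral>t. r t * F t \<partial>lborel) = (\<integral>p. of_real (g p) * (\<integral>s. cis (2 * s * (fst p \<bullet> snd p)) * ((\<tau> - s) * indicat_real {0..\<tau>} s) \<partial>lborel) \<partial>?L)" .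
  have EI: "integrable ?L (\<lambda>p. complex_of_real (g p) * (\<integral>s. cis (2 * s * (fst p \<bullet> snd p)) * ((\<tau> - s) * indicat_real {0..\<tau>} s) \<partial>lborel))"
  proof (rule integrable_mult_bounded(2)[OF gi])
    have "(\<lambda>(p, s). cis (2 * s * (fst p \<bullet> snd p)) * complex_of_real ((\<tau> - s) * indicat_real {0..\<tau>} s)) \<in> borel_measurable (?L \<Otimes>\<^sub>M lborel)"
    proof -
      have "(\<lambda>q::(R2 \<times> R2) \<times> real. cis (2 * snd q * (fst (fst q) \<bullet> snd (fst q)))) \<in> borel_measurable lborel"
        by (rule continuous_on_lborel_measurable, intro continuous_intros)
      then have [measurable]: "(\<lambda>(p, s). cis (2 * s * (fst p \<bullet> snd p))) \<in> borel_measurable (?L \<Otimes>\<^sub>M lborel)"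
        by (simp add: split_def lborel_prod)
      show ?thesis by measurable
    qed
    from lborel.borel_measurable_lebesgue_integral[OF this]
    show "(\<lambda>p. \<integral>s. cis (2 * s * (fst p \<bullet> snd p)) * ((\<tau> - s) * indicat_real {0..\<tau>} s) \<partial>lborel) \<in> borel_measurable ?L" .
    show "norm (\<integral>s. cis (2 * s * (fst p \<bullet> snd p)) * ((\<tau> - s) * indicat_real {0..\<tau>} s) \<partial>lborel) \<le> (\<integral>s. norm (complex_of_real ((\<tau> - s) * indicat_real {0..\<tau>} s)) \<partial>lborel)" for p :: "R2 \<times> R2"
      using integral_norm_bound[of lborel "\<lambda>s. cis (2 * s * (fst p \<bullet> snd p)) * ((\<tau> - s) * indicat_real {0..\<tau>} s)"]
      by (simp only: norm_mult norm_cis mult_1_left)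
  qed
  have ci: "integrable lborel (\<lambda>s. cis (2 * s * x) * complex_of_real ((\<tau> - s) * indicat_real {0..\<tau>} s))" for x
  proof (rule integrable_mult_bounded(1)[where C=1])
    show "integrable lborel (\<lambda>s. complex_of_real ((\<tau> - s) * indicat_real {0..\<tau>} s))"
      using Kr_integrable[of \<tau> 0] by (intro integrable_of_real) simp
    show "(\<lambda>s. cis (2 * s * x)) \<in> borel_measurable lborel"
      by (rule continuous_on_lborel_measurable, intro continuous_intros)
  qed simp
  have KR: "Re (\<integral>s. cis (2 * s * x) * ((\<tau> - s) * indicat_real {0..\<tau>} s) \<partial>lborel) = Kr \<tau> x" for x
    unfolding Kr_def integral_Re[OF ci, symmetric]
    by (intro Bochner_Integration.integral_cong refl) (simp add: mult_ac)
  have Rg: "Re (complex_of_real (g p) * (\<integral>s. cis (2 * s * (fst p \<bullet> snd p)) * ((\<tau> - s) * indicat_real {0..\<tau>} s) \<partial>lborel)) = g p * Kr \<tau> (fst p \<bullet> snd p)" for p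
    using KR[of "fst p \<bullet> snd p"] by simp
  show I: "integrable ?L (\<lambda>p. g p * Kr \<tau> (fst p \<bullet> snd p))"
    using integrable_Re[OF EI] unfolding Rg .
  show R: "Re (\<integral>t. of_real (indicat_real {0..\<tau>} t) * F t \<partial>lborel) = (\<integral>p. g p * Kr \<tau> (fst p \<bullet> snd p) \<partial>?L)"
    unfolding r_def[symmetric] E integral_Re[OF EI, symmetric] Rg ..
  fix K assume K: "\<And>t. 0 \<le> t \<Longrightarrow> t \<le> \<tau> \<Longrightarrow> norm (F t) \<le> K"
  have "(\<integral>p. g p * Kr \<tau> (fst p \<bullet> snd p) \<partial>?L) \<le> norm (\<integral>t. r t * F t \<partial>lborel)"
    unfolding R[symmetric] r_def by (rule complex_Re_le_cmod)
  also have "\<dots> \<le> (\<integral>t. norm (r t * F t) \<partial>lborel)" by (rule integral_norm_bound)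
  also have "\<dots> \<le> (\<integral>t. indicat_real {0..\<tau>} t * K \<partial>lborel)"
  proof (rule Bochner_Integration.integral_mono')
    show "integrable lborel (\<lambda>t. indicat_real {0..\<tau>} t * K)" by (intro integrable_mult_left integrable_indicator_Icc)
    show "norm (r t * F t) \<le> indicat_real {0..\<tau>} t * K" for t
      using K[of t] by (auto simp: r_def indicator_def norm_mult)
    show "0 \<le> indicat_real {0..\<tau>} t * K" for t
      using order_trans[OF norm_ge_zero K[of t]] by (auto simp: indicator_def)
  qed
  also have "\<dots> = \<tau> * K" using \<tau> by simp
  finally show "(\<integral>p. g p * Kr \<tau> (fst p \<bullet> snd p) \<partial>?L) \<le> \<tau> * K" .
qed

text \<open>The exponent is at least - 4 - 5/4.\<close>

lemma gam_lower:
  assumes "1 / 4 \<le> (norm x)\<^sup>2" "(norm x)\<^sup>2 \<le> 5 / 4"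
  shows "exp (- 6) \<le> gam x"
proof -
  have x: "x \<noteq> 0" using assms by auto
  have "(inverse (norm x))\<^sup>2 = inverse ((norm x)\<^sup>2)" by (simp add: power_inverse)
  also have "\<dots> \<le> inverse (1 / 4)" using assms by (intro le_imp_inverse_le) auto
  finally show ?thesis using assms x by (simp add: gam_def)
qed

text \<open>(n + 1/n)^2 exceeds n^2 by 2 + 1/n^2 \<le> 3 and b^2 adds at most 1, which uses up the
  gap 4 of the annulus.\<close>

lemma ann_eq_1:
  assumes "real n \<le> a" "a \<le> real n + 1 / real n" "\<bar>b\<bar> \<le> 1" "n \<ge> 1"
  shows "ann n (a, b) = 1"
proof -
  have nr: "(norm (a, b))\<^sup>2 = a\<^sup>2 + b\<^sup>2" by (simp add: norm_prod_def)
  have "a\<^sup>2 \<le> (real n + 1 / real n)\<^sup>2" using assms by (intro power_mono) auto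
  also have "\<dots> = (real n)\<^sup>2 + 2 + (1 / real n)\<^sup>2" using assms by (simp add: power2_eq_square field_simps)
  also have "\<dots> \<le> (real n)\<^sup>2 + 3" using assms by (simp add: power_le_one)
  finally have 1: "a\<^sup>2 \<le> (real n)\<^sup>2 + 3" .
  have 2: "b\<^sup>2 \<le> 1" using assms(3) by (simp add: abs_square_le_1)
  have 3: "(real n)\<^sup>2 \<le> a\<^sup>2" using assms by (intro power_mono) auto
  have "(real n)\<^sup>2 \<le> a\<^sup>2 + b\<^sup>2" using 3 by (simp add: add_increasing2)
  then show ?thesis using 1 2 unfolding ann_def indicator_def mem_Collect_eq nr by simp
qed

text \<open>All factors of the integrand are nonnegative, so the integral may be restricted to a
  product of two boxes. There each of the three Fejer kernels is at least n^2 / 4,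
  \<open>gam\<close> is at least exp (- 6) and \<open>Kr\<close> at least \<tau>^2 / 4. The areas
  multiply to 1 / (8 n^2), whence 4^3 * 4 * 8 = 2048.\<close>

lemma resonant_lower_bound:
  assumes n: "n \<ge> 1" and B: "0 \<le> B" and \<tau>: "0 \<le> \<tau>" "\<tau> \<le> 1 / 4"
  defines "\<phi> \<equiv> \<lambda>x. B * (ann n x * Fj n (1 * sgn (zz x)))" and "\<psi> \<equiv> \<lambda>x. gam x * Fj n (- \<i> * sgn (zz x))"
  defines "g \<equiv> \<lambda>p. \<psi> (fst p) * (\<phi> (fst p + snd p) * \<phi> (snd p))"
  assumes i: "integrable (lborel \<Otimes>\<^sub>M lborel) (\<lambda>p. g p * Kr \<tau> (fst p \<bullet> snd p))"
  shows "exp (- 6) / 2048 * B\<^sup>2 * real n ^ 4 * \<tau>\<^sup>2 \<le> (\<integral>p. g p * Kr \<tau> (fst p \<bullet> snd p) \<partial>(lborel \<Otimes>\<^sub>M lborel))"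
proof -
  let ?L = "lborel \<Otimes>\<^sub>M lborel :: (R2 \<times> R2) measure"
  define N where "N = real n"
  have N: "N \<ge> 1" using n by (simp add: N_def)
  \<comment> \<open>Output frequencies. The small first coordinate keeps the kernel of
    \<open>\<psi>\<close> near its peak, and the height between 1/2 and 1 keeps \<open>gam\<close>
    bounded below.\<close>
  define Q1 :: "R2 set" where "Q1 = cbox (0, 1 / 2) (1 / (2 * N), 1)"
  \<comment> \<open>The second coordinate is nonpositive so that adding a point of \<open>Q1\<close>
    leaves it in [-1, 1]. The first one uses half of the admissible width 1 / N; the other half is
    left for the sum.\<close>
  define Q2 :: "R2 set" where "Q2 = cbox (N, - 1) (N + 1 / (2 * N), 0)"
  have \<phi>0: "0 \<le> \<phi> x" for x unfolding \<phi>_def using B by (intro mult_nonneg_nonneg ann_range Fj_nonneg)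
  have \<psi>0: "0 \<le> \<psi> x" for x unfolding \<psi>_def by (intro mult_nonneg_nonneg gam_nonneg Fj_nonneg)
  have g0: "0 \<le> g p" for p unfolding g_def by (intro mult_nonneg_nonneg \<phi>0 \<psi>0)
  have h: "1 / (2 * N) \<le> 1 / 2" "0 \<le> 1 / (2 * N)" "1 / (2 * N) + 1 / (2 * N) = 1 / N" "1 / N \<le> 1" using N by (auto simp: field_simps)
  have \<phi>l: "B * (N\<^sup>2 / 4) \<le> \<phi> (a, b)" if "N \<le> a" "a \<le> N + 1 / N" "\<bar>b\<bar> \<le> 1" for a b
  proof -
    have A: "ann n (a, b) = 1" by (rule ann_eq_1) (use that n in \<open>simp_all add: N_def\<close>)
    have "(real n)\<^sup>2 / 4 \<le> Fj n (sgn (Complex a b))"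
    proof (rule Fj_lower_sgn)
      show "a > 0" using that N by simp
      have "N * \<bar>b\<bar> \<le> N * 1" using that N by (intro mult_left_mono) auto
      then show "real n * \<bar>b\<bar> \<le> a" using that by (simp add: N_def)
    qed
    then have "B * (N\<^sup>2 / 4) \<le> B * Fj n (sgn (Complex a b))" unfolding N_def by (intro mult_left_mono B)
    then show ?thesis by (simp add: \<phi>_def A zz_def)
  qed
  have \<psi>l: "exp (- 6) * (N\<^sup>2 / 4) \<le> \<psi> (x, y)" if "0 \<le> x" "x \<le> 1 / (2 * N)" "1 / 2 \<le> y" "y \<le> 1" for x y
  proof -
    have nr: "(norm (x, y))\<^sup>2 = x\<^sup>2 + y\<^sup>2" by (simp add: norm_prod_def)
    have y2: "(1 / 2)\<^sup>2 \<le> y\<^sup>2" "y\<^sup>2 \<le> 1\<^sup>2" using that by (intro power_mono; simp)+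
    have "x\<^sup>2 \<le> (1 / 2)\<^sup>2" using that h by (intro power_mono) auto
    then have "x\<^sup>2 + y\<^sup>2 \<le> 5 / 4" using y2 by (simp add: power2_eq_square)
    moreover have "1 / 4 \<le> x\<^sup>2 + y\<^sup>2" using y2 by (intro add_increasing) (simp_all add: power2_eq_square)
    ultimately have g: "exp (- 6) \<le> gam (x, y)" by (intro gam_lower) (simp_all only: nr)
    have "(real n)\<^sup>2 / 4 \<le> Fj n (sgn (Complex y (- x)))"
    proof (rule Fj_lower_sgn)
      show "y > 0" using that by simp
      have "N * x \<le> N * (1 / (2 * N))" using that N by (intro mult_left_mono) auto
      then have "N * x \<le> 1 / 2" using N by simp
      then show "real n * \<bar>- x\<bar> \<le> y" using that by (simp add: N_def)
    qed
    moreover have "sgn (Complex y (- x)) = - \<i> * sgn (zz (x, y))"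
    proof -
      have "Complex y (- x) = - \<i> * zz (x, y)" by (simp add: zz_def complex_eq_iff)
      then show ?thesis by (simp only: sgn_mult) (simp add: sgn_div_norm)
    qed
    ultimately have "N\<^sup>2 / 4 \<le> Fj n (- \<i> * sgn (zz (x, y)))" by (simp only: N_def)
    then show ?thesis unfolding \<psi>_def by (intro mult_mono g) (auto simp: gam_nonneg)
  qed
  define M where "M = exp (- 6) * (N\<^sup>2 / 4) * ((B * (N\<^sup>2 / 4)) * (B * (N\<^sup>2 / 4))) * (\<tau>\<^sup>2 / 4)"
  have M0: "0 \<le> M" unfolding M_def using B N by simp
  have low: "M \<le> g p * Kr \<tau> (fst p \<bullet> snd p)" if p: "p \<in> Q1 \<times> Q2" for p
  proof -
    obtain x y a b where P: "p = ((x, y), (a, b))" by (metis surj_pair)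
    have xy: "0 \<le> x" "x \<le> 1 / (2 * N)" "1 / 2 \<le> y" "y \<le> 1"
      and ab: "N \<le> a" "a \<le> N + 1 / (2 * N)" "- 1 \<le> b" "b \<le> 0"
      using p unfolding P Q1_def Q2_def by (auto simp: cbox_Pair_eq)
    have "B * (N\<^sup>2 / 4) \<le> \<phi> (x + a, y + b)" using xy ab h by (intro \<phi>l) auto
    moreover have "B * (N\<^sup>2 / 4) \<le> \<phi> (a, b)" using ab h by (intro \<phi>l) auto
    ultimately have "exp (- 6) * (N\<^sup>2 / 4) * ((B * (N\<^sup>2 / 4)) * (B * (N\<^sup>2 / 4))) \<le> g p"
      unfolding g_def P fst_conv snd_conv add_Pair using B N by (intro mult_mono \<psi>l xy) (auto simp: \<phi>0 \<psi>0)
    moreover have a2: "a \<le> 2 * N" using ab h N by linarith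
    moreover have "\<tau>\<^sup>2 / 4 \<le> Kr \<tau> ((x, y) \<bullet> (a, b))"
    proof (rule Kr_lower[OF \<tau>(1)])
      \<comment> \<open>The long coordinate of one frequency meets the short one of the other, so
        the inner product stays below 2 although the second frequency has length of order N. With
        \<tau> \<le> 1/4 the phase stays below 1.\<close>
      have "\<bar>(x, y) \<bullet> (a, b)\<bar> \<le> \<bar>x\<bar> * \<bar>a\<bar> + \<bar>y\<bar> * \<bar>b\<bar>"
        using abs_triangle_ineq[of "x * a" "y * b"] by (simp add: inner_prod_def abs_mult)
      also have "\<dots> \<le> (1 / (2 * N)) * (2 * N) + 1 * 1"
        by (intro add_mono mult_mono) (use xy ab a2 h N in linarith)+
      also have "\<dots> = 2" using N by simp
      finally have d: "\<bar>(x, y) \<bullet> (a, b)\<bar> \<le> 2" .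
      have "2 * \<tau> * \<bar>(x, y) \<bullet> (a, b)\<bar> \<le> (1 / 2) * 2" using d \<tau> by (intro mult_mono) auto
      then show "2 * \<tau> * \<bar>(x, y) \<bullet> (a, b)\<bar> \<le> 1" by simp
    qed
    ultimately show ?thesis unfolding M_def P fst_conv snd_conv
      using B N \<tau> by (intro mult_mono) (auto simp: g0)
  qed
  have "emeasure lborel Q1 = ennreal (1 / (2 * N) - 0) * ennreal (1 - 1 / 2)"
    unfolding Q1_def lborel_prod[symmetric] cbox_Pair_eq
    using N by (simp add: lborel.emeasure_pair_measure_Times)
  also have "\<dots> = ennreal ((1 / (2 * N) - 0) * (1 - 1 / 2))"
    by (rule ennreal_mult[symmetric]) (use N in simp_all)
  also have "(1 / (2 * N) - 0) * (1 - 1 / 2) = 1 / (4 * N)" by simp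
  finally have eQ1: "emeasure lborel Q1 = ennreal (1 / (4 * N))" .
  have eQ2: "emeasure lborel Q2 = ennreal (1 / (2 * N))"
    unfolding Q2_def lborel_prod[symmetric] cbox_Pair_eq
    using N by (simp add: lborel.emeasure_pair_measure_Times)
  have Qm: "Q1 \<in> sets borel" "Q2 \<in> sets borel" unfolding Q1_def Q2_def by simp_all
  have "emeasure ?L (Q1 \<times> Q2) = emeasure lborel Q1 * emeasure lborel Q2"
    by (rule lborel.emeasure_pair_measure_Times) (use Qm in simp_all)
  also have "\<dots> = ennreal (1 / (4 * N) * (1 / (2 * N)))"
    unfolding eQ1 eQ2 by (rule ennreal_mult[symmetric]) (use N in simp_all)
  finally have em: "emeasure ?L (Q1 \<times> Q2) = ennreal (1 / (4 * N) * (1 / (2 * N)))" .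
  then have meas: "measure ?L (Q1 \<times> Q2) = 1 / (4 * N) * (1 / (2 * N))" using N by (simp add: measure_def)
  have Qs: "Q1 \<times> Q2 \<in> sets ?L" using Qm by (intro pair_measureI) simp_all
  have "exp (- 6) / 2048 * B\<^sup>2 * real n ^ 4 * \<tau>\<^sup>2 = measure ?L (Q1 \<times> Q2) * M"
    unfolding meas M_def N_def[symmetric] using N by (simp add: field_simps power2_eq_square power4_eq_xxxx)
  also have "\<dots> = (\<integral>p. indicat_real (Q1 \<times> Q2) p * M \<partial>?L)" using Qs by simp
  also have "\<dots> \<le> (\<integral>p. g p * Kr \<tau> (fst p \<bullet> snd p) \<partial>?L)"
  proof (rule integral_mono[OF _ i])
    show "integrable ?L (\<lambda>p. indicat_real (Q1 \<times> Q2) p * M)"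
      by (intro integrable_mult_left integrable_real_indicator Qs) (simp add: em)
    show "indicat_real (Q1 \<times> Q2) p * M \<le> g p * Kr \<tau> (fst p \<bullet> snd p)" for p
      using low[of p] mult_nonneg_nonneg[OF g0 Kr_nonneg[OF \<tau>(1)]] by (auto simp: indicator_def)
  qed
  finally show ?thesis .
qed

section \<open>Sizes of the data and of the dual norm of the test function\<close>

lemma ann_weight:
  assumes s: "s \<le> 0" and n: "n \<ge> 1"
  shows "integrable lborel (\<lambda>x. (1 + (norm x)\<^sup>2) powr s * (ann n x)\<^sup>2)"
    and "(\<integral>x. (1 + (norm x)\<^sup>2) powr s * (ann n x)\<^sup>2 \<partial>lborel) \<le> 4 * pi * real n powr (2 * s)"
proof -
  have b: "(1 + (norm x)\<^sup>2) powr s * (ann n x)\<^sup>2 \<le> real n powr (2 * s) * ann n x" for x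
  proof (cases "ann n x = 0")
    case False
    then have "(real n)\<^sup>2 \<le> (norm x)\<^sup>2" unfolding ann_def indicator_def mem_Collect_eq by auto
    then have "(real n)\<^sup>2 \<le> 1 + (norm x)\<^sup>2" by linarith
    moreover have "0 < (real n)\<^sup>2" using n by simp
    ultimately have "(1 + (norm x)\<^sup>2) powr s \<le> ((real n)\<^sup>2) powr s" by (intro powr_mono2' s)
    also have "\<dots> = real n powr (2 * s)" using n by (simp add: powr_powr flip: powr_numeral)
    finally show ?thesis unfolding ann_range(3) by (intro mult_right_mono ann_range)
  qed simp
  have i: "integrable lborel (\<lambda>x. real n powr (2 * s) * ann n x)" by (intro integrable_mult_right ann_integral)
  show I: "integrable lborel (\<lambda>x. (1 + (norm x)\<^sup>2) powr s * (ann n x)\<^sup>2)"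
  proof (rule Bochner_Integration.integrable_bound[OF i])
    show "AE x in lborel. norm ((1 + (norm x)\<^sup>2) powr s * (ann n x)\<^sup>2) \<le> norm (real n powr (2 * s) * ann n x)"
      using order_trans[OF b abs_ge_self] by (intro AE_I2) simp
  qed measurable
  have "(\<integral>x. (1 + (norm x)\<^sup>2) powr s * (ann n x)\<^sup>2 \<partial>lborel) \<le> (\<integral>x. real n powr (2 * s) * ann n x \<partial>lborel)"
    by (rule integral_mono[OF I i b])
  also have "\<dots> = 4 * pi * real n powr (2 * s)" by (simp add: ann_integral)
  finally show "(\<integral>x. (1 + (norm x)\<^sup>2) powr s * (ann n x)\<^sup>2 \<partial>lborel) \<le> 4 * pi * real n powr (2 * s)" .
qed

text \<open>Comparison with the primitive x^q / q of x^(q - 1): the mean value theorem on each unit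
  step, then telescoping.\<close>

lemma sum_powr_le:
  assumes q: "0 < q" "q \<le> 1"
  shows "(\<Sum>j<n. real (Suc j) powr (q - 1)) \<le> real n powr q / q"
proof (induction n)
  case (Suc n)
  have "q * real (Suc n) powr (q - 1) \<le> real (Suc n) powr q - real n powr q"
  proof (cases "n = 0")
    case True then show ?thesis using q by simp
  next
    case False
    have "\<exists>z. real n < z \<and> z < real (Suc n) \<and> real (Suc n) powr q - real n powr q = (real (Suc n) - real n) * (q * z powr (q - 1))"
      using False by (intro MVT2) (auto intro!: derivative_eq_intros)
    then obtain z where z: "real n < z" "z < real (Suc n)" "real (Suc n) powr q - real n powr q = q * z powr (q - 1)" by auto
    have "real (Suc n) powr (q - 1) \<le> z powr (q - 1)" using z q by (intro powr_mono2') auto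
    then show ?thesis unfolding z(3) using q by (intro mult_left_mono) auto
  qed
  then have "real (Suc n) powr (q - 1) \<le> real (Suc n) powr q / q - real n powr q / q"
    using q by (simp add: field_simps)
  then show ?case using Suc by simp
qed simp

text \<open>Coefficients are at most n, and the inverse squared weights decay like |l|^(-2
  \<sigma>), whose sum up to n is of order n^(1 - 2 \<sigma>) because \<sigma> < 1/2. The factor 4
  is a 2 for the two signs of l and a 2 for the bound on 2^\<sigma>.\<close>

lemma modes_weight_sum:
  assumes \<sigma>: "0 \<le> \<sigma>" "\<sigma> < 1 / 2" and n: "n \<ge> 1"
  shows "(\<Sum>l\<in>modes n. (norm (of_nat (fc n l) / complex_of_real (ang_weight \<sigma> l)))\<^sup>2) \<le> 4 / (1 - 2 * \<sigma>) * real n powr (3 - 2 * \<sigma>)"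
proof -
  let ?f = "\<lambda>l::int. (1 + (of_int l)\<^sup>2) powr (- \<sigma>) :: real"
  have 1: "(norm (of_nat (fc n l) / complex_of_real (ang_weight \<sigma> l)))\<^sup>2 \<le> (real n)\<^sup>2 * ?f l" for l
  proof -
    have "(norm (of_nat (fc n l) / complex_of_real (ang_weight \<sigma> l)))\<^sup>2 = (real (fc n l))\<^sup>2 * ?f l"
      unfolding norm_divide norm_of_nat norm_of_real power_divide power2_abs ang_weight_square
      by (simp add: powr_minus divide_inverse)
    also have "\<dots> \<le> (real n)\<^sup>2 * ?f l" using fc_le[of n l] by (intro mult_right_mono power_mono) auto
    finally show ?thesis .
  qed
  have 2: "?f (int j) \<le> 2 * real (Suc j) powr ((1 - 2 * \<sigma>) - 1)" for j
  proof -
    have "(real (Suc j))\<^sup>2 / 2 \<le> 1 + (of_int (int j))\<^sup>2"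
      using sum_squares_ge_zero[of "real j - 1" 0] by (simp add: power2_eq_square algebra_simps)
    then have "?f (int j) \<le> ((real (Suc j))\<^sup>2 / 2) powr (- \<sigma>)" using \<sigma> by (intro powr_mono2') auto
    also have "\<dots> = 2 powr \<sigma> * real (Suc j) powr ((1 - 2 * \<sigma>) - 1)"
      by (simp add: powr_divide powr_minus_divide powr_powr divide_simps flip: powr_numeral)
    also have "\<dots> \<le> 2 powr 1 * real (Suc j) powr ((1 - 2 * \<sigma>) - 1)" using \<sigma> by (intro mult_right_mono powr_mono) auto
    finally show ?thesis by simp
  qed
  have "(\<Sum>l\<in>modes n. ?f l) \<le> (\<Sum>l\<in>int ` {..<n} \<union> (\<lambda>j. - int j) ` {..<n}. ?f l)"
  proof (rule sum_mono2)
    show "modes n \<subseteq> int ` {..<n} \<union> (\<lambda>j. - int j) ` {..<n}"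
    proof
      fix l assume "l \<in> modes n"
      then have "nat \<bar>l\<bar> < n" "l = int (nat \<bar>l\<bar>) \<or> l = - int (nat \<bar>l\<bar>)" by (auto simp: modes_def)
      then show "l \<in> int ` {..<n} \<union> (\<lambda>j. - int j) ` {..<n}" by blast
    qed
  qed simp_all
  also have "\<dots> \<le> (\<Sum>l\<in>int ` {..<n}. ?f l) + (\<Sum>l\<in>(\<lambda>j. - int j) ` {..<n}. ?f l)"
    by (subst sum.union_inter[symmetric]) (auto intro!: sum_nonneg)
  also have "\<dots> = 2 * (\<Sum>j<n. ?f (int j))"
    by (simp add: sum.reindex inj_on_def)
  also have "\<dots> \<le> 2 * (\<Sum>j<n. 2 * real (Suc j) powr ((1 - 2 * \<sigma>) - 1))"
    by (intro mult_left_mono sum_mono 2) auto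
  also have "\<dots> \<le> 2 * (2 * (real n powr (1 - 2 * \<sigma>) / (1 - 2 * \<sigma>)))"
    unfolding sum_distrib_left[symmetric] using \<sigma> by (intro mult_left_mono sum_powr_le) auto
  finally have 3: "(\<Sum>l\<in>modes n. ?f l) \<le> 4 / (1 - 2 * \<sigma>) * real n powr (1 - 2 * \<sigma>)" by simp
  have "(\<Sum>l\<in>modes n. (norm (of_nat (fc n l) / complex_of_real (ang_weight \<sigma> l)))\<^sup>2) \<le> (real n)\<^sup>2 * (\<Sum>l\<in>modes n. ?f l)"
    unfolding sum_distrib_left by (intro sum_mono 1)
  also have "\<dots> \<le> (real n)\<^sup>2 * (4 / (1 - 2 * \<sigma>) * real n powr (1 - 2 * \<sigma>))" by (intro mult_left_mono 3) simp
  also have "\<dots> = 4 / (1 - 2 * \<sigma>) * (real n powr 2 * real n powr (1 - 2 * \<sigma>))" using n by simp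
  also have "\<dots> = 4 / (1 - 2 * \<sigma>) * real n powr (3 - 2 * \<sigma>)" unfolding powr_add[symmetric] by simp
  finally show ?thesis .
qed

text \<open>There are at most 2 n modes, each with squared weight at most 2 n^(2 \<sigma>) and
  coefficient at most B n.\<close>

lemma data_weight_sum:
  assumes \<sigma>: "0 \<le> \<sigma>" "\<sigma> < 1 / 2" and n: "n \<ge> 1"
  shows "(\<Sum>l\<in>modes n. (norm (complex_of_real (ang_weight \<sigma> l) * of_real (B * real (fc n l))))\<^sup>2) \<le> 4 * B\<^sup>2 * real n powr (3 + 2 * \<sigma>)"
proof -
  have "(norm (complex_of_real (ang_weight \<sigma> l) * of_real (B * real (fc n l))))\<^sup>2 \<le> 2 * real n powr (2 * \<sigma>) * (B\<^sup>2 * (real n)\<^sup>2)" if l: "l \<in> modes n" for l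
  proof -
    have "\<bar>of_int l\<bar> \<le> real n" using l by (auto simp: modes_def)
    then have "(of_int l)\<^sup>2 \<le> (real n)\<^sup>2" by (metis abs_le_square_iff abs_of_nat)
    moreover have "1 \<le> (real n)\<^sup>2" using n by simp
    ultimately have "1 + (of_int l)\<^sup>2 \<le> 2 * (real n)\<^sup>2" by linarith
    then have "(1 + (of_int l)\<^sup>2) powr \<sigma> \<le> (2 * (real n)\<^sup>2) powr \<sigma>" using \<sigma> by (intro powr_mono2) auto
    also have "\<dots> = 2 powr \<sigma> * real n powr (2 * \<sigma>)" using n by (simp add: powr_mult powr_powr flip: powr_numeral)
    also have "\<dots> \<le> 2 powr 1 * real n powr (2 * \<sigma>)" using \<sigma> by (intro mult_right_mono powr_mono) auto
    finally have w: "(ang_weight \<sigma> l)\<^sup>2 \<le> 2 * real n powr (2 * \<sigma>)" by (simp add: ang_weight_square)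
    have f: "(real (fc n l))\<^sup>2 \<le> (real n)\<^sup>2" using fc_le[of n l] by (intro power_mono) auto
    have "(norm (complex_of_real (ang_weight \<sigma> l) * of_real (B * real (fc n l))))\<^sup>2 = (ang_weight \<sigma> l)\<^sup>2 * (B\<^sup>2 * (real (fc n l))\<^sup>2)"
      by (simp add: norm_mult power_mult_distrib)
    also have "\<dots> \<le> 2 * real n powr (2 * \<sigma>) * (B\<^sup>2 * (real n)\<^sup>2)"
      by (intro mult_mono w f order_refl) auto
    finally show ?thesis .
  qed
  then have "(\<Sum>l\<in>modes n. (norm (complex_of_real (ang_weight \<sigma> l) * of_real (B * real (fc n l))))\<^sup>2) \<le> real (card (modes n)) * (2 * real n powr (2 * \<sigma>) * (B\<^sup>2 * (real n)\<^sup>2))"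
    by (rule sum_bounded_above)
  also have "\<dots> \<le> (2 * real n) * (2 * real n powr (2 * \<sigma>) * (B\<^sup>2 * (real n)\<^sup>2))"
    by (intro mult_right_mono) (auto simp: modes_def)
  also have "\<dots> = 4 * B\<^sup>2 * (real n powr 3 * real n powr (2 * \<sigma>))" using n by (simp add: power2_eq_square power3_eq_cube)
  also have "\<dots> = 4 * B\<^sup>2 * real n powr (3 + 2 * \<sigma>)" unfolding powr_add[symmetric] ..
  finally show ?thesis .
qed

section \<open>Inflation\<close>

text \<open>The averaged pairing of the quadratic iterate with a Fejer kernel is bounded below by
  resonance and above by continuity with tolerance 1. The upper bound consists of the pairings with
  the profile at times t and 0, hence the factor 2, and of the remainder, in which n^2 bounds the
  test function and 2 P the mass of the majorant. \<open>P\<close> is the mass 4 pi B n of the data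
  times exp 3 for the exponential weight.\<close>

lemma main_inequality:
  fixes \<eta> :: complex and s \<sigma> T B \<delta> \<tau> :: real and n :: nat
  assumes \<eta>: "\<eta> \<noteq> 0" and T: "T > 0" and s: "s \<le> 0" and \<sigma>: "0 \<le> \<sigma>" "\<sigma> < 1 / 2"
    and \<Phi>: "data_to_solution_map \<eta> T s \<sigma> \<Phi>"
    and C: "\<And>u0 t. u0 \<in> ang_sobolev_unit_ball s \<sigma> \<Longrightarrow> ang_sobolev_norm s \<sigma> u0 < \<delta> \<Longrightarrow> t \<in> {0..T} \<Longrightarrow>
       ang_sobolev_norm s \<sigma> (\<Phi> u0 t - \<Phi> (\<lambda>_. 0) t) < 1"
    and n: "n \<ge> 1" and B: "0 \<le> B" and \<tau>: "0 \<le> \<tau>" "\<tau> \<le> T" "\<tau> \<le> 1 / 4"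
    and small_data: "sqrt (16 * pi * B\<^sup>2 * real n powr (3 + 2 * \<sigma> + 2 * s)) < min 1 \<delta>"
  defines "P \<equiv> exp 3 * (4 * pi * B * real n)"
    and "G \<equiv> \<integral>x. inverse ((1 + (norm x)\<^sup>2) powr s) * (gam x)\<^sup>2 \<partial>lborel"
    and "k \<equiv> - \<i> * \<eta> / (2 * pi)"
  assumes small_P: "16 * T * norm \<eta> / pi * P \<le> 1"
  shows "exp (- 6) / 2048 * B\<^sup>2 * real n ^ 4 * \<tau>\<^sup>2
    \<le> \<tau> * (2 * sqrt (4 / (1 - 2 * \<sigma>) * real n powr (3 - 2 * \<sigma>) * G) / norm k + 12 * T\<^sup>2 * norm k * (real n)\<^sup>2 * (2 * P) ^ 3)"
proof -
  let ?X = "sqrt (4 / (1 - 2 * \<sigma>) * real n powr (3 - 2 * \<sigma>) * G)"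
  define \<phi> where "\<phi> x = B * (ann n x * Fj n (1 * sgn (zz x)))" for x
  define \<psi> where "\<psi> x = gam x * Fj n (- \<i> * sgn (zz x))" for x
  define b where "b l = complex_of_real (B * real (fc n l))" for l
  note hn = ann_measurable[of n] ann_radial[of n] ann_0[OF n]
  have Fj_m [measurable]: "(\<lambda>x. Fj n (w * sgn (zz x))) \<in> borel_measurable borel" for w by (rule Fj_measurable)
  have \<phi>m[measurable]: "\<phi> \<in> borel_measurable borel" unfolding \<phi>_def[abs_def] by measurable
  have \<psi>m[measurable]: "\<psi> \<in> borel_measurable borel" unfolding \<psi>_def[abs_def] by measurable
  have sgn_le: "norm (w * sgn (zz x)) \<le> 1" if "norm w = 1" for w x
    using that by (simp add: norm_mult norm_sgn)
  have \<phi>0: "0 \<le> \<phi> x" for x unfolding \<phi>_def using B by (intro mult_nonneg_nonneg ann_range Fj_nonneg)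
  have \<psi>0: "0 \<le> \<psi> x" for x unfolding \<psi>_def by (intro mult_nonneg_nonneg gam_nonneg Fj_nonneg)
  have \<psi>1: "\<psi> x \<le> 1 * (real n)\<^sup>2" for x
    unfolding \<psi>_def by (intro mult_mono gam_le_1 Fj_bound sgn_le) (simp_all add: Fj_nonneg)
  have \<phi>1: "\<phi> x \<le> B * (1 * (real n)\<^sup>2)" for x
    unfolding \<phi>_def by (intro mult_left_mono mult_mono ann_range Fj_bound sgn_le B) (simp_all add: Fj_nonneg)
  have \<phi>_modes: "complex_of_real (\<phi> x) = (\<Sum>l\<in>modes n. b l * mf (ann n) 1 l x)" for x
  proof -
    have "complex_of_real (\<phi> x) = of_real B * (\<Sum>l\<in>modes n. of_nat (fc n l) * mf (ann n) 1 l x)"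
      using mf_sum[where h="ann n" and w=1 and n=n and x=x] hn(3) by (simp only: \<phi>_def of_real_mult norm_one simp_thms)
    then show ?thesis by (simp add: b_def sum_distrib_left mult.assoc)
  qed
  have \<psi>_modes: "complex_of_real (\<psi> x) = (\<Sum>l\<in>modes n. of_nat (fc n l) * mf gam (- \<i>) l x)" for x
    using mf_sum[where h=gam and w="- \<i>" and n=n and x=x] gam_0 by (simp add: \<psi>_def)
  have mi: "integrable lborel (mf (ann n) 1 l)" for l
  proof (rule Bochner_Integration.integrable_bound[OF ann_integral(1)[of n]])
    show "AE x in lborel. norm (mf (ann n) 1 l x) \<le> norm (ann n x)"
      using norm_mf[where h="ann n" and w=1] hn(3) by simp
  qed (use mf_measurable[OF hn(1)] in simp)
  have \<phi>ci: "integrable lborel (\<lambda>x. complex_of_real (\<phi> x))"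
    unfolding \<phi>_modes by (intro Bochner_Integration.integrable_sum integrable_mult_right mi)
  have \<phi>i: "integrable lborel \<phi>" using integrable_Re[OF \<phi>ci] by simp
  \<comment> \<open>Only the mode 0 has a nonzero integral, and its coefficient in the Fejer kernel
    is n.\<close>
  have \<phi>_int: "(\<integral>x. \<phi> x \<partial>lborel) = 4 * pi * B * real n"
  proof -
    have z: "(\<integral>x. mf (ann n) 1 l x \<partial>lborel) = (if l = 0 then of_real (4 * pi) else 0)" for l
    proof (cases "l = 0")
      case True
      have "mf (ann n) 1 0 x = complex_of_real (ann n x)" for x by (simp add: mf_def Em_def)
      then show ?thesis using True ann_integral[of n] by simp
    next
      case False
      then show ?thesis using mode_integral_zero[OF mf_measurable[OF hn(1)] mf_mode[OF hn(2)] False] by simp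
    qed
    have "complex_of_real (\<integral>x. \<phi> x \<partial>lborel) = (\<Sum>l\<in>modes n. (\<integral>x. b l * mf (ann n) 1 l x \<partial>lborel))"
      unfolding integral_of_real[OF \<phi>i, symmetric] \<phi>_modes
      by (rule Bochner_Integration.integral_sum) (intro integrable_mult_right mi)
    also have "\<dots> = (\<Sum>l\<in>modes n. if l = 0 then b l * of_real (4 * pi) else 0)"
      by (intro sum.cong refl) (simp add: z)
    also have "\<dots> = b 0 * of_real (4 * pi)" using n by (simp add: modes_def)
    also have "\<dots> = complex_of_real (4 * pi * B * real n)" by (simp add: b_def fc_0)
    finally show ?thesis by (simp only: of_real_eq_iff)
  qed
  define u0 where "u0 = distr_of_FT (\<lambda>x. complex_of_real (\<phi> x))"
  note md = mode_data[OF hn ann_integral(1) _ _ finite_modes ann_weight(1)[OF s n], where \<sigma>=\<sigma> and w=1]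
  have u0_ang: "u0 \<in> ang_sobolev s \<sigma>"
    unfolding u0_def \<phi>_modes by (rule md) (use \<sigma> in simp_all)
  have u0_norm: "ang_sobolev_norm s \<sigma> u0 < min 1 \<delta>"
  proof -
    have "ang_sobolev_norm s \<sigma> u0 = sqrt ((\<Sum>l\<in>modes n. (norm (of_real (ang_weight \<sigma> l) * b l))\<^sup>2) * (\<integral>x. (1 + (norm x)\<^sup>2) powr s * (ann n x)\<^sup>2 \<partial>lborel))"
      unfolding u0_def \<phi>_modes by (rule md) (use \<sigma> in simp_all)
    also have "\<dots> \<le> sqrt ((4 * B\<^sup>2 * real n powr (3 + 2 * \<sigma>)) * (4 * pi * real n powr (2 * s)))"
      unfolding b_def
      by (intro real_sqrt_le_mono mult_mono data_weight_sum ann_weight s n \<sigma> integral_nonneg_AE AE_I2) simp_all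
    also have "(4 * B\<^sup>2 * real n powr (3 + 2 * \<sigma>)) * (4 * pi * real n powr (2 * s)) = 16 * pi * B\<^sup>2 * real n powr (3 + 2 * \<sigma> + 2 * s)"
      by (simp add: powr_add mult_ac)
    finally show ?thesis by (rule order_le_less_trans[OF _ small_data])
  qed
  have u0_ball: "u0 \<in> ang_sobolev_unit_ball s \<sigma>" using u0_ang u0_norm by (simp add: ang_sobolev_unit_ball_def)
  have zero_ball: "(\<lambda>_. 0) \<in> ang_sobolev_unit_ball s \<sigma>"
  proof -
    have "(\<lambda>_. 0) = distr_of_FT (\<lambda>x. \<Sum>l\<in>modes n. 0 * mf (ann n) 1 l x)" by (simp add: distr_of_FT_0)
    moreover have "\<dots> \<in> ang_sobolev s \<sigma>" by (rule md) (use \<sigma> in simp_all)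
    moreover have "ang_sobolev_norm s \<sigma> (distr_of_FT (\<lambda>x. \<Sum>l\<in>modes n. 0 * mf (ann n) 1 l x)) = sqrt ((\<Sum>l\<in>modes n. (norm (complex_of_real (ang_weight \<sigma> l) * 0))\<^sup>2) * (\<integral>x. (1 + (norm x)\<^sup>2) powr s * (ann n x)\<^sup>2 \<partial>lborel))"
      by (rule md) (use \<sigma> in simp_all)
    ultimately show ?thesis unfolding ang_sobolev_unit_ball_def by (simp only: mem_Collect_eq) simp
  qed
  have zero_inf: "(\<lambda>_. 0) \<in> sobolev_inf"
    unfolding sobolev_inf_def using sobolev_distr_of_FT[of "\<lambda>_. 0"] by (simp add: distr_of_FT_0)
  have \<Phi>0: "\<Phi> (\<lambda>_. 0) t = (\<lambda>_. 0)" if "t \<in> {0..T}" for t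
    using \<Phi> zero_ball zero_inf zero_smooth_solution that unfolding data_to_solution_map_def by blast
  let ?\<phi> = "\<lambda>x. complex_of_real (\<phi> x)"
  \<comment> \<open>An exponential weight of rate 1 / n costs only a constant, since |x| \<le> n + 2
    \<le> 3 n on the annulus.\<close>
  have ew: "norm (?\<phi> x) * exp (1 / real n * norm x) \<le> exp 3 * \<phi> x" for x
  proof (cases "\<phi> x = 0")
    case False
    then have "ann n x \<noteq> 0" by (auto simp: \<phi>_def)
    then have "(norm x)\<^sup>2 \<le> (real n)\<^sup>2 + 4" unfolding ann_def indicator_def mem_Collect_eq by auto
    also have "\<dots> \<le> (real n + 2)\<^sup>2" by (simp add: power2_sum)
    finally have "norm x \<le> real n + 2" by (rule power2_le_imp_le) simp
    also have "\<dots> \<le> 3 * real n" using n by simp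
    finally have "1 / real n * norm x \<le> 3" using n by (simp add: divide_le_eq)
    then have "\<phi> x * exp (1 / real n * norm x) \<le> \<phi> x * exp 3" using \<phi>0 by (intro mult_left_mono) auto
    then show ?thesis using \<phi>0[of x] by (simp add: mult.commute)
  qed simp
  have ei: "integrable lborel (\<lambda>x. norm (?\<phi> x) * exp (1 / real n * norm x))"
  proof (rule Bochner_Integration.integrable_bound[OF integrable_mult_right[OF \<phi>i, of "exp 3"]])
    show "AE x in lborel. norm (norm (?\<phi> x) * exp (1 / real n * norm x)) \<le> norm (exp 3 * \<phi> x)"
      using order_trans[OF ew abs_ge_self] by (intro AE_I2) (simp only: real_norm_def abs_mult abs_norm_cancel abs_exp_cancel)
  qed measurable
  have eP: "(\<integral>x. norm (?\<phi> x) * exp (1 / real n * norm x) \<partial>lborel) \<le> P"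
    using integral_mono[OF ei integrable_mult_right[OF \<phi>i, of "exp 3"] ew] by (simp add: \<phi>_int P_def)
  have eS: "norm (?\<phi> x) * exp (1 / real n * norm x) \<le> exp 3 * (B * (1 * (real n)\<^sup>2))" for x
    by (rule order_trans[OF ew mult_left_mono[OF \<phi>1]]) simp
  have \<phi>cm: "?\<phi> \<in> borel_measurable borel" by measurable
  have n0: "1 / real n > 0" using n by simp
  obtain W v where W: "majorant (4 * T * norm \<eta> / pi) W" and \<phi>W: "\<And>\<xi>. norm (?\<phi> \<xi>) \<le> W \<xi>" and WP: "(\<integral>\<xi>. W \<xi> \<partial>lborel) \<le> 2 * P"
    and v: "mild_profile \<eta> T ?\<phi> v" and bv: "\<And>s \<xi>. norm (v (s, \<xi>)) \<le> 2 * W \<xi>"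
    using solution_exists[OF \<eta> T \<phi>cm n0 ei eP eS small_P] by metis
  have c: "4 * T * norm \<eta> / pi > 0" using \<eta> T by simp
  have vm: "v \<in> borel_measurable borel" using v by (simp add: mild_profile_def)
  have sol: "smooth_solution \<eta> T u0 (\<lambda>t. distr_of_FT (uhat v t))"
    unfolding u0_def by (rule uhat_smooth_solution[OF W c v bv \<phi>ci])
  have u0_inf: "u0 \<in> sobolev_inf"
    unfolding sobolev_inf_def u0_def
    by (intro INT_I sobolev_distr_of_FT \<phi>ci weighted_square_integrable[OF W \<phi>cm, where D=1]) (use \<phi>W in simp)
  have \<Phi>u: "\<Phi> u0 t = distr_of_FT (uhat v t)" if "t \<in> {0..T}" for t
    using \<Phi> u0_ball u0_inf sol that unfolding data_to_solution_map_def by blast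
  have \<Phi>_ang: "\<Phi> u0 t \<in> ang_sobolev s \<sigma>" if "t \<in> {0..T}" for t
    using \<Phi> u0_ball that unfolding data_to_solution_map_def C_ang_sobolev_def continuous_curve_def by blast
  have \<Phi>_norm: "ang_sobolev_norm s \<sigma> (\<Phi> u0 t) \<le> 1" if "t \<in> {0..T}" for t
  proof -
    have "\<Phi> u0 t - (\<lambda>_. 0) = \<Phi> u0 t" by (simp add: fun_eq_iff)
    then show ?thesis using C[OF u0_ball _ that] u0_norm \<Phi>0[OF that] by simp
  qed
  have G0: "0 \<le> G" unfolding G_def by (intro integral_nonneg_AE AE_I2) simp
  \<comment> \<open>The phase in \<open>uhat\<close> is undone by that of the test function, so the
    profile itself is paired; continuity at the origin has bounded the norm of the solution by
    1.\<close>
  have Vb: "norm (\<integral>\<xi>. of_real (\<psi> \<xi>) * v (t, \<xi>) \<partial>lborel) \<le> ?X" if t: "t \<in> {0..T}" for t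
  proof -
    have cc: "cis (t * r) * cis (- t * r) = 1" for r by (simp add: cis_mult)
    have e: "uhat v t \<xi> * (cis (- t * (norm \<xi>)\<^sup>2) * (\<Sum>l\<in>modes n. of_nat (fc n l) * mf gam (- \<i>) l \<xi>)) = of_real (\<psi> \<xi>) * v (t, \<xi>)" for \<xi>
    proof -
      have "uhat v t \<xi> * (cis (- t * (norm \<xi>)\<^sup>2) * of_real (\<psi> \<xi>)) = (cis (t * (norm \<xi>)\<^sup>2) * cis (- t * (norm \<xi>)\<^sup>2)) * (of_real (\<psi> \<xi>) * v (t, \<xi>))"
        unfolding uhat_def by (simp only: mult_ac)
      then show ?thesis unfolding \<psi>_modes[symmetric] cc by simp
    qed
    have "norm (\<integral>\<xi>. of_real (\<psi> \<xi>) * v (t, \<xi>) \<partial>lborel) \<le> ang_sobolev_norm s \<sigma> (\<Phi> u0 t) *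
      sqrt ((\<Sum>l\<in>modes n. (norm (of_nat (fc n l) / complex_of_real (ang_weight \<sigma> l)))\<^sup>2) * G)"
      using phase_pairing_bound[OF \<Phi>_ang[OF t, unfolded \<Phi>u[OF t]] _ finite_modes[of n], where w="- \<i>" and t=t and d="\<lambda>l. of_nat (fc n l)"]
      unfolding e G_def[symmetric] \<Phi>u[OF t, symmetric] by simp
    also have "\<dots> \<le> 1 * sqrt (4 / (1 - 2 * \<sigma>) * real n powr (3 - 2 * \<sigma>) * G)"
      by (intro mult_mono \<Phi>_norm t real_sqrt_le_mono mult_right_mono modes_weight_sum \<sigma> n G0)
         (simp_all add: G0 sum_nonneg)
    finally show ?thesis by simp
  qed
  have \<psi>b: "norm (complex_of_real (\<psi> \<xi>)) \<le> (real n)\<^sup>2" for \<xi> using \<psi>0[of \<xi>] \<psi>1[of \<xi>] by simp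
  have \<psi>cm: "(\<lambda>\<xi>. complex_of_real (\<psi> \<xi>)) \<in> borel_measurable borel" by measurable
  have \<psi>cl: "(\<lambda>\<xi>. complex_of_real (\<psi> \<xi>)) \<in> borel_measurable lborel" using \<psi>cm by simp
  have vi: "integrable lborel (\<lambda>\<xi>. v (t, \<xi>))" for t
  proof (rule Bochner_Integration.integrable_bound[OF integrable_mult_right[OF majorantD(4)[OF W], of 2]])
    show "AE \<xi> in lborel. norm (v (t, \<xi>)) \<le> norm (2 * W \<xi>)"
      using order_trans[OF bv abs_ge_self] by (intro AE_I2) simp
  qed (use slice_measurable[OF vm, of t] in simp)
  have k0: "norm k > 0" using \<eta> by (simp add: k_def norm_divide norm_mult)
  have vk: "v (t, \<xi>) = ?\<phi> \<xi> + k * Bf T v (t, \<xi>)" for t \<xi>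
    using v unfolding mild_profile_def k_def by (metis snd_conv)
  \<comment> \<open>At time zero \<open>Bf\<close> integrates over a single point. Hence
    \<open>Vb\<close> at time zero also bounds the pairing with the data, which is subtracted to
    isolate the Duhamel term.\<close>
  have v0: "v (0, \<xi>) = ?\<phi> \<xi>" for \<xi>
  proof -
    have "Bf T v (0, \<xi>) = (\<integral>r. (if r = (0::real) then Qf v 0 \<xi> else 0) \<partial>lborel)"
      unfolding Bf_def fst_conv snd_conv by (intro Bochner_Integration.integral_cong refl) (use T in auto)
    also have "\<dots> = 0"
      by (rule integral_eq_zero_AE) (use AE_lborel_singleton[of 0] in eventually_elim, simp)
    finally show ?thesis unfolding vk by simp
  qed
  have BfX: "norm (\<integral>\<xi>. of_real (\<psi> \<xi>) * Bf T v (t, \<xi>) \<partial>lborel) \<le> 2 * ?X / norm k" if t: "t \<in> {0..T}" for t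
  proof -
    have "k * (\<integral>\<xi>. of_real (\<psi> \<xi>) * Bf T v (t, \<xi>) \<partial>lborel) = (\<integral>\<xi>. of_real (\<psi> \<xi>) * v (t, \<xi>) - of_real (\<psi> \<xi>) * v (0, \<xi>) \<partial>lborel)"
      unfolding v0 unfolding vk[of t] integral_mult_right_zero[symmetric]
      by (intro Bochner_Integration.integral_cong refl) (simp add: algebra_simps)
    also have "\<dots> = (\<integral>\<xi>. of_real (\<psi> \<xi>) * v (t, \<xi>) \<partial>lborel) - (\<integral>\<xi>. of_real (\<psi> \<xi>) * v (0, \<xi>) \<partial>lborel)"
      by (rule Bochner_Integration.integral_diff) (rule integrable_mult_bounded(1)[OF vi \<psi>cl \<psi>b])+
    also have "norm \<dots> \<le> ?X + ?X"
      by (rule order_trans[OF norm_triangle_ineq4 add_mono[OF Vb[OF t] Vb]]) (use T in simp)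
    finally show ?thesis using k0 by (simp add: norm_mult pos_le_divide_eq mult.commute)
  qed
  let ?R = "12 * T\<^sup>2 * norm k * (real n)\<^sup>2 * (2 * P) ^ 3"
  have rem: "norm ((\<integral>\<xi>. of_real (\<psi> \<xi>) * Bf T v (t, \<xi>) \<partial>lborel) - (\<integral>\<xi>. of_real (\<psi> \<xi>) * Bf T (\<lambda>p. ?\<phi> (snd p)) (t, \<xi>) \<partial>lborel)) \<le> ?R" for t
  proof -
    have "8 * T * norm k = 4 * T * norm \<eta> / pi" by (simp add: k_def norm_divide norm_mult)
    note remainder_bound[OF W c T k_def[THEN meta_eq_to_obj_eq] this v bv \<phi>cm \<phi>W \<psi>cm \<psi>b, of t]
    also have "12 * T\<^sup>2 * norm k * (real n)\<^sup>2 * (\<integral>\<xi>. W \<xi> \<partial>lborel) ^ 3 \<le> ?R"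
      by (intro mult_left_mono power_mono WP integral_nonneg_AE AE_I2 majorantD(2)[OF W]) simp
    finally show ?thesis .
  qed
  have Fb: "norm (\<integral>\<xi>. of_real (\<psi> \<xi>) * Bf T (\<lambda>p. ?\<phi> (snd p)) (t, \<xi>) \<partial>lborel) \<le> 2 * ?X / norm k + ?R" if "0 \<le> t" "t \<le> \<tau>" for t
  proof -
    have "t \<in> {0..T}" using that \<tau> by simp
    from norm_triangle_le_diff[OF order_refl] add_mono[OF BfX[OF this] rem[of t]]
    show ?thesis using norm_triangle_sub[of "\<integral>\<xi>. of_real (\<psi> \<xi>) * Bf T (\<lambda>p. ?\<phi> (snd p)) (t, \<xi>) \<partial>lborel" "\<integral>\<xi>. of_real (\<psi> \<xi>) * Bf T v (t, \<xi>) \<partial>lborel"]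
      by (simp only: norm_minus_commute)
  qed
  have \<phi>W': "\<bar>\<phi> \<xi>\<bar> \<le> W \<xi>" for \<xi> using \<phi>W[of \<xi>] by simp
  have \<psi>b': "\<bar>\<psi> \<xi>\<bar> \<le> (real n)\<^sup>2" for \<xi> using \<psi>b[of \<xi>] by simp
  note av = averaged_Bf[OF W c \<phi>m \<phi>W' \<psi>m \<psi>b' \<tau>(1,2)]
  have "exp (- 6) / 2048 * B\<^sup>2 * real n ^ 4 * \<tau>\<^sup>2 \<le> (\<integral>p. \<psi> (fst p) * (\<phi> (fst p + snd p) * \<phi> (snd p)) * Kr \<tau> (fst p \<bullet> snd p) \<partial>(lborel \<Otimes>\<^sub>M lborel))"
    using resonant_lower_bound[OF n B \<tau>(1,3)] av(1) unfolding \<phi>_def \<psi>_def by blast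
  also have "\<dots> \<le> \<tau> * (2 * ?X / norm k + ?R)"
    by (rule av(3)) (rule Fb)
  finally show ?thesis .
qed

theorem theorem1p3:
  fixes \<eta> :: complex and s \<sigma> T :: real
  assumes "\<eta> \<noteq> 0"
    and "s < - 1 / 4"
    and "0 \<le> \<sigma>"
    and "\<sigma> < min (- 2 * s - 1 / 2) (1 / 2)"
    and "T > 0"
  shows "\<not> (\<exists>\<Phi>. data_to_solution_map \<eta> T s \<sigma> \<Phi> \<and> continuous_at_origin T s \<sigma> \<Phi>)"
proof
  assume "\<exists>\<Phi>. data_to_solution_map \<eta> T s \<sigma> \<Phi> \<and> continuous_at_origin T s \<sigma> \<Phi>"
  then obtain \<Phi> where \<Phi>: "data_to_solution_map \<eta> T s \<sigma> \<Phi>" and C: "continuous_at_origin T s \<sigma> \<Phi>" by blast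
  obtain \<delta> where \<delta>: "\<delta> > 0" and C1: "\<forall>u0 \<in> ang_sobolev_unit_ball s \<sigma>. ang_sobolev_norm s \<sigma> u0 < \<delta> \<longrightarrow>
        (\<forall>t\<in>{0..T}. ang_sobolev_norm s \<sigma> (\<Phi> u0 t - \<Phi> (\<lambda>_. 0) t) < 1)"
    using C[unfolded continuous_at_origin_def, rule_format, OF zero_less_one] by blast
  have \<sigma>: "\<sigma> < 1 / 2" and s: "s \<le> 0" using assms by auto
  \<comment> \<open>The bound by 1 comes from \<sigma> \<ge> 0, the other one from the upper bound
    on \<sigma> in terms of s.\<close>
  have "3 / 4 - \<sigma> / 2 < min 1 (1 / 2 - \<sigma> - s)" using assms by auto
  then obtain a where a: "3 / 4 - \<sigma> / 2 < a" "a < 1" "a < 1 / 2 - \<sigma> - s"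
    using dense by (metis min_less_iff_conj)
  \<comment> \<open>The averaging time must not exceed \<open>T\<close>, and 1/4 is small enough for
    the resonant phases.\<close>
  define \<tau> where "\<tau> = min T (1 / 4)"
  have \<tau>: "0 < \<tau>" "\<tau> \<le> T" "\<tau> \<le> 1 / 4" using assms by (auto simp: \<tau>_def)
  define k where "k = - \<i> * \<eta> / (2 * pi)"
  have k0: "norm k > 0" using assms by (simp add: k_def norm_divide norm_mult)
  define G where "G = (\<integral>x. inverse ((1 + (norm (x::R2))\<^sup>2) powr s) * (gam x)\<^sup>2 \<partial>lborel)"
  define Y where "Y = 2 * sqrt (4 / (1 - 2 * \<sigma>) * G) / norm k"
  define Z where "Z = 12 * T\<^sup>2 * norm k * (2 * (exp 3 * (4 * pi))) ^ 3"
  \<comment> \<open>Four quantities have to be small for large n: the squared norm of the data, the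
    mass that governs existence on [0, T], and the two upper terms, each to be below half of the
    main term after division by \<tau> n^(2 a). Each is a constant times a negative power of
    n.\<close>
  have lim: "(\<lambda>n. A * real n powr e) \<longlonglongrightarrow> 0" if "e < 0" for A e :: real
    using tendsto_mult_left[OF tendsto_neg_powr[OF that filterlim_real_sequentially], of A] by simp
  have "\<forall>\<^sub>F n in sequentially. (16 * pi) * real n powr (2 * a - 1 + 2 * \<sigma> + 2 * s) < (min 1 \<delta>)\<^sup>2"
    by (rule order_tendstoD(2)[OF lim]) (use a \<delta> in auto)
  moreover have "\<forall>\<^sub>F n in sequentially. (16 * T * norm \<eta> / pi * (exp 3 * (4 * pi))) * real n powr (a - 1) < 1"
    by (rule order_tendstoD(2)[OF lim]) (use a in auto)
  moreover have "\<forall>\<^sub>F n in sequentially. Y * real n powr (3 / 2 - \<sigma> - 2 * a) < exp (- 6) / 2048 * \<tau> / 2"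
    by (rule order_tendstoD(2)[OF lim]) (use a \<tau> in auto)
  moreover have "\<forall>\<^sub>F n in sequentially. Z * real n powr (a - 1) < exp (- 6) / 2048 * \<tau> / 2"
    by (rule order_tendstoD(2)[OF lim]) (use a \<tau> in auto)
  ultimately have "\<forall>\<^sub>F n in sequentially. False"
    using eventually_ge_at_top[of "1::nat"]
  proof eventually_elim
    case (elim n)
    define N where "N = real n"
    have N: "N \<ge> 1" "N > 0" using elim by (auto simp: N_def)
    define B where "B = N powr (a - 2)"
    have BN: "B * N = N powr (a - 1)" using N powr_add[of N "a - 2" 1] by (simp add: B_def)
    have B2: "B\<^sup>2 = N powr (2 * a - 4)" using N powr_add[of N "a - 2" "a - 2"] by (simp add: B_def power2_eq_square)
    have B4: "B\<^sup>2 * N ^ 4 = N powr (2 * a)" using N powr_add[of N "2 * a - 4" 4] by (simp add: B2)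
    have "16 * pi * B\<^sup>2 * N powr (3 + 2 * \<sigma> + 2 * s) = (16 * pi) * N powr (2 * a - 1 + 2 * \<sigma> + 2 * s)"
      using powr_add[of N "2 * a - 4" "3 + 2 * \<sigma> + 2 * s"] by (simp add: B2 algebra_simps)
    also have "\<dots> < (min 1 \<delta>)\<^sup>2" using elim(1) by (simp only: N_def)
    finally have "sqrt (16 * pi * B\<^sup>2 * N powr (3 + 2 * \<sigma> + 2 * s)) < sqrt ((min 1 \<delta>)\<^sup>2)" by (rule real_sqrt_less_mono)
    also have "\<dots> = min 1 \<delta>" using \<delta> by simp
    finally have sd: "sqrt (16 * pi * B\<^sup>2 * real n powr (3 + 2 * \<sigma> + 2 * s)) < min 1 \<delta>" by (simp only: N_def)
    have "16 * T * norm \<eta> / pi * (exp 3 * (4 * pi * B * N)) = (16 * T * norm \<eta> / pi * (exp 3 * (4 * pi))) * N powr (a - 1)"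
      unfolding BN[symmetric] by (simp only: mult_ac)
    then have sP: "16 * T * norm \<eta> / pi * (exp 3 * (4 * pi * B * real n)) \<le> 1" using elim(2) by (simp only: N_def)
    have m: "exp (- 6) / 2048 * B\<^sup>2 * N ^ 4 * \<tau>\<^sup>2 \<le> \<tau> * (2 * sqrt (4 / (1 - 2 * \<sigma>) * N powr (3 - 2 * \<sigma>) * G) / norm k
        + 12 * T\<^sup>2 * norm k * N\<^sup>2 * (2 * (exp 3 * (4 * pi * B * N))) ^ 3)"
      unfolding N_def k_def G_def
      by (rule main_inequality[OF assms(1,5) s assms(3) \<sigma> \<Phi> _ elim(5) _ less_imp_le[OF \<tau>(1)] \<tau>(2,3) sd sP])
         (use C1 in \<open>auto simp: B_def\<close>)
    have e1: "2 * sqrt (4 / (1 - 2 * \<sigma>) * N powr (3 - 2 * \<sigma>) * G) / norm k = (Y * N powr (3 / 2 - \<sigma> - 2 * a)) * N powr (2 * a)"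
    proof -
      have "sqrt (N powr (3 - 2 * \<sigma>)) = N powr (3 / 2 - \<sigma>)" using N by (simp add: powr_half_sqrt[symmetric] powr_powr diff_divide_distrib)
      also have "\<dots> = N powr (3 / 2 - \<sigma> - 2 * a) * N powr (2 * a)" by (simp add: powr_add[symmetric])
      finally have p: "sqrt (N powr (3 - 2 * \<sigma>)) = N powr (3 / 2 - \<sigma> - 2 * a) * N powr (2 * a)" .
      have "sqrt (4 / (1 - 2 * \<sigma>) * N powr (3 - 2 * \<sigma>) * G) = sqrt (4 / (1 - 2 * \<sigma>) * G) * sqrt (N powr (3 - 2 * \<sigma>))"
        unfolding real_sqrt_mult[symmetric] by (simp only: mult_ac)
      then show ?thesis unfolding p Y_def by simp
    qed
    have e2: "12 * T\<^sup>2 * norm k * N\<^sup>2 * (2 * (exp 3 * (4 * pi * B * N))) ^ 3 = (Z * N powr (a - 1)) * N powr (2 * a)"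
    proof -
      have "12 * T\<^sup>2 * norm k * N\<^sup>2 * (2 * (exp 3 * (4 * pi * B * N))) ^ 3 = Z * (B * N) * (B\<^sup>2 * N ^ 4)"
        by (simp add: Z_def power_mult_distrib power2_eq_square power3_eq_cube power4_eq_xxxx)
      then show ?thesis by (simp only: BN B4)
    qed
    have "(exp (- 6) / 2048 * \<tau>) * (\<tau> * N powr (2 * a)) = exp (- 6) / 2048 * (B\<^sup>2 * N ^ 4) * \<tau>\<^sup>2"
      unfolding B4 by (simp add: power2_eq_square)
    also have "\<dots> \<le> \<tau> * ((Y * N powr (3 / 2 - \<sigma> - 2 * a)) * N powr (2 * a) + (Z * N powr (a - 1)) * N powr (2 * a))"
      using m unfolding e1 e2 by (simp only: mult.assoc)
    also have "\<dots> = (Y * N powr (3 / 2 - \<sigma> - 2 * a) + Z * N powr (a - 1)) * (\<tau> * N powr (2 * a))" by (simp add: algebra_simps)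
    also have "\<dots> < (exp (- 6) / 2048 * \<tau>) * (\<tau> * N powr (2 * a))"
      by (rule mult_strict_right_mono) (use elim(3,4) \<tau> N in \<open>simp_all only: N_def, auto\<close>)
    finally show False by simp
  qed
  then show False by simp
qed

end
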